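(* There exists a real-valued function $\Psi$ on the set of finite trees such that the following hold. (1) For every fixed finite forest $F$ with $m = |E(F)|$ edges and connected components $T_1,\ldots,T_d$, $$\lim_{n\to\infty} n^{m}\,\mathbb{P}_n(F\subseteq M_n) = \prod_{i=1}^d \Psi(T_i).$$ (2) For every fixed finite tree $T$ and every $0<p<\infty$, $$\frac{N_n(T)}{n} \xrightarrow{L^p} \Psi(T) \qquad \text{as } n\to\infty,$$ that is, $\mathbb{E}_n\left[\left|N_n(T)/n-\Psi(T)\right|^p\right]\to 0$.
   Context: $K_n$ is the complete graph on $[n]=\{1,\ldots,n\}$, with i.i.d. uniform $[0,1]$ edge weights $(w_e)_{e\in E(K_n)}$; $\mathbb{P}_n,\mathbb{E}_n$ denote the corresponding law and expectation. $M_n$ is the minimum spanning tree: the almost surely unique spanning tree of $K_n$ minimizing $\sum_{e\in E(T)} w_e$. Fixed trees and forests are finite abstract graphs independent of $n$, and $\Psi$ is invariant under isomorphism. For $n\ge |V(F)|$, assign distinct labels in $[n]$ to the vertices of $F$; the event $F\subseteq M_n$ means that this fixed labeled copy of $F$ is contained in $M_n$ (all its edges are edges of $M_n$). By vertex exchangeability its probability does not depend on the labeling; the common value is $\mathbb{P}_n(F\subseteq M_n)$. For a fixed tree $T$, $N_n(T)$ is the number of injective maps $f:V(T)\to[n]$ with $\{f(u),f(v)\}\in E(M_n)$ for every $\{u,v\}\in E(T)$. *)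

theory Defs
  imports "HOL-Probability.Probability"
begin

text \<open>
  Simple graphs are pairs of a vertex set and a set of two-element vertex sets.  Abstract finite
  graphs are represented with natural numbers as vertices; this loses nothing, because every finite
  graph is isomorphic to such a graph.
\<close>

type_synonym 'a sgraph = "'a set \<times> 'a set set"

abbreviation gverts :: "'a sgraph \<Rightarrow> 'a set" where "gverts \<equiv> fst"

abbreviation gedges :: "'a sgraph \<Rightarrow> 'a set set" where "gedges \<equiv> snd"

definition finite_simple_graph :: "'a sgraph \<Rightarrow> bool" where
  "finite_simple_graph G \<longleftrightarrow>
     finite (gverts G) \<and> (\<forall>e\<in>gedges G. e \<subseteq> gverts G \<and> card e = 2)"

definition gadj :: "'a sgraph \<Rightarrow> ('a \<times> 'a) set" where
  "gadj G = {(u, v). {u, v} \<in> gedges G}"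

definition gconnected :: "'a sgraph \<Rightarrow> bool" where
  "gconnected G \<longleftrightarrow>
     gverts G \<noteq> {} \<and> (\<forall>u\<in>gverts G. \<forall>v\<in>gverts G. (u, v) \<in> (gadj G)\<^sup>*)"

text \<open>A cycle is given by its vertices in cyclic order, without repeating the starting point.\<close>

definition gcycle :: "'a sgraph \<Rightarrow> 'a list \<Rightarrow> bool" where
  "gcycle G xs \<longleftrightarrow>
     length xs \<ge> 3 \<and> distinct xs \<and>
     (\<forall>i<length xs. {xs ! i, xs ! (Suc i mod length xs)} \<in> gedges G)"

definition gforest :: "'a sgraph \<Rightarrow> bool" where
  "gforest G \<longleftrightarrow> finite_simple_graph G \<and> (\<nexists>xs. gcycle G xs)"

definition gtree :: "'a sgraph \<Rightarrow> bool" where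
  "gtree G \<longleftrightarrow> gforest G \<and> gconnected G"

definition gcomponents :: "'a sgraph \<Rightarrow> 'a sgraph set" where
  "gcomponents G =
     (\<lambda>u. let C = (gadj G)\<^sup>* `` {u} in (C, {e \<in> gedges G. e \<subseteq> C})) ` gverts G"

definition gisomorphic :: "'a sgraph \<Rightarrow> 'b sgraph \<Rightarrow> bool" where
  "gisomorphic G H \<longleftrightarrow>
     (\<exists>\<phi>. bij_betw \<phi> (gverts G) (gverts H) \<and>
          (\<forall>u\<in>gverts G. \<forall>v\<in>gverts G. {u, v} \<in> gedges G \<longleftrightarrow> {\<phi> u, \<phi> v} \<in> gedges H))"

definition complete_graph :: "nat \<Rightarrow> nat sgraph" where
  "complete_graph n = ({1..n}, {e. e \<subseteq> {1..n} \<and> card e = 2})"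

definition spanning_tree :: "'a sgraph \<Rightarrow> 'a sgraph \<Rightarrow> bool" where
  "spanning_tree G T \<longleftrightarrow> gtree T \<and> gverts T = gverts G \<and> gedges T \<subseteq> gedges G"

definition weight_law :: "nat \<Rightarrow> (nat set \<Rightarrow> real) measure" where
  "weight_law n = (\<Pi>\<^sub>M e\<in>gedges (complete_graph n). uniform_measure lborel {0..1})"

text \<open>
  When several spanning trees minimize the total weight, which has probability zero, one of
  them is selected by choice, depending only on the set of minimizers.
\<close>

definition mst :: "nat \<Rightarrow> (nat set \<Rightarrow> real) \<Rightarrow> nat sgraph" where
  "mst n w = (ARG_MIN (\<lambda>T. \<Sum>e\<in>gedges T. w e) T. spanning_tree (complete_graph n) T)"

definition labeling :: "nat \<Rightarrow> 'a sgraph \<Rightarrow> ('a \<Rightarrow> nat) \<Rightarrow> bool" where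
  "labeling n F \<phi> \<longleftrightarrow> inj_on \<phi> (gverts F) \<and> \<phi> ` gverts F \<subseteq> {1..n}"

text \<open>The probability that the copy of \<open>F\<close> labeled by \<open>\<phi>\<close> is contained in the tree \<open>mst n\<close>.\<close>

definition prob_contained :: "nat \<Rightarrow> 'a sgraph \<Rightarrow> ('a \<Rightarrow> nat) \<Rightarrow> real" where
  "prob_contained n F \<phi> =
     measure (weight_law n) {w \<in> space (weight_law n). \<forall>e\<in>gedges F. \<phi> ` e \<in> gedges (mst n w)}"

text \<open>
  Maps on the vertex set of \<open>T\<close> are represented by extensional functions, so that
  each of them is counted once.
\<close>

definition num_copies :: "nat \<Rightarrow> 'a sgraph \<Rightarrow> (nat set \<Rightarrow> real) \<Rightarrow> nat" where
  "num_copies n T w =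
     card {f \<in> gverts T \<rightarrow>\<^sub>E {1..n}.
             inj_on f (gverts T) \<and>
             (\<forall>u v. {u, v} \<in> gedges T \<longrightarrow> {f u, f v} \<in> gedges (mst n w))}"

end

theory Submission
  imports Defs "HOL-Real_Asymp.Real_Asymp"
begin

text \<open>
  Almost surely an edge lies in the minimum spanning tree if and only if its endpoints are not
  connected by strictly lighter edges.  Writing the weights of the edges of \<open>F\<close> as \<open>\<tau> e / n\<close> turns
  \<open>n\<close> to the power \<open>m\<close> times the containment probability into an integral over \<open>\<tau>\<close> of the
  conditional probability of this cut event.  Below level \<open>\<theta> / n\<close> the graph is a random graph of
  mean degree \<open>\<theta>\<close>: a second moment computation shows that a fraction close to \<open>rho \<theta>\<close> of the vertices
  lies in large components, and sprinkling joins these components into a single one.  By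
  exchangeability the vertices of \<open>F\<close> fall into the nested giant components independently, so the
  conditional probability converges for almost every \<open>\<tau>\<close>.  A Cayley-type union bound for the component of
  one endpoint gives the exponential decay in each \<open>\<tau> e\<close> that dominated convergence needs.  The
  limiting integrand factorizes over the components of \<open>F\<close>.

  For the second part, the \<open>k\<close>-th power of the number of copies of a tree counts the embeddings of
  all quotients of \<open>k\<close> disjoint copies.  A proper quotient has fewer vertices than its number of
  edges plus \<open>k\<close> and is negligible, so the moments converge to the powers of the limit; even central
  moments then tend to zero and control every \<open>p\<close>-th absolute moment.
\<close>

section \<open>Connectivity and minimum spanning trees\<close>

text \<open>At level \<theta> / n the graph enters the limit only through the giant fraction
  \<open>rho \<theta>\<close>, a decreasing limit in the cutoff \<open>K\<close> of explicit
  densities. Merging the large components costs a sprinkling step from some \<theta>' < \<theta> and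
  hence a loss of \<open>rho \<theta> - rho \<theta>'\<close>. This is why the limit is taken only
  at continuity points of \<open>rho\<close>; monotonicity makes the exceptions countable, and an
  integral does not see them. The giants belonging to different edges of one pattern are dependent
  because they are nested. One uniform label per pattern vertex captures this dependence without
  error: for a uniformly random map of the pattern into [n] and any fixed weights, the probability
  of the separation condition \<open>sep\<close> equals \<open>hsep\<close> at the actual fractions
  of vertices in large components. The edges of the pattern itself disturb the graph below a level.
  For fixed rescaled weights they are overwritten by \<open>overlay\<close>. In the tail estimate
  they are deleted: a bounded number of deletions is harmless against the k (n - k) boundary edges
  of a cluster of size k.\<close>

definition adj :: "'a set set \<Rightarrow> ('a \<times> 'a) set" where
  "adj H = {(u, v). {u, v} \<in> H}"

lemma gadj_eq: "gadj G = adj (gedges G)"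
  by (simp add: gadj_def adj_def)

lemma adj_mono: "H \<subseteq> H' \<Longrightarrow> adj H \<subseteq> adj H'"
  by (auto simp: adj_def)

lemma conn_mono: "H \<subseteq> H' \<Longrightarrow> (adj H)\<^sup>* \<subseteq> (adj H')\<^sup>*"
  by (intro rtrancl_mono adj_mono)

lemma sym_adj: "sym (adj H)"
  by (auto simp: adj_def sym_def insert_commute)

lemma conn_sym: "(x, y) \<in> (adj H)\<^sup>* \<Longrightarrow> (y, x) \<in> (adj H)\<^sup>*"
  using sym_rtrancl[OF sym_adj, of H] by (meson symD)

definition cluster :: "'a set set \<Rightarrow> 'a \<Rightarrow> 'a set" where
  "cluster H x = (adj H)\<^sup>* `` {x}"

lemma mem_cluster: "y \<in> cluster H x \<longleftrightarrow> (x, y) \<in> (adj H)\<^sup>*"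
  by (simp add: cluster_def)

lemma self_in_cluster [simp]: "x \<in> cluster H x"
  by (simp add: mem_cluster)

lemma cluster_eq_iff: "cluster H x = cluster H y \<longleftrightarrow> (x, y) \<in> (adj H)\<^sup>*"
proof
  assume "cluster H x = cluster H y"
  then show "(x, y) \<in> (adj H)\<^sup>*"
    using mem_cluster[of y H x] by auto
next
  assume "(x, y) \<in> (adj H)\<^sup>*"
  then show "cluster H x = cluster H y"
    using conn_sym[of x y H] by (auto simp: mem_cluster intro: rtrancl_trans)
qed

lemma cluster_subset:
  assumes "\<And>e. e \<in> H \<Longrightarrow> e \<subseteq> V" "x \<in> V"
  shows "cluster H x \<subseteq> V"
proof
  fix y assume "y \<in> cluster H x"
  then have "(x, y) \<in> (adj H)\<^sup>*" by (simp add: mem_cluster)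
  then show "y \<in> V"
    by (induction rule: rtrancl_induct) (use assms in \<open>auto simp: adj_def\<close>)
qed

text \<open>Breadth-first search from \<open>R\<close>: \<open>d\<close> is the distance to the root
  set and \<open>f\<close> picks a neighbor one step nearer. Distances drop strictly along
  \<open>f\<close>, so no edge is picked from both of its ends, and iterating \<open>f\<close> ends
  in \<open>R\<close>. The search forest serves \<open>card_roots_edges\<close>,
  \<open>tree_card\<close> and \<open>small_cluster_witness\<close>.\<close>

lemma parent_edges:
  fixes H :: "'a set set" and R :: "'a set"
  defines "V \<equiv> (adj H)\<^sup>* `` R"
  shows "\<exists>f. (\<forall>y\<in>V - R. f y \<in> V \<and> {y, f y} \<in> H) \<and> inj_on (\<lambda>y. {y, f y}) (V - R) \<and>
    (\<forall>y\<in>V. \<exists>r\<in>R. (r, y) \<in> (adj ((\<lambda>y. {y, f y}) ` (V - R)))\<^sup>*)"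
proof -
  define P where "P = (\<lambda>y k. \<exists>r\<in>R. (r, y) \<in> adj H ^^ k)"
  define d where "d = (\<lambda>y. LEAST k. P y k)"
  have ex: "\<exists>k. P y k" if "y \<in> V" for y
    using that unfolding V_def P_def Image_def by (auto simp: rtrancl_power)
  have d: "P y (d y)" if "y \<in> V" for y
    using ex[OF that] unfolding d_def by (rule LeastI_ex)
  have d_le: "d y \<le> k" if "P y k" for y k
    using that unfolding d_def by (rule Least_le)
  have step: "\<exists>z. z \<in> V \<and> {y, z} \<in> H \<and> Suc (d z) = d y" if "y \<in> V - R" for y
  proof -
    have "P y (d y)" using d that by auto
    then obtain r where r: "r \<in> R" "(r, y) \<in> adj H ^^ d y" by (auto simp: P_def)
    have "d y \<noteq> 0" using r that by (metis DiffD2 relpow_0_E)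
    then obtain k where k: "d y = Suc k" using not0_implies_Suc by blast
    with r obtain z where z: "(r, z) \<in> adj H ^^ k" "(z, y) \<in> adj H" by auto
    have zV: "z \<in> V" using z(1) r(1) relpow_imp_rtrancl[OF z(1)] unfolding V_def by blast
    have 1: "d z \<le> k" using z r by (intro d_le) (auto simp: P_def)
    from d[OF zV] obtain r' where r': "r' \<in> R" "(r', z) \<in> adj H ^^ d z" by (auto simp: P_def)
    then have "P y (Suc (d z))" using z(2) by (auto simp: P_def)
    from d_le[OF this] 1 k have "Suc (d z) = d y" by simp
    then show ?thesis using z(2) zV by (auto simp: adj_def insert_commute)
  qed
  then obtain f where f: "\<And>y. y \<in> V - R \<Longrightarrow> f y \<in> V \<and> {y, f y} \<in> H \<and> Suc (d (f y)) = d y"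
    by metis
  have inj: "inj_on (\<lambda>y. {y, f y}) (V - R)"
  proof (rule inj_onI, rule ccontr)
    fix y z assume yz: "y \<in> V - R" "z \<in> V - R" "{y, f y} = {z, f z}" "y \<noteq> z"
    then have "y = f z" "z = f y" by (auto simp: doubleton_eq_iff)
    then show False using f[OF yz(1)] f[OF yz(2)] by auto
  qed
  have "\<exists>r\<in>R. (r, y) \<in> (adj ((\<lambda>y. {y, f y}) ` (V - R)))\<^sup>*" if "y \<in> V" for y
    using that
  proof (induction "d y" arbitrary: y rule: less_induct)
    case less
    show ?case
    proof (cases "y \<in> R")
      case False
      then have y: "y \<in> V - R" using less by auto
      have "d (f y) < d y" "f y \<in> V" using f[OF y] by auto
      from less(1)[OF this] obtain r where r: "r \<in> R" "(r, f y) \<in> (adj ((\<lambda>y. {y, f y}) ` (V - R)))\<^sup>*" by auto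
      have "(f y, y) \<in> adj ((\<lambda>y. {y, f y}) ` (V - R))"
        using y by (auto simp: adj_def insert_commute)
      then show ?thesis using r by (meson rtrancl.rtrancl_into_rtrancl)
    qed auto
  qed
  then show ?thesis using f inj by blast
qed

text \<open>Every non-root owns its own edge of the search forest. With one root this bounds the
  edges of a connected graph from below; with k roots it bounds the vertices of a quotient of k tree
  copies.\<close>

lemma card_roots_edges:
  assumes "finite H" "V \<subseteq> (adj H)\<^sup>* `` R" "finite R"
  shows "card V \<le> card H + card R"
proof -
  define V' where "V' = (adj H)\<^sup>* `` R"
  obtain f where f: "\<forall>y\<in>V' - R. {y, f y} \<in> H" "inj_on (\<lambda>y. {y, f y}) (V' - R)"
    using parent_edges[of H R] unfolding V'_def by blast
  have sub: "(\<lambda>y. {y, f y}) ` (V' - R) \<subseteq> H" using f by auto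
  have fin: "finite (V' - R)"
    using finite_imageD[OF finite_subset[OF sub assms(1)] f(2)] .
  have le: "card (V' - R) \<le> card H" using card_inj_on_le[OF f(2) sub assms(1)] .
  have finV': "finite V'" using fin assms(3) by (metis finite_Diff2)
  have "card V \<le> card V'" using assms finV' unfolding V'_def by (intro card_mono) auto
  also have "\<dots> \<le> card (V' - R) + card R"
    using finV' assms(3) by (metis add.commute diff_card_le_card_Diff le_diff_conv)
  finally show ?thesis using le by simp
qed

text \<open>The path is built backwards from \<open>b\<close>. If the new first vertex already
  occurs, the path restarts at that occurrence, which cuts out the loop.\<close>

lemma rtrancl_distinct_path:
  assumes "(a, b) \<in> r\<^sup>*"
  shows "\<exists>xs. xs \<noteq> [] \<and> hd xs = a \<and> last xs = b \<and> distinct xs \<and>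
    (\<forall>i. Suc i < length xs \<longrightarrow> (xs ! i, xs ! Suc i) \<in> r)"
  using assms
proof (induction rule: converse_rtrancl_induct)
  case base
  show ?case by (intro exI[of _ "[b]"]) auto
next
  case (step y z)
  then obtain xs where xs: "xs \<noteq> []" "hd xs = z" "last xs = b" "distinct xs"
    "\<forall>i. Suc i < length xs \<longrightarrow> (xs ! i, xs ! Suc i) \<in> r" by auto
  show ?case
  proof (cases "y \<in> set xs")
    case True
    then obtain j where j: "j < length xs" "xs ! j = y" by (auto simp: in_set_conv_nth)
    show ?thesis
      by (intro exI[of _ "drop j xs"]) (use xs j in \<open>auto simp: hd_drop_conv_nth\<close>)
  next
    case False
    have "\<forall>i. Suc i < length (y # xs) \<longrightarrow> ((y # xs) ! i, (y # xs) ! Suc i) \<in> r"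
    proof (intro allI impI)
      fix i assume "Suc i < length (y # xs)"
      then show "((y # xs) ! i, (y # xs) ! Suc i) \<in> r"
        using xs step(1) by (cases i) (auto simp: hd_conv_nth)
    qed
    then show ?thesis
      by (intro exI[of _ "y # xs"]) (use xs False in auto)
  qed
qed

text \<open>The rest of the cycle is a detour around its first edge.\<close>

lemma adj_remove_edge_cycle:
  assumes "gcycle (V, H) xs"
  shows "(adj (H - {{xs ! 0, xs ! 1}}))\<^sup>* = (adj H)\<^sup>*" "{xs ! 0, xs ! 1} \<in> H"
proof -
  define e where "e = {xs ! 0, xs ! 1}"
  have len: "length xs \<ge> 3" and dist: "distinct xs"
    and ed: "\<And>i. i < length xs \<Longrightarrow> {xs ! i, xs ! (Suc i mod length xs)} \<in> H"
    using assms by (auto simp: gcycle_def)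
  have "0 < length xs" "Suc 0 mod length xs = 1" using len by auto
  then show "{xs ! 0, xs ! 1} \<in> H" using ed[of 0] by simp
  \<comment> \<open>The other edges of the cycle survive the deletion. The critical index is i = 1,
    whose edge also contains \<open>xs ! 1\<close>: its other end is \<open>xs ! 2\<close>, distinct
    from \<open>xs ! 0\<close> because the length is at least 3.\<close>
  have ne: "{xs ! i, xs ! (Suc i mod length xs)} \<noteq> e" if i: "1 \<le> i" "i < length xs" for i
  proof -
    have "xs ! i \<noteq> xs ! 0" using dist i len nth_eq_iff_index_eq[of xs i 0] by linarith
    moreover have "xs ! (Suc i mod length xs) \<noteq> xs ! 1"
    proof -
      have m: "Suc i mod length xs \<noteq> 1"
        using i len by (cases "Suc i = length xs") auto
      have "Suc i mod length xs < length xs" using i by (intro mod_less_divisor) linarith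
      moreover have "1 < length xs" using len by linarith
      ultimately show ?thesis using dist m nth_eq_iff_index_eq[of xs "Suc i mod length xs" 1] by auto
    qed
    moreover have "xs ! (Suc i mod length xs) \<noteq> xs ! i"
    proof -
      have "Suc i mod length xs \<noteq> i" using i by (cases "Suc i = length xs") auto
      moreover have "Suc i mod length xs < length xs" using i by (intro mod_less_divisor) linarith
      ultimately show ?thesis using dist i nth_eq_iff_index_eq[of xs "Suc i mod length xs" i] by auto
    qed
    moreover have "xs ! (Suc i mod length xs) \<noteq> xs ! 0" if "xs ! i = xs ! 1"
    proof -
      have "i = 1" using that dist i len nth_eq_iff_index_eq[of xs i 1] by linarith
      then have "Suc i mod length xs = 2" using len by simp
      moreover have "2 < length xs" "0 < length xs" using len by linarith+
      then have "xs ! 2 \<noteq> xs ! 0" using dist nth_eq_iff_index_eq[of xs 2 0] by simp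
      ultimately show ?thesis by simp
    qed
    ultimately show ?thesis by (auto simp: e_def doubleton_eq_iff)
  qed
  have st: "(xs ! i, xs ! (Suc i mod length xs)) \<in> adj (H - {e})" if "1 \<le> i" "i < length xs" for i
    using ne[OF that] ed[of i] that by (auto simp: adj_def)
  have "(xs ! 1, xs ! i) \<in> (adj (H - {e}))\<^sup>*" if "1 \<le> i" "i < length xs" for i
    using that
  proof (induction i rule: dec_induct)
    case (step i)
    then show ?case using st[of i] by (auto intro: rtrancl_into_rtrancl)
  qed auto
  from this[of "length xs - 1"] have "(xs ! 1, xs ! (length xs - 1)) \<in> (adj (H - {e}))\<^sup>*"
    using len by auto
  moreover have "(xs ! (length xs - 1), xs ! 0) \<in> adj (H - {e})"
  proof -
    have "Suc (length xs - 1) = length xs" using len by simp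
    then have "Suc (length xs - 1) mod length xs = 0" by simp
    moreover have "1 \<le> length xs - 1" "length xs - 1 < length xs" using len by auto
    ultimately show ?thesis using st[of "length xs - 1"] by simp
  qed
  ultimately have c: "(xs ! 1, xs ! 0) \<in> (adj (H - {e}))\<^sup>*" by (rule rtrancl_into_rtrancl)
  have "adj H \<subseteq> (adj (H - {e}))\<^sup>*"
  proof
    fix p assume p: "p \<in> adj H"
    obtain a b where ab: "p = (a, b)" by fastforce
    show "p \<in> (adj (H - {e}))\<^sup>*"
    proof (cases "{a, b} = e")
      case True
      then show ?thesis using c conn_sym[OF c] ab by (auto simp: e_def doubleton_eq_iff)
    next
      case False
      then show ?thesis using p ab by (auto simp: adj_def)
    qed
  qed
  moreover have "adj (H - {e}) \<subseteq> (adj H)\<^sup>*" using adj_mono[of "H - {e}" H] by auto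
  ultimately show "(adj (H - {{xs ! 0, xs ! 1}}))\<^sup>* = (adj H)\<^sup>*"
    unfolding e_def[symmetric] by (metis rtrancl_subset rtrancl_subset_rtrancl subset_antisym)
qed

section \<open>Forests and spanning trees of finite graphs\<close>

lemma finite_simple_graphD:
  assumes "finite_simple_graph G"
  shows "finite (gverts G)" "finite (gedges G)" "\<And>e. e \<in> gedges G \<Longrightarrow> e \<subseteq> gverts G"
    "\<And>e. e \<in> gedges G \<Longrightarrow> card e = 2"
  using assms unfolding finite_simple_graph_def
  by (auto intro: finite_subset[of _ "Pow (gverts G)"])

text \<open>Deleting an edge of a cycle preserves connectivity and lowers the number of edges, so
  repeated deletion ends in an acyclic graph.\<close>

lemma connected_contains_spanning_tree:
  assumes "finite_simple_graph (V, H)" "gconnected (V, H)"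
  shows "\<exists>T. spanning_tree (V, H) T"
  using assms
proof (induction "card H" arbitrary: H rule: less_induct)
  case less
  show ?case
  proof (cases "\<exists>xs. gcycle (V, H) xs")
    case False
    then show ?thesis using less
      by (intro exI[of _ "(V, H)"]) (auto simp: spanning_tree_def gtree_def gforest_def)
  next
    case True
    then obtain xs where xs: "gcycle (V, H) xs" by auto
    define H' where "H' = H - {{xs ! 0, xs ! 1}}"
    have "card H' < card H"
      unfolding H'_def using adj_remove_edge_cycle(2)[OF xs] finite_simple_graphD(2)[OF less(2)]
      by (intro psubset_card_mono) auto
    moreover have "finite_simple_graph (V, H')" using less(2)
      by (auto simp: finite_simple_graph_def H'_def)
    moreover have "gconnected (V, H')"
      using less(3) adj_remove_edge_cycle(1)[OF xs] by (simp add: gconnected_def gadj_eq H'_def)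
    ultimately obtain T where "spanning_tree (V, H') T" using less(1) by blast
    then show ?thesis by (intro exI[of _ T]) (auto simp: spanning_tree_def H'_def)
  qed
qed

text \<open>A distinct path around the edge closes up with it to a cycle. The path has at least 3
  vertices, since with 2 it would consist of the deleted edge.\<close>

lemma forest_edge_cut:
  assumes "gforest G" "{a, b} \<in> gedges G"
  shows "(a, b) \<notin> (adj (gedges G - {{a, b}}))\<^sup>*"
proof
  assume "(a, b) \<in> (adj (gedges G - {{a, b}}))\<^sup>*"
  from rtrancl_distinct_path[OF this] obtain xs where
    xs: "xs \<noteq> []" "hd xs = a" "last xs = b" "distinct xs" and
    ed: "\<And>i. Suc i < length xs \<Longrightarrow> {xs ! i, xs ! Suc i} \<in> gedges G - {{a, b}}"
    by (auto simp: adj_def)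
  have "card {a, b} = 2" using assms by (auto simp: gforest_def finite_simple_graph_def)
  then have ab: "a \<noteq> b" by auto
  have hd: "xs ! 0 = a" using xs by (simp add: hd_conv_nth)
  have la: "xs ! (length xs - 1) = b" using xs by (simp add: last_conv_nth)
  have len: "length xs \<ge> 3"
  proof (rule ccontr)
    assume "\<not> 3 \<le> length xs"
    then consider "length xs = 1" | "length xs = 2" using xs(1)
      by (metis One_nat_def Suc_1 length_greater_0_conv less_Suc_eq less_numeral_extra(3) not_less numeral_3_eq_3 le_zero_eq less_Suc_eq_le)
    then show False
    proof cases
      case 1 then show False using hd la ab by auto
    next
      case 2 then show False using hd la ed[of 0] by auto
    qed
  qed
  have "{xs ! i, xs ! (Suc i mod length xs)} \<in> gedges G" if "i < length xs" for i
  proof (cases "Suc i = length xs")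
    case True
    then have "xs ! i = b" using la by (metis diff_Suc_1)
    then show ?thesis using True hd assms by (simp add: insert_commute)
  next
    case False
    then show ?thesis using ed[of i] that by auto
  qed
  then have "gcycle G xs" using len xs by (auto simp: gcycle_def)
  then show False using assms by (auto simp: gforest_def)
qed

text \<open>The parent edges of a search tree from one root exhaust the tree: an edge missed by them
  would be bypassed by the search tree, contradicting \<open>forest_edge_cut\<close>.\<close>

lemma tree_card:
  assumes "gtree T"
  shows "card (gverts T) = Suc (card (gedges T))"
proof -
  define H where "H = gedges T"
  have fsg: "finite_simple_graph T" using assms by (simp add: gtree_def gforest_def)
  have con: "\<And>u v. u \<in> gverts T \<Longrightarrow> v \<in> gverts T \<Longrightarrow> (u, v) \<in> (adj H)\<^sup>*" and ne: "gverts T \<noteq> {}"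
    using assms by (auto simp: gtree_def gconnected_def gadj_eq H_def)
  obtain r where r: "r \<in> gverts T" using ne by auto
  have V: "(adj H)\<^sup>* `` {r} = gverts T"
    using con[OF r] cluster_subset[of H "gverts T" r] r finite_simple_graphD(3)[OF fsg]
    by (auto simp: cluster_def H_def)
  obtain f where f: "\<And>y. y \<in> gverts T - {r} \<Longrightarrow> f y \<in> gverts T \<and> {y, f y} \<in> H"
      "inj_on (\<lambda>y. {y, f y}) (gverts T - {r})"
      "\<And>y. y \<in> gverts T \<Longrightarrow> (r, y) \<in> (adj ((\<lambda>y. {y, f y}) ` (gverts T - {r})))\<^sup>*"
    using parent_edges[of H "{r}"] unfolding V by auto
  let ?I = "(\<lambda>y. {y, f y}) ` (gverts T - {r})"
  have "?I = H"
  proof (rule ccontr)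
    assume "?I \<noteq> H"
    then obtain e where e: "e \<in> H" "e \<notin> ?I" using f by auto
    then obtain a b where ab: "e = {a, b}" "a \<noteq> b"
      using finite_simple_graphD(4)[OF fsg] unfolding H_def by (metis card_2_iff)
    have abV: "a \<in> gverts T" "b \<in> gverts T" using finite_simple_graphD(3)[OF fsg] e ab H_def by auto
    have sub: "?I \<subseteq> H - {e}" using f e by auto
    have "(r, a) \<in> (adj (H - {e}))\<^sup>*" "(r, b) \<in> (adj (H - {e}))\<^sup>*"
      using f(3) abV conn_mono[OF sub] by auto
    then have "(a, b) \<in> (adj (H - {e}))\<^sup>*" using conn_sym rtrancl_trans by metis
    then show False using forest_edge_cut[of T a b] assms e ab unfolding H_def gtree_def by auto
  qed
  then have "card H = card (gverts T - {r})" using card_image[OF f(2)] by simp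
  then show ?thesis using r finite_simple_graphD(1)[OF fsg] unfolding H_def
    by (metis card.remove)
qed

section \<open>Edges of the minimum spanning tree as cuts of the lighter edges\<close>

abbreviation cedges :: "nat \<Rightarrow> nat set set" where
  "cedges n \<equiv> gedges (complete_graph n)"

definition lower :: "nat \<Rightarrow> (nat set \<Rightarrow> real) \<Rightarrow> real \<Rightarrow> nat set set" where
  "lower n w s = {f \<in> cedges n. w f < s}"

lemma cedges_iff: "e \<in> cedges n \<longleftrightarrow> e \<subseteq> {1..n} \<and> card e = 2"
  by (simp add: complete_graph_def)

lemma gverts_complete [simp]: "gverts (complete_graph n) = {1..n}"
  by (simp add: complete_graph_def)

lemma finite_cedges [simp, intro]: "finite (cedges n)"
  by (rule finite_subset[of _ "Pow {1..n}"]) (simp_all add: cedges_iff subset_iff)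

lemma pair_in_cedges: "{u, v} \<in> cedges n \<longleftrightarrow> u \<in> {1..n} \<and> v \<in> {1..n} \<and> u \<noteq> v"
  by (auto simp: cedges_iff card_2_iff doubleton_eq_iff)

lemma lower_subset: "lower n w s \<subseteq> cedges n"
  by (auto simp: lower_def)

lemma finite_lower [simp]: "finite (lower n w s)"
  by (rule finite_subset[OF lower_subset]) simp

lemma lower_mono: "s \<le> s' \<Longrightarrow> lower n w s \<subseteq> lower n w s'"
  by (auto simp: lower_def)

lemma fsg_sub: "H \<subseteq> cedges n \<Longrightarrow> finite_simple_graph ({1..n}, H)"
  unfolding finite_simple_graph_def using cedges_iff by auto

lemma finite_spanning_trees: "finite {T. spanning_tree (complete_graph n) T}"
  by (rule finite_subset[of _ "{{1..n}} \<times> Pow (cedges n)"])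
     (auto simp: spanning_tree_def intro!: finite_cartesian_product)

lemma complete_spanning_tree:
  assumes "n \<ge> 1"
  shows "\<exists>T. spanning_tree (complete_graph n) T"
proof -
  have "gconnected ({1..n}, cedges n)"
    unfolding gconnected_def gadj_eq
  proof (intro conjI ballI)
    fix u v assume uv: "u \<in> gverts ({1..n}, cedges n)" "v \<in> gverts ({1..n}, cedges n)"
    show "(u, v) \<in> (adj (gedges ({1..n}, cedges n)))\<^sup>*"
      using uv pair_in_cedges[of u v n] by (cases "u = v") (auto simp: adj_def)
  qed (use assms in auto)
  moreover have "complete_graph n = ({1..n}, cedges n)" by (simp add: complete_graph_def)
  ultimately show ?thesis
    using connected_contains_spanning_tree[OF fsg_sub[OF order_refl]] by metis
qed

lemma mst_props:
  assumes "n \<ge> 1"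
  shows "spanning_tree (complete_graph n) (mst n w)"
    "\<And>T. spanning_tree (complete_graph n) T \<Longrightarrow> (\<Sum>e\<in>gedges (mst n w). w e) \<le> (\<Sum>e\<in>gedges T. w e)"
proof -
  let ?S = "{T. spanning_tree (complete_graph n) T}"
  have ne: "?S \<noteq> {}" using complete_spanning_tree[OF assms] by auto
  have eq: "mst n w = arg_min_on (\<lambda>T. \<Sum>e\<in>gedges T. w e) ?S"
    unfolding mst_def arg_min_on_def by simp
  show "spanning_tree (complete_graph n) (mst n w)"
    using arg_min_if_finite(1)[OF finite_spanning_trees ne] unfolding eq by auto
  show "(\<Sum>e\<in>gedges (mst n w). w e) \<le> (\<Sum>e\<in>gedges T. w e)" if "spanning_tree (complete_graph n) T" for T
    using arg_min_least[OF finite_spanning_trees ne, of T "\<lambda>T. \<Sum>e\<in>gedges T. w e"] that unfolding eq by simp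
qed

text \<open>Positive weights allow comparison with any connected spanning edge set, because thinning
  it to a tree only lowers the weight. The exchange arguments below thus have to check connectivity
  alone, and never acyclicity.\<close>

lemma spanning_subgraph_weight:
  assumes "n \<ge> 1" "\<And>f. f \<in> cedges n \<Longrightarrow> w f > 0" "H \<subseteq> cedges n" "gconnected ({1..n}, H)"
  shows "(\<Sum>e\<in>gedges (mst n w). w e) \<le> (\<Sum>e\<in>H. w e)"
proof -
  obtain T where T: "spanning_tree ({1..n}, H) T"
    using connected_contains_spanning_tree[OF fsg_sub[OF assms(3)] assms(4)] by auto
  then have "spanning_tree (complete_graph n) T" using assms(3) by (auto simp: spanning_tree_def)
  from mst_props(2)[OF assms(1) this, of w] have "(\<Sum>e\<in>gedges (mst n w). w e) \<le> (\<Sum>e\<in>gedges T. w e)" .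
  also have "\<dots> \<le> (\<Sum>e\<in>H. w e)"
    using T assms(2,3) finite_subset[OF assms(3)]
    by (intro sum_mono2) (auto simp: spanning_tree_def intro!: less_imp_le)
  finally show ?thesis .
qed

text \<open>Exchange argument: without \<open>e\<close> the tree splits into the part reached from
  \<open>u\<close> and the part reached from \<open>v\<close>. A lighter path has an edge across
  this split, and putting it in place of \<open>e\<close> lowers the total weight.\<close>

lemma mst_no_lighter_path:
  assumes pos: "\<And>f. f \<in> cedges n \<Longrightarrow> w f > 0" and uv: "{u, v} \<in> gedges (mst n w)" and n: "n \<ge> 1"
  shows "(u, v) \<notin> (adj (lower n w (w {u, v})))\<^sup>*"
proof
  assume path: "(u, v) \<in> (adj (lower n w (w {u, v})))\<^sup>*"
  define M where "M = gedges (mst n w)"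
  have st: "spanning_tree (complete_graph n) (mst n w)" by (rule mst_props(1)[OF n])
  have M: "M \<subseteq> cedges n" "finite M" and con: "\<And>a b. a \<in> {1..n} \<Longrightarrow> b \<in> {1..n} \<Longrightarrow> (a, b) \<in> (adj M)\<^sup>*"
    using st finite_subset[OF _ finite_cedges]
    by (auto simp: spanning_tree_def gtree_def gconnected_def gadj_eq M_def)
  define e where "e = {u, v}"
  have e: "e \<in> M" "e \<in> cedges n" using uv M by (auto simp: e_def M_def)
  have uvn: "u \<in> {1..n}" "v \<in> {1..n}" "u \<noteq> v" using e(2) pair_in_cedges by (auto simp: e_def)
  define R where "R = (adj (M - {e}))\<^sup>*"
  have split: "(u, z) \<in> R \<or> (v, z) \<in> R" if "z \<in> {1..n}" for z
    using con[OF uvn(1) that]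
  proof (induction rule: rtrancl_induct)
    case base show ?case by (simp add: R_def)
  next
    case (step y z)
    show ?case
    proof (cases "{y, z} = e")
      case True then show ?thesis by (auto simp: e_def R_def doubleton_eq_iff)
    next
      case False
      then have "(y, z) \<in> adj (M - {e})" using step by (auto simp: adj_def)
      then show ?thesis using step(3) unfolding R_def by (auto intro: rtrancl_into_rtrancl)
    qed
  qed
  show False
  \<comment> \<open>If \<open>u\<close> and \<open>v\<close> stay connected without
    \<open>e\<close>, dropping \<open>e\<close> already beats the minimum because its weight is
    positive.\<close>
  proof (cases "(u, v) \<in> R")
    case True
    have "(u, z) \<in> R" if "z \<in> {1..n}" for z
      using split[OF that] True rtrancl_trans[of u v _ z] unfolding R_def by blast
    then have "(x, z) \<in> R" if "x \<in> {1..n}" "z \<in> {1..n}" for x z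
      using that conn_sym[of u x] rtrancl_trans[of x u _ z] unfolding R_def by blast
    then have "gconnected ({1..n}, M - {e})" using uvn by (auto simp: gconnected_def gadj_eq R_def)
    moreover have "M - {e} \<subseteq> cedges n" using M by auto
    ultimately have "(\<Sum>e\<in>M. w e) \<le> (\<Sum>e\<in>M - {e}. w e)"
      using spanning_subgraph_weight[OF n, of w "M - {e}"] pos by (simp add: M_def)
    then show False using M e pos[of e] by (simp add: sum_diff1)
  next
    case False
    \<comment> \<open>The lighter path starts in the part of \<open>u\<close> and ends outside it,
      so one of its edges crosses.\<close>
    have "\<exists>a b. (u, a) \<in> R \<and> (u, b) \<notin> R \<and> {a, b} \<in> lower n w (w {u, v})"
    proof (rule ccontr)
      assume neg: "\<not> ?thesis"
      have "(u, z) \<in> R" if "(u, z) \<in> (adj (lower n w (w {u, v})))\<^sup>*" for z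
        using that
        by (induction rule: rtrancl_induct) (use neg in \<open>auto simp: adj_def R_def\<close>)
      then show False using path False by auto
    qed
    then obtain a b where ab: "(u, a) \<in> R" "(u, b) \<notin> R" "{a, b} \<in> lower n w (w {u, v})" by auto
    define f where "f = {a, b}"
    have f: "f \<in> cedges n" "w f < w e" using ab(3) by (auto simp: lower_def f_def e_def)
    then have abn: "a \<in> {1..n}" "b \<in> {1..n}" using pair_in_cedges by (auto simp: f_def)
    have vb: "(v, b) \<in> R" using split[OF abn(2)] ab by auto
    define H where "H = insert f (M - {e})"
    have RH: "R \<subseteq> (adj H)\<^sup>*" unfolding R_def H_def by (intro conn_mono) auto
    have "(a, b) \<in> adj H" by (auto simp: adj_def H_def f_def)
    then have "(u, v) \<in> (adj H)\<^sup>*"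
      using RH ab(1) vb conn_sym[of v b H] rtrancl_into_rtrancl[of u a "adj H" b] rtrancl_trans[of u b "adj H" v] by blast
    then have "(u, z) \<in> (adj H)\<^sup>*" if "z \<in> {1..n}" for z
      using split[OF that] RH rtrancl_trans[of u v "adj H" z] by blast
    then have "(x, z) \<in> (adj H)\<^sup>*" if "x \<in> {1..n}" "z \<in> {1..n}" for x z
      using that conn_sym[of u x H] rtrancl_trans[of x u "adj H" z] by blast
    then have "gconnected ({1..n}, H)" using uvn by (auto simp: gconnected_def gadj_eq)
    moreover have "H \<subseteq> cedges n" using M f by (auto simp: H_def)
    ultimately have "(\<Sum>e\<in>M. w e) \<le> (\<Sum>e\<in>H. w e)"
      using spanning_subgraph_weight[OF n, of w H] pos by (simp add: M_def)
    also have "\<dots> \<le> w f + (\<Sum>e\<in>M - {e}. w e)"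
      unfolding H_def using M f pos[of f] by (subst sum.insert_if) auto
    finally show False using M e f by (simp add: sum_diff1)
  qed
qed

text \<open>The tree path from \<open>u\<close> to \<open>v\<close> cannot consist of edges lighter
  than \<open>e\<close>, so it has an edge at least as heavy. Distinct weights make this edge
  strictly heavier when \<open>e\<close> is outside the tree, and swapping it for \<open>e\<close>
  lowers the total weight.\<close>

lemma mst_edge_if_cut:
  assumes pos: "\<And>f. f \<in> cedges n \<Longrightarrow> w f > 0" and inj: "inj_on w (cedges n)"
    and uv: "{u, v} \<in> cedges n" and cut: "(u, v) \<notin> (adj (lower n w (w {u, v})))\<^sup>*"
  shows "{u, v} \<in> gedges (mst n w)"
proof (rule ccontr)
  assume notin: "{u, v} \<notin> gedges (mst n w)"
  have uvn: "u \<in> {1..n}" "v \<in> {1..n}" using uv pair_in_cedges by auto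
  then have n: "n \<ge> 1" by auto
  define M where "M = gedges (mst n w)"
  define e where "e = {u, v}"
  have st: "spanning_tree (complete_graph n) (mst n w)" by (rule mst_props(1)[OF n])
  have M: "M \<subseteq> cedges n" "finite M" and con: "\<And>a b. a \<in> {1..n} \<Longrightarrow> b \<in> {1..n} \<Longrightarrow> (a, b) \<in> (adj M)\<^sup>*"
    using st finite_subset[OF _ finite_cedges]
    by (auto simp: spanning_tree_def gtree_def gconnected_def gadj_eq M_def)
  \<comment> \<open>Tree edges at least as heavy as \<open>e\<close> are deleted one at a time. At
    the start \<open>u\<close> and \<open>v\<close> are connected and at the end they are not, so
    some deletion of an edge \<open>f\<close> from the remaining set \<open>H\<close> breaks the
    connection.\<close>
  have "\<exists>H f. H \<subseteq> M \<and> f \<in> H \<and> w e \<le> w f \<and> (u, v) \<in> (adj H)\<^sup>* \<and> (u, v) \<notin> (adj (H - {f}))\<^sup>*"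
  proof -
    have "finite X \<Longrightarrow> X \<subseteq> M \<Longrightarrow> (\<forall>f\<in>X. w e \<le> w f) \<Longrightarrow> (u, v) \<notin> (adj (M - X))\<^sup>* \<Longrightarrow> ?thesis" for X
    proof (induction X rule: finite_induct)
      case empty then show ?case using con uvn by auto
    next
      case (insert f X)
      show ?case
      proof (cases "(u, v) \<in> (adj (M - X))\<^sup>*")
        case True
        have "M - insert f X = (M - X) - {f}" by auto
        then show ?thesis using insert True by (intro exI[of _ "M - X"] exI[of _ f]) auto
      qed (use insert in auto)
    qed
    moreover have "M - {f \<in> M. w e \<le> w f} \<subseteq> lower n w (w e)" using M by (auto simp: lower_def)
    then have "(u, v) \<notin> (adj (M - {f \<in> M. w e \<le> w f}))\<^sup>*" using cut conn_mono unfolding e_def by blast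
    moreover have "finite {f \<in> M. w e \<le> w f}" "{f \<in> M. w e \<le> w f} \<subseteq> M" using M by auto
    ultimately show ?thesis by blast
  qed
  then obtain H f where H: "H \<subseteq> M" "f \<in> H" "w e \<le> w f" "(u, v) \<in> (adj H)\<^sup>*" "(u, v) \<notin> (adj (H - {f}))\<^sup>*"
    by auto
  have "f \<noteq> e" using H notin by (auto simp: M_def e_def)
  then have wf: "w e < w f" using inj H M uv unfolding e_def by (metis inj_on_def order_le_less subsetD)
  define R where "R = (adj (insert e (M - {f})))\<^sup>*"
  have sub: "(adj (H - {f}))\<^sup>* \<subseteq> R" unfolding R_def using H by (intro conn_mono) auto
  have uvR: "(u, v) \<in> R" by (auto simp: R_def adj_def e_def)
  have Rsym: "(x, y) \<in> R \<Longrightarrow> (y, x) \<in> R" for x y unfolding R_def by (rule conn_sym)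
  have Rtr: "(x, y) \<in> R \<Longrightarrow> (y, z) \<in> R \<Longrightarrow> (x, z) \<in> R" for x y z unfolding R_def by (rule rtrancl_trans)
  obtain a b where ab: "f = {a, b}" using H M by (metis card_2_iff cedges_iff subsetD)
  have reach: "(u, z) \<in> (adj (H - {f}))\<^sup>* \<or> (a, z) \<in> (adj (H - {f}))\<^sup>* \<or> (b, z) \<in> (adj (H - {f}))\<^sup>*"
    if "(u, z) \<in> (adj H)\<^sup>*" for z
    using that
  proof (induction rule: rtrancl_induct)
    case (step y z)
    show ?case
    proof (cases "{y, z} = f")
      case True then show ?thesis using ab by (auto simp: doubleton_eq_iff)
    next
      case False
      then have "(y, z) \<in> adj (H - {f})" using step by (auto simp: adj_def)
      then show ?thesis using step(3) by (auto intro: rtrancl_into_rtrancl)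
    qed
  qed auto
  have reach': "\<exists>c\<in>{a, b}. (u, c) \<in> (adj (H - {f}))\<^sup>*"
  proof (rule ccontr)
    assume neg: "\<not> ?thesis"
    have "(u, z) \<in> (adj (H - {f}))\<^sup>*" if "(u, z) \<in> (adj H)\<^sup>*" for z
      using that
    proof (induction rule: rtrancl_induct)
      case (step y z)
      then have "{y, z} \<noteq> f" using neg ab by (auto simp: doubleton_eq_iff)
      then have "(y, z) \<in> adj (H - {f})" using step by (auto simp: adj_def)
      then show ?case using step(3) by (auto intro: rtrancl_into_rtrancl)
    qed auto
    then show False using H by auto
  qed
  have "\<exists>c\<in>{a, b}. (v, c) \<in> (adj (H - {f}))\<^sup>*"
    using reach[OF H(4)] H(5) conn_sym[of a v "H - {f}"] conn_sym[of b v "H - {f}"] by blast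
  \<comment> \<open>The two ends of \<open>f\<close> are on different sides, one joined to
    \<open>u\<close> and the other to \<open>v\<close> in \<open>H - {f}\<close>. Hence
    \<open>e\<close> joins them again after \<open>f\<close> is removed.\<close>
  then obtain c d where cd: "c \<in> {a, b}" "d \<in> {a, b}" "(u, c) \<in> (adj (H - {f}))\<^sup>*" "(v, d) \<in> (adj (H - {f}))\<^sup>*"
    using reach' by auto
  have cR: "(u, c) \<in> R" "(v, d) \<in> R" using cd sub by auto
  have "c \<noteq> d"
  proof
    assume "c = d"
    then have "(u, v) \<in> (adj (H - {f}))\<^sup>*" using cd conn_sym[of v d] rtrancl_trans[of u c _ v] by blast
    then show False using H by auto
  qed
  moreover have "(c, d) \<in> R" using cR uvR Rsym Rtr by blast
  ultimately have abR: "(a, b) \<in> R" "(b, a) \<in> R" using cd Rsym by auto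
  have "adj M \<subseteq> R"
  proof
    fix p assume p: "p \<in> adj M"
    obtain x y where xy: "p = (x, y)" by fastforce
    show "p \<in> R"
    proof (cases "{x, y} = f")
      case True then show ?thesis using abR ab xy by (auto simp: doubleton_eq_iff)
    next
      case False then show ?thesis using p xy by (auto simp: R_def adj_def)
    qed
  qed
  then have "(adj M)\<^sup>* \<subseteq> R" unfolding R_def by (metis rtrancl_idemp rtrancl_mono)
  then have "gconnected ({1..n}, insert e (M - {f}))" using con n unfolding R_def
    by (auto simp: gconnected_def gadj_eq)
  moreover have "insert e (M - {f}) \<subseteq> cedges n" using M uv by (auto simp: e_def)
  ultimately have "(\<Sum>e\<in>M. w e) \<le> (\<Sum>e\<in>insert e (M - {f}). w e)"
    using spanning_subgraph_weight[OF n, of w "insert e (M - {f})"] pos by (simp add: M_def)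
  also have "\<dots> \<le> w e + (\<Sum>e\<in>M - {f}. w e)"
    using M pos[OF uv] unfolding e_def by (subst sum.insert_if) auto
  finally show False using M H wf by (auto simp: sum_diff1)
qed

abbreviation unif :: "real measure" where
  "unif \<equiv> uniform_measure lborel {0..1}"

section \<open>The law of the weights\<close>

lemma prob_space_unif [simp, intro]: "prob_space unif"
  by (rule prob_space_uniform_measure) auto

lemma measure_unif_less: "0 \<le> s \<Longrightarrow> s \<le> 1 \<Longrightarrow> measure unif {..<s} = s"
proof -
  assume s: "0 \<le> s" "s \<le> 1"
  have "{0..1} \<inter> {..<s} = {0..<s}" using s by auto
  then show ?thesis using s by simp
qed

lemma measure_unif_ge: "0 \<le> s \<Longrightarrow> s \<le> 1 \<Longrightarrow> measure unif {s..} = 1 - s"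
proof -
  assume s: "0 \<le> s" "s \<le> 1"
  have "{0..1} \<inter> {s..} = {s..1}" using s by auto
  then show ?thesis using s by simp
qed

lemma measure_unif_UNIV [simp]: "measure unif UNIV = 1"
  using prob_space.prob_space[OF prob_space_unif] by simp

lemma product_prob_space_unif: "product_prob_space (\<lambda>_. unif)"
  by (intro product_prob_spaceI) auto

lemma prob_space_weight [simp, intro]: "prob_space (weight_law n)"
  unfolding weight_law_def by (intro prob_space_PiM) auto

lemma sets_weight [measurable_cong]: "sets (weight_law n) = sets (\<Pi>\<^sub>M e\<in>cedges n. borel)"
  unfolding weight_law_def by (intro sets_PiM_cong) auto

lemma space_weight: "space (weight_law n) = cedges n \<rightarrow>\<^sub>E UNIV"
  by (simp add: weight_law_def space_PiM)

lemma weight_component_measurable [measurable]: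
  "f \<in> cedges n \<Longrightarrow> (\<lambda>w. w f) \<in> borel_measurable (weight_law n)"
  using measurable_component_singleton[of f "cedges n" "\<lambda>_. borel"]
  by (simp add: measurable_cong_sets[OF sets_weight refl])

lemma weight_box:
  assumes "\<And>f. f \<in> cedges n \<Longrightarrow> A f \<in> sets borel"
  shows "measure (weight_law n) {w \<in> space (weight_law n). \<forall>f\<in>cedges n. w f \<in> A f} =
    (\<Prod>f\<in>cedges n. measure unif (A f))"
proof -
  interpret product_prob_space "\<lambda>_::nat set. unif" by (rule product_prob_space_unif)
  have "{w \<in> space (weight_law n). \<forall>f\<in>cedges n. w f \<in> A f} = (\<Pi>\<^sub>E f\<in>cedges n. A f)"
    by (auto simp: space_weight PiE_def extensional_def)
  moreover have "emeasure (weight_law n) (\<Pi>\<^sub>E f\<in>cedges n. A f) = (\<Prod>f\<in>cedges n. emeasure unif (A f))"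
    unfolding weight_law_def using assms by (intro emeasure_PiM) auto
  moreover have "\<dots> = ennreal (\<Prod>f\<in>cedges n. measure unif (A f))"
    by (subst prod_ennreal[symmetric])
       (auto intro!: prod.cong simp: finite_measure.emeasure_eq_measure[OF prob_space.finite_measure])
  ultimately show ?thesis by (simp add: measure_def prod_nonneg)
qed

text \<open>The form fits sprinkling: edges of \<open>X\<close> are present at level
  \<open>s\<close>, those of \<open>Y\<close> are absent at \<open>s\<close>, and those of
  \<open>Z\<close>, the cut, are absent even at the higher level \<open>s'\<close>. Single-level
  computations take \<open>Z\<close> empty.\<close>

lemma weight_box_threshold:
  assumes "X \<subseteq> cedges n" "Y \<subseteq> cedges n" "Z \<subseteq> cedges n" "X \<inter> Y = {}" "X \<inter> Z = {}" "Y \<inter> Z = {}"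
    and s: "0 \<le> s" "s \<le> 1" "0 \<le> s'" "s' \<le> 1"
  shows "measure (weight_law n) {w \<in> space (weight_law n). (\<forall>f\<in>X. w f < s) \<and> (\<forall>f\<in>Y. s \<le> w f) \<and> (\<forall>f\<in>Z. s' \<le> w f)}
    = s ^ card X * (1 - s) ^ card Y * (1 - s') ^ card Z"
proof -
  define A where "A = (\<lambda>f. if f \<in> X then {..<s} else if f \<in> Y then {s..} else if f \<in> Z then {s'..} else UNIV)"
  have "{w \<in> space (weight_law n). (\<forall>f\<in>X. w f < s) \<and> (\<forall>f\<in>Y. s \<le> w f) \<and> (\<forall>f\<in>Z. s' \<le> w f)}
    = {w \<in> space (weight_law n). \<forall>f\<in>cedges n. w f \<in> A f}"
    using assms(1-6) by (auto simp: A_def split: if_splits)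
  also have "measure (weight_law n) \<dots> = (\<Prod>f\<in>cedges n. measure unif (A f))"
    by (intro weight_box) (auto simp: A_def)
  also have "\<dots> = (\<Prod>f\<in>cedges n. (if f \<in> X then s else 1) * (if f \<in> Y then 1 - s else 1) * (if f \<in> Z then 1 - s' else 1))"
    using assms by (intro prod.cong) (auto simp: A_def measure_unif_less measure_unif_ge simp del: measure_uniform_measure)
  also have "\<dots> = s ^ card X * (1 - s) ^ card Y * (1 - s') ^ card Z"
    using assms(1-3) by (simp add: prod.distrib prod.If_cases Int_absorb1)
  finally show ?thesis .
qed

text \<open>The source of nearly all measurability here. There are finitely many patterns of truth
  values, so any \<open>h\<close> at all is measurable after them, including reachability, component
  sizes and values of a choice operator.\<close>

lemma finite_pattern_measurable:
  assumes "finite I" "\<And>i. i \<in> I \<Longrightarrow> {\<omega> \<in> space M. P i \<omega>} \<in> sets M" "\<And>X. X \<subseteq> I \<Longrightarrow> h X \<in> space N"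
  shows "(\<lambda>\<omega>. h {i \<in> I. P i \<omega>}) \<in> M \<rightarrow>\<^sub>M N"
proof (rule measurableI)
  fix A assume "A \<in> sets N"
  have "(\<lambda>\<omega>. h {i \<in> I. P i \<omega>}) -` A \<inter> space M =
    (\<Union>X\<in>{X \<in> Pow I. h X \<in> A}. {\<omega> \<in> space M. \<forall>i\<in>I. P i \<omega> \<longleftrightarrow> i \<in> X})"
  proof (intro equalityI subsetI)
    fix \<omega> assume "\<omega> \<in> (\<lambda>\<omega>. h {i \<in> I. P i \<omega>}) -` A \<inter> space M"
    then show "\<omega> \<in> (\<Union>X\<in>{X \<in> Pow I. h X \<in> A}. {\<omega> \<in> space M. \<forall>i\<in>I. P i \<omega> \<longleftrightarrow> i \<in> X})"
      by (intro UN_I[of "{i \<in> I. P i \<omega>}"]) auto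
  next
    fix \<omega> assume "\<omega> \<in> (\<Union>X\<in>{X \<in> Pow I. h X \<in> A}. {\<omega> \<in> space M. \<forall>i\<in>I. P i \<omega> \<longleftrightarrow> i \<in> X})"
    then obtain X where X: "X \<subseteq> I" "h X \<in> A" "\<omega> \<in> space M" "\<forall>i\<in>I. P i \<omega> \<longleftrightarrow> i \<in> X" by auto
    then have "{i \<in> I. P i \<omega>} = X" by auto
    then show "\<omega> \<in> (\<lambda>\<omega>. h {i \<in> I. P i \<omega>}) -` A \<inter> space M" using X by simp
  qed
  also have "\<dots> \<in> sets M"
  proof (rule sets.finite_UN)
    show "finite {X \<in> Pow I. h X \<in> A}" using assms(1) by auto
    show "{\<omega> \<in> space M. \<forall>i\<in>I. P i \<omega> \<longleftrightarrow> i \<in> X} \<in> sets M" for X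
    proof (rule sets.sets_Collect_finite_All[OF _ assms(1)])
      fix i assume i: "i \<in> I"
      have "{\<omega> \<in> space M. P i \<omega> \<longleftrightarrow> i \<in> X} = (if i \<in> X then {\<omega> \<in> space M. P i \<omega>} else space M - {\<omega> \<in> space M. P i \<omega>})"
        by auto
      then show "{\<omega> \<in> space M. P i \<omega> \<longleftrightarrow> i \<in> X} \<in> sets M" using assms(2)[OF i] by auto
    qed
  qed
  finally show "(\<lambda>\<omega>. h {i \<in> I. P i \<omega>}) -` A \<inter> space M \<in> sets M" .
qed (rule assms(3), blast)

lemma finite_pattern_sets:
  assumes "finite I" "\<And>i. i \<in> I \<Longrightarrow> {\<omega> \<in> space M. P i \<omega>} \<in> sets M"
  shows "{\<omega> \<in> space M. \<Phi> {i \<in> I. P i \<omega>}} \<in> sets M"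
proof -
  have "(\<lambda>\<omega>. \<Phi> {i \<in> I. P i \<omega>}) \<in> M \<rightarrow>\<^sub>M count_space UNIV"
    by (rule finite_pattern_measurable[where h = \<Phi> and I = I and P = P]) (use assms in auto)
  then show ?thesis by (simp add: pred_def)
qed

lemma finite_pattern_integrable:
  fixes h :: "'i set \<Rightarrow> real"
  assumes "finite_measure M" "finite I" "\<And>i. i \<in> I \<Longrightarrow> {\<omega> \<in> space M. P i \<omega>} \<in> sets M"
  shows "integrable M (\<lambda>\<omega>. h {i \<in> I. P i \<omega>})"
proof -
  have "(\<lambda>\<omega>. h {i \<in> I. P i \<omega>}) \<in> borel_measurable M"
    by (rule finite_pattern_measurable[where h = h and I = I and P = P]) (use assms in auto)
  moreover have "AE \<omega> in M. norm (h {i \<in> I. P i \<omega>}) \<le> (\<Sum>X\<in>Pow I. \<bar>h X\<bar>)"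
  proof (rule AE_I2)
    fix \<omega>
    have "\<bar>h {i \<in> I. P i \<omega>}\<bar> \<le> (\<Sum>X\<in>Pow I. \<bar>h X\<bar>)"
      using assms(2) by (intro member_le_sum[of _ _ "\<lambda>X. \<bar>h X\<bar>"]) auto
    then show "norm (h {i \<in> I. P i \<omega>}) \<le> (\<Sum>X\<in>Pow I. \<bar>h X\<bar>)" by simp
  qed
  ultimately show ?thesis by (rule finite_measure.integrable_const_bound[OF assms(1), rotated])
qed

text \<open>All graphs below finitely many levels in one object. The default {} off \<open>L\<close>
  makes the whole function depend only on the comparisons \<open>w f < s\<close> with
  \<open>s\<close> in \<open>L\<close>, which is a finite pattern.\<close>

definition lowfam :: "nat \<Rightarrow> real set \<Rightarrow> (nat set \<Rightarrow> real) \<Rightarrow> real \<Rightarrow> nat set set" where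
  "lowfam n L w = (\<lambda>s. if s \<in> L then lower n w s else {})"

lemma lowfam_eq: "lowfam n L w = (\<lambda>s. {f. (f, s) \<in> {(f, s) \<in> cedges n \<times> L. w f < s}})"
  by (intro ext) (simp add: lowfam_def lower_def)

lemma lowfam_sets:
  assumes "finite L"
  shows "{w \<in> space (weight_law n). \<Phi> (lowfam n L w)} \<in> sets (weight_law n)"
proof -
  have "{w \<in> space (weight_law n). \<Phi> (\<lambda>s. {f. (f, s) \<in> {i \<in> cedges n \<times> L. w (fst i) < snd i}})} \<in> sets (weight_law n)"
    using assms by (intro finite_pattern_sets[where \<Phi> = "\<lambda>X. \<Phi> (\<lambda>s. {f. (f, s) \<in> X})"]) auto
  then show ?thesis unfolding lowfam_eq by (simp add: case_prod_unfold)
qed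

lemma lowfam_integrable:
  fixes h :: "(real \<Rightarrow> nat set set) \<Rightarrow> real"
  assumes "finite L"
  shows "integrable (weight_law n) (\<lambda>w. h (lowfam n L w))"
proof -
  have "integrable (weight_law n) (\<lambda>w. h (\<lambda>s. {f. (f, s) \<in> {i \<in> cedges n \<times> L. w (fst i) < snd i}}))"
    using assms by (intro finite_pattern_integrable[where h = "\<lambda>X. h (\<lambda>s. {f. (f, s) \<in> X})"])
      (auto intro: prob_space.finite_measure)
  then show ?thesis unfolding lowfam_eq by (simp add: case_prod_unfold)
qed

lemma lower_sets: "{w \<in> space (weight_law n). \<Phi> (lower n w s)} \<in> sets (weight_law n)"
  using lowfam_sets[of "{s}" n "\<lambda>g. \<Phi> (g s)"] by (simp add: lowfam_def)

lemma lower_integrable: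
  fixes h :: "nat set set \<Rightarrow> real"
  shows "integrable (weight_law n) (\<lambda>w. h (lower n w s))"
  using lowfam_integrable[of "{s}" n "\<lambda>g. h (g s)"] by (simp add: lowfam_def)

lemma lower2_sets: "{w \<in> space (weight_law n). \<Phi> (lower n w s) (lower n w s')} \<in> sets (weight_law n)"
  using lowfam_sets[of "{s, s'}" n "\<lambda>g. \<Phi> (g s) (g s')"] by (simp add: lowfam_def)

lemma lower2_integrable:
  fixes h :: "nat set set \<Rightarrow> nat set set \<Rightarrow> real"
  shows "integrable (weight_law n) (\<lambda>w. h (lower n w s) (lower n w s'))"
  using lowfam_integrable[of "{s, s'}" n "\<lambda>g. h (g s) (g s')"] by (simp add: lowfam_def)

lemma integral_of_bool:
  assumes "{\<omega> \<in> space M. P \<omega>} \<in> sets M"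
  shows "(\<integral>\<omega>. (of_bool (P \<omega>) :: real) \<partial>M) = measure M {\<omega> \<in> space M. P \<omega>}"
proof -
  have "(\<integral>\<omega>. (of_bool (P \<omega>) :: real) \<partial>M) = (\<integral>\<omega>. indicator {\<omega> \<in> space M. P \<omega>} \<omega> \<partial>M)"
    by (intro Bochner_Integration.integral_cong) (auto simp: indicator_def)
  then show ?thesis using assms sets.sets_into_space[OF assms] by (simp add: Int_absorb2)
qed

section \<open>Almost sure positivity and distinctness of the weights\<close>

lemma AE_weight_pos: "AE w in weight_law n. \<forall>f\<in>cedges n. 0 < w f"
proof (rule AE_finite_allI[OF finite_cedges])
  fix f assume f: "f \<in> cedges n"
  have "AE x in unif. x \<noteq> 0 \<and> x \<in> {0..1}"
    using AE_lborel_singleton[of 0] by (intro AE_uniform_measureI) (auto elim: eventually_mono)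
  then have "AE x in unif. 0 < x" by eventually_elim auto
  then show "AE w in weight_law n. 0 < w f"
    unfolding weight_law_def using f by (intro AE_PiM_component) auto
qed

text \<open>The diagonal of the unit square is covered by N squares of side 1 / N, each of
  probability 1 / N^2, so a tie has probability at most 1 / N for every N.\<close>

lemma weight_tie_null:
  assumes f: "f \<in> cedges n" "g \<in> cedges n" "f \<noteq> g"
  shows "AE w in weight_law n. w f \<noteq> w g"
proof -
  interpret prob_space "weight_law n" by simp
  define T where "T = {w \<in> space (weight_law n). w f = w g}"
  have T[measurable]: "T \<in> sets (weight_law n)" unfolding T_def using f by measurable
  define B where "B = (\<lambda>N i. {w \<in> space (weight_law n). w f \<in> {real i / real N..real (Suc i) / real N} \<and>
      w g \<in> {real i / real N..real (Suc i) / real N}})"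
  define Z where "Z = {w \<in> space (weight_law n). w f \<notin> {0..1}}"
  have "AE w in weight_law n. w f \<in> {0..1}"
    unfolding weight_law_def using f by (intro AE_PiM_component AE_uniform_measureI) auto
  then have Z0: "prob Z = 0"
    unfolding Z_def using f by (subst prob_eq_0) auto
  have Bm: "prob (B N i) = 1 / (real N)\<^sup>2" if "i < N" for N i
  proof -
    define A where "A = (\<lambda>h. if h = f \<or> h = g then {real i / real N..real (Suc i) / real N} else UNIV)"
    have "B N i = {w \<in> space (weight_law n). \<forall>h\<in>cedges n. w h \<in> A h}"
      using f by (auto simp: B_def A_def)
    then have "prob (B N i) = (\<Prod>h\<in>cedges n. measure unif (A h))"
      by (simp only:) (rule weight_box, auto simp: A_def)
    also have "\<dots> = (\<Prod>h\<in>{f, g}. measure unif (A h))"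
      using f by (intro prod.mono_neutral_right) (auto simp: A_def simp del: measure_uniform_measure)
    also have "measure unif {real i / real N..real (Suc i) / real N} = 1 / real N"
    proof -
      have "real (Suc i) / real N \<le> 1" using that by simp
      then have "{0..1} \<inter> {real i / real N..real (Suc i) / real N} = {real i / real N..real (Suc i) / real N}"
        by (auto intro: order_trans[rotated])
      then show ?thesis by (simp add: divide_right_mono diff_divide_distrib[symmetric])
    qed
    then have "(\<Prod>h\<in>{f, g}. measure unif (A h)) = 1 / (real N)\<^sup>2"
      using f(3) by (simp add: A_def power2_eq_square del: measure_uniform_measure)
    finally show ?thesis .
  qed
  have "prob T \<le> 1 / real N" if N: "N > 0" for N
  proof -
    have "T \<subseteq> Z \<union> (\<Union>i<N. B N i)"
    proof
      fix w assume w: "w \<in> T"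
      show "w \<in> Z \<union> (\<Union>i<N. B N i)"
      proof (cases "w f \<in> {0..1}")
        case True
        \<comment> \<open>The minimum with \<open>N - 1\<close> puts the value 1 into the last
          closed interval.\<close>
        define i where "i = min (nat \<lfloor>w f * real N\<rfloor>) (N - 1)"
        have "real i \<le> real (nat \<lfloor>w f * real N\<rfloor>)" by (simp add: i_def)
        also have "\<dots> \<le> w f * real N" using True by (intro of_nat_floor) auto
        finally have "real i \<le> w f * real N" .
        moreover have "w f * real N \<le> real (Suc i)"
        proof (cases "nat \<lfloor>w f * real N\<rfloor> \<le> N - 1")
          case True then show ?thesis by (simp add: i_def) linarith
        next
          case False
          then have "real (Suc i) = real N" using N by (simp add: i_def)
          moreover have "w f * real N \<le> 1 * real N" using True by (intro mult_right_mono) auto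
          ultimately show ?thesis by simp
        qed
        ultimately have "w f \<in> {real i / real N..real (Suc i) / real N}" using N by (simp add: field_simps)
        moreover have "i < N" using N by (auto simp: i_def)
        ultimately show ?thesis using w by (auto simp: B_def T_def)
      qed (use w in \<open>auto simp: Z_def T_def\<close>)
    qed
    then have "prob T \<le> prob (Z \<union> (\<Union>i<N. B N i))"
      using f by (intro finite_measure_mono) (auto simp: Z_def B_def)
    also have "\<dots> \<le> prob Z + prob (\<Union>i<N. B N i)"
      using f by (intro measure_Un_le) (auto simp: Z_def B_def)
    also have "prob (\<Union>i<N. B N i) \<le> (\<Sum>i<N. prob (B N i))"
      using f by (intro finite_measure_subadditive_finite) (auto simp: B_def)
    also have "(\<Sum>i<N. prob (B N i)) = 1 / real N"
      using Bm N by (simp add: power2_eq_square)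
    finally show ?thesis using Z0 by simp
  qed
  then have "\<forall>\<^sub>F N in sequentially. prob T \<le> 1 / real N"
    unfolding eventually_sequentially by (intro exI[of _ 1]) auto
  then have "prob T \<le> 0"
    by (rule tendsto_lowerbound[OF lim_1_over_n]) auto
  then have "prob T = 0" by (simp add: measure_le_0_iff)
  then show ?thesis unfolding T_def using f by (subst (asm) prob_eq_0) auto
qed

lemma AE_weight_inj: "AE w in weight_law n. inj_on w (cedges n)"
proof -
  have "AE w in weight_law n. \<forall>f\<in>cedges n. \<forall>g\<in>cedges n. f \<noteq> g \<longrightarrow> w f \<noteq> w g"
    by (intro AE_finite_allI finite_cedges AE_impI weight_tie_null)
  then show ?thesis by eventually_elim (auto simp: inj_on_def)
qed

section \<open>Invariance of the law under relabeling of the vertices\<close>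

definition wact :: "nat \<Rightarrow> (nat \<Rightarrow> nat) \<Rightarrow> (nat set \<Rightarrow> real) \<Rightarrow> nat set \<Rightarrow> real" where
  "wact n \<sigma> w = (\<lambda>e\<in>cedges n. w (\<sigma> ` e))"

lemma image_cedges_iff:
  assumes "\<sigma> permutes {1..n}"
  shows "\<sigma> ` e \<in> cedges n \<longleftrightarrow> e \<in> cedges n"
proof -
  have "inj \<sigma>" using assms by (rule permutes_inj)
  then have "card (\<sigma> ` e) = card e" by (intro card_image) (auto intro: inj_on_subset)
  moreover have "\<sigma> ` e \<subseteq> {1..n} \<longleftrightarrow> e \<subseteq> {1..n}"
    unfolding image_subset_iff subset_iff using permutes_in_image[OF assms] by blast
  ultimately show ?thesis by (simp add: cedges_iff)
qed

lemma weight_law_wact: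
  assumes "\<sigma> permutes {1..n}"
  shows "distr (weight_law n) (weight_law n) (wact n \<sigma>) = weight_law n"
proof -
  have "inj_on ((`) \<sigma>) (cedges n)"
    using permutes_inj[OF assms] by (simp add: inj_image_eq_iff inj_on_def)
  moreover have "(`) \<sigma> \<in> cedges n \<rightarrow> cedges n" using image_cedges_iff[OF assms] by auto
  ultimately show ?thesis
    unfolding weight_law_def wact_def using distr_PiM_reindex[of "cedges n" "\<lambda>_. unif" "(`) \<sigma>" "cedges n"] by auto
qed

lemma measure_wact:
  assumes "\<sigma> permutes {1..n}" "{w \<in> space (weight_law n). P w} \<in> sets (weight_law n)"
  shows "measure (weight_law n) {w \<in> space (weight_law n). P (wact n \<sigma> w)} =
    measure (weight_law n) {w \<in> space (weight_law n). P w}"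
proof -
  have m: "wact n \<sigma> \<in> weight_law n \<rightarrow>\<^sub>M weight_law n"
    unfolding wact_def using image_cedges_iff[OF assms(1)]
    by (simp add: measurable_cong_sets[OF refl sets_weight] measurable_restrict)
  have "measure (weight_law n) {w \<in> space (weight_law n). P w} =
    measure (distr (weight_law n) (weight_law n) (wact n \<sigma>)) {w \<in> space (weight_law n). P w}"
    by (simp add: weight_law_wact[OF assms(1)])
  also have "\<dots> = measure (weight_law n) (wact n \<sigma> -` {w \<in> space (weight_law n). P w} \<inter> space (weight_law n))"
    by (rule measure_distr[OF m assms(2)])
  also have "wact n \<sigma> -` {w \<in> space (weight_law n). P w} \<inter> space (weight_law n) =
      {w \<in> space (weight_law n). P (wact n \<sigma> w)}"
    using measurable_space[OF m] by auto
  finally show ?thesis by simp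
qed

lemma lower_wact: "\<sigma> permutes {1..n} \<Longrightarrow> e \<in> lower n (wact n \<sigma> w) s \<longleftrightarrow> \<sigma> ` e \<in> lower n w s"
  using image_cedges_iff[of \<sigma> n e] by (auto simp: lower_def wact_def)

lemma conn_wact:
  assumes "\<sigma> permutes {1..n}"
  shows "(x, y) \<in> (adj (lower n (wact n \<sigma> w) s))\<^sup>* \<longleftrightarrow> (\<sigma> x, \<sigma> y) \<in> (adj (lower n w s))\<^sup>*"
proof -
  have adj_iff: "(a, b) \<in> adj (lower n (wact n \<sigma> w) s) \<longleftrightarrow> (\<sigma> a, \<sigma> b) \<in> adj (lower n w s)" for a b
    by (simp add: adj_def lower_wact[OF assms])
  have 1: "(\<sigma> x, \<sigma> y) \<in> (adj (lower n w s))\<^sup>*" if "(x, y) \<in> (adj (lower n (wact n \<sigma> w) s))\<^sup>*" for x y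
    using that by (induction rule: rtrancl_induct) (auto simp: adj_iff intro: rtrancl_into_rtrancl)
  have 2: "(x, inv \<sigma> z) \<in> (adj (lower n (wact n \<sigma> w) s))\<^sup>*" if "(\<sigma> x, z) \<in> (adj (lower n w s))\<^sup>*" for x z
    using that
  proof (induction rule: rtrancl_induct)
    case base then show ?case by (simp add: permutes_inverses[OF assms])
  next
    case (step y z)
    then have "(inv \<sigma> y, inv \<sigma> z) \<in> adj (lower n (wact n \<sigma> w) s)"
      by (simp add: adj_iff permutes_inverses[OF assms])
    then show ?case using step(3) by (rule rtrancl_into_rtrancl[rotated])
  qed
  show ?thesis using 1 2[of x "\<sigma> y"] by (auto simp: permutes_inverses[OF assms])
qed

lemma card_cluster_wact:
  assumes "\<sigma> permutes {1..n}"
  shows "card (cluster (lower n (wact n \<sigma> w) s) x) = card (cluster (lower n w s) (\<sigma> x))"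
proof -
  have "\<sigma> ` cluster (lower n (wact n \<sigma> w) s) x = cluster (lower n w s) (\<sigma> x)"
  proof (intro equalityI subsetI)
    fix z assume "z \<in> cluster (lower n w s) (\<sigma> x)"
    then have "inv \<sigma> z \<in> cluster (lower n (wact n \<sigma> w) s) x"
      by (simp add: mem_cluster conn_wact[OF assms] permutes_inverses[OF assms])
    then show "z \<in> \<sigma> ` cluster (lower n (wact n \<sigma> w) s) x"
      using permutes_inverses(1)[OF assms, of z] by (metis imageI)
  qed (auto simp: mem_cluster conn_wact[OF assms])
  moreover have "inj_on \<sigma> (cluster (lower n (wact n \<sigma> w) s) x)"
    using permutes_inj[OF assms] by (auto intro: inj_on_subset)
  ultimately show ?thesis using card_image by metis
qed

section \<open>Components of the sparse random graph\<close>

definition inner :: "nat \<Rightarrow> nat set \<Rightarrow> nat set set" where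
  "inner n S = {e \<in> cedges n. e \<subseteq> S}"

definition bdry :: "nat \<Rightarrow> nat set \<Rightarrow> nat set set" where
  "bdry n S = {e \<in> cedges n. e \<inter> S \<noteq> {} \<and> \<not> e \<subseteq> S}"

definition comps :: "nat \<Rightarrow> nat set set \<Rightarrow> nat set set" where
  "comps n H = cluster H ` {1..n}"

definition connects :: "nat set set \<Rightarrow> nat set \<Rightarrow> bool" where
  "connects X S \<longleftrightarrow> (\<forall>u\<in>S. \<forall>v\<in>S. (u, v) \<in> (adj X)\<^sup>*)"

definition cross :: "'a set \<Rightarrow> 'a set \<Rightarrow> 'a set set" where
  "cross A B = (\<lambda>(x, y). {x, y}) ` (A \<times> B)"

lemma card_cross:
  assumes "A \<inter> B = {}"
  shows "card (cross A B) = card A * card B"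
proof -
  have "inj_on (\<lambda>(x, y). {x, y}) (A \<times> B)"
    using assms by (auto simp: inj_on_def doubleton_eq_iff)
  then show ?thesis by (simp add: cross_def card_image card_cartesian_product)
qed

lemma cedgeE:
  assumes "e \<in> cedges n"
  obtains a b where "e = {a, b}" "a \<noteq> b" "a \<in> {1..n}" "b \<in> {1..n}"
  using assms pair_in_cedges by (metis card_2_iff cedges_iff)

lemma bdry_eq_cross: "S \<subseteq> {1..n} \<Longrightarrow> bdry n S = cross S ({1..n} - S)"
proof (intro equalityI subsetI)
  fix e assume S: "S \<subseteq> {1..n}" and e: "e \<in> bdry n S"
  then obtain a b where ab: "e = {a, b}" "a \<in> {1..n}" "b \<in> {1..n}"
    unfolding bdry_def by (blast elim: cedgeE)
  then have "(a \<in> S \<and> b \<notin> S) \<or> (b \<in> S \<and> a \<notin> S)" using e by (auto simp: bdry_def)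
  then show "e \<in> cross S ({1..n} - S)"
  proof
    assume "a \<in> S \<and> b \<notin> S"
    then show ?thesis using ab unfolding cross_def by (intro image_eqI[of _ _ "(a, b)"]) auto
  next
    assume "b \<in> S \<and> a \<notin> S"
    then show ?thesis using ab unfolding cross_def by (intro image_eqI[of _ _ "(b, a)"]) auto
  qed
next
  fix e assume S: "S \<subseteq> {1..n}" and e: "e \<in> cross S ({1..n} - S)"
  then obtain a b where ab: "e = {a, b}" "a \<in> S" "b \<in> {1..n}" "b \<notin> S" by (auto simp: cross_def)
  then have "{a, b} \<in> cedges n" using S by (subst pair_in_cedges) auto
  then show "e \<in> bdry n S" using ab by (auto simp: bdry_def)
qed

lemma card_bdry:
  assumes "S \<subseteq> {1..n}" "card S = k"
  shows "card (bdry n S) = k * (n - k)"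
proof -
  have "finite S" using assms(1) by (rule finite_subset) simp
  then have "card ({1..n} - S) = n - k" using assms by (simp add: card_Diff_subset)
  then show ?thesis using assms by (simp add: bdry_eq_cross card_cross)
qed

lemma card_bdry_Un:
  assumes "S \<subseteq> {1..n}" "card S = k" "S' \<subseteq> {1..n}" "card S' = k" "S \<inter> S' = {}"
  shows "card (bdry n S \<union> bdry n S') + k * k = 2 * (k * (n - k))"
proof -
  have "bdry n S \<inter> bdry n S' = cross S S'"
  proof (intro equalityI subsetI)
    fix e assume e: "e \<in> bdry n S \<inter> bdry n S'"
    then obtain a b where ab: "e = {a, b}" by (auto simp: bdry_def elim!: cedgeE)
    have "(a \<in> S \<and> b \<in> S') \<or> (b \<in> S \<and> a \<in> S')" using e ab assms by (auto simp: bdry_def)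
    then show "e \<in> cross S S'"
    proof
      assume "a \<in> S \<and> b \<in> S'"
      then show ?thesis using ab unfolding cross_def by (intro image_eqI[of _ _ "(a, b)"]) auto
    next
      assume "b \<in> S \<and> a \<in> S'"
      then show ?thesis using ab unfolding cross_def by (intro image_eqI[of _ _ "(b, a)"]) auto
    qed
  next
    fix e assume e: "e \<in> cross S S'"
    then obtain a b where ab: "e = {a, b}" "a \<in> S" "b \<in> S'" by (auto simp: cross_def)
    then have "{a, b} \<in> cedges n" using assms by (subst pair_in_cedges) auto
    then show "e \<in> bdry n S \<inter> bdry n S'" using ab assms by (auto simp: bdry_def)
  qed
  then have "card (bdry n S \<inter> bdry n S') = k * k" using assms by (simp add: card_cross)
  moreover have "finite (bdry n S)" "finite (bdry n S')" by (auto simp: bdry_def)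
  ultimately show ?thesis using card_Un_Int[of "bdry n S" "bdry n S'"] assms by (simp add: card_bdry)
qed

text \<open>This splits the event into a condition on edges inside \<open>S\<close> and a condition
  on edges leaving \<open>S\<close>. The two edge sets are disjoint, which yields the product
  formula for its probability.\<close>

lemma mem_comps_iff:
  assumes "H \<subseteq> cedges n" "S \<subseteq> {1..n}" "S \<noteq> {}"
  shows "S \<in> comps n H \<longleftrightarrow> connects (H \<inter> inner n S) S \<and> H \<inter> bdry n S = {}"
proof
  assume "S \<in> comps n H"
  then obtain x where x: "S = cluster H x" by (auto simp: comps_def)
  have "(x, z) \<in> (adj (H \<inter> inner n S))\<^sup>*" if "z \<in> S" for z
  proof -
    have "(x, z) \<in> (adj H)\<^sup>*" using that x by (simp add: mem_cluster)
    then show ?thesis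
    proof (induction rule: rtrancl_induct)
      case (step y z)
      then have "y \<in> S" "z \<in> S" using x by (auto simp: mem_cluster intro: rtrancl_into_rtrancl)
      then have "(y, z) \<in> adj (H \<inter> inner n S)" using step assms(1) by (auto simp: adj_def inner_def)
      then show ?case using step by (auto intro: rtrancl_into_rtrancl)
    qed auto
  qed
  then have "connects (H \<inter> inner n S) S"
    unfolding connects_def using conn_sym rtrancl_trans by metis
  moreover have "H \<inter> bdry n S = {}"
  proof (rule ccontr)
    assume "H \<inter> bdry n S \<noteq> {}"
    then obtain e where e: "e \<in> H" "e \<in> bdry n S" by auto
    then obtain a b where ab: "e = {a, b}" "a \<in> S" "b \<notin> S"
      using bdry_eq_cross[OF assms(2)] by (auto simp: cross_def)
    then have "(x, a) \<in> (adj H)\<^sup>*" "(a, b) \<in> adj H" using e x by (auto simp: mem_cluster adj_def)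
    then have "b \<in> S" using x by (auto simp: mem_cluster intro: rtrancl_into_rtrancl)
    then show False using ab by simp
  qed
  ultimately show "connects (H \<inter> inner n S) S \<and> H \<inter> bdry n S = {}" by simp
next
  assume a: "connects (H \<inter> inner n S) S \<and> H \<inter> bdry n S = {}"
  obtain x where x: "x \<in> S" using assms by auto
  have "cluster H x = S"
  proof (intro equalityI subsetI)
    fix z assume "z \<in> cluster H x"
    then have "(x, z) \<in> (adj H)\<^sup>*" by (simp add: mem_cluster)
    then show "z \<in> S"
    proof (induction rule: rtrancl_induct)
      case (step y z)
      show ?case
      proof (rule ccontr)
        assume "z \<notin> S"
        then have "{y, z} \<in> bdry n S" using step assms(1) by (auto simp: adj_def bdry_def)
        then show False using a step by (auto simp: adj_def)
      qed
    qed (use x in auto)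
  next
    fix z assume "z \<in> S"
    then have "(x, z) \<in> (adj (H \<inter> inner n S))\<^sup>*" using a x by (auto simp: connects_def)
    then show "z \<in> cluster H x" using conn_mono[of "H \<inter> inner n S" H] by (auto simp: mem_cluster)
  qed
  then show "S \<in> comps n H" using x assms(2) by (auto simp: comps_def)
qed

lemma measure_lower_pattern:
  assumes D: "D \<subseteq> cedges n" and B: "B \<subseteq> cedges n" "B \<inter> D = {}" and XX: "XX \<subseteq> Pow D"
    and s: "0 \<le> s" "s \<le> 1"
  shows "measure (weight_law n) {w \<in> space (weight_law n). lower n w s \<inter> D \<in> XX \<and> lower n w s \<inter> B = {}} =
    (\<Sum>X\<in>XX. s ^ card X * (1 - s) ^ (card D - card X)) * (1 - s) ^ card B"
proof -
  interpret prob_space "weight_law n" by simp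
  have fD: "finite D" using D finite_subset by blast
  have fB: "finite B" using B finite_subset by blast
  define Q where "Q = (\<lambda>X. {w \<in> space (weight_law n). lower n w s \<inter> D = X \<and> lower n w s \<inter> B = {}})"
  have Q: "prob (Q X) = s ^ card X * (1 - s) ^ (card D - card X) * (1 - s) ^ card B" if "X \<in> XX" for X
  proof -
    have X: "X \<subseteq> D" using that XX by auto
    have "Q X = {w \<in> space (weight_law n). (\<forall>f\<in>X. w f < s) \<and> (\<forall>f\<in>(D - X) \<union> B. s \<le> w f) \<and> (\<forall>f\<in>{}. s \<le> w f)}"
      using X D B by (auto simp: Q_def lower_def not_less[symmetric])
    also have "prob \<dots> = s ^ card X * (1 - s) ^ card ((D - X) \<union> B) * (1 - s) ^ card ({} :: nat set set)"
      using X D B s by (intro weight_box_threshold) auto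
    also have "card ((D - X) \<union> B) = (card D - card X) + card B"
      using B fB fD X by (subst card_Un_disjoint) (auto simp: card_Diff_subset finite_subset)
    finally show ?thesis by (simp add: power_add)
  qed
  have "{w \<in> space (weight_law n). lower n w s \<inter> D \<in> XX \<and> lower n w s \<inter> B = {}} = (\<Union>X\<in>XX. Q X)"
    by (auto simp: Q_def)
  also have "prob \<dots> = (\<Sum>X\<in>XX. prob (Q X))"
    using XX fD lower_sets[of n "\<lambda>H. H \<inter> D = _ \<and> H \<inter> B = {}" s]
    by (intro finite_measure_finite_Union) (auto simp: Q_def disjoint_family_on_def finite_subset)
  also have "\<dots> = (\<Sum>X\<in>XX. s ^ card X * (1 - s) ^ (card D - card X)) * (1 - s) ^ card B"
    by (simp add: Q sum_distrib_right)
  finally show ?thesis .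
qed

text \<open>For \<open>s\<close> in [0, 1] this is the probability that the edges inside
  \<open>S\<close> with weight below \<open>s\<close> connect \<open>S\<close>; \<open>X\<close>
  runs over the connecting configurations.\<close>

definition kappa :: "nat \<Rightarrow> nat set \<Rightarrow> real \<Rightarrow> real" where
  "kappa n S s = (\<Sum>X\<in>{X \<in> Pow (inner n S). connects X S}. s ^ card X * (1 - s) ^ (card (inner n S) - card X))"

definition compprob :: "nat \<Rightarrow> nat set \<Rightarrow> real \<Rightarrow> real" where
  "compprob n S s = measure (weight_law n) {w \<in> space (weight_law n). S \<in> comps n (lower n w s)}"

lemma inner_bdry: "inner n S \<subseteq> cedges n" "bdry n S \<subseteq> cedges n" "bdry n S \<inter> inner n S = {}"
  "finite (inner n S)" "finite (bdry n S)"
  by (auto simp: inner_def bdry_def)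

lemma compprob_eq:
  assumes "S \<subseteq> {1..n}" "S \<noteq> {}" "0 \<le> s" "s \<le> 1"
  shows "compprob n S s = kappa n S s * (1 - s) ^ card (bdry n S)"
proof -
  have "{w \<in> space (weight_law n). S \<in> comps n (lower n w s)} = {w \<in> space (weight_law n).
    lower n w s \<inter> inner n S \<in> {X \<in> Pow (inner n S). connects X S} \<and> lower n w s \<inter> bdry n S = {}}"
    using mem_comps_iff[OF lower_subset assms(1,2)] by auto
  then show ?thesis unfolding compprob_def kappa_def
    using assms by (simp only:) (intro measure_lower_pattern inner_bdry, auto)
qed

text \<open>The inner edges of the two sets are disjoint, but the k * k edges between the sets lie
  in both boundaries and are counted twice in the product on the right. The extra factor
  \<open>(1 - s) ^ (k * k)\<close> on the left repairs this; the two events are asymptotically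
  independent for s of order 1 / n.\<close>

lemma compprob_pair:
  assumes S: "S \<subseteq> {1..n}" "S' \<subseteq> {1..n}" "card S = k" "card S' = k" "k \<ge> 1" "S \<inter> S' = {}"
    and s: "0 \<le> s" "s \<le> 1"
  shows "measure (weight_law n) {w \<in> space (weight_law n). S \<in> comps n (lower n w s) \<and> S' \<in> comps n (lower n w s)}
    * (1 - s) ^ (k * k) = compprob n S s * compprob n S' s"
proof -
  have ne: "S \<noteq> {}" "S' \<noteq> {}" using S by auto
  define A where "A = {X \<in> Pow (inner n S). connects X S}"
  define A' where "A' = {X \<in> Pow (inner n S'). connects X S'}"
  define XX where "XX = (\<lambda>(X, X'). X \<union> X') ` (A \<times> A')"
  have disj: "inner n S \<inter> inner n S' = {}"
  proof (rule ccontr)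
    assume "inner n S \<inter> inner n S' \<noteq> {}"
    then obtain e where "e \<in> cedges n" "e \<subseteq> S" "e \<subseteq> S'" by (auto simp: inner_def)
    then show False using S(6) by (auto elim!: cedgeE)
  qed
  have disj': "inner n S' \<inter> bdry n S = {}" "inner n S \<inter> bdry n S' = {}"
    using S(6) by (auto simp: inner_def bdry_def)
  have mem: "H \<inter> (inner n S \<union> inner n S') \<in> XX \<longleftrightarrow> connects (H \<inter> inner n S) S \<and> connects (H \<inter> inner n S') S'" for H
  proof
    assume "H \<inter> (inner n S \<union> inner n S') \<in> XX"
    then obtain X X' where X: "X \<in> A" "X' \<in> A'" "H \<inter> (inner n S \<union> inner n S') = X \<union> X'" by (auto simp: XX_def)
    then have "H \<inter> inner n S = X" "H \<inter> inner n S' = X'" using disj by (auto simp: A_def A'_def)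
    then show "connects (H \<inter> inner n S) S \<and> connects (H \<inter> inner n S') S'" using X by (auto simp: A_def A'_def)
  next
    assume "connects (H \<inter> inner n S) S \<and> connects (H \<inter> inner n S') S'"
    then show "H \<inter> (inner n S \<union> inner n S') \<in> XX"
      unfolding XX_def by (intro image_eqI[of _ _ "(H \<inter> inner n S, H \<inter> inner n S')"]) (auto simp: A_def A'_def)
  qed
  have "{w \<in> space (weight_law n). S \<in> comps n (lower n w s) \<and> S' \<in> comps n (lower n w s)} =
    {w \<in> space (weight_law n). lower n w s \<inter> (inner n S \<union> inner n S') \<in> XX \<and> lower n w s \<inter> (bdry n S \<union> bdry n S') = {}}"
    unfolding mem mem_comps_iff[OF lower_subset S(1) ne(1)] mem_comps_iff[OF lower_subset S(2) ne(2)] by auto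
  also have "measure (weight_law n) \<dots> =
    (\<Sum>X\<in>XX. s ^ card X * (1 - s) ^ (card (inner n S \<union> inner n S') - card X)) * (1 - s) ^ card (bdry n S \<union> bdry n S')"
    using s disj' inner_bdry(1,2)[of n S] inner_bdry(1,2)[of n S'] inner_bdry(3)[of n S] inner_bdry(3)[of n S']
    by (intro measure_lower_pattern) (auto simp: XX_def A_def A'_def)
  also have "(\<Sum>X\<in>XX. s ^ card X * (1 - s) ^ (card (inner n S \<union> inner n S') - card X)) =
    (\<Sum>(X, X')\<in>A \<times> A'. (s ^ card X * (1 - s) ^ (card (inner n S) - card X)) * (s ^ card X' * (1 - s) ^ (card (inner n S') - card X')))"
  proof -
    have "inj_on (\<lambda>(X, X'). X \<union> X') (A \<times> A')"
    proof (rule inj_onI, clarify)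
      fix X X' Y Y' assume a: "X \<in> A" "X' \<in> A'" "Y \<in> A" "Y' \<in> A'" "X \<union> X' = Y \<union> Y'"
      have "X = (X \<union> X') \<inter> inner n S" "X' = (X \<union> X') \<inter> inner n S'" using a disj by (auto simp: A_def A'_def)
      moreover have "Y = (Y \<union> Y') \<inter> inner n S" "Y' = (Y \<union> Y') \<inter> inner n S'" using a disj by (auto simp: A_def A'_def)
      ultimately show "X = Y \<and> X' = Y'" using a(5) by simp
    qed
    then have "(\<Sum>X\<in>XX. s ^ card X * (1 - s) ^ (card (inner n S \<union> inner n S') - card X)) =
      (\<Sum>(X, X')\<in>A \<times> A'. s ^ card (X \<union> X') * (1 - s) ^ (card (inner n S \<union> inner n S') - card (X \<union> X')))"
      unfolding XX_def by (subst sum.reindex) (auto simp: case_prod_unfold)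
    also have "\<dots> = (\<Sum>(X, X')\<in>A \<times> A'. (s ^ card X * (1 - s) ^ (card (inner n S) - card X)) * (s ^ card X' * (1 - s) ^ (card (inner n S') - card X')))"
    proof (rule sum.cong[OF refl], clarify)
      fix X X' assume X: "X \<in> A" "X' \<in> A'"
      then have sub: "X \<subseteq> inner n S" "X' \<subseteq> inner n S'" by (auto simp: A_def A'_def)
      have fin: "finite X" "finite X'" using sub inner_bdry(4) finite_subset by blast+
      have c1: "card (X \<union> X') = card X + card X'" using sub fin disj by (intro card_Un_disjoint) auto
      have c2: "card (inner n S \<union> inner n S') = card (inner n S) + card (inner n S')"
        using disj by (intro card_Un_disjoint) (auto simp: inner_bdry)
      have le: "card X \<le> card (inner n S)" "card X' \<le> card (inner n S')"
        using sub by (auto intro: card_mono simp: inner_bdry)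
      then have "card (inner n S \<union> inner n S') - card (X \<union> X') = (card (inner n S) - card X) + (card (inner n S') - card X')"
        using c1 c2 by simp
      then show "s ^ card (X \<union> X') * (1 - s) ^ (card (inner n S \<union> inner n S') - card (X \<union> X')) =
        (s ^ card X * (1 - s) ^ (card (inner n S) - card X)) * (s ^ card X' * (1 - s) ^ (card (inner n S') - card X'))"
        by (simp add: c1 power_add)
    qed
    finally show ?thesis .
  qed
  also have "\<dots> = kappa n S s * kappa n S' s"
    unfolding kappa_def A_def A'_def sum_product sum.cartesian_product ..
  finally have "measure (weight_law n) {w \<in> space (weight_law n). S \<in> comps n (lower n w s) \<and> S' \<in> comps n (lower n w s)}
    * (1 - s) ^ (k * k) = kappa n S s * kappa n S' s * (1 - s) ^ (card (bdry n S \<union> bdry n S') + k * k)"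
    by (simp add: power_add)
  also have "\<dots> = compprob n S s * compprob n S' s"
    using S s ne by (simp add: card_bdry_Un compprob_eq card_bdry mult_2 power_add)
  finally show ?thesis .
qed

lemma comps_disjoint:
  assumes "S \<in> comps n H" "S' \<in> comps n H" "S \<noteq> S'"
  shows "S \<inter> S' = {}"
proof (rule ccontr)
  assume "S \<inter> S' \<noteq> {}"
  then obtain z x y where z: "z \<in> S" "z \<in> S'" "S = cluster H x" "S' = cluster H y" using assms by (auto simp: comps_def)
  then have "cluster H x = cluster H z" "cluster H y = cluster H z" by (auto simp: cluster_eq_iff mem_cluster)
  then show False using z assms by simp
qed

text \<open>Supplies the relabelings for exchangeability: any two labelings of the same finite set
  differ by a permutation of the whole vertex set.\<close>

lemma permutes_extend:
  assumes "inj_on \<phi> A" "\<phi> ` A \<subseteq> B" "inj_on \<psi> A" "\<psi> ` A \<subseteq> B" "finite B"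
  shows "\<exists>\<sigma>. \<sigma> permutes B \<and> (\<forall>x\<in>A. \<sigma> (\<phi> x) = \<psi> x)"
proof -
  have fA: "finite A" using assms finite_imageD finite_subset by metis
  have "card (B - \<phi> ` A) = card (B - \<psi> ` A)"
    using assms fA by (simp add: card_Diff_subset card_image)
  then obtain g where g: "bij_betw g (B - \<phi> ` A) (B - \<psi> ` A)"
    using assms(5) finite_same_card_bij[of "B - \<phi> ` A" "B - \<psi> ` A"] by auto
  define f where "f = (\<lambda>z. \<psi> (the_inv_into A \<phi> z))"
  have f\<phi>: "f (\<phi> x) = \<psi> x" if "x \<in> A" for x using that assms(1) by (simp add: f_def the_inv_into_f_f)
  have f: "bij_betw f (\<phi> ` A) (\<psi> ` A)"
    unfolding bij_betw_def using assms(1,3) f\<phi> by (auto simp: inj_on_def image_iff)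
  define \<sigma> where "\<sigma> = (\<lambda>z. if z \<in> \<phi> ` A then f z else if z \<in> B then g z else z)"
  have 1: "bij_betw \<sigma> (\<phi> ` A) (\<psi> ` A)" using f by (rule bij_betw_cong[THEN iffD1, rotated]) (auto simp: \<sigma>_def)
  have 2: "bij_betw \<sigma> (B - \<phi> ` A) (B - \<psi> ` A)" using g by (rule bij_betw_cong[THEN iffD1, rotated]) (auto simp: \<sigma>_def)
  have "bij_betw \<sigma> (\<phi> ` A \<union> (B - \<phi> ` A)) (\<psi> ` A \<union> (B - \<psi> ` A))"
    by (rule bij_betw_combine[OF 1 2]) auto
  then have "bij_betw \<sigma> B B" using assms by (simp add: Un_absorb1)
  then have "\<sigma> permutes B" using assms(2) by (intro bij_imp_permutes) (auto simp: \<sigma>_def)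
  moreover have "\<forall>x\<in>A. \<sigma> (\<phi> x) = \<psi> x" using f\<phi> by (auto simp: \<sigma>_def)
  ultimately show ?thesis by blast
qed

lemma comps_wact:
  assumes "\<sigma> permutes {1..n}"
  shows "S \<in> comps n (lower n (wact n \<sigma> w) s) \<longleftrightarrow> \<sigma> ` S \<in> comps n (lower n w s)"
proof -
  have cl: "\<sigma> ` cluster (lower n (wact n \<sigma> w) s) x = cluster (lower n w s) (\<sigma> x)" for x
  proof (intro equalityI subsetI)
    fix z assume "z \<in> cluster (lower n w s) (\<sigma> x)"
    then have "inv \<sigma> z \<in> cluster (lower n (wact n \<sigma> w) s) x"
      by (simp add: mem_cluster conn_wact[OF assms] permutes_inverses[OF assms])
    then show "z \<in> \<sigma> ` cluster (lower n (wact n \<sigma> w) s) x"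
      using permutes_inverses(1)[OF assms, of z] by (metis imageI)
  qed (auto simp: mem_cluster conn_wact[OF assms])
  have "S \<in> comps n (lower n (wact n \<sigma> w) s) \<longleftrightarrow> \<sigma> ` S \<in> ((`) \<sigma>) ` comps n (lower n (wact n \<sigma> w) s)"
    using permutes_inj[OF assms] by (auto simp: inj_image_eq_iff)
  also have "((`) \<sigma>) ` comps n (lower n (wact n \<sigma> w) s) = cluster (lower n w s) ` (\<sigma> ` {1..n})"
    by (simp add: comps_def image_image cl)
  also have "\<sigma> ` {1..n} = {1..n}" using assms by (rule permutes_image)
  finally show ?thesis by (simp add: comps_def)
qed

lemma compprob_card:
  assumes "S \<subseteq> {1..n}" "card S = k"
  shows "compprob n S s = compprob n {1..k} s"
proof -
  have kn: "k \<le> n" using assms card_mono[of "{1..n}" S] by auto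
  obtain \<psi> where \<psi>: "bij_betw \<psi> {1..k} S" using assms finite_subset[OF assms(1)]
    by (metis card_atLeastAtMost diff_Suc_1 finite_atLeastAtMost finite_same_card_bij)
  then obtain \<sigma> where \<sigma>: "\<sigma> permutes {1..n}" "\<forall>x\<in>{1..k}. \<sigma> x = \<psi> x"
    using permutes_extend[of "\<lambda>x. x" "{1..k}" "{1..n}" \<psi>] assms(1) kn by (auto simp: bij_betw_def)
  have "\<sigma> ` {1..k} = S" using \<sigma>(2) \<psi> by (simp add: bij_betw_def)
  then have "{w \<in> space (weight_law n). S \<in> comps n (lower n w s)} =
      {w \<in> space (weight_law n). {1..k} \<in> comps n (lower n (wact n \<sigma> w) s)}"
    by (simp add: comps_wact[OF \<sigma>(1)])
  then show ?thesis unfolding compprob_def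
    using measure_wact[OF \<sigma>(1) lower_sets] by simp
qed

section \<open>Counting the vertices in large components\<close>

definition bigset :: "nat \<Rightarrow> nat set set \<Rightarrow> nat \<Rightarrow> nat set" where
  "bigset n H K = {x \<in> {1..n}. K < card (cluster H x)}"

definition ncomps :: "nat \<Rightarrow> nat set set \<Rightarrow> nat \<Rightarrow> nat" where
  "ncomps n H k = card {C \<in> comps n H. card C = k}"

lemma cluster_in_range: "H \<subseteq> cedges n \<Longrightarrow> x \<in> {1..n} \<Longrightarrow> cluster H x \<subseteq> {1..n}"
  using cedges_iff by (intro cluster_subset) auto

lemma comps_subset: "H \<subseteq> cedges n \<Longrightarrow> C \<in> comps n H \<Longrightarrow> C \<subseteq> {1..n}"
  unfolding comps_def by (elim imageE) (simp only: cluster_in_range)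

lemma finite_comps [simp]: "finite (comps n H)"
  by (simp add: comps_def)

lemma finite_cluster: "H \<subseteq> cedges n \<Longrightarrow> x \<in> {1..n} \<Longrightarrow> finite (cluster H x)"
  by (rule finite_subset[OF cluster_in_range]) auto

lemma card_cluster_eq:
  assumes "H \<subseteq> cedges n"
  shows "card {x \<in> {1..n}. card (cluster H x) = k} = k * ncomps n H k"
proof -
  have "{x \<in> {1..n}. card (cluster H x) = k} = \<Union>{C \<in> comps n H. card C = k}"
  proof (intro equalityI subsetI)
    fix x assume "x \<in> {x \<in> {1..n}. card (cluster H x) = k}"
    then show "x \<in> \<Union>{C \<in> comps n H. card C = k}"
      by (intro UnionI[of "cluster H x"]) (auto simp: comps_def)
  next
    fix x assume "x \<in> \<Union>{C \<in> comps n H. card C = k}"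
    then obtain C where C: "x \<in> C" "C \<in> comps n H" "card C = k" by auto
    then obtain y where y: "C = cluster H y" by (auto simp: comps_def)
    then have "cluster H x = C" using C by (auto simp: mem_cluster cluster_eq_iff conn_sym)
    moreover have "x \<in> {1..n}" using comps_subset[OF assms C(2)] C(1) by blast
    ultimately show "x \<in> {x \<in> {1..n}. card (cluster H x) = k}" using C by auto
  qed
  also have "card \<dots> = (\<Sum>C\<in>{C \<in> comps n H. card C = k}. card C)"
  proof (rule card_Union_disjoint)
    show "pairwise disjnt {C \<in> comps n H. card C = k}"
      unfolding pairwise_def disjnt_def using comps_disjoint by blast
    show "finite C" if "C \<in> {C \<in> comps n H. card C = k}" for C
      using comps_subset[OF assms, of C] that finite_subset[of C "{1..n}"] by auto
  qed
  also have "\<dots> = k * ncomps n H k" by (simp add: ncomps_def)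
  finally show ?thesis .
qed

text \<open>Large components are counted through the complement: only the finitely many sizes up to
  \<open>K\<close> occur in the sum, and for each of them the first two moments can be
  computed.\<close>

lemma card_bigset:
  assumes "H \<subseteq> cedges n"
  shows "real (card (bigset n H K)) = real n - (\<Sum>k\<in>{1..K}. real k * real (ncomps n H k))"
proof -
  let ?S = "\<lambda>k. {x \<in> {1..n}. card (cluster H x) = k}"
  have pos: "1 \<le> card (cluster H x)" if "x \<in> {1..n}" for x
    using finite_cluster[OF assms that] self_in_cluster[of x H] by (metis One_nat_def Suc_leI card_gt_0_iff empty_iff)
  have "{1..n} = bigset n H K \<union> (\<Union>k\<in>{1..K}. ?S k)"
    using pos by (auto simp: bigset_def)
  then have "card {1..n} = card (bigset n H K \<union> (\<Union>k\<in>{1..K}. ?S k))" by (rule arg_cong)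
  also have "\<dots> = card (bigset n H K) + card (\<Union>k\<in>{1..K}. ?S k)"
    by (rule card_Un_disjoint) (auto simp: bigset_def)
  also have "card (\<Union>k\<in>{1..K}. ?S k) = (\<Sum>k\<in>{1..K}. card (?S k))"
    by (rule card_UN_disjoint) auto
  finally have "card {1..n} = card (bigset n H K) + (\<Sum>k\<in>{1..K}. k * ncomps n H k)"
    by (simp only: card_cluster_eq[OF assms])
  then have "real (card {1..n}) = real (card (bigset n H K) + (\<Sum>k\<in>{1..K}. k * ncomps n H k))"
    by (rule arg_cong)
  then show ?thesis by simp
qed

lemma ncomps_sum:
  assumes "H \<subseteq> cedges n"
  shows "real (ncomps n H k) = (\<Sum>S\<in>{S \<in> Pow {1..n}. card S = k}. of_bool (S \<in> comps n H))"
proof -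
  have "{C \<in> comps n H. card C = k} = {S \<in> Pow {1..n}. card S = k} \<inter> {S. S \<in> comps n H}"
    using comps_subset[OF assms] by auto
  then show ?thesis by (simp add: ncomps_def sum.If_cases of_bool_def)
qed

lemma integral_ncomps:
  "(\<integral>w. real (ncomps n (lower n w s) k) \<partial>weight_law n) = real (n choose k) * compprob n {1..k} s"
proof -
  have "(\<integral>w. real (ncomps n (lower n w s) k) \<partial>weight_law n) =
    (\<Sum>S\<in>{S \<in> Pow {1..n}. card S = k}. \<integral>w. of_bool (S \<in> comps n (lower n w s)) \<partial>weight_law n)"
    unfolding ncomps_sum[OF lower_subset] by (intro Bochner_Integration.integral_sum lower_integrable)
  also have "\<dots> = (\<Sum>S\<in>{S \<in> Pow {1..n}. card S = k}. compprob n {1..k} s)"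
  proof (rule sum.cong[OF refl])
    fix S assume "S \<in> {S \<in> Pow {1..n}. card S = k}"
    then have "compprob n S s = compprob n {1..k} s" by (intro compprob_card) auto
    then show "(\<integral>w. of_bool (S \<in> comps n (lower n w s)) \<partial>weight_law n) = compprob n {1..k} s"
      by (simp add: integral_of_bool[OF lower_sets[where \<Phi> = "\<lambda>H. S \<in> comps n H"]] compprob_def)
  qed
  also have "\<dots> = real (card {S. S \<subseteq> {1..n} \<and> card S = k}) * compprob n {1..k} s"
    by simp
  also have "card {S. S \<subseteq> {1..n} \<and> card S = k} = n choose k"
    using n_subsets[of "{1..n}" k] by simp
  finally show ?thesis .
qed

text \<open>Expand the square over pairs of k-sets. Equal sets contribute the mean, distinct
  overlapping sets cannot both be components, and for disjoint sets \<open>compprob_pair\<close>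
  gives the product up to the factor 1 / (1 - s)^(k * k).\<close>

lemma integral_ncomps_sq:
  assumes "0 \<le> s" "s < 1" "k \<ge> 1"
  shows "(\<integral>w. (real (ncomps n (lower n w s) k))\<^sup>2 \<partial>weight_law n) \<le>
    real (n choose k) * compprob n {1..k} s + (real (n choose k) * compprob n {1..k} s)\<^sup>2 / (1 - s) ^ (k * k)"
proof -
  interpret prob_space "weight_law n" by simp
  let ?Sk = "{S \<in> Pow {1..n}. card S = k}"
  define q where "q = compprob n {1..k} s"
  have q0: "0 \<le> q" by (simp add: q_def compprob_def)
  have cq: "compprob n S s = q" if "S \<in> ?Sk" for S using compprob_card[of S n k] that by (simp add: q_def)
  have cardSk: "card ?Sk = n choose k" using n_subsets[of "{1..n}" k] by simp
  have fin: "finite ?Sk" by simp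
  define T where "T = (\<lambda>S S'. prob {w \<in> space (weight_law n). S \<in> comps n (lower n w s) \<and> S' \<in> comps n (lower n w s)})"
  have T: "T S S' \<le> (if S = S' then q else 0) + q\<^sup>2 / (1 - s) ^ (k * k)" if S: "S \<in> ?Sk" "S' \<in> ?Sk" for S S'
  proof -
    consider "S = S'" | "S \<noteq> S'" "S \<inter> S' \<noteq> {}" | "S \<noteq> S'" "S \<inter> S' = {}" by blast
    then show ?thesis
    proof cases
      case 1
      then have "T S S' = q" using cq[OF S(1)] by (simp add: T_def compprob_def)
      then show ?thesis using 1 assms by simp
    next
      case 2
      then have e: "{w \<in> space (weight_law n). S \<in> comps n (lower n w s) \<and> S' \<in> comps n (lower n w s)} = {}"
        using comps_disjoint by blast
      have "T S S' = 0" unfolding T_def e by simp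
      then show ?thesis using 2 assms by simp
    next
      case 3
      have "T S S' * (1 - s) ^ (k * k) = q * q"
        using compprob_pair[of S n S' k s] S assms 3 cq[OF S(1)] cq[OF S(2)] by (simp add: T_def)
      then show ?thesis using 3 assms by (simp add: field_simps power2_eq_square)
    qed
  qed
  have "(\<integral>w. (real (ncomps n (lower n w s) k))\<^sup>2 \<partial>weight_law n) =
    (\<integral>w. (\<Sum>S\<in>?Sk. \<Sum>S'\<in>?Sk. of_bool (S \<in> comps n (lower n w s) \<and> S' \<in> comps n (lower n w s))) \<partial>weight_law n)"
    unfolding ncomps_sum[OF lower_subset] power2_eq_square sum_product by (simp add: of_bool_conj)
  also have "\<dots> = (\<Sum>S\<in>?Sk. \<Sum>S'\<in>?Sk. \<integral>w. of_bool (S \<in> comps n (lower n w s) \<and> S' \<in> comps n (lower n w s)) \<partial>weight_law n)"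
    by (subst Bochner_Integration.integral_sum, rule lower_integrable[where h = "\<lambda>H. \<Sum>S'\<in>?Sk. of_bool (_ \<in> comps n H \<and> S' \<in> comps n H)"],
        rule sum.cong[OF refl], rule Bochner_Integration.integral_sum, rule lower_integrable[where h = "\<lambda>H. of_bool (_ \<in> comps n H \<and> _ \<in> comps n H)"])
  also have "\<dots> = (\<Sum>S\<in>?Sk. \<Sum>S'\<in>?Sk. T S S')"
    by (intro sum.cong refl) (simp add: integral_of_bool[OF lower_sets[where \<Phi> = "\<lambda>H. _ \<in> comps n H \<and> _ \<in> comps n H"]] T_def)
  also have "\<dots> \<le> (\<Sum>S\<in>?Sk. \<Sum>S'\<in>?Sk. (if S = S' then q else 0) + q\<^sup>2 / (1 - s) ^ (k * k))"
    by (intro sum_mono T)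
  also have "\<dots> = (\<Sum>S\<in>?Sk. q + real (n choose k) * (q\<^sup>2 / (1 - s) ^ (k * k)))"
    using fin by (intro sum.cong refl) (simp add: sum.distrib cardSk[simplified])
  also have "\<dots> = real (n choose k) * q + (real (n choose k) * q)\<^sup>2 / (1 - s) ^ (k * k)"
    using cardSk by (simp add: algebra_simps power2_eq_square)
  finally show ?thesis by (simp add: q_def)
qed

section \<open>Asymptotics of the component counts\<close>

lemma tendsto_eqI:
  fixes a :: "'b :: t2_space"
  assumes "f \<longlonglongrightarrow> a" "a = b" "\<forall>\<^sub>F n in sequentially. f n = g n"
  shows "g \<longlonglongrightarrow> b"
  using Lim_transform_eventually[OF assms(1,3)] assms(2) by simp

lemma diff_ratio_lim: "(\<lambda>n. real (n - i) / real n) \<longlonglongrightarrow> 1"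
proof (rule tendsto_eqI)
  show "(\<lambda>n. 1 - real i / real n) \<longlonglongrightarrow> 1 - 0"
    by (intro tendsto_diff tendsto_const lim_const_over_n)
  show "\<forall>\<^sub>F n in sequentially. 1 - real i / real n = real (n - i) / real n"
    using eventually_gt_at_top[of i] by eventually_elim (simp add: of_nat_diff field_simps)
qed simp

lemma choose_lim: "(\<lambda>n. real (n choose k) / real n ^ k) \<longlonglongrightarrow> 1 / fact k"
proof -
  have "(\<lambda>n. \<Prod>i<k. (real (n - i) / real n) / real (k - i)) \<longlonglongrightarrow> (\<Prod>i<k. 1 / real (k - i))"
    by (intro tendsto_prod tendsto_divide diff_ratio_lim tendsto_const) auto
  moreover have "(\<Prod>i<k. 1 / real (k - i)) = 1 / fact k"
    by (simp add: prod_dividef fact_prod_rev atLeast0LessThan)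
  moreover have "\<forall>\<^sub>F n in sequentially. (\<Prod>i<k. (real (n - i) / real n) / real (k - i)) = real (n choose k) / real n ^ k"
    using eventually_ge_at_top[of k]
  proof eventually_elim
    case (elim n)
    have "(\<Prod>i<k. (real (n - i) / real n) / real (k - i)) = (\<Prod>i<k. (real (n - i) / real (k - i)) / real n)"
      by (intro prod.cong refl) simp
    also have "\<dots> = (\<Prod>i<k. real (n - i) / real (k - i)) / real n ^ k"
      by (simp only: prod_dividef prod_constant card_lessThan)
    also have "(\<Prod>i<k. real (n - i) / real (k - i)) = real (n choose k)"
      using elim by (subst binomial_altdef_of_nat) (auto simp: atLeast0LessThan)
    finally show ?case .
  qed
  ultimately show ?thesis by (rule tendsto_eqI)
qed

text \<open>For positive \<open>k\<close> this counts the labelled trees on k vertices, since a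
  connected graph with k - 1 edges is a tree.\<close>

definition tree_count :: "nat \<Rightarrow> nat" where
  "tree_count k = card {X \<in> Pow (cedges k). connects X {1..k} \<and> card X = k - 1}"

text \<open>
  The limiting number per vertex of components of size \<open>k\<close> at edge probability \<open>\<theta> / n\<close>.
\<close>

definition ysize :: "nat \<Rightarrow> real \<Rightarrow> real" where
  "ysize k \<theta> = real (tree_count k) * \<theta> ^ (k - 1) * exp (- \<theta> * real k) / fact k"

lemma connects_card:
  assumes "X \<subseteq> cedges k" "connects X {1..k}" "k \<ge> 1"
  shows "k - 1 \<le> card X"
proof -
  have "{1..k} \<subseteq> (adj X)\<^sup>* `` {1}" using assms by (auto simp: connects_def)
  from card_roots_edges[OF finite_subset[OF assms(1) finite_cedges] this] show ?thesis by simp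
qed

lemma one_minus_lim: "(\<lambda>n. 1 - \<theta> / real n) \<longlonglongrightarrow> (1 :: real)"
  using tendsto_diff[OF tendsto_const lim_const_over_n[of \<theta>], of 1] by simp

text \<open>Connecting k vertices takes at least k - 1 edges, each of probability \<theta> / n.
  After multiplication by n^(k - 1) every further edge leaves a vanishing factor, so only trees
  survive in the limit.\<close>

lemma kappa_lim:
  assumes "k \<ge> 1" "\<theta> > 0"
  shows "(\<lambda>n. real n ^ (k - 1) * kappa n {1..k} (\<theta> / real n)) \<longlonglongrightarrow> real (tree_count k) * \<theta> ^ (k - 1)"
proof -
  let ?XX = "{X \<in> Pow (cedges k). connects X {1..k}}"
  have "(\<lambda>n. \<Sum>X\<in>?XX. \<theta> ^ (k - 1) * (\<theta> / real n) ^ (card X - (k - 1)) * (1 - \<theta> / real n) ^ (card (cedges k) - card X))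
    \<longlonglongrightarrow> (\<Sum>X\<in>?XX. \<theta> ^ (k - 1) * 0 ^ (card X - (k - 1)) * 1 ^ (card (cedges k) - card X))"
    by (intro tendsto_sum tendsto_mult tendsto_power tendsto_const lim_const_over_n one_minus_lim)
  moreover have "(\<Sum>X\<in>?XX. \<theta> ^ (k - 1) * 0 ^ (card X - (k - 1)) * 1 ^ (card (cedges k) - card X)) = real (tree_count k) * \<theta> ^ (k - 1)"
  proof -
    have "(\<Sum>X\<in>?XX. \<theta> ^ (k - 1) * 0 ^ (card X - (k - 1)) * 1 ^ (card (cedges k) - card X)) =
      (\<Sum>X\<in>?XX. if card X = k - 1 then \<theta> ^ (k - 1) else 0)"
    proof (rule sum.cong[OF refl])
      fix X assume "X \<in> ?XX"
      then have "k - 1 \<le> card X" using connects_card[of X k] assms by auto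
      then show "\<theta> ^ (k - 1) * 0 ^ (card X - (k - 1)) * 1 ^ (card (cedges k) - card X) = (if card X = k - 1 then \<theta> ^ (k - 1) else 0)"
        by (cases "card X = k - 1") auto
    qed
    also have "\<dots> = real (card (?XX \<inter> {X. card X = k - 1})) * \<theta> ^ (k - 1)"
      by (simp add: sum.If_cases)
    also have "?XX \<inter> {X. card X = k - 1} = {X \<in> Pow (cedges k). connects X {1..k} \<and> card X = k - 1}" by auto
    finally show ?thesis by (simp add: tree_count_def)
  qed
  moreover have "\<forall>\<^sub>F n in sequentially.
    (\<Sum>X\<in>?XX. \<theta> ^ (k - 1) * (\<theta> / real n) ^ (card X - (k - 1)) * (1 - \<theta> / real n) ^ (card (cedges k) - card X)) =
    real n ^ (k - 1) * kappa n {1..k} (\<theta> / real n)"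
    using eventually_ge_at_top[of k] eventually_gt_at_top[of 0]
  proof eventually_elim
    case (elim n)
    have i: "inner n {1..k} = cedges k"
    proof -
      have "{1..k} \<subseteq> {1..n}" using elim by auto
      then have "e \<subseteq> {1..n}" if "e \<subseteq> {1..k}" for e using that by (rule order_trans[rotated])
      then show ?thesis unfolding inner_def by (simp add: set_eq_iff cedges_iff) metis
    qed
    show ?case unfolding kappa_def i sum_distrib_left
    proof (rule sum.cong[OF refl])
      fix X assume "X \<in> ?XX"
      then have "k - 1 \<le> card X" using connects_card[of X k] assms by auto
      then have a1: "(\<theta> / real n) ^ card X = (\<theta> / real n) ^ (k - 1) * (\<theta> / real n) ^ (card X - (k - 1))"
        by (simp add: power_add[symmetric])
      have a2: "real n ^ (k - 1) * (\<theta> / real n) ^ (k - 1) = \<theta> ^ (k - 1)"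
        using elim by (simp add: power_divide)
      show "\<theta> ^ (k - 1) * (\<theta> / real n) ^ (card X - (k - 1)) * (1 - \<theta> / real n) ^ (card (cedges k) - card X) =
        real n ^ (k - 1) * ((\<theta> / real n) ^ card X * (1 - \<theta> / real n) ^ (card (cedges k) - card X))"
        by (simp only: a1 a2[symmetric] mult.assoc)
    qed
  qed
  ultimately show ?thesis by (rule tendsto_eqI)
qed

lemma bdry_power_lim:
  assumes "\<theta> > 0"
  shows "(\<lambda>n. (1 - \<theta> / real n) ^ (k * (n - k))) \<longlonglongrightarrow> exp (- \<theta> * real k)"
proof -
  have 1: "(\<lambda>n. (1 - \<theta> / real n) ^ n) \<longlonglongrightarrow> exp (- \<theta>)"
    using tendsto_exp_limit_sequentially[of "- \<theta>"] by simp
  have "(\<lambda>n. ((1 - \<theta> / real n) ^ n) ^ k / (1 - \<theta> / real n) ^ (k * k)) \<longlonglongrightarrow> exp (- \<theta>) ^ k / 1 ^ (k * k)"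
    by (intro tendsto_divide tendsto_power 1 one_minus_lim) simp
  moreover have "exp (- \<theta>) ^ k / 1 ^ (k * k) = exp (- \<theta> * real k)"
    using exp_of_nat_mult[of k "- \<theta>"] by (simp add: mult.commute)
  moreover have "\<forall>\<^sub>F n in sequentially. ((1 - \<theta> / real n) ^ n) ^ k / (1 - \<theta> / real n) ^ (k * k) = (1 - \<theta> / real n) ^ (k * (n - k))"
    using eventually_ge_at_top[of k] eventually_gt_at_top[of "nat \<lceil>\<theta>\<rceil>"]
  proof eventually_elim
    case (elim n)
    then have "\<theta> < real n" by linarith
    then have "1 - \<theta> / real n \<noteq> 0" using assms by (simp add: field_simps)
    then have nz: "(1 - \<theta> / real n) ^ (k * k) \<noteq> 0" by (rule power_not_zero)
    have e: "n * k = k * (n - k) + k * k" using elim by (simp add: diff_mult_distrib2 mult.commute)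
    have "((1 - \<theta> / real n) ^ n) ^ k = (1 - \<theta> / real n) ^ (k * (n - k)) * (1 - \<theta> / real n) ^ (k * k)"
      by (simp only: power_mult[symmetric] e power_add)
    then show ?case by (simp only: nonzero_mult_div_cancel_right[OF nz])
  qed
  ultimately show ?thesis by (rule tendsto_eqI)
qed

lemma eventually_threshold:
  assumes "\<theta> > 0"
  shows "\<forall>\<^sub>F n in sequentially. 0 \<le> \<theta> / real n \<and> \<theta> / real n < 1 \<and> 0 < n"
  using eventually_gt_at_top[of "nat \<lceil>\<theta>\<rceil>"]
proof eventually_elim
  case (elim n)
  then have "\<theta> < real n" by linarith
  then show ?case using assms by auto
qed

text \<open>The choice of the set gives n^k / k!, the edges of a spanning tree cost n^(k - 1), and
  the absent boundary edges contribute exp (-\<theta> k). The mean is therefore of order n.\<close>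

lemma mean_ncomps_lim:
  assumes "k \<ge> 1" "\<theta> > 0"
  shows "(\<lambda>n. real (n choose k) * compprob n {1..k} (\<theta> / real n) / real n) \<longlonglongrightarrow> ysize k \<theta>"
proof -
  have "(\<lambda>n. (real (n choose k) / real n ^ k) * (real n ^ (k - 1) * kappa n {1..k} (\<theta> / real n)) * (1 - \<theta> / real n) ^ (k * (n - k)))
    \<longlonglongrightarrow> (1 / fact k) * (real (tree_count k) * \<theta> ^ (k - 1)) * exp (- \<theta> * real k)"
    by (intro tendsto_mult choose_lim kappa_lim bdry_power_lim assms)
  moreover have "(1 / fact k) * (real (tree_count k) * \<theta> ^ (k - 1)) * exp (- \<theta> * real k) = ysize k \<theta>"
    by (simp add: ysize_def)
  moreover have "\<forall>\<^sub>F n in sequentially. (real (n choose k) / real n ^ k) * (real n ^ (k - 1) * kappa n {1..k} (\<theta> / real n)) * (1 - \<theta> / real n) ^ (k * (n - k))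
    = real (n choose k) * compprob n {1..k} (\<theta> / real n) / real n"
    using eventually_threshold[OF assms(2)] eventually_ge_at_top[of k]
  proof eventually_elim
    case (elim n)
    have c1: "compprob n {1..k} (\<theta> / real n) = kappa n {1..k} (\<theta> / real n) * (1 - \<theta> / real n) ^ (k * (n - k))"
      using elim assms by (subst compprob_eq) (auto simp: card_bdry)
    have c2: "real n ^ k = real n * real n ^ (k - 1)" using assms by (cases k) auto
    have gen: "c / (N * P) * (P * a) * b = c * (a * b) / N" if "P \<noteq> 0" for c N P a b :: real
      using that by simp
    show ?case unfolding c1 c2 by (rule gen) (use elim in simp)
  qed
  ultimately show ?thesis by (rule tendsto_eqI)
qed

lemma tendsto_squeeze_zero:
  fixes f g :: "nat \<Rightarrow> real"
  assumes "\<forall>\<^sub>F n in sequentially. f n \<le> g n" "g \<longlonglongrightarrow> 0" "\<And>n. 0 \<le> f n"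
  shows "f \<longlonglongrightarrow> 0"
  by (rule tendsto_sandwich[OF always_eventually assms(1) tendsto_const assms(2)]) (use assms(3) in simp)

lemma (in prob_space) expectation_abs_le:
  fixes Z :: "'a \<Rightarrow> real"
  assumes "integrable M Z" "integrable M (\<lambda>x. (Z x)\<^sup>2)"
  shows "expectation (\<lambda>x. \<bar>Z x\<bar>) \<le> sqrt (expectation (\<lambda>x. (Z x)\<^sup>2))"
proof -
  have "0 \<le> variance (\<lambda>x. \<bar>Z x\<bar>)" by (rule variance_positive)
  also have "variance (\<lambda>x. \<bar>Z x\<bar>) = expectation (\<lambda>x. \<bar>Z x\<bar>\<^sup>2) - (expectation (\<lambda>x. \<bar>Z x\<bar>))\<^sup>2"
    using assms by (intro variance_eq) auto
  finally have "(expectation (\<lambda>x. \<bar>Z x\<bar>))\<^sup>2 \<le> expectation (\<lambda>x. (Z x)\<^sup>2)" by simp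
  then show ?thesis by (rule real_le_rsqrt)
qed

text \<open>Second moment method: the mean square deviation of the density tends to 0, and it
  controls the first absolute moment.\<close>

lemma ncomps_L1:
  assumes "k \<ge> 1" "\<theta> > 0"
  shows "(\<lambda>n. \<integral>w. \<bar>real (ncomps n (lower n w (\<theta> / real n)) k) / real n - ysize k \<theta>\<bar> \<partial>weight_law n) \<longlonglongrightarrow> 0"
proof -
  define y where "y = ysize k \<theta>"
  define m where "m = (\<lambda>n. real (n choose k) * compprob n {1..k} (\<theta> / real n) / real n)"
  \<comment> \<open>An upper bound for the mean square deviation from \<open>y\<close>, obtained by
    inserting \<open>integral_ncomps_sq\<close> into the expanded square. As \<open>m n\<close>
    tends to \<open>y\<close>, it tends to y^2 - 2 y^2 + y^2 = 0.\<close>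
  define v where "v = (\<lambda>n. m n / real n + (m n)\<^sup>2 / (1 - \<theta> / real n) ^ (k * k) - 2 * y * m n + y\<^sup>2)"
  have m: "m \<longlonglongrightarrow> y" unfolding m_def y_def by (rule mean_ncomps_lim[OF assms])
  have "v \<longlonglongrightarrow> 0 + y\<^sup>2 / 1 ^ (k * k) - 2 * y * y + y\<^sup>2"
    unfolding v_def
    by (intro tendsto_add tendsto_diff tendsto_mult tendsto_divide tendsto_power m one_minus_lim tendsto_const
        real_tendsto_divide_at_top[OF m] filterlim_real_sequentially) simp
  then have v: "v \<longlonglongrightarrow> 0" by (simp add: power2_eq_square)
  have le: "\<forall>\<^sub>F n in sequentially. (\<integral>w. \<bar>real (ncomps n (lower n w (\<theta> / real n)) k) / real n - y\<bar> \<partial>weight_law n) \<le> sqrt (v n)"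
    using eventually_threshold[OF assms(2)]
  proof eventually_elim
    case (elim n)
    interpret prob_space "weight_law n" by simp
    let ?Y = "\<lambda>w. real (ncomps n (lower n w (\<theta> / real n)) k)"
    have iY: "integrable (weight_law n) ?Y" "integrable (weight_law n) (\<lambda>w. (?Y w)\<^sup>2)"
      by (rule lower_integrable[where h = "\<lambda>H. real (ncomps n H k)"], rule lower_integrable[where h = "\<lambda>H. (real (ncomps n H k))\<^sup>2"])
    have "expectation (\<lambda>w. (?Y w / real n - y)\<^sup>2) = expectation (\<lambda>w. (?Y w)\<^sup>2 * (1 / (real n)\<^sup>2) - ?Y w * (2 * y / real n) + y\<^sup>2)"
      by (intro Bochner_Integration.integral_cong refl) (simp add: power2_diff power_divide algebra_simps)
    also have "\<dots> = expectation (\<lambda>w. (?Y w)\<^sup>2) * (1 / (real n)\<^sup>2) - expectation ?Y * (2 * y / real n) + y\<^sup>2"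
      using iY by (simp add: prob_space)
    also have "\<dots> \<le> (expectation ?Y + (expectation ?Y)\<^sup>2 / (1 - \<theta> / real n) ^ (k * k)) * (1 / (real n)\<^sup>2) - expectation ?Y * (2 * y / real n) + y\<^sup>2"
      unfolding integral_ncomps
      by (intro add_right_mono diff_right_mono mult_right_mono integral_ncomps_sq) (use elim assms in auto)
    also have "\<dots> = v n"
    proof -
      have "expectation ?Y = m n * real n" using elim by (simp add: m_def integral_ncomps)
      then show ?thesis using elim by (simp add: v_def power2_eq_square field_simps)
    qed
    finally have "expectation (\<lambda>w. (?Y w / real n - y)\<^sup>2) \<le> v n" .
    moreover have "expectation (\<lambda>w. \<bar>?Y w / real n - y\<bar>) \<le> sqrt (expectation (\<lambda>w. (?Y w / real n - y)\<^sup>2))"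
      by (intro expectation_abs_le lower_integrable[where h = "\<lambda>H. real (ncomps n H k) / real n - y"]
          lower_integrable[where h = "\<lambda>H. (real (ncomps n H k) / real n - y)\<^sup>2"])
    ultimately show ?case by (meson order_trans real_sqrt_le_mono)
  qed
  have "(\<lambda>n. sqrt (v n)) \<longlonglongrightarrow> 0" using tendsto_real_sqrt[OF v] by simp
  then show ?thesis unfolding y_def[symmetric]
    by (rule tendsto_squeeze_zero[OF le]) simp
qed

section \<open>The limiting fraction of vertices in components of more than K vertices, and its
  limit in K\<close>

definition rhoK :: "nat \<Rightarrow> real \<Rightarrow> real" where
  "rhoK K \<theta> = 1 - (\<Sum>k\<in>{1..K}. real k * ysize k \<theta>)"

lemma bigset_L1:
  assumes "\<theta> > 0"
  shows "(\<lambda>n. \<integral>w. \<bar>real (card (bigset n (lower n w (\<theta> / real n)) K)) / real n - rhoK K \<theta>\<bar> \<partial>weight_law n) \<longlonglongrightarrow> 0"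
proof -
  let ?E = "\<lambda>n k. \<integral>w. \<bar>real (ncomps n (lower n w (\<theta> / real n)) k) / real n - ysize k \<theta>\<bar> \<partial>weight_law n"
  have lim: "(\<lambda>n. \<Sum>k\<in>{1..K}. real k * ?E n k) \<longlonglongrightarrow> (\<Sum>k\<in>{1..K}. real k * 0)"
    using assms by (intro tendsto_sum tendsto_mult tendsto_const ncomps_L1) auto
  have le: "\<forall>\<^sub>F n in sequentially. (\<integral>w. \<bar>real (card (bigset n (lower n w (\<theta> / real n)) K)) / real n - rhoK K \<theta>\<bar> \<partial>weight_law n)
      \<le> (\<Sum>k\<in>{1..K}. real k * ?E n k)"
    using eventually_gt_at_top[of 0]
  proof eventually_elim
    case (elim n)
    have pt: "\<bar>real (card (bigset n H K)) / real n - rhoK K \<theta>\<bar> \<le> (\<Sum>k\<in>{1..K}. real k * \<bar>real (ncomps n H k) / real n - ysize k \<theta>\<bar>)"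
      if "H \<subseteq> cedges n" for H
    proof -
      have "real (card (bigset n H K)) / real n - rhoK K \<theta> = - (\<Sum>k\<in>{1..K}. real k * (real (ncomps n H k) / real n - ysize k \<theta>))"
        using elim by (simp add: card_bigset[OF that] rhoK_def diff_divide_distrib sum_subtractf sum_divide_distrib algebra_simps)
      then show ?thesis
        by (simp only: abs_minus_cancel) (rule order_trans[OF sum_abs], simp add: abs_mult)
    qed
    have "(\<integral>w. \<bar>real (card (bigset n (lower n w (\<theta> / real n)) K)) / real n - rhoK K \<theta>\<bar> \<partial>weight_law n)
      \<le> (\<integral>w. (\<Sum>k\<in>{1..K}. real k * \<bar>real (ncomps n (lower n w (\<theta> / real n)) k) / real n - ysize k \<theta>\<bar>) \<partial>weight_law n)"
      by (intro integral_mono pt lower_subset lower_integrable[where h = "\<lambda>H. \<bar>real (card (bigset n H K)) / real n - rhoK K \<theta>\<bar>"]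
          lower_integrable[where h = "\<lambda>H. (\<Sum>k\<in>{1..K}. real k * \<bar>real (ncomps n H k) / real n - ysize k \<theta>\<bar>)"])
    also have "\<dots> = (\<Sum>k\<in>{1..K}. \<integral>w. real k * \<bar>real (ncomps n (lower n w (\<theta> / real n)) k) / real n - ysize k \<theta>\<bar> \<partial>weight_law n)"
      by (intro Bochner_Integration.integral_sum lower_integrable[where h = "\<lambda>H. real _ * \<bar>real (ncomps n H _) / real n - ysize _ \<theta>\<bar>"])
    finally show ?case by simp
  qed
  from lim have "(\<lambda>n. \<Sum>k\<in>{1..K}. real k * ?E n k) \<longlonglongrightarrow> 0" by simp
  then show ?thesis
    by (rule tendsto_squeeze_zero[OF le]) simp
qed

lemma tree_count_ysize: "0 \<le> \<theta> \<Longrightarrow> 0 \<le> ysize k \<theta>"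
  by (simp add: ysize_def)

lemma rhoK_antimono: "0 \<le> \<theta> \<Longrightarrow> K \<le> K' \<Longrightarrow> rhoK K' \<theta> \<le> rhoK K \<theta>"
  unfolding rhoK_def by (intro diff_left_mono sum_mono2) (auto simp: tree_count_ysize)

lemma rhoK_le_1: "0 \<le> \<theta> \<Longrightarrow> rhoK K \<theta> \<le> 1"
  unfolding rhoK_def by (auto intro!: sum_nonneg simp: tree_count_ysize)

lemma mean_bigset_lim:
  assumes "\<theta> > 0"
  shows "(\<lambda>n. \<integral>w. real (card (bigset n (lower n w (\<theta> / real n)) K)) / real n \<partial>weight_law n) \<longlonglongrightarrow> rhoK K \<theta>"
proof -
  let ?X = "\<lambda>n w. real (card (bigset n (lower n w (\<theta> / real n)) K)) / real n"
  have le: "\<bar>(\<integral>w. ?X n w \<partial>weight_law n) - rhoK K \<theta>\<bar> \<le> (\<integral>w. \<bar>?X n w - rhoK K \<theta>\<bar> \<partial>weight_law n)" for n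
  proof -
    interpret prob_space "weight_law n" by simp
    have i: "integrable (weight_law n) (?X n)" by (rule lower_integrable[where h = "\<lambda>H. real (card (bigset n H K)) / real n"])
    have "expectation (?X n) - rhoK K \<theta> = expectation (\<lambda>w. ?X n w - rhoK K \<theta>)"
      using i by (simp add: prob_space)
    then show ?thesis using integral_abs_bound[of "weight_law n" "\<lambda>w. ?X n w - rhoK K \<theta>"] by simp
  qed
  have "(\<lambda>n. \<bar>(\<integral>w. ?X n w \<partial>weight_law n) - rhoK K \<theta>\<bar>) \<longlonglongrightarrow> 0"
    by (rule tendsto_squeeze_zero[OF always_eventually bigset_L1[OF assms]]) (use le in auto)
  then show ?thesis by (simp add: LIM_zero_iff tendsto_rabs_zero_iff)
qed

lemma rhoK_nonneg: "\<theta> > 0 \<Longrightarrow> 0 \<le> rhoK K \<theta>"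
  by (rule LIMSEQ_le_const[OF mean_bigset_lim]) (auto intro!: exI[of _ 0] Bochner_Integration.integral_nonneg)

lemma card_cluster_mono:
  assumes "H \<subseteq> H'" "H' \<subseteq> cedges n" "x \<in> {1..n}"
  shows "card (cluster H x) \<le> card (cluster H' x)"
  using conn_mono[OF assms(1)] finite_cluster[OF assms(2,3)]
  by (intro card_mono) (auto simp: cluster_def)

lemma bigset_mono:
  assumes "H \<subseteq> H'" "H' \<subseteq> cedges n" "K' \<le> K"
  shows "bigset n H K \<subseteq> bigset n H' K'"
  using card_cluster_mono[OF assms(1,2)] assms(3) unfolding bigset_def
  by (auto intro: le_less_trans less_le_trans)

lemma finite_bigset [simp]: "finite (bigset n H K)"
  by (simp add: bigset_def)

lemma card_bigset_le: "card (bigset n H K) \<le> n"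
proof -
  have "bigset n H K \<subseteq> {1..n}" by (auto simp: bigset_def)
  from card_mono[OF _ this] show ?thesis by simp
qed

text \<open>The defining formula does not display monotonicity in the level. It is inherited from
  the finite graphs, where the same weights couple the two levels and larger graphs have larger
  clusters.\<close>

lemma rhoK_mono:
  assumes "0 < \<theta>" "\<theta> \<le> \<theta>'"
  shows "rhoK K \<theta> \<le> rhoK K \<theta>'"
proof (rule LIMSEQ_le[OF mean_bigset_lim mean_bigset_lim])
  show "\<exists>N. \<forall>n\<ge>N. (\<integral>w. real (card (bigset n (lower n w (\<theta> / real n)) K)) / real n \<partial>weight_law n) \<le>
      (\<integral>w. real (card (bigset n (lower n w (\<theta>' / real n)) K)) / real n \<partial>weight_law n)"
  proof (intro exI[of _ 0] allI impI integral_mono)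
    fix n
    show "integrable (weight_law n) (\<lambda>w. real (card (bigset n (lower n w (\<theta> / real n)) K)) / real n)"
      "integrable (weight_law n) (\<lambda>w. real (card (bigset n (lower n w (\<theta>' / real n)) K)) / real n)"
      by (rule lower_integrable[where h = "\<lambda>H. real (card (bigset n H K)) / real n"])+
    fix w
    have "\<theta> / real n \<le> \<theta>' / real n" using assms by (simp add: divide_right_mono)
    then have "bigset n (lower n w (\<theta> / real n)) K \<subseteq> bigset n (lower n w (\<theta>' / real n)) K"
      by (intro bigset_mono lower_mono lower_subset) auto
    then have "card (bigset n (lower n w (\<theta> / real n)) K) \<le> card (bigset n (lower n w (\<theta>' / real n)) K)"
      by (intro card_mono) auto
    then show "real (card (bigset n (lower n w (\<theta> / real n)) K)) / real n \<le> real (card (bigset n (lower n w (\<theta>' / real n)) K)) / real n"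
      by (simp add: divide_right_mono)
  qed
qed (use assms in auto)

text \<open>
  As \<open>K\<close> grows, \<open>rhoK K \<theta>\<close> decreases to the survival probability of a branching
  process with Poisson offspring of mean \<open>\<theta>\<close>.
\<close>

definition rho :: "real \<Rightarrow> real" where
  "rho \<theta> = (if \<theta> \<le> 0 then 0 else (INF K. rhoK K \<theta>))"

lemma bdd_rhoK: "\<theta> > 0 \<Longrightarrow> bdd_below (range (\<lambda>K. rhoK K \<theta>))"
  using rhoK_nonneg by (intro bdd_belowI[of _ 0]) auto

lemma rhoK_lim: "\<theta> > 0 \<Longrightarrow> (\<lambda>K. rhoK K \<theta>) \<longlonglongrightarrow> rho \<theta>"
  using LIMSEQ_decseq_INF[OF bdd_rhoK, of \<theta>] rhoK_antimono[of \<theta>] by (auto simp: rho_def decseq_def)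

lemma rho_le_rhoK: "\<theta> > 0 \<Longrightarrow> rho \<theta> \<le> rhoK K \<theta>"
  using cINF_lower[OF bdd_rhoK, of \<theta> K] by (simp add: rho_def)

lemma rho_nonneg: "0 \<le> rho \<theta>"
  using rhoK_nonneg[of \<theta>] by (auto simp: rho_def intro!: cINF_greatest)

text \<open>Monotonicity on the whole line, with the value 0 on nonpositive arguments, makes
  \<open>rho\<close> Borel measurable and continuous outside a countable set. The integration over
  rescaled weights rests on both.\<close>

lemma mono_rho: "mono rho"
proof (rule monoI)
  fix a b :: real assume ab: "a \<le> b"
  show "rho a \<le> rho b"
  proof (cases "a \<le> 0")
    case True then show ?thesis using rho_nonneg by (simp add: rho_def)
  next
    case False
    then have "rho a \<le> rhoK K b" for K
      using rho_le_rhoK[of a K] rhoK_mono[of a b K] ab by simp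
    then show ?thesis using False ab by (auto simp: rho_def intro!: cINF_greatest)
  qed
qed

section \<open>Sprinkling\<close>

text \<open>Greedy balancing: each new item goes to the lighter side, so the cross term in the
  square of the imbalance is nonpositive and the square grows by at most
  \<open>(m i)\<^sup>2\<close>.\<close>

lemma balanced_signs:
  fixes m :: "'a \<Rightarrow> real"
  assumes "finite I" "\<And>i. i \<in> I \<Longrightarrow> 0 \<le> m i"
  shows "\<exists>J\<subseteq>I. (sum m J - sum m (I - J))\<^sup>2 \<le> (\<Sum>i\<in>I. (m i)\<^sup>2)"
  using assms
proof (induction I rule: finite_induct)
  case (insert i I)
  then obtain J where J: "J \<subseteq> I" "(sum m J - sum m (I - J))\<^sup>2 \<le> (\<Sum>i\<in>I. (m i)\<^sup>2)" by auto
  define a where "a = sum m J - sum m (I - J)"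
  have fin: "finite J" "finite (I - J)" using J insert finite_subset by auto
  have i: "i \<notin> J" "i \<notin> I - J" using J insert by auto
  have a: "a\<^sup>2 \<le> (\<Sum>i\<in>I. (m i)\<^sup>2)" using J(2) by (simp only: a_def)
  have ins: "(\<Sum>i\<in>insert i I. (m i)\<^sup>2) = (m i)\<^sup>2 + (\<Sum>i\<in>I. (m i)\<^sup>2)" using insert by simp
  show ?case
  proof (cases "a \<ge> 0")
    case True
    have "sum m J - sum m (insert i I - J) = a - m i"
      using i fin insert by (simp add: a_def insert_Diff_if)
    moreover have "(a - m i)\<^sup>2 \<le> a\<^sup>2 + (m i)\<^sup>2" using True insert by (simp add: power2_diff)
    ultimately have "(sum m J - sum m (insert i I - J))\<^sup>2 \<le> (\<Sum>i\<in>insert i I. (m i)\<^sup>2)"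
      using a ins by simp
    then show ?thesis using J by (intro exI[of _ J]) auto
  next
    case False
    have "insert i I - insert i J = I - J" using i insert by auto
    then have "sum m (insert i J) - sum m (insert i I - insert i J) = a + m i"
      using i fin by (simp add: a_def)
    moreover have "(a + m i)\<^sup>2 \<le> a\<^sup>2 + (m i)\<^sup>2"
      using False insert by (simp add: power2_sum mult_nonpos_nonneg)
    ultimately have "(sum m (insert i J) - sum m (insert i I - insert i J))\<^sup>2 \<le> (\<Sum>i\<in>insert i I. (m i)\<^sup>2)"
      using a ins by simp
    then show ?thesis using J by (intro exI[of _ "insert i J"]) auto
  qed
qed auto

text \<open>Balance the sizes of the connectivity classes of \<open>B\<close>. If the sides have a
  and b elements, then (a - b)^2 is at most the sum of the squared class sizes, which counts the
  connected pairs. The number of disconnected pairs is therefore at most (a + b)^2 - (a - b)^2 = 4 a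
  b.\<close>

lemma split_exists:
  fixes H :: "'a set set"
  assumes "finite B"
  shows "\<exists>A\<subseteq>B. card {(x, y) \<in> B \<times> B. (x, y) \<notin> (adj H)\<^sup>*} \<le> 4 * (card A * card (B - A)) \<and>
    (\<forall>x\<in>A. \<forall>y\<in>B - A. (x, y) \<notin> (adj H)\<^sup>*)"
proof -
  define cl where "cl = (\<lambda>x. cluster H x \<inter> B)"
  define I where "I = cl ` B"
  have fI: "finite I" using assms by (simp add: I_def)
  have fC: "finite C" if "C \<in> I" for C using that assms by (auto simp: I_def cl_def)
  have disj: "C \<inter> C' = {}" if "C \<in> I" "C' \<in> I" "C \<noteq> C'" for C C'
  proof (rule ccontr)
    assume "C \<inter> C' \<noteq> {}"
    then obtain z where "z \<in> C" "z \<in> C'" by blast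
    moreover obtain x y where "C = cl x" "C' = cl y" using \<open>C \<in> I\<close> \<open>C' \<in> I\<close> unfolding I_def by (elim imageE)
    ultimately have xyz: "C = cl x" "C' = cl y" "z \<in> C" "z \<in> C'" by auto
    then have "cluster H x = cluster H z" "cluster H y = cluster H z" by (auto simp: cl_def cluster_eq_iff mem_cluster)
    then show False using that xyz by (simp add: cl_def)
  qed
  have cardU: "card (\<Union>J) = (\<Sum>C\<in>J. card C)" if "J \<subseteq> I" for J
  proof (rule card_Union_disjoint)
    show "pairwise disjnt J" unfolding pairwise_def disjnt_def using disj that by blast
    show "finite C" if "C \<in> J" for C using fC that \<open>J \<subseteq> I\<close> by auto
  qed
  have UI: "\<Union>I = B" by (auto simp: I_def cl_def)
  obtain J where J: "J \<subseteq> I" "(sum (\<lambda>C. real (card C)) J - sum (\<lambda>C. real (card C)) (I - J))\<^sup>2 \<le> (\<Sum>C\<in>I. (real (card C))\<^sup>2)"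
    using balanced_signs[OF fI, of "\<lambda>C. real (card C)"] by auto
  define A where "A = \<Union>J"
  have AB: "A \<subseteq> B" using J(1) UI by (auto simp: A_def)
  have BA: "B - A = \<Union>(I - J)"
  proof (intro equalityI subsetI)
    fix x assume "x \<in> B - A"
    then show "x \<in> \<Union>(I - J)" using UI by (auto simp: A_def)
  next
    fix x assume "x \<in> \<Union>(I - J)"
    then obtain C where C: "x \<in> C" "C \<in> I" "C \<notin> J" by auto
    then have "x \<notin> A" using disj[of C] J(1) unfolding A_def by blast
    then show "x \<in> B - A" using C UI by auto
  qed
  have cA: "real (card A) = sum (\<lambda>C. real (card C)) J" using cardU[OF J(1)] by (simp add: A_def)
  have cBA: "real (card (B - A)) = sum (\<lambda>C. real (card C)) (I - J)" using cardU[of "I - J"] by (simp add: BA)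
  have cB: "real (card B) = real (card A) + real (card (B - A))"
    using AB assms finite_subset[OF AB assms] by (simp add: card_Diff_subset card_mono of_nat_diff)
  define D where "D = {(x, y) \<in> B \<times> B. (x, y) \<notin> (adj H)\<^sup>*}"
  have conn_pairs: "B \<times> B - D = (\<Union>C\<in>I. C \<times> C)"
  proof (intro equalityI subsetI)
    fix p assume "p \<in> B \<times> B - D"
    then obtain x y where p: "p = (x, y)" "x \<in> B" "y \<in> B" "(x, y) \<in> (adj H)\<^sup>*" by (auto simp: D_def)
    then have "p \<in> cl x \<times> cl x" by (auto simp: cl_def mem_cluster)
    then show "p \<in> (\<Union>C\<in>I. C \<times> C)" using p by (auto simp: I_def)
  next
    fix p assume "p \<in> (\<Union>C\<in>I. C \<times> C)"
    then obtain x y z where p: "p = (x, y)" "x \<in> cl z" "y \<in> cl z" by (auto simp: I_def)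
    then have "(x, z) \<in> (adj H)\<^sup>*" "(z, y) \<in> (adj H)\<^sup>*" using conn_sym[of z x H] by (auto simp: cl_def mem_cluster)
    then have "(x, y) \<in> (adj H)\<^sup>*" by (rule rtrancl_trans)
    then show "p \<in> B \<times> B - D" using p by (auto simp: D_def cl_def)
  qed
  have "card (\<Union>C\<in>I. C \<times> C) = (\<Sum>C\<in>I. card (C \<times> C))"
  proof (rule card_UN_disjoint[OF fI])
    show "\<forall>C\<in>I. finite (C \<times> C)" using fC by auto
    show "\<forall>C\<in>I. \<forall>C'\<in>I. C \<noteq> C' \<longrightarrow> C \<times> C \<inter> C' \<times> C' = {}" using disj by blast
  qed
  then have "real (card (B \<times> B - D)) = (\<Sum>C\<in>I. (real (card C))\<^sup>2)"
    by (simp add: conn_pairs card_cartesian_product power2_eq_square)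
  moreover have "D \<subseteq> B \<times> B" by (auto simp: D_def)
  then have "card D \<le> card (B \<times> B)" "card (B \<times> B - D) = card (B \<times> B) - card D"
    using assms finite_subset[of D "B \<times> B"] card_mono[of "B \<times> B" D] card_Diff_subset[of D "B \<times> B"] by simp_all
  then have "real (card (B \<times> B - D)) = real (card B) * real (card B) - real (card D)"
    by (simp add: of_nat_diff card_cartesian_product)
  moreover have "(real (card A) - real (card (B - A)))\<^sup>2 \<le> (\<Sum>C\<in>I. (real (card C))\<^sup>2)"
    using J(2) by (simp only: cA cBA)
  moreover have "real (card B) * real (card B) = (real (card A) + real (card (B - A)))\<^sup>2"
    by (simp only: cB power2_eq_square)
  ultimately have "real (card D) \<le> (real (card A) + real (card (B - A)))\<^sup>2 - (real (card A) - real (card (B - A)))\<^sup>2"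
    by linarith
  also have "\<dots> = real (4 * (card A * card (B - A)))" by (simp add: power2_eq_square algebra_simps)
  finally have "card D \<le> 4 * (card A * card (B - A))" by (simp only: of_nat_le_iff)
  moreover have "(x, y) \<notin> (adj H)\<^sup>*" if "x \<in> A" "y \<in> B - A" for x y
  proof
    assume xy: "(x, y) \<in> (adj H)\<^sup>*"
    from that(1) obtain C where C: "C \<in> J" "x \<in> C" by (auto simp: A_def)
    then obtain z where z: "C = cl z" using J(1) by (auto simp: I_def)
    then have "(z, y) \<in> (adj H)\<^sup>*" using C xy by (auto simp: cl_def mem_cluster intro: rtrancl_trans)
    then have "y \<in> C" using that(2) z by (auto simp: cl_def mem_cluster)
    then show False using C that(2) by (auto simp: A_def)
  qed
  ultimately show ?thesis using AB unfolding D_def by blast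
qed

text \<open>\<open>H'\<close> is the graph at the lower level, whose large components are meant to
  merge in the sprinkled graph \<open>H\<close>. Ordered pairs are counted.\<close>

definition disc :: "nat \<Rightarrow> nat set set \<Rightarrow> nat set set \<Rightarrow> nat \<Rightarrow> nat" where
  "disc n H' H K = card {(x, y) \<in> bigset n H' K \<times> bigset n H' K. (x, y) \<notin> (adj H)\<^sup>*}"

definition bigcomps :: "nat \<Rightarrow> nat set set \<Rightarrow> nat \<Rightarrow> nat set set" where
  "bigcomps n H K = cluster H ` bigset n H K"

lemma card_bigcomps:
  assumes "H \<subseteq> cedges n"
  shows "K * card (bigcomps n H K) \<le> n"
proof -
  have sub: "bigcomps n H K \<subseteq> comps n H" by (auto simp: bigcomps_def comps_def bigset_def)
  have in_range: "C \<subseteq> {1..n}" if "C \<in> bigcomps n H K" for C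
    using that sub comps_subset[OF assms, of C] by auto
  have "K * card (bigcomps n H K) = (\<Sum>C\<in>bigcomps n H K. K)" by simp
  also have "\<dots> \<le> (\<Sum>C\<in>bigcomps n H K. card C)"
    by (intro sum_mono) (auto simp: bigcomps_def bigset_def)
  also have "\<dots> = card (\<Union>(bigcomps n H K))"
  proof (rule card_Union_disjoint[symmetric])
    show "pairwise disjnt (bigcomps n H K)"
      unfolding pairwise_def disjnt_def using comps_disjoint sub by blast
    show "finite C" if "C \<in> bigcomps n H K" for C
      using in_range[OF that] by (rule finite_subset) simp
  qed
  also have "\<dots> \<le> card {1..n}"
    using in_range by (intro card_mono) auto
  finally show ?thesis by simp
qed

text \<open>
  Distributing the large components of \<open>H'\<close> over two sides of nearly equal size turns the
  disconnected pairs into a cut of quadratic size that contains no edge of \<open>H\<close>.  There are at most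
  \<open>2\<close> to the power \<open>n / K\<close> such distributions, so a union bound excludes all of them.
\<close>

lemma disc_split:
  assumes "H' \<subseteq> H" "H \<subseteq> cedges n"
  shows "\<exists>A\<in>Union ` Pow (bigcomps n H' K). A \<subseteq> bigset n H' K \<and>
    disc n H' H K \<le> 4 * (card A * card (bigset n H' K - A)) \<and>
    H \<inter> cross A (bigset n H' K - A) = {}"
proof -
  let ?B = "bigset n H' K"
  obtain A where A: "A \<subseteq> ?B" "disc n H' H K \<le> 4 * (card A * card (?B - A))"
    "\<And>x y. x \<in> A \<Longrightarrow> y \<in> ?B - A \<Longrightarrow> (x, y) \<notin> (adj H)\<^sup>*"
    using split_exists[of ?B H] unfolding disc_def by auto
  have closed: "cluster H' x \<subseteq> A" if x: "x \<in> A" for x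
  proof
    fix y assume y: "y \<in> cluster H' x"
    have xn: "x \<in> {1..n}" using A(1) x by (auto simp: bigset_def)
    have "H' \<subseteq> cedges n" using assms by auto
    then have "y \<in> {1..n}" using subsetD[OF cluster_in_range[OF _ xn] y] by simp
    moreover have "cluster H' y = cluster H' x" using y by (auto simp: cluster_eq_iff mem_cluster conn_sym)
    ultimately have "y \<in> ?B" using A(1) x by (auto simp: bigset_def)
    moreover have "(x, y) \<in> (adj H)\<^sup>*" using y conn_mono[OF assms(1)] by (auto simp: mem_cluster)
    ultimately show "y \<in> A" using A(3)[OF x, of y] by blast
  qed
  have "A = \<Union>(cluster H' ` A)"
    using closed self_in_cluster by fast
  moreover have "cluster H' ` A \<in> Pow (bigcomps n H' K)" using A(1) by (auto simp: bigcomps_def)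
  ultimately have "A \<in> Union ` Pow (bigcomps n H' K)" by (rule image_eqI)
  moreover have "H \<inter> cross A (?B - A) = {}"
  proof (rule ccontr)
    assume "H \<inter> cross A (?B - A) \<noteq> {}"
    then obtain x y where "{x, y} \<in> H" "x \<in> A" "y \<in> ?B - A" by (auto simp: cross_def)
    then show False using A(3)[of x y] by (auto simp: adj_def)
  qed
  ultimately show ?thesis using A by blast
qed

lemma measure_lower_eq:
  assumes "g \<subseteq> cedges n" "0 \<le> s" "s \<le> 1"
  shows "measure (weight_law n) {w \<in> space (weight_law n). lower n w s = g} =
    s ^ card g * (1 - s) ^ card (cedges n - g)"
proof -
  have "{w \<in> space (weight_law n). lower n w s = g} =
    {w \<in> space (weight_law n). (\<forall>f\<in>g. w f < s) \<and> (\<forall>f\<in>cedges n - g. s \<le> w f) \<and> (\<forall>f\<in>{}. s \<le> w f)}"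
    using assms(1) by (auto simp: lower_def not_less[symmetric])
  then show ?thesis
    using weight_box_threshold[of g n "cedges n - g" "{}" s s] assms by simp
qed

text \<open>Conditioning on the lower graph is done by summing over its possible values
  \<open>g\<close>. Given \<open>g\<close>, the candidate cuts are determined; each has at least t /
  4 edges, and all of them must stay absent while the level rises from \<open>s\<close> to
  \<open>s'\<close>.\<close>

lemma sprinkle_prob:
  assumes n: "n > 0" and s: "0 \<le> s" "s \<le> s'" "s' \<le> 1" and K: "K \<ge> 1"
  shows "measure (weight_law n) {w \<in> space (weight_law n). t \<le> real (disc n (lower n w s) (lower n w s') K)}
    \<le> 2 powr (real n / real K) * exp (- (s' - s) * t / 4)"
proof -
  interpret prob_space "weight_law n" by simp
  \<comment> \<open>Candidate cuts, read off the lower graph alone, so that for a given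
    \<open>g\<close> their number is fixed before the edges between the two levels are
    revealed.\<close>
  define \<U> where "\<U> = (\<lambda>g. {A \<in> Union ` Pow (bigcomps n g K). A \<subseteq> bigset n g K \<and>
    t \<le> 4 * real (card A * card (bigset n g K - A)) \<and> g \<inter> cross A (bigset n g K - A) = {}})"
  define Q where "Q = (\<lambda>g A. {w \<in> space (weight_law n). lower n w s = g \<and> lower n w s' \<inter> cross A (bigset n g K - A) = {}})"
  have Qs: "Q g A \<in> events" for g A
    unfolding Q_def by (rule lower2_sets[where \<Phi> = "\<lambda>x y. x = g \<and> y \<inter> cross A (bigset n g K - A) = {}"])
  have finU: "finite (\<U> g)" for g by (simp add: \<U>_def bigcomps_def)
  have cardU: "real (card (\<U> g)) \<le> 2 powr (real n / real K)" if "g \<subseteq> cedges n" for g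
  proof -
    have fb: "finite (bigcomps n g K)" by (simp add: bigcomps_def)
    have "card (\<U> g) \<le> card (Union ` Pow (bigcomps n g K))" using fb by (intro card_mono) (auto simp: \<U>_def)
    also have "\<dots> \<le> card (Pow (bigcomps n g K))" using fb by (intro card_image_le) simp
    also have "\<dots> = 2 ^ card (bigcomps n g K)" using fb by (simp add: card_Pow)
    finally have "real (card (\<U> g)) \<le> 2 ^ card (bigcomps n g K)" using of_nat_mono by fastforce
    also have "\<dots> = 2 powr real (card (bigcomps n g K))" by (simp add: powr_realpow)
    also have "\<dots> \<le> 2 powr (real n / real K)"
    proof (rule powr_mono)
      have "real K * real (card (bigcomps n g K)) \<le> real n"
        using card_bigcomps[OF that, of K] by (metis of_nat_le_iff of_nat_mult)
      then show "real (card (bigcomps n g K)) \<le> real n / real K" using K by (simp add: field_simps)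
    qed simp
    finally show ?thesis .
  qed
  have Qle: "prob (Q g A) \<le> prob {w \<in> space (weight_law n). lower n w s = g} * exp (- (s' - s) * t / 4)"
    if g: "g \<subseteq> cedges n" and A: "A \<in> \<U> g" for g A
  proof -
    let ?B = "bigset n g K"
    let ?X = "cross A (?B - A)"
    have AB: "A \<subseteq> ?B" "t \<le> 4 * real (card A * card (?B - A))" "g \<inter> ?X = {}" using A by (auto simp: \<U>_def)
    have Xsub: "?X \<subseteq> cedges n"
    proof
      fix e assume "e \<in> ?X"
      then obtain x y where e: "e = {x, y}" "x \<in> A" "y \<in> ?B" "y \<notin> A" by (auto simp: cross_def)
      then have "x \<in> {1..n}" "y \<in> {1..n}" "x \<noteq> y" using AB(1) by (auto simp: bigset_def)
      then show "e \<in> cedges n" unfolding e by (subst pair_in_cedges) simp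
    qed
    have cX: "card ?X = card A * card (?B - A)" by (rule card_cross) auto
    define c where "c = card ?X"
    have "Q g A = {w \<in> space (weight_law n). (\<forall>f\<in>g. w f < s) \<and> (\<forall>f\<in>cedges n - g - ?X. s \<le> w f) \<and> (\<forall>f\<in>?X. s' \<le> w f)}"
      (is "_ = ?R")
    proof (intro equalityI subsetI)
      fix w assume "w \<in> Q g A"
      then have w: "w \<in> space (weight_law n)" "lower n w s = g" "lower n w s' \<inter> ?X = {}" by (auto simp: Q_def)
      have "\<forall>f\<in>g. w f < s" using w(2) by (auto simp: lower_def)
      moreover have "\<forall>f\<in>cedges n - g - ?X. s \<le> w f" using w(2) by (auto simp: lower_def)
      moreover have "\<forall>f\<in>?X. s' \<le> w f" using w(3) Xsub unfolding lower_def by fastforce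
      ultimately show "w \<in> ?R" using w(1) by blast
    next
      fix w assume w: "w \<in> ?R"
      have "lower n w s = g"
      proof (intro equalityI subsetI)
        fix f assume f: "f \<in> lower n w s"
        show "f \<in> g"
        proof (rule ccontr)
          assume "f \<notin> g"
          then have "s \<le> w f \<or> s' \<le> w f" using w f unfolding lower_def by blast
          then show False using f s by (auto simp: lower_def)
        qed
      qed (use w g in \<open>auto simp: lower_def\<close>)
      moreover have "lower n w s' \<inter> ?X = {}" using w by (auto simp: lower_def)
      ultimately show "w \<in> Q g A" using w by (auto simp: Q_def)
    qed
    then have pQ: "prob (Q g A) = s ^ card g * (1 - s) ^ card (cedges n - g - ?X) * (1 - s') ^ c"
      unfolding c_def using g Xsub AB(3) s by (simp only:) (intro weight_box_threshold, auto)
    \<comment> \<open>The factor 1 - s per cut edge restores the probability that the lower graph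
      equals \<open>g\<close>; the factor 1 - (s' - s) is the price of surviving the
      sprinkling.\<close>
    have e1: "(1 - s') ^ c \<le> ((1 - s) * (1 - (s' - s))) ^ c"
    proof (rule power_mono)
      have "0 \<le> s * (s' - s)" using s by simp
      then show "1 - s' \<le> (1 - s) * (1 - (s' - s))" by (simp add: algebra_simps)
    qed (use s in simp)
    have e2: "(1 - (s' - s)) ^ c \<le> exp (- (s' - s) * t / 4)"
    proof -
      have "(1 - (s' - s)) ^ c \<le> exp (- (s' - s)) ^ c"
      proof (rule power_mono)
        show "1 - (s' - s) \<le> exp (- (s' - s))" using exp_ge_add_one_self[of "- (s' - s)"] by linarith
      qed (use s in simp)
      also have "\<dots> = exp (real c * (- (s' - s)))" by (rule exp_of_nat_mult[symmetric])
      also have "\<dots> \<le> exp (- (s' - s) * t / 4)"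
      proof -
        have "t / 4 \<le> real c" using AB(2) by (simp add: c_def cX)
        then have "(s' - s) * (t / 4) \<le> (s' - s) * real c" using s by (intro mult_left_mono) auto
        moreover have "- (s' - s) * t / 4 = - ((s' - s) * (t / 4))" "real c * (- (s' - s)) = - ((s' - s) * real c)"
          by (simp_all add: field_simps)
        ultimately show ?thesis by (simp only: exp_le_cancel_iff neg_le_iff_le)
      qed
      finally show ?thesis .
    qed
    have "(1 - s) ^ c * (1 - (s' - s)) ^ c \<le> (1 - s) ^ c * exp (- (s' - s) * t / 4)"
      by (rule mult_left_mono[OF e2]) (use s in simp)
    then have "(1 - s') ^ c \<le> (1 - s) ^ c * exp (- (s' - s) * t / 4)"
      using e1 by (simp only: power_mult_distrib)
    then have "prob (Q g A) \<le> s ^ card g * (1 - s) ^ card (cedges n - g - ?X) * ((1 - s) ^ c * exp (- (s' - s) * t / 4))"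
      unfolding pQ by (rule mult_left_mono) (use s in simp)
    also have "\<dots> = s ^ card g * (1 - s) ^ (card (cedges n - g - ?X) + c) * exp (- (s' - s) * t / 4)"
      by (simp add: power_add)
    also have "card (cedges n - g - ?X) + c = card (cedges n - g)"
    proof -
      have "?X \<subseteq> cedges n - g" using Xsub AB(3) by auto
      moreover have "finite ?X" using Xsub finite_cedges by (rule finite_subset)
      ultimately show ?thesis unfolding c_def by (simp add: card_Diff_subset card_mono)
    qed
    finally show ?thesis using g s by (simp add: measure_lower_eq)
  qed
  have "{w \<in> space (weight_law n). t \<le> real (disc n (lower n w s) (lower n w s') K)} \<subseteq>
    (\<Union>g\<in>Pow (cedges n). \<Union>A\<in>\<U> g. Q g A)"
  proof
    fix w assume "w \<in> {w \<in> space (weight_law n). t \<le> real (disc n (lower n w s) (lower n w s') K)}"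
    then have w: "w \<in> space (weight_law n)" "t \<le> real (disc n (lower n w s) (lower n w s') K)" by auto
    define g where "g = lower n w s"
    have gs: "g \<subseteq> lower n w s'" unfolding g_def by (rule lower_mono) (rule s)
    obtain A where A: "A \<in> Union ` Pow (bigcomps n g K)" "A \<subseteq> bigset n g K"
      "disc n g (lower n w s') K \<le> 4 * (card A * card (bigset n g K - A))"
      "lower n w s' \<inter> cross A (bigset n g K - A) = {}"
      using disc_split[OF gs lower_subset, of K] by auto
    have "t \<le> real (4 * (card A * card (bigset n g K - A)))"
      using w(2) A(3) unfolding g_def[symmetric] by (meson of_nat_mono order_trans)
    then have "A \<in> \<U> g" using A gs by (auto simp: \<U>_def)
    moreover have "w \<in> Q g A" using w(1) A(4) by (simp add: Q_def g_def)
    moreover have "g \<in> Pow (cedges n)" using lower_subset by (simp add: g_def)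
    ultimately show "w \<in> (\<Union>g\<in>Pow (cedges n). \<Union>A\<in>\<U> g. Q g A)" by blast
  qed
  then have "prob {w \<in> space (weight_law n). t \<le> real (disc n (lower n w s) (lower n w s') K)} \<le>
    prob (\<Union>g\<in>Pow (cedges n). \<Union>A\<in>\<U> g. Q g A)"
    using Qs finU by (intro finite_measure_mono) (auto intro!: sets.finite_UN)
  also have "\<dots> \<le> (\<Sum>g\<in>Pow (cedges n). prob (\<Union>A\<in>\<U> g. Q g A))"
    using Qs finU by (intro finite_measure_subadditive_finite) (auto intro!: sets.finite_UN)
  also have "\<dots> \<le> (\<Sum>g\<in>Pow (cedges n). \<Sum>A\<in>\<U> g. prob (Q g A))"
    using Qs finU by (intro sum_mono finite_measure_subadditive_finite) auto
  also have "\<dots> \<le> (\<Sum>g\<in>Pow (cedges n). \<Sum>A\<in>\<U> g. prob {w \<in> space (weight_law n). lower n w s = g} * exp (- (s' - s) * t / 4))"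
    using Qle by (intro sum_mono) auto
  also have "\<dots> = (\<Sum>g\<in>Pow (cedges n). real (card (\<U> g)) * (prob {w \<in> space (weight_law n). lower n w s = g} * exp (- (s' - s) * t / 4)))"
    by simp
  also have "\<dots> \<le> (\<Sum>g\<in>Pow (cedges n). 2 powr (real n / real K) * (prob {w \<in> space (weight_law n). lower n w s = g} * exp (- (s' - s) * t / 4)))"
    using cardU by (intro sum_mono mult_right_mono) auto
  also have "\<dots> = 2 powr (real n / real K) * exp (- (s' - s) * t / 4) * (\<Sum>g\<in>Pow (cedges n). prob {w \<in> space (weight_law n). lower n w s = g})"
    unfolding sum_distrib_left by (intro sum.cong refl) (simp only: ac_simps)
  also have "(\<Sum>g\<in>Pow (cedges n). prob {w \<in> space (weight_law n). lower n w s = g}) = prob (\<Union>g\<in>Pow (cedges n). {w \<in> space (weight_law n). lower n w s = g})"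
    using lower_sets[where \<Phi> = "\<lambda>H. H = _"]
    by (intro finite_measure_finite_Union[symmetric]) (auto simp: disjoint_family_on_def)
  also have "(\<Union>g\<in>Pow (cedges n). {w \<in> space (weight_law n). lower n w s = g}) = space (weight_law n)"
    using lower_subset by auto
  finally show ?thesis by (simp add: prob_space)
qed

lemma disc_le: "disc n H' H K \<le> n * n"
proof -
  have "disc n H' H K \<le> card (bigset n H' K \<times> bigset n H' K)"
    unfolding disc_def by (intro card_mono) auto
  also have "\<dots> \<le> n * n" using card_bigset_le by (simp add: card_cartesian_product mult_le_mono)
  finally show ?thesis .
qed

text \<open>The expectation is at most t + n^2 P(disc \<ge> t) with t = (\<delta> / 2) n^2, and
  sprinkling makes the probability exponentially small in n.\<close>

lemma disc_mean:
  assumes "0 < \<theta>'" "\<theta>' < \<theta>" "\<delta> > 0"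
  shows "\<exists>K0\<ge>1. \<forall>K\<ge>K0. \<forall>\<^sub>F n in sequentially.
    (\<integral>w. real (disc n (lower n w (\<theta>' / real n)) (lower n w (\<theta> / real n)) K) \<partial>weight_law n) \<le> \<delta> * (real n)\<^sup>2"
proof -
  \<comment> \<open>For t = (\<delta> / 2) n^2 the exponent in \<open>sprinkle_prob\<close> equals
    -c n.\<close>
  define c where "c = (\<theta> - \<theta>') * (\<delta> / 2) / 4"
  have c: "c > 0" using assms by (simp add: c_def)
  \<comment> \<open>Beyond this cutoff the union bound 2^(n / K) uses up at most half of the
    exponent c n.\<close>
  obtain K0 where K0: "real K0 > 2 * ln 2 / c" using reals_Archimedean2 by blast
  show ?thesis
  proof (intro exI[of _ "Suc K0"] conjI allI impI)
    fix K assume K: "Suc K0 \<le> K"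
    have "2 * ln 2 / c < real K" using K0 K by linarith
    then have Kc: "ln 2 / real K \<le> c / 2" using K c by (simp add: field_simps)
    have "(\<lambda>n. exp (- (c / 2) * real n)) \<longlonglongrightarrow> 0" using c by real_asymp
    then have ev: "\<forall>\<^sub>F n in sequentially. exp (- (c / 2) * real n) < \<delta> / 2"
      using assms(3) by (intro order_tendstoD(2)[of _ 0]) auto
    show "\<forall>\<^sub>F n in sequentially.
      (\<integral>w. real (disc n (lower n w (\<theta>' / real n)) (lower n w (\<theta> / real n)) K) \<partial>weight_law n) \<le> \<delta> * (real n)\<^sup>2"
      using ev eventually_threshold[OF less_trans[OF assms(1,2)]] eventually_threshold[OF assms(1)]
    proof (eventually_elim, goal_cases)
      case (1 n)
      then have n: "n > 0" "0 \<le> \<theta>' / real n" "\<theta> / real n \<le> 1" "exp (- (c / 2) * real n) < \<delta> / 2" by auto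
      interpret prob_space "weight_law n" by simp
      let ?D = "\<lambda>w. real (disc n (lower n w (\<theta>' / real n)) (lower n w (\<theta> / real n)) K)"
      let ?t = "\<delta> / 2 * (real n)\<^sup>2"
      let ?E = "{w \<in> space (weight_law n). ?t \<le> ?D w}"
      define EV where "EV = ?E"
      have E: "EV \<in> events" unfolding EV_def by (rule lower2_sets[where \<Phi> = "\<lambda>x y. ?t \<le> real (disc n x y K)"])
      have "prob ?E \<le> 2 powr (real n / real K) * exp (- (\<theta> / real n - \<theta>' / real n) * ?t / 4)"
        using n K assms by (intro sprinkle_prob) (auto simp: divide_right_mono)
      also have "2 powr (real n / real K) = exp (ln 2 / real K * real n)"
        by (simp add: powr_def mult.commute)
      also have "- (\<theta> / real n - \<theta>' / real n) * ?t / 4 = - c * real n"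
        using n(1) by (simp add: c_def power2_eq_square field_simps)
      also have "exp (ln 2 / real K * real n) * exp (- c * real n) \<le> exp (- (c / 2) * real n)"
      proof -
        have "ln 2 / real K * real n \<le> c / 2 * real n" using Kc by (intro mult_right_mono) auto
        then have "ln 2 / real K * real n + - c * real n \<le> - (c / 2) * real n" by (simp add: algebra_simps)
        then show ?thesis unfolding exp_add[symmetric] by simp
      qed
      finally have pE: "prob EV \<le> \<delta> / 2" using n(4) unfolding EV_def by linarith
      have iF: "integrable (weight_law n) (\<lambda>w. of_bool (?t \<le> ?D w) :: real)"
        by (rule lower2_integrable[where h = "\<lambda>x y. of_bool (?t \<le> real (disc n x y K))"])
      have eF: "expectation (\<lambda>w. of_bool (?t \<le> ?D w) :: real) = prob EV"
        unfolding EV_def by (rule integral_of_bool) (use E in \<open>simp only: EV_def\<close>)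
      have "expectation ?D \<le> expectation (\<lambda>w. ?t + (real n)\<^sup>2 * of_bool (?t \<le> ?D w))"
      proof (rule integral_mono)
        show "integrable (weight_law n) ?D"
          by (rule lower2_integrable[where h = "\<lambda>x y. real (disc n x y K)"])
        show "integrable (weight_law n) (\<lambda>w. ?t + (real n)\<^sup>2 * of_bool (?t \<le> ?D w))"
          using iF by (intro Bochner_Integration.integrable_add integrable_const integrable_mult_right)
        fix w
        have "?D w \<le> real (n * n)" by (simp only: of_nat_le_iff disc_le)
        moreover have "0 \<le> ?t" using assms by simp
        ultimately show "?D w \<le> ?t + (real n)\<^sup>2 * of_bool (?t \<le> ?D w)"
          by (cases "?t \<le> ?D w") (auto simp: power2_eq_square)
      qed
      also have "\<dots> = ?t + (real n)\<^sup>2 * prob EV"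
      proof -
        have "expectation (\<lambda>w. ?t + (real n)\<^sup>2 * of_bool (?t \<le> ?D w)) =
            expectation (\<lambda>w. ?t) + expectation (\<lambda>w. (real n)\<^sup>2 * of_bool (?t \<le> ?D w))"
          using iF by (intro Bochner_Integration.integral_add integrable_const integrable_mult_right)
        also have "expectation (\<lambda>w. (real n)\<^sup>2 * of_bool (?t \<le> ?D w)) = (real n)\<^sup>2 * prob EV"
          unfolding eF[symmetric] by (rule integral_mult_right_zero)
        finally show ?thesis by (simp only: lebesgue_integral_const prob_space scaleR_one)
      qed
      also have "\<dots> \<le> ?t + (real n)\<^sup>2 * (\<delta> / 2)"
        using pE by (intro add_left_mono mult_left_mono) auto
      finally show ?case by (simp add: algebra_simps)
    qed
  qed simp
qed

section \<open>Connectivity compared with membership in large components\<close>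

definition badpairs :: "nat \<Rightarrow> nat set set \<Rightarrow> nat \<Rightarrow> nat" where
  "badpairs n H K = card {(x, y) \<in> {1..n} \<times> {1..n}. x \<noteq> y \<and>
     ((x, y) \<in> (adj H)\<^sup>*) \<noteq> (x \<in> bigset n H K \<and> y \<in> bigset n H K)}"

text \<open>A pair is bad for one of three reasons: it is joined inside a component of at most
  \<open>K\<close> vertices; both vertices are large already in \<open>H'\<close> but still not
  joined in \<open>H\<close>; or one of them is large in \<open>H\<close> and not in
  \<open>H'\<close>. The last kind is counted by the difference of two cardinalities, because the
  large sets are nested.\<close>

lemma badpairs_le:
  assumes H: "H' \<subseteq> H" "H \<subseteq> cedges n" and K: "K \<le> K'"
  shows "real (badpairs n H K) \<le> real n * real K + real (disc n H' H K') +
    2 * real n * (real (card (bigset n H K)) - real (card (bigset n H' K')))"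
proof -
  let ?B = "bigset n H K" and ?B' = "bigset n H' K'"
  have sub: "?B' \<subseteq> ?B" using bigset_mono[OF H K] .
  define P1 where "P1 = (SIGMA x:{1..n} - ?B. cluster H x)"
  define P2 where "P2 = {(x, y) \<in> ?B' \<times> ?B'. (x, y) \<notin> (adj H)\<^sup>*}"
  define P3 where "P3 = (?B - ?B') \<times> {1..n} \<union> {1..n} \<times> (?B - ?B')"
  have fin: "finite P1" "finite P2" "finite P3"
    using finite_cluster[OF H(2)] finite_subset[of P2 "?B' \<times> ?B'"] by (auto simp: P1_def P2_def P3_def)
  have "{(x, y) \<in> {1..n} \<times> {1..n}. x \<noteq> y \<and> ((x, y) \<in> (adj H)\<^sup>*) \<noteq> (x \<in> ?B \<and> y \<in> ?B)} \<subseteq> P1 \<union> P2 \<union> P3"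
  proof (intro subsetI, clarify)
    fix x y assume xy: "x \<in> {1..n}" "y \<in> {1..n}" "x \<noteq> y" "((x, y) \<in> (adj H)\<^sup>*) \<noteq> (x \<in> ?B \<and> y \<in> ?B)"
      and not2: "(x, y) \<notin> P3" "(x, y) \<notin> P2"
    show "(x, y) \<in> P1"
    proof (cases "(x, y) \<in> (adj H)\<^sup>*")
      case True
      then have "cluster H x = cluster H y" by (simp add: cluster_eq_iff)
      then have "x \<notin> ?B" using xy True by (auto simp: bigset_def)
      then show ?thesis using True xy by (simp add: P1_def mem_cluster)
    next
      case False
      then have "x \<in> ?B" "y \<in> ?B" using xy by auto
      then show ?thesis using not2 False xy unfolding P2_def P3_def by blast
    qed
  qed
  then have "badpairs n H K \<le> card (P1 \<union> P2 \<union> P3)"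
    unfolding badpairs_def using fin by (intro card_mono) auto
  also have "\<dots> \<le> card P1 + card P2 + card P3"
    using card_Un_le[of "P1 \<union> P2" P3] card_Un_le[of P1 P2] by linarith
  also have "card P1 \<le> n * K"
  proof -
    have "card P1 = (\<Sum>x\<in>{1..n} - ?B. card (cluster H x))"
      unfolding P1_def using finite_cluster[OF H(2)] by (intro card_SigmaI) auto
    also have "\<dots> \<le> (\<Sum>x\<in>{1..n} - ?B. K)" by (intro sum_mono) (auto simp: bigset_def)
    also have "\<dots> \<le> n * K" using card_mono[of "{1..n}" "{1..n} - ?B"] by simp
    finally show ?thesis .
  qed
  also have "card P2 = disc n H' H K'" by (simp add: P2_def disc_def)
  also have "card P3 \<le> 2 * n * card (?B - ?B')"
  proof -
    have "card P3 \<le> card ((?B - ?B') \<times> {1..n}) + card ({1..n} \<times> (?B - ?B'))"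
      unfolding P3_def by (rule card_Un_le)
    then show ?thesis by (simp add: card_cartesian_product algebra_simps)
  qed
  finally have "real (badpairs n H K) \<le> real (n * K + disc n H' H K' + 2 * n * card (?B - ?B'))"
    by (simp only: of_nat_le_iff)
  moreover have "real (card (?B - ?B')) = real (card ?B) - real (card ?B')"
    using sub card_mono[OF finite_bigset sub] by (simp add: card_Diff_subset of_nat_diff)
  ultimately show ?thesis by simp
qed

lemma integrable_bigset: "integrable (weight_law n) (\<lambda>w. real (card (bigset n (lower n w s) K)))"
  by (rule lower_integrable[where h = "\<lambda>H. real (card (bigset n H K))"])

lemma integrable_badpairs: "integrable (weight_law n) (\<lambda>w. real (badpairs n (lower n w s) K))"
  by (rule lower_integrable[where h = "\<lambda>H. real (badpairs n H K)"])

text \<open>Sprinkle from a level slightly below \<theta>. Continuity of \<open>rho\<close> at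
  \<theta> keeps the fraction of vertices that become large only during the sprinkling
  small.\<close>

lemma badpairs_limit:
  assumes \<theta>: "\<theta> > 0" "isCont rho \<theta>" and \<epsilon>: "\<epsilon> > 0"
  shows "\<exists>K0. \<forall>K\<ge>K0. \<forall>\<^sub>F n in sequentially.
    (\<integral>w. real (badpairs n (lower n w (\<theta> / real n)) K) \<partial>weight_law n) \<le> 10 * \<epsilon> * (real n)\<^sup>2"
proof -
  have "\<forall>\<^sub>F x in at \<theta>. dist (rho x) (rho \<theta>) < \<epsilon>"
    using assms by (auto simp: isCont_def tendsto_iff)
  then obtain d where d: "d > 0" "\<And>x. x \<noteq> \<theta> \<Longrightarrow> dist x \<theta> < d \<Longrightarrow> dist (rho x) (rho \<theta>) < \<epsilon>"
    by (auto simp: eventually_at)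
  \<comment> \<open>The maximum keeps \<theta>' positive and within distance d of \<theta>.\<close>
  define \<theta>' where "\<theta>' = max (\<theta> / 2) (\<theta> - d / 2)"
  have \<theta>': "0 < \<theta>'" "\<theta>' < \<theta>" "dist \<theta>' \<theta> < d"
    using \<theta>(1) d(1) by (auto simp: \<theta>'_def dist_real_def max_def)
  have r1: "rho \<theta> - \<epsilon> < rho \<theta>'" using d(2)[of \<theta>'] \<theta>' by (auto simp: dist_real_def)
  obtain K0 where K0: "\<And>K. K \<ge> K0 \<Longrightarrow> rhoK K \<theta> < rho \<theta> + \<epsilon>"
    using order_tendstoD(2)[OF rhoK_lim[OF \<theta>(1)], of "rho \<theta> + \<epsilon>"] \<epsilon> by (auto simp: eventually_sequentially)
  obtain K1 where K1: "\<And>K n. K \<ge> K1 \<Longrightarrow> \<forall>\<^sub>F n in sequentially.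
    (\<integral>w. real (disc n (lower n w (\<theta>' / real n)) (lower n w (\<theta> / real n)) K) \<partial>weight_law n) \<le> \<epsilon> * (real n)\<^sup>2"
    using disc_mean[OF \<theta>'(1,2) \<epsilon>] by blast
  show ?thesis
  proof (intro exI[of _ K0] allI impI)
    fix K assume K: "K0 \<le> K"
    \<comment> \<open>The lower graph uses a possibly larger cutoff, so that sprinkling applies for
      every \<open>K\<close> from \<open>K0\<close> on. The lower bound through \<open>rho\<close>
      holds at all cutoffs.\<close>
    define K' where "K' = max K K1"
    let ?r = "\<lambda>K \<theta> n. \<integral>w. real (card (bigset n (lower n w (\<theta> / real n)) K)) / real n \<partial>weight_law n"
    have e1: "\<forall>\<^sub>F n in sequentially. ?r K \<theta> n < rho \<theta> + \<epsilon>"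
      by (rule order_tendstoD(2)[OF mean_bigset_lim[OF \<theta>(1)] K0[OF K]])
    have "rho \<theta> - \<epsilon> < rhoK K' \<theta>'" using r1 rho_le_rhoK[OF \<theta>'(1), of K'] by simp
    then have e2: "\<forall>\<^sub>F n in sequentially. rho \<theta> - \<epsilon> < ?r K' \<theta>' n"
      by (rule order_tendstoD(1)[OF mean_bigset_lim[OF \<theta>'(1)]])
    have e3: "\<forall>\<^sub>F n in sequentially. real K / \<epsilon> < real n"
      using filterlim_real_sequentially by (simp add: filterlim_at_top_dense)
    have "K1 \<le> K'" by (simp add: K'_def)
    note e4 = K1[OF this]
    show "\<forall>\<^sub>F n in sequentially. (\<integral>w. real (badpairs n (lower n w (\<theta> / real n)) K) \<partial>weight_law n) \<le> 10 * \<epsilon> * (real n)\<^sup>2"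
      using e1 e2 e3 e4 eventually_gt_at_top[of 0]
    proof (eventually_elim, goal_cases)
      case (1 n)
      note 2 = this
      interpret prob_space "weight_law n" by simp
      let ?H = "\<lambda>w. lower n w (\<theta> / real n)" and ?H' = "\<lambda>w. lower n w (\<theta>' / real n)"
      have iD: "integrable (weight_law n) (\<lambda>w. real (disc n (?H' w) (?H w) K'))"
        by (rule lower2_integrable[where h = "\<lambda>x y. real (disc n x y K')"])
      have "expectation (\<lambda>w. real (badpairs n (?H w) K)) \<le> expectation (\<lambda>w. real n * real K + real (disc n (?H' w) (?H w) K') +
        2 * real n * (real (card (bigset n (?H w) K)) - real (card (bigset n (?H' w) K'))))"
      proof (rule integral_mono[OF integrable_badpairs])
        show "integrable (weight_law n) (\<lambda>w. real n * real K + real (disc n (?H' w) (?H w) K') +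
          2 * real n * (real (card (bigset n (?H w) K)) - real (card (bigset n (?H' w) K'))))"
          using iD by (simp add: integrable_bigset)
        fix w
        have "\<theta>' / real n \<le> \<theta> / real n" using \<theta>' by (simp add: divide_right_mono)
        then show "real (badpairs n (?H w) K) \<le> real n * real K + real (disc n (?H' w) (?H w) K') +
          2 * real n * (real (card (bigset n (?H w) K)) - real (card (bigset n (?H' w) K')))"
          by (intro badpairs_le lower_mono lower_subset) (auto simp: K'_def)
      qed
      also have "\<dots> = real n * real K + expectation (\<lambda>w. real (disc n (?H' w) (?H w) K')) +
        2 * real n * (expectation (\<lambda>w. real (card (bigset n (?H w) K))) - expectation (\<lambda>w. real (card (bigset n (?H' w) K'))))"
        using iD by (simp add: integrable_bigset prob_space)
      also have "\<dots> = real n * real K + expectation (\<lambda>w. real (disc n (?H' w) (?H w) K')) +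
        2 * (real n)\<^sup>2 * (?r K \<theta> n - ?r K' \<theta>' n)"
        using 2 by (simp add: power2_eq_square field_simps)
      \<comment> \<open>One \<epsilon> n^2 each for small components and for pairs left
        disconnected. The two large fractions differ by at most 2 \<epsilon>: one is below
        \<open>rho \<theta> + \<epsilon>\<close>, the other above
        \<open>rho \<theta> - \<epsilon>\<close>.\<close>
      also have "\<dots> \<le> \<epsilon> * (real n)\<^sup>2 + \<epsilon> * (real n)\<^sup>2 + 2 * (real n)\<^sup>2 * (2 * \<epsilon>)"
      proof (intro add_mono mult_left_mono)
        have "real K < \<epsilon> * real n" using 2 \<epsilon> by (simp add: field_simps)
        then show "real n * real K \<le> \<epsilon> * (real n)\<^sup>2" using 2 by (simp add: power2_eq_square)
      qed (use 2 in auto)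
      also have "\<dots> \<le> 10 * \<epsilon> * (real n)\<^sup>2" using \<epsilon> by (simp add: algebra_simps)
      finally show ?case .
    qed
  qed
qed

section \<open>Exponential decay of disconnection\<close>

text \<open>The term of index k in the series of exp k. It turns the quotient of k^(k - 1) by (k -
  1)! in the count of small clusters into a geometric factor.\<close>

lemma power_self_le_exp_fact: "real k ^ k \<le> exp (real k) * fact k"
proof -
  have "(\<Sum>n\<in>{k}. real k ^ n /\<^sub>R fact n) \<le> (\<Sum>n. real k ^ n /\<^sub>R fact n)"
    by (rule sum_le_suminf[OF summable_exp_generic]) auto
  then have "real k ^ k / fact k \<le> exp (real k)" by (simp add: exp_def divide_inverse mult.commute)
  then show ?thesis by (simp add: field_simps)
qed

lemma card_sets_containing:
  assumes "x \<in> {1..n}" "k \<ge> 1"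
  shows "card {S. S \<subseteq> {1..n} \<and> x \<in> S \<and> card S = k} \<le> (n - 1) choose (k - 1)"
proof -
  have "card {S. S \<subseteq> {1..n} \<and> x \<in> S \<and> card S = k} \<le> card {T. T \<subseteq> {1..n} - {x} \<and> card T = k - 1}"
  proof (rule card_inj_on_le[where f = "\<lambda>S. S - {x}"])
    show "inj_on (\<lambda>S. S - {x}) {S. S \<subseteq> {1..n} \<and> x \<in> S \<and> card S = k}"
      by (rule inj_onI) blast
    show "(\<lambda>S. S - {x}) ` {S. S \<subseteq> {1..n} \<and> x \<in> S \<and> card S = k} \<subseteq> {T. T \<subseteq> {1..n} - {x} \<and> card T = k - 1}"
      by (auto simp: card_Diff_singleton)
    show "finite {T. T \<subseteq> {1..n} - {x} \<and> card T = k - 1}"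
      by (rule finite_subset[of _ "Pow ({1..n} - {x})"]) auto
  qed
  also have "\<dots> = (n - 1) choose (k - 1)"
    using n_subsets[of "{1..n} - {x}" "k - 1"] assms by (simp add: card_Diff_singleton)
  finally show ?thesis .
qed

text \<open>Parent functions encode rooted spanning trees of the cluster. There are at most k^(k -
  1) of them on k vertices, a number of the order needed in the union bound; restriction makes them
  extensional so that they can be counted.\<close>

lemma small_cluster_witness:
  assumes H: "H \<subseteq> cedges n" and x: "x \<in> {1..n}"
  defines "S \<equiv> cluster H x"
  shows "\<exists>f\<in>S - {x} \<rightarrow>\<^sub>E S. inj_on (\<lambda>y. {y, f y}) (S - {x}) \<and> (\<lambda>y. {y, f y}) ` (S - {x}) \<subseteq> H \<inter> inner n S"
proof -
  obtain f where f: "\<forall>y\<in>S - {x}. f y \<in> S \<and> {y, f y} \<in> H" "inj_on (\<lambda>y. {y, f y}) (S - {x})"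
    using parent_edges[of H "{x}"] unfolding S_def cluster_def by blast
  define g where "g = restrict f (S - {x})"
  have "g \<in> S - {x} \<rightarrow>\<^sub>E S" using f(1) by (auto simp: g_def)
  moreover have "inj_on (\<lambda>y. {y, g y}) (S - {x})"
    using f(2) by (simp add: g_def inj_on_def)
  moreover have "(\<lambda>y. {y, g y}) ` (S - {x}) \<subseteq> H \<inter> inner n S"
    using f(1) H by (auto simp: g_def inner_def)
  ultimately show ?thesis by blast
qed

text \<open>Union bound over the size k of the cluster, its vertex set and a parent function: the k
  - 1 tree edges are present and the boundary edges outside \<open>J\<close> are absent. The set
  \<open>J\<close> stands for the edges of a pattern, whose weights are prescribed
  separately.\<close>

lemma small_cluster_prob:
  assumes n: "n \<ge> 1" "4 * m \<le> n" and J: "J \<subseteq> cedges n" "card J \<le> m" and x: "x \<in> {1..n}"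
    and t: "0 \<le> t" "t \<le> real n"
  shows "measure (weight_law n) {w \<in> space (weight_law n). 2 * card (cluster (lower n w (t / real n) - J) x) \<le> n}
    \<le> (\<Sum>k=1..n. exp (real k) * t ^ (k - 1) * exp (- t * real k / 4))"
proof -
  interpret prob_space "weight_law n" by simp
  define s where "s = t / real n"
  have s: "0 \<le> s" "s \<le> 1" using t n by (auto simp: s_def)
  define SS where "SS = (\<lambda>k. {S. S \<subseteq> {1..n} \<and> x \<in> S \<and> card S = k \<and> 2 * k \<le> n})"
  define Tr where "Tr = (\<lambda>(S :: nat set) f. (\<lambda>y. {y, f y}) ` (S - {x}))"
  define FF where "FF = (\<lambda>S. {f \<in> S - {x} \<rightarrow>\<^sub>E S. inj_on (\<lambda>y. {y, f y}) (S - {x}) \<and> Tr S f \<subseteq> inner n S})"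
  define Q where "Q = (\<lambda>S f. {w \<in> space (weight_law n). Tr S f \<subseteq> lower n w s \<and> lower n w s \<inter> (bdry n S - J) = {}})"
  have Qs: "Q S f \<in> events" for S f
    unfolding Q_def by (rule lower_sets[where \<Phi> = "\<lambda>H. Tr S f \<subseteq> H \<and> H \<inter> (bdry n S - J) = {}"])
  have finSS: "finite (SS k)" for k
    by (rule finite_subset[of _ "Pow {1..n}"]) (auto simp: SS_def)
  have finS: "finite S" if "S \<in> SS k" for S k
    using that finite_subset[of S "{1..n}"] by (simp add: SS_def)
  have finFF: "finite (FF S)" if "S \<in> SS k" for S k
    by (rule finite_subset[of _ "S - {x} \<rightarrow>\<^sub>E S"], force simp: FF_def) (use finS[OF that] in \<open>auto intro: finite_PiE\<close>)
  have cardFF: "real (card (FF S)) \<le> real k ^ (k - 1)" if S: "S \<in> SS k" for S k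
  proof -
    have "card (FF S) \<le> card (S - {x} \<rightarrow>\<^sub>E S)"
      unfolding FF_def using finS[OF S] by (intro card_mono finite_PiE) auto
    also have "\<dots> = k ^ (k - 1)"
      using finS[OF S] S by (simp add: card_funcsetE SS_def card_Diff_singleton)
    finally have "card (FF S) \<le> k ^ (k - 1)" .
    then have "real (card (FF S)) \<le> real (k ^ (k - 1))" by (simp only: of_nat_le_iff)
    then show ?thesis by simp
  qed
  have Qle: "prob (Q S f) \<le> s ^ (k - 1) * exp (- t * real k / 4)" if k: "k \<ge> 1" and S: "S \<in> SS k" and f: "f \<in> FF S" for k S f
  proof -
    have Sn: "S \<subseteq> {1..n}" "x \<in> S" "card S = k" "2 * k \<le> n" using S by (auto simp: SS_def)
    have inj: "inj_on (\<lambda>y. {y, f y}) (S - {x})" and Tin: "Tr S f \<subseteq> inner n S" using f by (auto simp: FF_def)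
    have "Tr S f \<inter> (bdry n S - J) = {}" using Tin inner_bdry(3)[of n S] by blast
    moreover have "Tr S f \<subseteq> cedges n" using Tin inner_bdry(1)[of n S] by (rule order_trans)
    moreover have "bdry n S - J \<subseteq> cedges n" using inner_bdry(2)[of n S] by blast
    moreover have "Q S f = {w \<in> space (weight_law n). (\<forall>e\<in>Tr S f. w e < s) \<and> (\<forall>e\<in>bdry n S - J. s \<le> w e) \<and> (\<forall>e\<in>{}. s \<le> w e)}"
    proof -
      have "Tr S f \<subseteq> lower n w s \<longleftrightarrow> (\<forall>e\<in>Tr S f. w e < s)" for w
        using \<open>Tr S f \<subseteq> cedges n\<close> unfolding lower_def by blast
      moreover have "lower n w s \<inter> (bdry n S - J) = {} \<longleftrightarrow> (\<forall>e\<in>bdry n S - J. s \<le> w e)" for w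
        using \<open>bdry n S - J \<subseteq> cedges n\<close> unfolding lower_def not_less[symmetric] by blast
      ultimately show ?thesis by (simp add: Q_def)
    qed
    ultimately have "prob (Q S f) = s ^ card (Tr S f) * (1 - s) ^ card (bdry n S - J) * (1 - s) ^ card ({} :: nat set set)"
      using s by (simp only:) (intro weight_box_threshold, auto)
    also have "card (Tr S f) = k - 1"
      unfolding Tr_def using inj Sn by (simp add: card_image card_Diff_singleton)
    finally have p: "prob (Q S f) = s ^ (k - 1) * (1 - s) ^ card (bdry n S - J)" by simp
    \<comment> \<open>Since 2 k \<le> n, the boundary has k (n - k) \<ge> k n / 2 edges, and
      deleting at most m \<le> n / 4 \<le> k n / 4 of them leaves k n / 4.\<close>
    have c: "real k * real n / 4 \<le> real (card (bdry n S - J))"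
    proof -
      have fJ: "finite J" using J(1) finite_cedges by (rule finite_subset)
      have "card (bdry n S) - card J \<le> card (bdry n S - J)"
        by (rule diff_card_le_card_Diff[OF fJ])
      then have "k * (n - k) \<le> card (bdry n S - J) + m" using J(2) card_bdry[OF Sn(1,3)] by simp
      then have "real (k * (n - k)) \<le> real (card (bdry n S - J) + m)" by (simp only: of_nat_le_iff)
      moreover have "real k * (real n / 2) \<le> real (k * (n - k))"
      proof -
        have "real n / 2 \<le> real (n - k)" using Sn(4) by (simp add: of_nat_diff)
        then have "real k * (real n / 2) \<le> real k * real (n - k)" by (intro mult_left_mono) auto
        then show ?thesis by (simp only: of_nat_mult)
      qed
      moreover have "real m \<le> real k * real n / 4"
      proof -
        have "real (4 * m) \<le> real n" using n(2) by (simp only: of_nat_le_iff)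
        moreover have "1 * real n \<le> real k * real n" using k by (intro mult_right_mono) auto
        ultimately show ?thesis by simp
      qed
      ultimately show ?thesis by simp
    qed
    have "(1 - s) ^ card (bdry n S - J) \<le> exp (- s) ^ card (bdry n S - J)"
    proof (rule power_mono)
      show "1 - s \<le> exp (- s)" using exp_ge_add_one_self[of "- s"] by linarith
    qed (use s in simp)
    also have "\<dots> = exp (real (card (bdry n S - J)) * (- s))" by (rule exp_of_nat_mult[symmetric])
    also have "\<dots> \<le> exp (- t * real k / 4)"
    proof -
      have "s * (real k * real n / 4) \<le> s * real (card (bdry n S - J))" by (rule mult_left_mono[OF c s(1)])
      moreover have "s * real n = t" using n(1) by (simp add: s_def)
      then have "s * (real k * real n / 4) = t * real k / 4" by (simp add: algebra_simps flip: \<open>s * real n = t\<close>)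
      ultimately have "t * real k / 4 \<le> s * real (card (bdry n S - J))" by (simp only:)
      moreover have "real (card (bdry n S - J)) * (- s) = - (s * real (card (bdry n S - J)))"
        "- t * real k / 4 = - (t * real k / 4)" by simp_all
      ultimately show ?thesis by (simp only: exp_le_cancel_iff neg_le_iff_le)
    qed
    finally show ?thesis unfolding p using s by (intro mult_left_mono) auto
  qed
  have "{w \<in> space (weight_law n). 2 * card (cluster (lower n w s - J) x) \<le> n} \<subseteq> (\<Union>k\<in>{1..n}. \<Union>S\<in>SS k. \<Union>f\<in>FF S. Q S f)"
  proof
    fix w assume "w \<in> {w \<in> space (weight_law n). 2 * card (cluster (lower n w s - J) x) \<le> n}"
    then have w: "w \<in> space (weight_law n)" "2 * card (cluster (lower n w s - J) x) \<le> n" by auto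
    define H where "H = lower n w s - J"
    have H: "H \<subseteq> cedges n" using lower_subset[of n w s] by (auto simp: H_def)
    define S where "S = cluster H x"
    have Sn: "S \<subseteq> {1..n}" unfolding S_def by (rule cluster_in_range[OF H x])
    have xS: "x \<in> S" by (simp add: S_def)
    have fS: "finite S" using Sn by (rule finite_subset) simp
    have cS: "card S \<ge> 1" using xS fS by (metis One_nat_def Suc_leI card_gt_0_iff empty_iff)
    have cSn: "2 * card S \<le> n" using w(2) by (simp add: S_def H_def)
    have S: "S \<in> SS (card S)" using Sn xS cSn by (simp add: SS_def)
    obtain f where f: "f \<in> S - {x} \<rightarrow>\<^sub>E S" "inj_on (\<lambda>y. {y, f y}) (S - {x})" "(\<lambda>y. {y, f y}) ` (S - {x}) \<subseteq> H \<inter> inner n S"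
      using small_cluster_witness[OF H x] unfolding S_def by blast
    then have fF: "f \<in> FF S" by (auto simp: FF_def Tr_def)
    have "S \<in> comps n H" using x by (simp add: comps_def S_def)
    then have "H \<inter> bdry n S = {}" using mem_comps_iff[OF H Sn] xS by blast
    then have "w \<in> Q S f" using w(1) f(3) by (auto simp: Q_def Tr_def H_def)
    moreover have "card S \<in> {1..n}" using cS cSn by auto
    ultimately show "w \<in> (\<Union>k\<in>{1..n}. \<Union>S\<in>SS k. \<Union>f\<in>FF S. Q S f)" using S fF by blast
  qed
  then have "prob {w \<in> space (weight_law n). 2 * card (cluster (lower n w s - J) x) \<le> n} \<le> prob (\<Union>k\<in>{1..n}. \<Union>S\<in>SS k. \<Union>f\<in>FF S. Q S f)"
    using Qs finSS finFF by (intro finite_measure_mono) (auto intro!: sets.finite_UN)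
  also have "\<dots> \<le> (\<Sum>k\<in>{1..n}. prob (\<Union>S\<in>SS k. \<Union>f\<in>FF S. Q S f))"
    using Qs finSS finFF by (intro finite_measure_subadditive_finite) (auto intro!: sets.finite_UN)
  also have "\<dots> \<le> (\<Sum>k\<in>{1..n}. \<Sum>S\<in>SS k. prob (\<Union>f\<in>FF S. Q S f))"
    using Qs finSS finFF by (intro sum_mono finite_measure_subadditive_finite) (auto intro!: sets.finite_UN)
  also have "\<dots> \<le> (\<Sum>k\<in>{1..n}. \<Sum>S\<in>SS k. \<Sum>f\<in>FF S. prob (Q S f))"
    using Qs finFF by (intro sum_mono finite_measure_subadditive_finite) auto
  also have "\<dots> \<le> (\<Sum>k\<in>{1..n}. \<Sum>S\<in>SS k. \<Sum>f\<in>FF S. s ^ (k - 1) * exp (- t * real k / 4))"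
    by (intro sum_mono Qle) auto
  also have "\<dots> \<le> (\<Sum>k\<in>{1..n}. \<Sum>S\<in>SS k. real k ^ (k - 1) * (s ^ (k - 1) * exp (- t * real k / 4)))"
  proof (intro sum_mono)
    fix k S assume "S \<in> SS k"
    from cardFF[OF this] show "(\<Sum>f\<in>FF S. s ^ (k - 1) * exp (- t * real k / 4)) \<le> real k ^ (k - 1) * (s ^ (k - 1) * exp (- t * real k / 4))"
      unfolding sum_constant using s by (intro mult_right_mono) auto
  qed
  \<comment> \<open>There are at most n^(k - 1) / (k - 1)! vertex sets, and k^(k - 1) / (k - 1)! =
    k^k / k! \<le> e^k. With s = t / n the powers of n cancel.\<close>
  also have "\<dots> \<le> (\<Sum>k\<in>{1..n}. exp (real k) * t ^ (k - 1) * exp (- t * real k / 4))"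
  proof (rule sum_mono)
    fix k assume k: "k \<in> {1..n}"
    have "card (SS k) \<le> (n - 1) choose (k - 1)"
    proof -
      have "card (SS k) \<le> card {S. S \<subseteq> {1..n} \<and> x \<in> S \<and> card S = k}"
        by (rule card_mono[OF finite_subset[of _ "Pow {1..n}"]]) (auto simp: SS_def)
      then show ?thesis using card_sets_containing[OF x, of k] k by simp
    qed
    then have "card (SS k) * fact (k - 1) \<le> n ^ (k - 1)"
      using binomial_fact_pow[of "n - 1" "k - 1"] power_mono[of "n - 1" n "k - 1"]
      by (meson diff_le_self le_trans mult_le_mono1 zero_le)
    then have "real (card (SS k) * fact (k - 1)) \<le> real (n ^ (k - 1))" by (simp only: of_nat_le_iff)
    then have a: "real (card (SS k)) * fact (k - 1) \<le> real n ^ (k - 1)" by simp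
    have b: "real k ^ (k - 1) \<le> exp (real k) * fact (k - 1)"
    proof -
      obtain j where j: "k = Suc j" using k by (cases k) auto
      have "real k * real k ^ (k - 1) \<le> real k * (exp (real k) * fact (k - 1))"
        using power_self_le_exp_fact[of k] unfolding j by (simp add: algebra_simps)
      then show ?thesis using k by simp
    qed
    define a1 where "a1 = real (card (SS k))"
    define f1 where "f1 = (fact (k - 1) :: real)"
    have f1: "f1 > 0" by (simp add: f1_def)
    have a10: "0 \<le> a1" by (simp add: a1_def)
    have ns: "real n ^ (k - 1) * s ^ (k - 1) = t ^ (k - 1)"
      using n(1) by (simp add: s_def power_mult_distrib[symmetric])
    have "a1 * real k ^ (k - 1) \<le> a1 * (exp (real k) * f1)"
      using b a10 unfolding f1_def by (intro mult_left_mono)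
    also have "\<dots> = exp (real k) * (a1 * f1)" by simp
    also have "\<dots> \<le> exp (real k) * real n ^ (k - 1)"
      using a unfolding a1_def f1_def by (intro mult_left_mono) auto
    finally have "a1 * real k ^ (k - 1) * (s ^ (k - 1) * exp (- t * real k / 4)) \<le>
      exp (real k) * real n ^ (k - 1) * (s ^ (k - 1) * exp (- t * real k / 4))"
      using s by (intro mult_right_mono) auto
    also have "\<dots> = exp (real k) * t ^ (k - 1) * exp (- t * real k / 4)"
      unfolding ns[symmetric] by (simp only: mult.assoc)
    finally show "(\<Sum>S\<in>SS k. real k ^ (k - 1) * (s ^ (k - 1) * exp (- t * real k / 4))) \<le>
      exp (real k) * t ^ (k - 1) * exp (- t * real k / 4)"
      by (simp add: a1_def mult.assoc)
  qed
  finally show ?thesis by (simp add: s_def)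
qed

text \<open>The subtracted term strengthens the bound 2 q just enough for the induction to
  close.\<close>

lemma sum_powers_le:
  fixes q :: real
  assumes "0 \<le> q" "q \<le> 1 / 2"
  shows "(\<Sum>k=1..n. q ^ k) \<le> 2 * q - 2 * q ^ Suc n"
proof (induction n)
  case (Suc n)
  have "2 * (q ^ Suc n * q) \<le> 2 * (q ^ Suc n * (1 / 2))"
    using assms by (intro mult_left_mono) auto
  moreover have "(\<Sum>k=1..Suc n. q ^ k) = (\<Sum>k=1..n. q ^ k) + q ^ Suc n" by simp
  moreover have "q ^ Suc (Suc n) = q ^ Suc n * q" by simp
  ultimately show ?case using Suc by linarith
qed simp

text \<open>If \<open>u\<close> and \<open>v\<close> are not joined, their clusters are disjoint and
  one of them has at most n / 2 vertices. The constants depend on \<open>m\<close> alone neither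
  through the edges in \<open>J\<close> nor through the endpoints, which gives the uniformity
  required for domination.\<close>

lemma tail_bound:
  "\<exists>C>0. \<exists>c>0. \<forall>n\<ge>max 1 (4 * m). \<forall>J\<subseteq>cedges n. card J \<le> m \<longrightarrow> (\<forall>u\<in>{1..n}. \<forall>v\<in>{1..n}. \<forall>t. 0 \<le> t \<and> t \<le> real n \<longrightarrow>
    measure (weight_law n) {w \<in> space (weight_law n). (u, v) \<notin> (adj (lower n w (t / real n) - J))\<^sup>*} \<le> C * exp (- c * t))"
proof -
  have "((\<lambda>t :: real. exp 1 * t * exp (- t / 8)) \<longlongrightarrow> 0) at_top" by real_asymp
  then have "\<forall>\<^sub>F t in at_top. exp 1 * t * exp (- t / 8) < (1 / 2 :: real)"
    by (rule order_tendstoD(2)) simp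
  then obtain t1 :: real where t1: "\<And>t. t \<ge> t1 \<Longrightarrow> exp 1 * t * exp (- t / 8) < 1 / 2"
    by (auto simp: eventually_at_top_linorder)
  define t0 where "t0 = max 1 t1"
  \<comment> \<open>The 2 accounts for the two endpoints when t \<ge> t0; the second summand makes
    the bound trivial for smaller t.\<close>
  define C where "C = 2 + exp (t0 / 8)"
  have C0: "C > 0" unfolding C_def by (intro add_pos_pos) auto
  have main: "\<forall>n\<ge>max 1 (4 * m). \<forall>J\<subseteq>cedges n. card J \<le> m \<longrightarrow> (\<forall>u\<in>{1..n}. \<forall>v\<in>{1..n}. \<forall>t. 0 \<le> t \<and> t \<le> real n \<longrightarrow>
    measure (weight_law n) {w \<in> space (weight_law n). (u, v) \<notin> (adj (lower n w (t / real n) - J))\<^sup>*} \<le> C * exp (- (1 / 8) * t))"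
  proof (intro allI impI ballI)
    fix n J u v t
    assume n: "n \<ge> max 1 (4 * m)" and J: "J \<subseteq> cedges n" "card J \<le> m"
      and uv: "u \<in> {1..n}" "v \<in> {1..n}" and t: "0 \<le> t \<and> t \<le> real n"
    interpret prob_space "weight_law n" by simp
    let ?P = "\<lambda>w. (u, v) \<notin> (adj (lower n w (t / real n) - J))\<^sup>*"
    show "prob {w \<in> space (weight_law n). ?P w} \<le> C * exp (- (1 / 8) * t)"
    proof (cases "t \<ge> t0")
      case False
      have "prob {w \<in> space (weight_law n). ?P w} \<le> 1" by (rule prob_le_1)
      also have "1 \<le> exp (t0 / 8) * exp (- (1 / 8) * t)"
        using False by (simp add: exp_add[symmetric])
      also have "\<dots> \<le> C * exp (- (1 / 8) * t)" unfolding C_def by (intro mult_right_mono) auto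
      finally show ?thesis .
    next
      case True
      then have t1t: "1 \<le> t" "t1 \<le> t" by (auto simp: t0_def)
      \<comment> \<open>For t \<ge> 1 the k-th term of the cluster bound is at most q^k. The choice
        of \<open>t1\<close> splits exp (-t / 4) into two equal factors: one absorbs e t, the other
        remains as the decay rate 1 / 8.\<close>
      define q where "q = exp 1 * t * exp (- t / 4)"
      have q0: "0 \<le> q" using t by (simp add: q_def)
      have "exp (- t / 4) = exp (- t / 8) * exp (- t / 8)" by (simp add: exp_add[symmetric])
      then have "q = (exp 1 * t * exp (- t / 8)) * exp (- t / 8)" by (simp add: q_def)
      also have "\<dots> \<le> 1 / 2 * exp (- t / 8)" using t1[OF t1t(2)] by (intro mult_right_mono) auto
      finally have q1: "q \<le> 1 / 2 * exp (- t / 8)" .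
      also have "\<dots> \<le> 1 / 2 * 1" using t by (intro mult_left_mono) auto
      finally have q2: "q \<le> 1 / 2" by simp
      define S where "S = (\<lambda>x. {w \<in> space (weight_law n). 2 * card (cluster (lower n w (t / real n) - J) x) \<le> n})"
      have Ss: "S x \<in> events" for x
        unfolding S_def by (rule lower_sets[where \<Phi> = "\<lambda>H. 2 * card (cluster (H - J) x) \<le> n"])
      have S: "prob (S x) \<le> exp (- t / 8)" if x: "x \<in> {1..n}" for x
      proof -
        have "prob (S x) \<le> (\<Sum>k=1..n. exp (real k) * t ^ (k - 1) * exp (- t * real k / 4))"
          unfolding S_def using n J x t by (intro small_cluster_prob) auto
        also have "\<dots> \<le> (\<Sum>k=1..n. q ^ k)"
        proof (rule sum_mono)
          fix k assume "k \<in> {1..n}"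
          have "q ^ k = exp (real k) * t ^ k * exp (- t * real k / 4)"
            using exp_of_nat_mult[of k "1 :: real"] exp_of_nat_mult[of k "- t / 4"]
            by (simp add: q_def power_mult_distrib mult.commute)
          moreover have "t ^ (k - 1) \<le> t ^ k" using t1t by (intro power_increasing) auto
          ultimately show "exp (real k) * t ^ (k - 1) * exp (- t * real k / 4) \<le> q ^ k"
            by (simp add: mult_right_mono)
        qed
        also have "\<dots> \<le> 2 * q - 2 * q ^ Suc n" by (rule sum_powers_le[OF q0 q2])
        also have "\<dots> \<le> exp (- t / 8)" using q1 zero_le_power[OF q0, of "Suc n"] by linarith
        finally show ?thesis .
      qed
      have "{w \<in> space (weight_law n). ?P w} \<subseteq> S u \<union> S v"
      proof
        fix w assume "w \<in> {w \<in> space (weight_law n). ?P w}"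
        then have w: "w \<in> space (weight_law n)" "?P w" by auto
        define H where "H = lower n w (t / real n) - J"
        have H: "H \<subseteq> cedges n" using lower_subset[of n w "t / real n"] by (auto simp: H_def)
        have "cluster H u \<inter> cluster H v = {}"
        proof (rule ccontr)
          assume "cluster H u \<inter> cluster H v \<noteq> {}"
          then obtain z where "(u, z) \<in> (adj H)\<^sup>*" "(v, z) \<in> (adj H)\<^sup>*" by (auto simp: mem_cluster)
          then have "(u, v) \<in> (adj H)\<^sup>*" using conn_sym[of v z H] rtrancl_trans by fast
          then show False using w by (simp add: H_def)
        qed
        then have "card (cluster H u) + card (cluster H v) = card (cluster H u \<union> cluster H v)"
          using finite_cluster[OF H uv(1)] finite_cluster[OF H uv(2)] by (simp add: card_Un_disjoint)
        also have "\<dots> \<le> card {1..n}"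
          using cluster_in_range[OF H uv(1)] cluster_in_range[OF H uv(2)] by (intro card_mono) auto
        finally have "2 * card (cluster H u) \<le> n \<or> 2 * card (cluster H v) \<le> n" by simp linarith
        then show "w \<in> S u \<union> S v" using w(1) by (auto simp: S_def H_def)
      qed
      then have "prob {w \<in> space (weight_law n). ?P w} \<le> prob (S u \<union> S v)"
        using Ss by (intro finite_measure_mono) auto
      also have "\<dots> \<le> prob (S u) + prob (S v)" using Ss by (intro measure_Un_le)
      also have "\<dots> \<le> 2 * exp (- t / 8)" using S[OF uv(1)] S[OF uv(2)] by simp
      also have "\<dots> \<le> C * exp (- (1 / 8) * t)" unfolding C_def by (simp add: algebra_simps)
      finally show ?thesis .
    qed
  qed
  show ?thesis
    by (rule exI[where x = C], rule conjI[OF C0], rule exI[where x = "1 / 8"], rule conjI, simp, rule main)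
qed

section \<open>Cut events\<close>

text \<open>
  The limit of the cut event: two vertices are joined below level \<open>\<tau> e\<close> when both lie in the giant
  component at that level, represented by \<open>B e\<close>, or through lighter edges of the pattern itself.
\<close>

definition sep :: "'a set set \<Rightarrow> ('a set \<Rightarrow> real) \<Rightarrow> ('a set \<Rightarrow> 'a set) \<Rightarrow> bool" where
  "sep EF \<tau> B \<longleftrightarrow> (\<forall>u v. {u, v} \<in> EF \<longrightarrow>
     (u, v) \<notin> ({(x, y). {x, y} \<in> EF \<and> \<tau> {x, y} < \<tau> {u, v}} \<union> B {u, v} \<times> B {u, v})\<^sup>*)"

text \<open>
  An edge belongs to the minimum spanning tree when strictly lighter edges do not join its endpoints.
\<close>

definition cutev :: "nat \<Rightarrow> 'a set set \<Rightarrow> ('a \<Rightarrow> nat) \<Rightarrow> (nat set \<Rightarrow> real) \<Rightarrow> bool" where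
  "cutev n EF \<phi> \<omega> \<longleftrightarrow> (\<forall>u v. {u, v} \<in> EF \<longrightarrow> (\<phi> u, \<phi> v) \<notin> (adj (lower n \<omega> (\<omega> (\<phi> ` {u, v}))))\<^sup>*)"

text \<open>The weights \<open>w\<close> with those on the copy of the pattern overwritten by \<tau>
  / n. As weights of different edges are independent, fixing \<tau> and averaging over
  \<open>w\<close> amounts to conditioning on the weights of the copy.\<close>

definition overlay :: "nat \<Rightarrow> 'a set set \<Rightarrow> ('a \<Rightarrow> nat) \<Rightarrow> ('a set \<Rightarrow> real) \<Rightarrow> (nat set \<Rightarrow> real) \<Rightarrow> nat set \<Rightarrow> real" where
  "overlay n EF \<phi> \<tau> w = (\<lambda>f\<in>cedges n. if f \<in> (`) \<phi> ` EF then \<tau> (the_inv_into EF ((`) \<phi>) f) / real n else w f)"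

lemma sep_cong: "(\<And>e. e \<in> EF \<Longrightarrow> B e = B' e) \<Longrightarrow> sep EF \<tau> B = sep EF \<tau> B'"
  by (simp add: sep_def cong: imp_cong)

lemma image_inj_on_edges:
  assumes "finite_simple_graph (V, EF)" "inj_on \<phi> V"
  shows "inj_on ((`) \<phi>) EF"
  using assms finite_simple_graphD(3)[OF assms(1)] by (intro inj_onI) (metis inj_on_image_eq_iff snd_conv fst_conv)

lemma image_edges_cedges:
  assumes "finite_simple_graph (V, EF)" "inj_on \<phi> V" "\<phi> ` V \<subseteq> {1..n}"
  shows "(`) \<phi> ` EF \<subseteq> cedges n"
proof
  fix f assume "f \<in> (`) \<phi> ` EF"
  then obtain e where e: "e \<in> EF" "f = \<phi> ` e" by auto
  have eV: "e \<subseteq> V" "card e = 2" using finite_simple_graphD(3,4)[OF assms(1)] e by auto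
  have "card f = 2" using eV inj_on_subset[OF assms(2) eV(1)] by (simp add: e card_image)
  moreover have "f \<subseteq> {1..n}" using e eV assms(3) by blast
  ultimately show "f \<in> cedges n" by (simp add: cedges_iff)
qed

lemma overlay_image:
  assumes "finite_simple_graph (V, EF)" "inj_on \<phi> V" "\<phi> ` V \<subseteq> {1..n}" "e \<in> EF"
  shows "overlay n EF \<phi> \<tau> w (\<phi> ` e) = \<tau> e / real n"
  using image_edges_cedges[OF assms(1-3)] the_inv_into_f_f[OF image_inj_on_edges[OF assms(1,2)] assms(4)] assms(4)
  by (auto simp: overlay_def)

lemma overlay_other:
  "f \<in> cedges n \<Longrightarrow> f \<notin> (`) \<phi> ` EF \<Longrightarrow> overlay n EF \<phi> \<tau> w f = w f"
  by (simp add: overlay_def)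

lemma lower_overlay:
  assumes F: "finite_simple_graph (V, EF)" "inj_on \<phi> V" "\<phi> ` V \<subseteq> {1..n}" and n: "n > 0"
  shows "lower n (overlay n EF \<phi> \<tau> w) (t / real n) = (lower n w (t / real n) - (`) \<phi> ` EF) \<union> (`) \<phi> ` {e \<in> EF. \<tau> e < t}"
proof (intro equalityI subsetI)
  fix f assume f: "f \<in> lower n (overlay n EF \<phi> \<tau> w) (t / real n)"
  then have fc: "f \<in> cedges n" and lt: "overlay n EF \<phi> \<tau> w f < t / real n" by (auto simp: lower_def)
  show "f \<in> (lower n w (t / real n) - (`) \<phi> ` EF) \<union> (`) \<phi> ` {e \<in> EF. \<tau> e < t}"
  proof (cases "f \<in> (`) \<phi> ` EF")
    case True
    then obtain e where e: "e \<in> EF" "f = \<phi> ` e" by auto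
    then have "\<tau> e < t" using lt overlay_image[OF F e(1)] n by (simp add: divide_less_cancel)
    then show ?thesis using e by auto
  next
    case False
    then show ?thesis using lt fc overlay_other[OF fc False] by (simp add: lower_def)
  qed
next
  fix f assume "f \<in> (lower n w (t / real n) - (`) \<phi> ` EF) \<union> (`) \<phi> ` {e \<in> EF. \<tau> e < t}"
  then show "f \<in> lower n (overlay n EF \<phi> \<tau> w) (t / real n)"
  proof
    assume f: "f \<in> lower n w (t / real n) - (`) \<phi> ` EF"
    then have "f \<in> cedges n" "f \<notin> (`) \<phi> ` EF" by (auto simp: lower_def)
    then show ?thesis using f overlay_other[of f n \<phi> EF] by (simp add: lower_def)
  next
    assume "f \<in> (`) \<phi> ` {e \<in> EF. \<tau> e < t}"
    then obtain e where e: "e \<in> EF" "f = \<phi> ` e" "\<tau> e < t" by auto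
    then have "f \<in> cedges n" using image_edges_cedges[OF F] by auto
    then show ?thesis using e overlay_image[OF F e(1)] n by (simp add: lower_def divide_strict_right_mono)
  qed
qed

lemma cutev_overlay:
  assumes F: "finite_simple_graph (V, EF)" "inj_on \<phi> V" "\<phi> ` V \<subseteq> {1..n}" and n: "n > 0"
  shows "cutev n EF \<phi> (overlay n EF \<phi> \<tau> w) \<longleftrightarrow> (\<forall>u v. {u, v} \<in> EF \<longrightarrow>
    (\<phi> u, \<phi> v) \<notin> (adj ((lower n w (\<tau> {u, v} / real n) - (`) \<phi> ` EF) \<union> (`) \<phi> ` {e \<in> EF. \<tau> e < \<tau> {u, v}}))\<^sup>*)"
  unfolding cutev_def
  by (intro all_cong1 imp_cong refl) (simp only: overlay_image[OF F] lower_overlay[OF F n])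

text \<open>The deterministic core of the limit: if no weight of \<open>w\<close> on the copy lies
  below a level in question, and being joined outside the pattern means lying in \<open>B e\<close>,
  then the cut event becomes a statement about the abstract pattern.\<close>

lemma cutev_overlay_iff_sep:
  assumes F: "finite_simple_graph (V, EF)" "inj_on \<phi> V" "\<phi> ` V \<subseteq> {1..n}" and n: "n > 0"
    and J: "\<And>e f. e \<in> EF \<Longrightarrow> f \<in> (`) \<phi> ` EF \<Longrightarrow> \<tau> e / real n \<le> w f"
    and B: "\<And>e. e \<in> EF \<Longrightarrow> B e \<subseteq> V"
    and conn: "\<And>e x y. e \<in> EF \<Longrightarrow> x \<in> V \<Longrightarrow> y \<in> V \<Longrightarrow> x \<noteq> y \<Longrightarrow>
      (\<phi> x, \<phi> y) \<in> (adj (lower n w (\<tau> e / real n)))\<^sup>* \<longleftrightarrow> x \<in> B e \<and> y \<in> B e"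
  shows "cutev n EF \<phi> (overlay n EF \<phi> \<tau> w) \<longleftrightarrow> sep EF \<tau> B"
  unfolding cutev_overlay[OF F n] sep_def
proof (intro all_cong1 imp_cong refl)
  fix u v assume uv: "{u, v} \<in> EF"
  define t where "t = \<tau> {u, v}"
  define L where "L = lower n w (t / real n)"
  define G where "G = L \<union> (`) \<phi> ` {e \<in> EF. \<tau> e < t}"
  define R where "R = {(x, y). {x, y} \<in> EF \<and> \<tau> {x, y} < t} \<union> B {u, v} \<times> B {u, v}"
  \<comment> \<open>By assumption the original weights on the copy are not below the level, so
    deleting the copy from the lower graph changes nothing.\<close>
  have "L \<inter> (`) \<phi> ` EF = {}"
    using J[OF uv] unfolding L_def t_def lower_def by (auto simp: not_less[symmetric])
  then have Geq: "(L - (`) \<phi> ` EF) \<union> (`) \<phi> ` {e \<in> EF. \<tau> e < t} = G" by (auto simp: G_def)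
  have uvV: "u \<in> V" "v \<in> V" using finite_simple_graphD(3)[OF F(1)] uv by auto
  have conn': "(\<phi> x, \<phi> y) \<in> (adj L)\<^sup>* \<longleftrightarrow> x \<in> B {u, v} \<and> y \<in> B {u, v}" if "x \<in> V" "y \<in> V" "x \<noteq> y" for x y
    using conn[OF uv that] by (simp add: L_def t_def)
  have 1: "(\<phi> x, \<phi> y) \<in> (adj G)\<^sup>*" if "(x, y) \<in> R\<^sup>*" for x y
    using that
  proof (induction rule: rtrancl_induct)
    case (step y z)
    have "(\<phi> y, \<phi> z) \<in> (adj G)\<^sup>*"
    proof (cases "{y, z} \<in> EF \<and> \<tau> {y, z} < t")
      case True
      then have "\<phi> ` {y, z} \<in> (`) \<phi> ` {e \<in> EF. \<tau> e < t}" by blast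
      then have "(\<phi> y, \<phi> z) \<in> adj G" by (simp add: adj_def G_def)
      then show ?thesis by (rule r_into_rtrancl)
    next
      case False
      then have yz: "y \<in> B {u, v}" "z \<in> B {u, v}" using step by (auto simp: R_def)
      show ?thesis
      proof (cases "y = z")
        case False
        have "y \<in> V" "z \<in> V" using yz B[OF uv] by auto
        then have "(\<phi> y, \<phi> z) \<in> (adj L)\<^sup>*" using conn' False yz by simp
        then show ?thesis using conn_mono[of L G] by (auto simp: G_def)
      qed simp
    qed
    then show ?case using step(3) by (rule rtrancl_trans[rotated])
  qed simp
  \<comment> \<open>A walk in \<open>G\<close> is followed through the last pattern vertex x' that
    has been reached by steps of \<open>R\<close>, together with an excursion in \<open>L\<close>
    since then. Each pattern edge used ends the excursion at a pattern vertex, where it becomes a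
    step inside \<open>B {u, v}\<close>.\<close>
  have 2: "\<exists>x'\<in>V. (x, x') \<in> R\<^sup>* \<and> (\<phi> x', z) \<in> (adj L)\<^sup>*" if "(\<phi> x, z) \<in> (adj G)\<^sup>*" "x \<in> V" for x z
    using that(1)
  proof (induction rule: rtrancl_induct)
    case base show ?case using that(2) by auto
  next
    case (step z z')
    then obtain x' where x': "x' \<in> V" "(x, x') \<in> R\<^sup>*" "(\<phi> x', z) \<in> (adj L)\<^sup>*" by auto
    show ?case
    proof (cases "{z, z'} \<in> L")
      case True
      then have "(z, z') \<in> adj L" by (simp add: adj_def)
      then show ?thesis using x' rtrancl_into_rtrancl by fast
    next
      case False
      then obtain e where e: "e \<in> EF" "\<tau> e < t" "{z, z'} = \<phi> ` e" using step by (auto simp: adj_def G_def)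
      have "e \<subseteq> V" "card e = 2" using finite_simple_graphD(3,4)[OF F(1)] e by auto
      then obtain a0 b0 where ab0: "e = {a0, b0}" "a0 \<in> V" "b0 \<in> V" by (auto simp: card_2_iff)
      then have "\<exists>a b. e = {a, b} \<and> a \<in> V \<and> b \<in> V \<and> z = \<phi> a \<and> z' = \<phi> b"
        using e(3) by (auto simp: doubleton_eq_iff)
      then obtain a b where ab: "e = {a, b}" "a \<in> V" "b \<in> V" "z = \<phi> a" "z' = \<phi> b" by auto
      have "(x', a) \<in> R\<^sup>*"
      proof (cases "x' = a")
        case False
        then have "x' \<in> B {u, v}" "a \<in> B {u, v}" using conn'[OF x'(1) ab(2)] x'(3) ab by auto
        then show ?thesis by (auto simp: R_def)
      qed simp
      moreover have "(a, b) \<in> R" using ab e by (auto simp: R_def)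
      ultimately have "(x, b) \<in> R\<^sup>*" using x'(2) by (meson rtrancl.rtrancl_into_rtrancl rtrancl_trans)
      then show ?thesis using ab by auto
    qed
  qed
  have "(\<phi> u, \<phi> v) \<in> (adj G)\<^sup>* \<longleftrightarrow> (u, v) \<in> R\<^sup>*"
  proof
    assume "(\<phi> u, \<phi> v) \<in> (adj G)\<^sup>*"
    from 2[OF this uvV(1)] obtain x' where x': "x' \<in> V" "(u, x') \<in> R\<^sup>*" "(\<phi> x', \<phi> v) \<in> (adj L)\<^sup>*" by auto
    show "(u, v) \<in> R\<^sup>*"
    proof (cases "x' = v")
      case False
      then have "(x', v) \<in> R" using conn'[OF x'(1) uvV(2)] x'(3) by (auto simp: R_def)
      then show ?thesis using x'(2) by (rule rtrancl_into_rtrancl[rotated])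
    qed (use x' in simp)
  qed (rule 1)
  then show "((\<phi> u, \<phi> v) \<notin> (adj ((lower n w (\<tau> {u, v} / real n) - (`) \<phi> ` EF) \<union> (`) \<phi> ` {e \<in> EF. \<tau> e < \<tau> {u, v}}))\<^sup>*) =
    ((u, v) \<notin> ({(x, y). {x, y} \<in> EF \<and> \<tau> {x, y} < \<tau> {u, v}} \<union> B {u, v} \<times> B {u, v})\<^sup>*)"
    using Geq by (simp add: L_def R_def t_def)
qed

text \<open>
  The label \<open>U x\<close> encodes the level at which \<open>x\<close> joins the giant component: one uniform label per
  vertex makes the giant components at different levels nested.
\<close>

definition hsep :: "'a set \<Rightarrow> 'a set set \<Rightarrow> ('a set \<Rightarrow> real) \<Rightarrow> ('a set \<Rightarrow> real) \<Rightarrow> real" where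
  "hsep V EF \<tau> r = measure (PiM V (\<lambda>_. unif)) {U \<in> space (PiM V (\<lambda>_. unif)). sep EF \<tau> (\<lambda>e. {x \<in> V. U x < r e})}"

section \<open>Nested random sets generated by independent uniform labels\<close>

lemma prob_space_PiM_unif [simp, intro]: "prob_space (PiM V (\<lambda>_. unif))"
  by (intro prob_space_PiM) auto

lemma PiM_unif_component [measurable]: "x \<in> V \<Longrightarrow> (\<lambda>U. U x) \<in> borel_measurable (PiM V (\<lambda>_. unif))"
  using measurable_component_singleton[of x V "\<lambda>_. unif"] by (simp add: measurable_cong_sets[OF refl sets_uniform_measure])

lemma measure_PiM_unif:
  assumes "finite V" "\<And>x. x \<in> V \<Longrightarrow> A x \<in> sets borel"
  shows "measure (PiM V (\<lambda>_. unif)) (Pi\<^sub>E V A) = (\<Prod>x\<in>V. measure unif (A x))"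
proof -
  interpret product_prob_space "\<lambda>_::'a. unif" by (rule product_prob_space_unif)
  have "emeasure (PiM V (\<lambda>_. unif)) (Pi\<^sub>E V A) = (\<Prod>x\<in>V. emeasure unif (A x))"
    using assms by (intro emeasure_PiM) auto
  moreover have "\<dots> = ennreal (\<Prod>x\<in>V. measure unif (A x))"
    by (subst prod_ennreal[symmetric])
       (auto intro!: prod.cong simp: finite_measure.emeasure_eq_measure[OF prob_space.finite_measure])
  ultimately show ?thesis by (simp add: measure_def prod_nonneg)
qed

lemma hsep_sets:
  assumes "finite V" "finite EF"
  shows "{U \<in> space (PiM V (\<lambda>_. unif)). sep EF \<tau> (\<lambda>e. {x \<in> V. U x < r e})} \<in> sets (PiM V (\<lambda>_. unif))"
proof -
  have "{U \<in> space (PiM V (\<lambda>_. unif)). sep EF \<tau> (\<lambda>e. {x \<in> V. (x, e) \<in> {i \<in> V \<times> EF. U (fst i) < r (snd i)}})} \<in> sets (PiM V (\<lambda>_. unif))"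
    by (rule finite_pattern_sets[where \<Phi> = "\<lambda>X. sep EF \<tau> (\<lambda>e. {x \<in> V. (x, e) \<in> X})"]) (use assms in auto)
  moreover have "sep EF \<tau> (\<lambda>e. {x \<in> V. (x, e) \<in> {i \<in> V \<times> EF. U (fst i) < r (snd i)}}) = sep EF \<tau> (\<lambda>e. {x \<in> V. U x < r e})" for U
    by (rule sep_cong) auto
  ultimately show ?thesis by simp
qed

text \<open>Agreement on {0..<1} is the right demand: at the null point 1 the test
  \<open>u < r\<close> fails even for r = 1, so label patterns behave differently there.\<close>

lemma measure_unif_Ico:
  assumes "S \<in> sets borel" "S \<inter> {0..<1} = {b..<a} \<inter> {0..<1}" "0 \<le> b" "a \<le> 1"
  shows "measure unif S = max 0 (a - b)"
proof -
  interpret prob_space unif by simp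
  have "AE x in unif. x \<noteq> 1 \<and> x \<in> {0..1}"
    using AE_lborel_singleton[of 1] by (intro AE_uniform_measureI) (auto elim: eventually_mono)
  then have "AE x in unif. x \<in> S \<longleftrightarrow> x \<in> {b..<a}"
  proof eventually_elim
    case (elim x)
    then have "x \<in> {0..<1}" by auto
    then show ?case using assms(2) by blast
  qed
  then have "measure unif S = measure unif {b..<a}"
    using assms(1) by (intro finite_measure_eq_AE) auto
  also have "{0..1} \<inter> {b..<a} = {b..<a}" using assms by auto
  then have "measure unif {b..<a} = measure lborel {b..<a}" by simp
  also have "\<dots> = max 0 (a - b)" by (cases "b \<le> a") auto
  finally show ?thesis .
qed

text \<open>Replacing r by r' changes the event only if some label falls between \<open>r e\<close>
  and \<open>r' e\<close>, which has probability equal to their distance. The estimate passes both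
  from empirical fractions to \<open>rhoK\<close> and from \<open>rhoK\<close> to
  \<open>rho\<close>.\<close>

lemma hsep_lipschitz:
  assumes "finite V" "finite EF" "\<And>e. e \<in> EF \<Longrightarrow> 0 \<le> r e \<and> r e \<le> 1 \<and> 0 \<le> r' e \<and> r' e \<le> 1"
  shows "\<bar>hsep V EF \<tau> r - hsep V EF \<tau> r'\<bar> \<le> (\<Sum>x\<in>V. \<Sum>e\<in>EF. \<bar>r e - r' e\<bar>)"
proof -
  interpret prob_space "PiM V (\<lambda>_. unif)" by simp
  let ?M = "PiM V (\<lambda>_. unif)"
  define D where "D = (\<lambda>x e. {U \<in> space ?M. (U x < r e) \<noteq> (U x < r' e)})"
  define DD where "DD = (\<Union>x\<in>V. \<Union>e\<in>EF. D x e)"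
  have D: "D x e \<in> events" if "x \<in> V" for x e unfolding D_def using that by measurable
  have DDs: "DD \<in> events" unfolding DD_def using D assms by (intro sets.finite_UN) auto
  have pD: "prob (D x e) \<le> \<bar>r e - r' e\<bar>" if xe: "x \<in> V" "e \<in> EF" for x e
  proof -
    let ?S = "{u. (u < r e) \<noteq> (u < r' e)}"
    have S: "?S \<in> sets borel" by measurable
    have "D x e = {U \<in> space ?M. U x \<in> ?S}" by (auto simp: D_def)
    also have "emeasure ?M \<dots> = emeasure unif ?S"
      using product_prob_space.emeasure_PiM_Collect_single[OF product_prob_space_unif xe(1), of ?S] S by simp
    finally have "prob (D x e) = measure unif ?S" by (simp only: measure_def)
    also have "?S = {min (r e) (r' e)..<max (r e) (r' e)}" by (auto simp: min_def max_def)
    also have "measure unif \<dots> = max 0 (max (r e) (r' e) - min (r e) (r' e))"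
      using assms(3)[OF xe(2)] by (intro measure_unif_Ico) auto
    finally show ?thesis by (auto simp: max_def min_def split: if_splits)
  qed
  have pDD: "prob DD \<le> (\<Sum>x\<in>V. \<Sum>e\<in>EF. \<bar>r e - r' e\<bar>)"
  proof -
    have "prob DD \<le> (\<Sum>x\<in>V. prob (\<Union>e\<in>EF. D x e))"
      unfolding DD_def using D assms by (intro finite_measure_subadditive_finite) (auto intro!: sets.finite_UN)
    also have "\<dots> \<le> (\<Sum>x\<in>V. \<Sum>e\<in>EF. prob (D x e))"
      using D assms by (intro sum_mono finite_measure_subadditive_finite) auto
    also have "\<dots> \<le> (\<Sum>x\<in>V. \<Sum>e\<in>EF. \<bar>r e - r' e\<bar>)" by (intro sum_mono pD)
    finally show ?thesis .
  qed
  define A where "A = (\<lambda>r. {U \<in> space ?M. sep EF \<tau> (\<lambda>e. {x \<in> V. U x < r e})})"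
  have As: "A r \<in> events" for r unfolding A_def by (rule hsep_sets[OF assms(1,2)])
  have same: "U \<in> A r \<longleftrightarrow> U \<in> A r'" if "U \<in> space ?M" "U \<notin> DD" for U
  proof -
    have "sep EF \<tau> (\<lambda>e. {x \<in> V. U x < r e}) = sep EF \<tau> (\<lambda>e. {x \<in> V. U x < r' e})"
      by (rule sep_cong) (use that in \<open>auto simp: DD_def D_def\<close>)
    then show ?thesis using that by (simp add: A_def)
  qed
  have "A r \<subseteq> A r' \<union> DD" "A r' \<subseteq> A r \<union> DD"
    using same by (auto simp: A_def)
  then have "prob (A r) \<le> prob (A r' \<union> DD)" "prob (A r') \<le> prob (A r \<union> DD)"
    using As DDs by (auto intro!: finite_measure_mono)
  moreover have "prob (A r' \<union> DD) \<le> prob (A r') + prob DD" "prob (A r \<union> DD) \<le> prob (A r) + prob DD"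
    using As DDs by (auto intro!: measure_Un_le)
  ultimately have "\<bar>prob (A r) - prob (A r')\<bar> \<le> prob DD" by linarith
  then show ?thesis using pDD unfolding hsep_def A_def by linarith
qed

lemma chain_min:
  fixes \<beta> :: "'e \<Rightarrow> 'b set"
  assumes "finite A" "A \<noteq> {}" "\<And>e e'. e \<in> A \<Longrightarrow> e' \<in> A \<Longrightarrow> \<beta> e \<subseteq> \<beta> e' \<or> \<beta> e' \<subseteq> \<beta> e"
  shows "\<exists>e0\<in>A. \<forall>e\<in>A. \<beta> e0 \<subseteq> \<beta> e"
  using assms
proof (induction A rule: finite_ne_induct)
  case (insert a A)
  then obtain e0 where e0: "e0 \<in> A" "\<forall>e\<in>A. \<beta> e0 \<subseteq> \<beta> e" by auto
  show ?case
  proof (cases "\<beta> e0 \<subseteq> \<beta> a")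
    case True then show ?thesis using e0 by auto
  next
    case False
    then have "\<beta> a \<subseteq> \<beta> e0" using insert.prems[of a e0] e0 by auto
    then show ?thesis using e0 by (intro bexI[of _ a]) auto
  qed
qed auto

lemma chain_max:
  fixes \<beta> :: "'e \<Rightarrow> 'b set"
  assumes "finite A" "A \<noteq> {}" "\<And>e e'. e \<in> A \<Longrightarrow> e' \<in> A \<Longrightarrow> \<beta> e \<subseteq> \<beta> e' \<or> \<beta> e' \<subseteq> \<beta> e"
  shows "\<exists>e0\<in>A. \<forall>e\<in>A. \<beta> e \<subseteq> \<beta> e0"
  using assms
proof (induction A rule: finite_ne_induct)
  case (insert a A)
  then obtain e0 where e0: "e0 \<in> A" "\<forall>e\<in>A. \<beta> e \<subseteq> \<beta> e0" by auto
  show ?case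
  proof (cases "\<beta> a \<subseteq> \<beta> e0")
    case True then show ?thesis using e0 by auto
  next
    case False
    then have "\<beta> e0 \<subseteq> \<beta> a" using insert.prems[of a e0] e0 by auto
    then show ?thesis using e0 by (intro bexI[of _ a]) auto
  qed
qed auto

text \<open>In a chain of sets, the vertices with membership pattern \<open>A\<close> form a
  difference \<open>X - Y\<close>, where \<open>X\<close> is the smallest set of the chain in
  \<open>A\<close> and \<open>Y\<close> the largest outside it. The labels with that pattern form
  the interval from |Y| / n to |X| / n. With nothing to intersect or unite, \<open>X\<close> is
  everything and \<open>Y\<close> is empty.\<close>

lemma pattern_fraction:
  fixes \<beta> :: "'e \<Rightarrow> nat set"
  assumes fin: "finite EF" and n: "n > 0" and A: "A \<subseteq> EF"
    and \<beta>: "\<And>e. e \<in> EF \<Longrightarrow> \<beta> e \<subseteq> {1..n}"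
    and ch: "\<And>e e'. e \<in> EF \<Longrightarrow> e' \<in> EF \<Longrightarrow> \<beta> e \<subseteq> \<beta> e' \<or> \<beta> e' \<subseteq> \<beta> e"
  shows "real (card {y \<in> {1..n}. {e \<in> EF. y \<in> \<beta> e} = A}) / real n =
    measure unif {u. {e \<in> EF. u < real (card (\<beta> e)) / real n} = A}"
proof -
  define X where "X = {y \<in> {1..n}. \<forall>e\<in>A. y \<in> \<beta> e}"
  define Y where "Y = (\<Union>e\<in>EF - A. \<beta> e)"
  let ?r = "\<lambda>Z. real (card Z) / real n"
  have r_mono: "?r Z \<le> ?r Z'" if "Z \<subseteq> Z'" "Z' \<subseteq> {1..n}" for Z Z'
  proof -
    have "card Z \<le> card Z'" using that by (intro card_mono finite_subset[OF that(2)]) auto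
    then show ?thesis by (simp add: divide_right_mono)
  qed
  have X: "X \<subseteq> {1..n}" by (auto simp: X_def)
  have Y: "Y \<subseteq> {1..n}" using \<beta> by (auto simp: Y_def)
  have X_iff: "(\<forall>e\<in>A. u < ?r (\<beta> e)) \<longleftrightarrow> u < ?r X" if "u < 1" for u
  proof (cases "A = {}")
    case True
    then have "X = {1..n}" by (auto simp: X_def)
    then show ?thesis using True that n by simp
  next
    case False
    have "\<exists>e0\<in>A. \<forall>e\<in>A. \<beta> e0 \<subseteq> \<beta> e"
      by (rule chain_min[OF finite_subset[OF A fin] False]) (rule ch; use A in blast)
    then obtain e0 where e0: "e0 \<in> A" "\<forall>e\<in>A. \<beta> e0 \<subseteq> \<beta> e" by auto
    have "\<beta> e0 \<subseteq> {1..n}" using e0(1) A by (intro \<beta>) blast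
    then have "X = \<beta> e0" unfolding X_def using e0 by blast
    moreover have "?r (\<beta> e0) \<le> ?r (\<beta> e)" if "e \<in> A" for e using e0 that \<beta> A by (intro r_mono) auto
    ultimately show ?thesis using e0(1) by (auto intro: less_le_trans)
  qed
  have Y_iff: "(\<forall>e\<in>EF - A. \<not> u < ?r (\<beta> e)) \<longleftrightarrow> ?r Y \<le> u" if "0 \<le> u" for u
  proof (cases "EF - A = {}")
    case True
    then have "Y = {}" unfolding Y_def by (simp only: UN_empty)
    then show ?thesis unfolding True using that by simp
  next
    case False
    have "\<exists>e1\<in>EF - A. \<forall>e\<in>EF - A. \<beta> e \<subseteq> \<beta> e1"
      by (rule chain_max[OF finite_Diff[OF fin] False]) (rule ch; blast)
    then obtain e1 where e1: "e1 \<in> EF - A" "\<forall>e\<in>EF - A. \<beta> e \<subseteq> \<beta> e1" by auto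
    have "Y = \<beta> e1" using e1 by (auto simp: Y_def)
    moreover have "?r (\<beta> e) \<le> ?r (\<beta> e1)" if "e \<in> EF - A" for e using e1 that \<beta> by (intro r_mono) auto
    ultimately show ?thesis using e1(1) by (auto simp: not_less intro: order_trans)
  qed
  have XY: "X \<subseteq> Y \<or> Y \<subseteq> X"
  proof (rule ccontr)
    assume "\<not> ?thesis"
    then obtain x y where xy: "x \<in> X" "x \<notin> Y" "y \<in> Y" "y \<notin> X" by blast
    then obtain e where e: "e \<in> EF - A" "y \<in> \<beta> e" by (auto simp: Y_def)
    have "y \<in> {1..n}" using Y xy by auto
    then obtain e' where e': "e' \<in> A" "y \<notin> \<beta> e'" using xy by (auto simp: X_def)
    have "x \<in> \<beta> e'" "x \<notin> \<beta> e" using xy e e' by (auto simp: X_def Y_def)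
    then show False using ch[of e e'] e e' A by blast
  qed
  have set_eq: "{e \<in> EF. Q e} = A \<longleftrightarrow> (\<forall>e\<in>A. Q e) \<and> (\<forall>e\<in>EF - A. \<not> Q e)" for Q
    using A by blast
  have "{y \<in> {1..n}. {e \<in> EF. y \<in> \<beta> e} = A} = X - Y"
    unfolding set_eq by (auto simp: X_def Y_def)
  moreover have "measure unif {u. {e \<in> EF. u < ?r (\<beta> e)} = A} = max 0 (?r X - ?r Y)"
  proof (rule measure_unif_Ico)
    show "{u. {e \<in> EF. u < ?r (\<beta> e)} = A} \<in> sets borel"
      using finite_pattern_sets[OF fin, of borel "\<lambda>e u. u < ?r (\<beta> e)" "\<lambda>Z. Z = A"] by simp
    show "{u. {e \<in> EF. u < ?r (\<beta> e)} = A} \<inter> {0..<1} = {?r Y..<?r X} \<inter> {0..<1}"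
      unfolding set_eq
    proof (rule set_eqI)
      fix u
      show "u \<in> {u. (\<forall>e\<in>A. u < ?r (\<beta> e)) \<and> (\<forall>e\<in>EF - A. \<not> u < ?r (\<beta> e))} \<inter> {0..<1} \<longleftrightarrow> u \<in> {?r Y..<?r X} \<inter> {0..<1}"
      proof (cases "0 \<le> u \<and> u < 1")
        case True
        then show ?thesis
          using X_iff[of u] Y_iff[of u] by (simp only: Int_iff mem_Collect_eq atLeastLessThan_iff) blast
      next
        case False
        then have "u \<notin> {0..<1}" by simp
        then show ?thesis by blast
      qed
    qed
    show "?r X \<le> 1" using r_mono[OF X order_refl] n by simp
  qed simp
  moreover have "?r (X - Y) = max 0 (?r X - ?r Y)"
  proof (cases "Y \<subseteq> X")
    case True
    have fX: "finite X" by (simp add: X_def)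
    have "card (X - Y) = card X - card Y" "card Y \<le> card X"
      using True fX finite_subset[OF True fX] card_mono[OF fX True] by (simp_all add: card_Diff_subset)
    then show ?thesis by (simp add: of_nat_diff diff_divide_distrib divide_right_mono)
  next
    case False
    then have e: "X - Y = {}" and le: "?r X \<le> ?r Y" using XY r_mono[OF _ Y, of X] by auto
    show ?thesis unfolding e using le by simp
  qed
  ultimately show ?thesis by simp
qed

text \<open>An exact identity: a uniformly random map has independent values, \<open>sep\<close>
  sees each value only through its membership pattern, and by \<open>pattern_fraction\<close> a
  random vertex and a uniform label have the same pattern law.\<close>

lemma count_sep_fraction:
  fixes \<beta> :: "'a set \<Rightarrow> nat set"
  assumes fin: "finite V" "finite EF" and n: "n > 0"
    and \<beta>: "\<And>e. e \<in> EF \<Longrightarrow> \<beta> e \<subseteq> {1..n}"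
    and ch: "\<And>e e'. e \<in> EF \<Longrightarrow> e' \<in> EF \<Longrightarrow> \<beta> e \<subseteq> \<beta> e' \<or> \<beta> e' \<subseteq> \<beta> e"
  shows "real (card {\<phi> \<in> V \<rightarrow>\<^sub>E {1..n}. sep EF \<tau> (\<lambda>e. {x \<in> V. \<phi> x \<in> \<beta> e})}) / real n ^ card V =
    hsep V EF \<tau> (\<lambda>e. real (card (\<beta> e)) / real n)"
proof -
  let ?r = "\<lambda>e. real (card (\<beta> e)) / real n"
  \<comment> \<open>The admissible assignments of a membership pattern to each vertex of
    \<open>V\<close>; both sides are disjoint sums over them.\<close>
  define AA where "AA = {a \<in> V \<rightarrow>\<^sub>E Pow EF. sep EF \<tau> (\<lambda>e. {x \<in> V. e \<in> a x})}"
  have fAA: "finite AA"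
    by (rule finite_subset[of _ "V \<rightarrow>\<^sub>E Pow EF"], force simp: AA_def) (use fin in \<open>auto intro: finite_PiE\<close>)
  define pat where "pat = (\<lambda>y. {e \<in> EF. y \<in> \<beta> e})"
  define upat where "upat = (\<lambda>u. {e \<in> EF. u < ?r e})"
  interpret PM: prob_space "PiM V (\<lambda>_. unif)" by simp
  let ?M = "PiM V (\<lambda>_. unif)"
  have sep_pat: "sep EF \<tau> (\<lambda>e. {x \<in> V. \<phi> x \<in> \<beta> e}) \<longleftrightarrow> restrict (\<lambda>x. pat (\<phi> x)) V \<in> AA" for \<phi>
  proof -
    have "sep EF \<tau> (\<lambda>e. {x \<in> V. \<phi> x \<in> \<beta> e}) = sep EF \<tau> (\<lambda>e. {x \<in> V. e \<in> restrict (\<lambda>x. pat (\<phi> x)) V x})"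
      by (rule sep_cong) (auto simp: pat_def)
    moreover have "restrict (\<lambda>x. pat (\<phi> x)) V \<in> V \<rightarrow>\<^sub>E Pow EF" by (auto simp: pat_def)
    ultimately show ?thesis by (simp add: AA_def)
  qed
  have sep_upat: "sep EF \<tau> (\<lambda>e. {x \<in> V. U x < ?r e}) \<longleftrightarrow> restrict (\<lambda>x. upat (U x)) V \<in> AA" for U
  proof -
    have "sep EF \<tau> (\<lambda>e. {x \<in> V. U x < ?r e}) = sep EF \<tau> (\<lambda>e. {x \<in> V. e \<in> restrict (\<lambda>x. upat (U x)) V x})"
      by (rule sep_cong) (auto simp: upat_def)
    moreover have "restrict (\<lambda>x. upat (U x)) V \<in> V \<rightarrow>\<^sub>E Pow EF" by (auto simp: upat_def)
    ultimately show ?thesis by (simp add: AA_def)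
  qed
  have ext: "restrict g V = a \<longleftrightarrow> (\<forall>x\<in>V. g x = a x)" if "a \<in> AA" for g a
    using that by (auto simp: AA_def PiE_iff extensional_def fun_eq_iff)
  define CC where "CC = (\<lambda>a. \<Pi>\<^sub>E x\<in>V. {y \<in> {1..n}. pat y = a x})"
  define UU where "UU = (\<lambda>a. \<Pi>\<^sub>E x\<in>V. {u. upat u = a x})"
  have c1: "{\<phi> \<in> V \<rightarrow>\<^sub>E {1..n}. sep EF \<tau> (\<lambda>e. {x \<in> V. \<phi> x \<in> \<beta> e})} = (\<Union>a\<in>AA. CC a)"
  proof (intro equalityI subsetI)
    fix \<phi> assume p: "\<phi> \<in> {\<phi> \<in> V \<rightarrow>\<^sub>E {1..n}. sep EF \<tau> (\<lambda>e. {x \<in> V. \<phi> x \<in> \<beta> e})}"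
    then have "\<phi> \<in> CC (restrict (\<lambda>x. pat (\<phi> x)) V)" unfolding CC_def PiE_iff by auto
    then show "\<phi> \<in> (\<Union>a\<in>AA. CC a)" using p sep_pat by auto
  next
    fix \<phi> assume "\<phi> \<in> (\<Union>a\<in>AA. CC a)"
    then obtain a where a: "a \<in> AA" "\<phi> \<in> CC a" by auto
    then have "restrict (\<lambda>x. pat (\<phi> x)) V = a" by (subst ext) (auto simp: CC_def PiE_iff)
    moreover have "\<phi> \<in> V \<rightarrow>\<^sub>E {1..n}" using a by (auto simp: CC_def PiE_iff)
    ultimately show "\<phi> \<in> {\<phi> \<in> V \<rightarrow>\<^sub>E {1..n}. sep EF \<tau> (\<lambda>e. {x \<in> V. \<phi> x \<in> \<beta> e})}" using a sep_pat by simp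
  qed
  have c2: "{U \<in> space ?M. sep EF \<tau> (\<lambda>e. {x \<in> V. U x < ?r e})} = (\<Union>a\<in>AA. UU a)"
  proof (intro equalityI subsetI)
    fix \<phi> assume p: "\<phi> \<in> {U \<in> space ?M. sep EF \<tau> (\<lambda>e. {x \<in> V. U x < ?r e})}"
    then have "\<phi> \<in> UU (restrict (\<lambda>x. upat (\<phi> x)) V)" unfolding UU_def PiE_iff by (auto simp: space_PiM PiE_iff)
    then show "\<phi> \<in> (\<Union>a\<in>AA. UU a)" using p sep_upat by auto
  next
    fix \<phi> assume "\<phi> \<in> (\<Union>a\<in>AA. UU a)"
    then obtain a where a: "a \<in> AA" "\<phi> \<in> UU a" by auto
    then have "restrict (\<lambda>x. upat (\<phi> x)) V = a" by (subst ext) (auto simp: UU_def PiE_iff)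
    moreover have "\<phi> \<in> space ?M" using a by (auto simp: UU_def PiE_iff space_PiM)
    ultimately show "\<phi> \<in> {U \<in> space ?M. sep EF \<tau> (\<lambda>e. {x \<in> V. U x < ?r e})}" using a sep_upat by simp
  qed
  have usets: "{u. upat u = A} \<in> sets borel" for A
    unfolding upat_def using finite_pattern_sets[OF fin(2), of borel "\<lambda>e u. u < ?r e" "\<lambda>Z. Z = A"] by simp
  have mU: "PM.prob (UU a) = (\<Prod>x\<in>V. measure unif {u. upat u = a x})" for a
    unfolding UU_def by (rule measure_PiM_unif[OF fin(1) usets])
  have "hsep V EF \<tau> ?r = PM.prob (\<Union>a\<in>AA. UU a)" by (simp only: hsep_def c2)
  also have "\<dots> = (\<Sum>a\<in>AA. PM.prob (UU a))"
  proof (rule PM.finite_measure_finite_Union[OF fAA])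
    show "UU ` AA \<subseteq> PM.events" unfolding UU_def using usets fin by (auto intro!: sets_PiM_I_finite)
    show "disjoint_family_on UU AA"
    proof (unfold disjoint_family_on_def, intro ballI impI, rule ccontr)
      fix a b assume ab: "a \<in> AA" "b \<in> AA" "a \<noteq> b" "UU a \<inter> UU b \<noteq> {}"
      then obtain U where "U \<in> UU a" "U \<in> UU b" by auto
      then have "restrict (\<lambda>x. upat (U x)) V = a" "restrict (\<lambda>x. upat (U x)) V = b"
        using ext[OF ab(1)] ext[OF ab(2)] by (auto simp: UU_def PiE_iff)
      then show False using ab by simp
    qed
  qed
  also have "\<dots> = (\<Sum>a\<in>AA. \<Prod>x\<in>V. measure unif {u. upat u = a x})" by (simp only: mU)
  also have "\<dots> = (\<Sum>a\<in>AA. \<Prod>x\<in>V. real (card {y \<in> {1..n}. pat y = a x}) / real n)"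
  proof (intro sum.cong prod.cong refl)
    fix a x assume "a \<in> AA" "x \<in> V"
    then have "a x \<subseteq> EF" by (auto simp: AA_def PiE_iff)
    from pattern_fraction[OF fin(2) n this \<beta> ch]
    show "measure unif {u. upat u = a x} = real (card {y \<in> {1..n}. pat y = a x}) / real n"
      by (simp add: upat_def pat_def)
  qed
  also have "\<dots> = (\<Sum>a\<in>AA. real (card (CC a)) / real n ^ card V)"
    using fin by (simp add: CC_def card_PiE prod_dividef)
  also have "\<dots> = real (\<Sum>a\<in>AA. card (CC a)) / real n ^ card V"
    by (simp add: sum_divide_distrib)
  also have "(\<Sum>a\<in>AA. card (CC a)) = card (\<Union>a\<in>AA. CC a)"
  proof (rule card_UN_disjoint[symmetric, OF fAA])
    show "\<forall>a\<in>AA. finite (CC a)" unfolding CC_def using fin by (intro ballI finite_PiE) auto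
    show "\<forall>a\<in>AA. \<forall>b\<in>AA. a \<noteq> b \<longrightarrow> CC a \<inter> CC b = {}"
    proof (intro ballI impI, rule ccontr)
      fix a b assume ab: "a \<in> AA" "b \<in> AA" "a \<noteq> b" "CC a \<inter> CC b \<noteq> {}"
      then obtain U where "U \<in> CC a" "U \<in> CC b" by auto
      then have "restrict (\<lambda>x. pat (U x)) V = a" "restrict (\<lambda>x. pat (U x)) V = b"
        using ext[OF ab(1)] ext[OF ab(2)] by (auto simp: CC_def PiE_iff)
      then show False using ab by simp
    qed
  qed
  finally show ?thesis by (simp only: c1)
qed

section \<open>Averaging over all labelings by exchangeability\<close>

lemma (in prob_space) integrable_of_bool:
  assumes "{\<omega> \<in> space M. P \<omega>} \<in> events"
  shows "integrable M (\<lambda>\<omega>. of_bool (P \<omega>) :: real)"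
proof -
  have "integrable M (\<lambda>\<omega>. (\<lambda>X. of_bool (X \<noteq> {}) :: real) {i \<in> {()}. P \<omega>})"
    by (rule finite_pattern_integrable) (use assms in \<open>auto intro: finite_measure_axioms\<close>)
  moreover have "(\<lambda>\<omega>. (\<lambda>X. of_bool (X \<noteq> {}) :: real) {i \<in> {()}. P \<omega>}) = (\<lambda>\<omega>. of_bool (P \<omega>))"
    by auto
  ultimately show ?thesis by (simp only:)
qed

lemma (in prob_space) abs_prob_diff_le:
  assumes "A \<in> events" "B \<in> events" "D \<in> events" "\<And>w. w \<in> space M \<Longrightarrow> w \<notin> D \<Longrightarrow> w \<in> A \<longleftrightarrow> w \<in> B"
  shows "\<bar>prob A - prob B\<bar> \<le> prob D"
proof -
  have "A \<subseteq> B \<union> D" "B \<subseteq> A \<union> D"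
    using assms(4) sets.sets_into_space[OF assms(1)] sets.sets_into_space[OF assms(2)] by auto
  then have "prob A \<le> prob (B \<union> D)" "prob B \<le> prob (A \<union> D)"
    using assms(1-3) by (auto intro!: finite_measure_mono)
  moreover have "prob (B \<union> D) \<le> prob B + prob D" "prob (A \<union> D) \<le> prob A + prob D"
    using assms(1-3) by (auto intro!: measure_Un_le)
  ultimately show ?thesis by linarith
qed

text \<open>Some pair of distinct vertices has equal images, and the map is then determined by its
  values off one of the two.\<close>

lemma card_noninjective:
  assumes "finite V"
  shows "real (card {\<phi> \<in> V \<rightarrow>\<^sub>E {1..n}. \<not> inj_on \<phi> V}) \<le> (real (card V))\<^sup>2 * real n ^ (card V - 1)"
proof -
  define N where "N = (\<lambda>(x, y). {\<phi> \<in> V \<rightarrow>\<^sub>E {1..n}. \<phi> x = \<phi> y})"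
  define P where "P = {(x, y) \<in> V \<times> V. x \<noteq> y}"
  have fP: "finite P" unfolding P_def by (rule finite_subset[of _ "V \<times> V"]) (use assms in auto)
  have fMaps: "finite (V \<rightarrow>\<^sub>E {1..n})" using assms by (intro finite_PiE) auto
  have cN: "card (N p) \<le> n ^ (card V - 1)" if p: "p \<in> P" for p
  proof -
    obtain x y where xy: "p = (x, y)" "x \<in> V" "y \<in> V" "x \<noteq> y" using p by (auto simp: P_def)
    have "card (N p) \<le> card (V - {y} \<rightarrow>\<^sub>E {1..n})"
    proof (rule card_inj_on_le[where f = "\<lambda>\<phi>. restrict \<phi> (V - {y})"])
      show "inj_on (\<lambda>\<phi>. restrict \<phi> (V - {y})) (N p)"
      proof (rule inj_onI)
        fix \<phi> \<psi> assume a: "\<phi> \<in> N p" "\<psi> \<in> N p" "restrict \<phi> (V - {y}) = restrict \<psi> (V - {y})"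
        have eq: "\<phi> z = \<psi> z" if "z \<in> V - {y}" for z using fun_cong[OF a(3), of z] that by simp
        have "\<phi> z = \<psi> z" for z
        proof (cases "z \<in> V")
          case True
          show ?thesis
          proof (cases "z = y")
            case True
            have "\<phi> y = \<phi> x" "\<psi> y = \<psi> x" using a(1,2) xy by (auto simp: N_def)
            then show ?thesis using eq[of x] xy True by simp
          qed (use eq True in auto)
        next
          case False
          then show ?thesis using a(1,2) xy by (auto simp: N_def PiE_iff extensional_def)
        qed
        then show "\<phi> = \<psi>" by (rule ext)
      qed
      show "(\<lambda>\<phi>. restrict \<phi> (V - {y})) ` N p \<subseteq> V - {y} \<rightarrow>\<^sub>E {1..n}"
      proof (rule image_subsetI)
        fix \<phi> assume "\<phi> \<in> N p"
        then have "\<forall>z\<in>V. \<phi> z \<in> {1..n}" by (simp add: N_def xy PiE_iff)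
        then show "restrict \<phi> (V - {y}) \<in> V - {y} \<rightarrow>\<^sub>E {1..n}" by (simp only: restrict_PiE_iff) blast
      qed
      show "finite (V - {y} \<rightarrow>\<^sub>E {1..n})" using assms by (intro finite_PiE) auto
    qed
    also have "\<dots> = n ^ (card V - 1)" using assms xy by (simp add: card_funcsetE card_Diff_singleton)
    finally show ?thesis .
  qed
  have "{\<phi> \<in> V \<rightarrow>\<^sub>E {1..n}. \<not> inj_on \<phi> V} \<subseteq> (\<Union>p\<in>P. N p)"
    by (auto simp: inj_on_def N_def P_def)
  then have "card {\<phi> \<in> V \<rightarrow>\<^sub>E {1..n}. \<not> inj_on \<phi> V} \<le> card (\<Union>p\<in>P. N p)"
    by (intro card_mono finite_subset[OF _ fMaps]) (auto simp: N_def)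
  also have "\<dots> \<le> (\<Sum>p\<in>P. card (N p))" by (rule card_UN_le[OF fP])
  also have "\<dots> \<le> (\<Sum>p\<in>P. n ^ (card V - 1))" by (intro sum_mono cN)
  also have "\<dots> = card P * n ^ (card V - 1)" by simp
  also have "\<dots> \<le> card (V \<times> V) * n ^ (card V - 1)"
    using assms by (intro mult_le_mono1 card_mono) (auto simp: P_def)
  finally have "real (card {\<phi> \<in> V \<rightarrow>\<^sub>E {1..n}. \<not> inj_on \<phi> V}) \<le> real (card (V \<times> V) * n ^ (card V - 1))"
    by (simp only: of_nat_le_iff)
  then show ?thesis by (simp add: card_cartesian_product power2_eq_square)
qed

text \<open>All injective labelings have the same probability, so a fixed labeling may be replaced
  by a uniformly random map at the cost of the non-injective ones, a fraction of order 1 / n. Random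
  maps are preferred because their values are independent.\<close>

lemma injective_average:
  fixes A :: "('a \<Rightarrow> nat) \<Rightarrow> (nat set \<Rightarrow> real) \<Rightarrow> bool"
  assumes fin: "finite V" and n: "n > 0"
    and meas: "\<And>\<phi>. {w \<in> space (weight_law n). A \<phi> w} \<in> sets (weight_law n)"
    and act: "\<And>\<sigma> \<phi> w. \<sigma> permutes {1..n} \<Longrightarrow> \<phi> ` V \<subseteq> {1..n} \<Longrightarrow> A \<phi> (wact n \<sigma> w) \<longleftrightarrow> A (\<sigma> \<circ> \<phi>) w"
    and cong: "\<And>\<phi> \<psi> w. (\<And>x. x \<in> V \<Longrightarrow> \<phi> x = \<psi> x) \<Longrightarrow> A \<phi> w \<longleftrightarrow> A \<psi> w"
    and \<phi>0: "inj_on \<phi>0 V" "\<phi>0 ` V \<subseteq> {1..n}"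
  shows "\<bar>measure (weight_law n) {w \<in> space (weight_law n). A \<phi>0 w} -
    (\<integral>w. real (card {\<phi> \<in> V \<rightarrow>\<^sub>E {1..n}. A \<phi> w}) / real n ^ card V \<partial>weight_law n)\<bar> \<le> (real (card V))\<^sup>2 / real n"
proof -
  interpret prob_space "weight_law n" by simp
  define Maps where "Maps = V \<rightarrow>\<^sub>E {1..n}"
  define INJ where "INJ = {\<phi> \<in> Maps. inj_on \<phi> V}"
  define NI where "NI = {\<phi> \<in> Maps. \<not> inj_on \<phi> V}"
  define p where "p = (\<lambda>\<phi>. prob {w \<in> space (weight_law n). A \<phi> w})"
  have fMaps: "finite Maps" unfolding Maps_def using fin by (intro finite_PiE) auto
  have cMaps: "real (card Maps) = real n ^ card V" unfolding Maps_def using fin by (simp add: card_funcsetE)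
  have p_eq: "p \<phi> = p \<phi>0" if \<phi>: "\<phi> \<in> INJ" for \<phi>
  proof -
    have i: "inj_on \<phi> V" "\<phi> ` V \<subseteq> {1..n}" using \<phi> by (auto simp: INJ_def Maps_def)
    obtain \<sigma> where \<sigma>: "\<sigma> permutes {1..n}" "\<forall>x\<in>V. \<sigma> (\<phi> x) = \<phi>0 x"
      using permutes_extend[OF i \<phi>0] by auto
    have "A \<phi> (wact n \<sigma> w) \<longleftrightarrow> A \<phi>0 w" for w
      unfolding act[OF \<sigma>(1) i(2)] by (rule cong) (use \<sigma>(2) in simp)
    then show ?thesis using measure_wact[OF \<sigma>(1) meas[of \<phi>]] by (simp add: p_def)
  qed
  have part: "Maps = INJ \<union> NI" "INJ \<inter> NI = {}" "finite INJ" "finite NI" using fMaps by (auto simp: INJ_def NI_def)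
  have N: "(\<integral>w. real (card {\<phi> \<in> V \<rightarrow>\<^sub>E {1..n}. A \<phi> w}) / real n ^ card V \<partial>weight_law n) = (\<Sum>\<phi>\<in>Maps. p \<phi>) / real n ^ card V"
  proof -
    have "real (card {\<phi> \<in> V \<rightarrow>\<^sub>E {1..n}. A \<phi> w}) = (\<Sum>\<phi>\<in>Maps. of_bool (A \<phi> w))" for w
    proof -
      have "{\<phi> \<in> V \<rightarrow>\<^sub>E {1..n}. A \<phi> w} = Maps \<inter> {\<phi>. A \<phi> w}" by (auto simp: Maps_def)
      then show ?thesis using fMaps by (simp add: sum.If_cases of_bool_def)
    qed
    then have "(\<integral>w. real (card {\<phi> \<in> V \<rightarrow>\<^sub>E {1..n}. A \<phi> w}) / real n ^ card V \<partial>weight_law n) =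
      (\<integral>w. (\<Sum>\<phi>\<in>Maps. of_bool (A \<phi> w)) / real n ^ card V \<partial>weight_law n)" by simp
    also have "\<dots> = (\<integral>w. (\<Sum>\<phi>\<in>Maps. of_bool (A \<phi> w)) \<partial>weight_law n) / real n ^ card V"
      by (rule integral_divide_zero)
    also have "(\<integral>w. (\<Sum>\<phi>\<in>Maps. (of_bool (A \<phi> w) :: real)) \<partial>weight_law n) = (\<Sum>\<phi>\<in>Maps. \<integral>w. of_bool (A \<phi> w) \<partial>weight_law n)"
    proof (rule Bochner_Integration.integral_sum)
      show "integrable (weight_law n) (\<lambda>w. of_bool (A \<phi> w) :: real)" for \<phi> using meas by (rule integrable_of_bool)
    qed
    also have "\<dots> = (\<Sum>\<phi>\<in>Maps. p \<phi>)" by (simp only: integral_of_bool[OF meas] p_def)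
    finally show ?thesis .
  qed
  have "(\<Sum>\<phi>\<in>Maps. p \<phi>) = (\<Sum>\<phi>\<in>INJ. p \<phi>) + (\<Sum>\<phi>\<in>NI. p \<phi>)"
    unfolding part(1) using part by (intro sum.union_disjoint) auto
  also have "(\<Sum>\<phi>\<in>INJ. p \<phi>) = real (card INJ) * p \<phi>0" using p_eq by simp
  finally have s: "(\<Sum>\<phi>\<in>Maps. p \<phi>) = real (card INJ) * p \<phi>0 + (\<Sum>\<phi>\<in>NI. p \<phi>)" .
  have "card Maps = card INJ + card NI" unfolding part(1) using part by (intro card_Un_disjoint) auto
  then have c: "real n ^ card V = real (card INJ) + real (card NI)" using cMaps by simp
  have pb: "0 \<le> p \<phi> \<and> p \<phi> \<le> 1" for \<phi> by (simp add: p_def)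
  have NIb: "0 \<le> (\<Sum>\<phi>\<in>NI. p \<phi>)" "(\<Sum>\<phi>\<in>NI. p \<phi>) \<le> real (card NI)"
    using pb sum_bounded_above[of NI p 1] by (auto intro: sum_nonneg)
  have d: "p \<phi>0 * real n ^ card V - (\<Sum>\<phi>\<in>Maps. p \<phi>) = p \<phi>0 * real (card NI) - (\<Sum>\<phi>\<in>NI. p \<phi>)"
    unfolding s c by (simp add: algebra_simps)
  have "0 \<le> p \<phi>0 * real (card NI)" "p \<phi>0 * real (card NI) \<le> real (card NI)"
    using pb[of \<phi>0] by (auto intro: mult_left_le_one_le)
  then have "\<bar>p \<phi>0 * real n ^ card V - (\<Sum>\<phi>\<in>Maps. p \<phi>)\<bar> \<le> real (card NI)"
    using d NIb by linarith
  also have "\<dots> \<le> (real (card V))\<^sup>2 * real n ^ (card V - 1)"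
    using card_noninjective[OF fin, of n] by (simp add: NI_def Maps_def)
  finally have e: "\<bar>p \<phi>0 * real n ^ card V - (\<Sum>\<phi>\<in>Maps. p \<phi>)\<bar> \<le> (real (card V))\<^sup>2 * real n ^ (card V - 1)" .
  have nv: "real n ^ card V > 0" using n by simp
  have "p \<phi>0 - (\<Sum>\<phi>\<in>Maps. p \<phi>) / real n ^ card V = (p \<phi>0 * real n ^ card V - (\<Sum>\<phi>\<in>Maps. p \<phi>)) / real n ^ card V"
    using nv by (simp add: diff_divide_distrib)
  then have "\<bar>p \<phi>0 - (\<Sum>\<phi>\<in>Maps. p \<phi>) / real n ^ card V\<bar> = \<bar>p \<phi>0 * real n ^ card V - (\<Sum>\<phi>\<in>Maps. p \<phi>)\<bar> / real n ^ card V"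
    using nv by (simp add: abs_divide)
  also have "\<dots> \<le> (real (card V))\<^sup>2 * real n ^ (card V - 1) / real n ^ card V"
    using e nv by (intro divide_right_mono) auto
  also have "\<dots> \<le> (real (card V))\<^sup>2 / real n"
  proof (cases "card V")
    case (Suc j)
    then show ?thesis using n by simp
  qed simp
  finally show ?thesis unfolding N p_def .
qed

lemma in_bigset_wact:
  assumes "\<sigma> permutes {1..n}" "x \<in> {1..n}"
  shows "x \<in> bigset n (lower n (wact n \<sigma> w) s) K \<longleftrightarrow> \<sigma> x \<in> bigset n (lower n w s) K"
proof -
  have "\<sigma> x \<in> {1..n}" using permutes_in_image[OF assms(1)] assms(2) by blast
  then show ?thesis using assms(2) by (simp add: bigset_def card_cluster_wact[OF assms(1)])
qed

text \<open>The n (n - 1) ordered pairs of distinct vertices are equally likely to be bad, and their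
  probabilities add up to the expected number of bad pairs.\<close>

lemma badpair_prob:
  assumes xy: "x \<in> {1..n}" "y \<in> {1..n}" "x \<noteq> y"
  shows "real n * (real n - 1) * measure (weight_law n) {w \<in> space (weight_law n).
      ((x, y) \<in> (adj (lower n w s))\<^sup>*) \<noteq> (x \<in> bigset n (lower n w s) K \<and> y \<in> bigset n (lower n w s) K)}
    = (\<integral>w. real (badpairs n (lower n w s) K) \<partial>weight_law n)"
proof -
  interpret prob_space "weight_law n" by simp
  define bad where "bad = (\<lambda>x y w. ((x, y) \<in> (adj (lower n w s))\<^sup>*) \<noteq> (x \<in> bigset n (lower n w s) K \<and> y \<in> bigset n (lower n w s) K))"
  define PP where "PP = {(a, b) \<in> {1..n} \<times> {1..n}. a \<noteq> b}"
  have fPP: "finite PP" unfolding PP_def by (rule finite_subset[of _ "{1..n} \<times> {1..n}"]) auto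
  have bs: "{w \<in> space (weight_law n). bad a b w} \<in> events" for a b
    unfolding bad_def by (rule lower_sets[where \<Phi> = "\<lambda>H. ((a, b) \<in> (adj H)\<^sup>*) \<noteq> (a \<in> bigset n H K \<and> b \<in> bigset n H K)"])
  have same: "prob {w \<in> space (weight_law n). bad a b w} = prob {w \<in> space (weight_law n). bad x y w}"
    if ab: "(a, b) \<in> PP" for a b
  proof -
    define \<phi> where "\<phi> = (\<lambda>i :: nat. if i = 0 then a else b)"
    define \<psi> where "\<psi> = (\<lambda>i :: nat. if i = 0 then x else y)"
    have "inj_on \<phi> {0, 1}" "\<phi> ` {0, 1} \<subseteq> {1..n}" "inj_on \<psi> {0, 1}" "\<psi> ` {0, 1} \<subseteq> {1..n}"
      using ab xy by (auto simp: \<phi>_def \<psi>_def PP_def)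
    from permutes_extend[OF this finite_atLeastAtMost] obtain \<sigma> where
      \<sigma>: "\<sigma> permutes {1..n}" "\<forall>i\<in>{0, 1}. \<sigma> (\<phi> i) = \<psi> i" by auto
    have ab': "\<sigma> a = x" "\<sigma> b = y" using \<sigma>(2) by (auto simp: \<phi>_def \<psi>_def)
    have abn: "a \<in> {1..n}" "b \<in> {1..n}" using ab by (auto simp: PP_def)
    have "bad a b (wact n \<sigma> w) = bad x y w" for w
      unfolding bad_def conn_wact[OF \<sigma>(1)] in_bigset_wact[OF \<sigma>(1) abn(1)] in_bigset_wact[OF \<sigma>(1) abn(2)] ab' ..
    then show ?thesis using measure_wact[OF \<sigma>(1) bs[of a b]] by simp
  qed
  have "real (badpairs n (lower n w s) K) = (\<Sum>(a, b)\<in>PP. of_bool (bad a b w))" for w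
  proof -
    have "{(a, b) \<in> {1..n} \<times> {1..n}. a \<noteq> b \<and> bad a b w} = PP \<inter> {p. case p of (a, b) \<Rightarrow> bad a b w}"
      by (auto simp: PP_def)
    then show ?thesis using fPP by (simp add: badpairs_def bad_def sum.If_cases of_bool_def case_prod_unfold)
  qed
  then have "(\<integral>w. real (badpairs n (lower n w s) K) \<partial>weight_law n) = (\<integral>w. (\<Sum>p\<in>PP. of_bool (bad (fst p) (snd p) w)) \<partial>weight_law n)"
    by (simp add: case_prod_unfold)
  also have "\<dots> = (\<Sum>p\<in>PP. \<integral>w. of_bool (bad (fst p) (snd p) w) \<partial>weight_law n)"
  proof (rule Bochner_Integration.integral_sum)
    show "integrable (weight_law n) (\<lambda>w. of_bool (bad (fst p) (snd p) w) :: real)" for p using bs by (rule integrable_of_bool)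
  qed
  also have "\<dots> = (\<Sum>p\<in>PP. prob {w \<in> space (weight_law n). bad x y w})"
    using same by (intro sum.cong refl) (simp add: integral_of_bool[OF bs])
  also have "\<dots> = real (card PP) * prob {w \<in> space (weight_law n). bad x y w}" by simp
  also have "real (card PP) = real n * (real n - 1)"
  proof -
    have "PP = {1..n} \<times> {1..n} - (\<lambda>a. (a, a)) ` {1..n}" by (auto simp: PP_def)
    moreover have "card ({1..n} \<times> {1..n} - (\<lambda>a. (a, a)) ` {1..n}) = card ({1..n} \<times> {1..n}) - card ((\<lambda>a. (a, a)) ` {1..n})"
      by (rule card_Diff_subset) auto
    moreover have "card ((\<lambda>a. (a, a)) ` {1..n}) = n" by (subst card_image) (auto simp: inj_on_def)
    ultimately have "card PP = n * n - n" by (simp add: card_cartesian_product)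
    moreover have "n \<le> n * n" by (cases n) auto
    ultimately show ?thesis by (simp add: of_nat_diff algebra_simps)
  qed
  finally show ?thesis by (simp add: bad_def)
qed

section \<open>Limit of the cut probability for fixed rescaled weights\<close>

lemma lowfam_image: "e \<in> EF \<Longrightarrow> lowfam n (g ` EF) w (g e) = lower n w (g e)"
  by (auto simp: lowfam_def)

lemma sep_event_sets:
  assumes "finite EF"
  shows "{w \<in> space (weight_law n). sep EF \<tau> (\<lambda>e. {x \<in> V. \<phi> x \<in> bigset n (lower n w (\<tau> e / real n)) K})} \<in> sets (weight_law n)"
proof -
  let ?L = "(\<lambda>e. \<tau> e / real n) ` EF"
  have "sep EF \<tau> (\<lambda>e. {x \<in> V. \<phi> x \<in> bigset n (lower n w (\<tau> e / real n)) K}) =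
    sep EF \<tau> (\<lambda>e. {x \<in> V. \<phi> x \<in> bigset n (lowfam n ?L w (\<tau> e / real n)) K})" for w
    by (rule sep_cong) (simp only: lowfam_image[where g = "\<lambda>e. \<tau> e / real n"])
  then show ?thesis
    using lowfam_sets[of ?L n "\<lambda>g. sep EF \<tau> (\<lambda>e. {x \<in> V. \<phi> x \<in> bigset n (g (\<tau> e / real n)) K})"] assms by simp
qed

lemma cutev_event_sets:
  assumes F: "finite_simple_graph (V, EF)" "inj_on \<phi> V" "\<phi> ` V \<subseteq> {1..n}" and n: "n > 0"
  shows "{w \<in> space (weight_law n). cutev n EF \<phi> (overlay n EF \<phi> \<tau> w)} \<in> sets (weight_law n)"
proof -
  let ?L = "(\<lambda>e. \<tau> e / real n) ` EF"
  have fin: "finite ?L" using finite_simple_graphD(2)[OF F(1)] by simp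
  have "cutev n EF \<phi> (overlay n EF \<phi> \<tau> w) \<longleftrightarrow> (\<forall>u v. {u, v} \<in> EF \<longrightarrow>
    (\<phi> u, \<phi> v) \<notin> (adj ((lowfam n ?L w (\<tau> {u, v} / real n) - (`) \<phi> ` EF) \<union> (`) \<phi> ` {e \<in> EF. \<tau> e < \<tau> {u, v}}))\<^sup>*)" for w
    unfolding cutev_overlay[OF F n] by (intro all_cong1 imp_cong refl) (simp only: lowfam_image[where g = "\<lambda>e. \<tau> e / real n"])
  then show ?thesis
    using lowfam_sets[OF fin, of n "\<lambda>g. \<forall>u v. {u, v} \<in> EF \<longrightarrow>
      (\<phi> u, \<phi> v) \<notin> (adj ((g (\<tau> {u, v} / real n) - (`) \<phi> ` EF) \<union> (`) \<phi> ` {e \<in> EF. \<tau> e < \<tau> {u, v}}))\<^sup>*"] by simp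
qed

text \<open>Replacing the fixed labeling by a random map costs the first error term. Its conditional
  probability is then exactly \<open>hsep\<close> at the empirical fractions, and the Lipschitz
  bound moves these to \<open>rhoK\<close> at the cost of the second.\<close>

lemma sep_prob_approx:
  fixes V :: "'a set"
  assumes F: "finite_simple_graph (V, EF)" "inj_on \<phi> V" "\<phi> ` V \<subseteq> {1..n}" and n: "n > 0"
    and \<tau>: "\<And>e. e \<in> EF \<Longrightarrow> 0 < \<tau> e"
  shows "\<bar>measure (weight_law n) {w \<in> space (weight_law n). sep EF \<tau> (\<lambda>e. {x \<in> V. \<phi> x \<in> bigset n (lower n w (\<tau> e / real n)) K})}
      - hsep V EF \<tau> (\<lambda>e. rhoK K (\<tau> e))\<bar>
    \<le> (real (card V))\<^sup>2 / real n + (\<Sum>x\<in>V. \<Sum>e\<in>EF. \<integral>w. \<bar>real (card (bigset n (lower n w (\<tau> e / real n)) K)) / real n - rhoK K (\<tau> e)\<bar> \<partial>weight_law n)"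
proof -
  interpret prob_space "weight_law n" by simp
  have fV: "finite V" and fE: "finite EF" using finite_simple_graphD(1,2)[OF F(1)] by auto
  define \<beta> where "\<beta> = (\<lambda>w e. bigset n (lower n w (\<tau> e / real n)) K)"
  define r where "r = (\<lambda>w e. real (card (\<beta> w e)) / real n)"
  define A where "A = (\<lambda>\<phi> w. sep EF \<tau> (\<lambda>e. {x \<in> V. \<phi> x \<in> \<beta> w e}))"
  have As: "{w \<in> space (weight_law n). A \<phi> w} \<in> events" for \<phi>
    unfolding A_def \<beta>_def by (rule sep_event_sets[OF fE])
  have ir: "integrable (weight_law n) (\<lambda>w. \<bar>r w e - rhoK K (\<tau> e)\<bar>)" for e
    unfolding r_def \<beta>_def by (rule lower_integrable[where h = "\<lambda>H. \<bar>real (card (bigset n H K)) / real n - rhoK K (\<tau> e)\<bar>"])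
  have r01: "0 \<le> r w e \<and> r w e \<le> 1" for w e
  proof -
    have "card (\<beta> w e) \<le> n" unfolding \<beta>_def by (rule card_bigset_le)
    then show ?thesis using n by (simp add: r_def)
  qed
  have cnt: "real (card {\<phi> \<in> V \<rightarrow>\<^sub>E {1..n}. A \<phi> w}) / real n ^ card V = hsep V EF \<tau> (r w)" for w
    unfolding A_def r_def
  proof (rule count_sep_fraction[OF fV fE n])
    show "\<beta> w e \<subseteq> {1..n}" for e by (auto simp: \<beta>_def bigset_def)
    show "\<beta> w e \<subseteq> \<beta> w e' \<or> \<beta> w e' \<subseteq> \<beta> w e" for e e'
    proof (cases "\<tau> e \<le> \<tau> e'")
      case True
      then have "\<beta> w e \<subseteq> \<beta> w e'"
        unfolding \<beta>_def by (intro bigset_mono lower_mono lower_subset) (auto simp: divide_right_mono)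
      then show ?thesis by simp
    next
      case False
      then have "\<beta> w e' \<subseteq> \<beta> w e"
        unfolding \<beta>_def by (intro bigset_mono lower_mono lower_subset) (auto simp: divide_right_mono)
      then show ?thesis by simp
    qed
  qed
  \<comment> \<open>Integrability is read off the counting formula, a finite sum of indicators
    divided by a constant.\<close>
  have ih: "integrable (weight_law n) (\<lambda>w. hsep V EF \<tau> (r w))"
  proof -
    have "integrable (weight_law n) (\<lambda>w. (\<Sum>\<phi>\<in>V \<rightarrow>\<^sub>E {1..n}. of_bool (A \<phi> w)) / real n ^ card V)"
      by (intro integrable_divide_zero impI Bochner_Integration.integrable_sum integrable_of_bool As)
    moreover have "(\<Sum>\<phi>\<in>V \<rightarrow>\<^sub>E {1..n}. of_bool (A \<phi> w)) / real n ^ card V = hsep V EF \<tau> (r w)" for w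
    proof -
      have "finite (V \<rightarrow>\<^sub>E {1..n})" using fV by (intro finite_PiE) auto
      moreover have "{\<phi> \<in> V \<rightarrow>\<^sub>E {1..n}. A \<phi> w} = (V \<rightarrow>\<^sub>E {1..n}) \<inter> {\<phi>. A \<phi> w}" by auto
      ultimately show ?thesis unfolding cnt[symmetric] by (simp add: sum.If_cases of_bool_def)
    qed
    ultimately show ?thesis by simp
  qed
  have lip: "\<bar>hsep V EF \<tau> (r w) - hsep V EF \<tau> (\<lambda>e. rhoK K (\<tau> e))\<bar> \<le> (\<Sum>x\<in>V. \<Sum>e\<in>EF. \<bar>r w e - rhoK K (\<tau> e)\<bar>)" for w
    by (rule hsep_lipschitz[OF fV fE]) (use r01 rhoK_nonneg rhoK_le_1 \<tau> in \<open>auto simp: less_imp_le\<close>)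
  have "\<bar>expectation (\<lambda>w. hsep V EF \<tau> (r w)) - hsep V EF \<tau> (\<lambda>e. rhoK K (\<tau> e))\<bar> =
    \<bar>expectation (\<lambda>w. hsep V EF \<tau> (r w) - hsep V EF \<tau> (\<lambda>e. rhoK K (\<tau> e)))\<bar>"
    using ih by (simp add: prob_space)
  also have "\<dots> \<le> expectation (\<lambda>w. \<bar>hsep V EF \<tau> (r w) - hsep V EF \<tau> (\<lambda>e. rhoK K (\<tau> e))\<bar>)"
    by (rule integral_abs_bound)
  also have "\<dots> \<le> expectation (\<lambda>w. \<Sum>x\<in>V. \<Sum>e\<in>EF. \<bar>r w e - rhoK K (\<tau> e)\<bar>)"
    using ih lip by (intro integral_mono Bochner_Integration.integrable_sum ir) auto
  also have "\<dots> = (\<Sum>x\<in>V. \<Sum>e\<in>EF. expectation (\<lambda>w. \<bar>r w e - rhoK K (\<tau> e)\<bar>))"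
    by (simp add: Bochner_Integration.integral_sum ir)
  finally have 1: "\<bar>expectation (\<lambda>w. hsep V EF \<tau> (r w)) - hsep V EF \<tau> (\<lambda>e. rhoK K (\<tau> e))\<bar> \<le>
    (\<Sum>x\<in>V. \<Sum>e\<in>EF. expectation (\<lambda>w. \<bar>r w e - rhoK K (\<tau> e)\<bar>))" .
  have "\<bar>prob {w \<in> space (weight_law n). A \<phi> w} - expectation (\<lambda>w. real (card {\<phi> \<in> V \<rightarrow>\<^sub>E {1..n}. A \<phi> w}) / real n ^ card V)\<bar> \<le> (real (card V))\<^sup>2 / real n"
  proof (rule injective_average[OF fV n As _ _ F(2,3)])
    fix \<sigma> \<psi> w assume \<sigma>: "\<sigma> permutes {1..n}" and \<psi>: "\<psi> ` V \<subseteq> {1..n}"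
    have "x \<in> V \<Longrightarrow> \<psi> x \<in> \<beta> (wact n \<sigma> w) e \<longleftrightarrow> (\<sigma> \<circ> \<psi>) x \<in> \<beta> w e" for x e
      using in_bigset_wact[OF \<sigma>, of "\<psi> x"] \<psi> by (auto simp: \<beta>_def)
    then show "A \<psi> (wact n \<sigma> w) = A (\<sigma> \<circ> \<psi>) w"
      unfolding A_def by (intro sep_cong) auto
  next
    fix \<psi> \<psi>' :: "'a \<Rightarrow> nat" and w assume "\<And>x. x \<in> V \<Longrightarrow> \<psi> x = \<psi>' x"
    then show "A \<psi> w = A \<psi>' w" unfolding A_def by (intro sep_cong) auto
  qed
  then have "\<bar>prob {w \<in> space (weight_law n). A \<phi> w} - expectation (\<lambda>w. hsep V EF \<tau> (r w))\<bar> \<le> (real (card V))\<^sup>2 / real n"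
    by (simp only: cnt)
  with 1 have "\<bar>prob {w \<in> space (weight_law n). A \<phi> w} - hsep V EF \<tau> (\<lambda>e. rhoK K (\<tau> e))\<bar> \<le>
    (real (card V))\<^sup>2 / real n + (\<Sum>x\<in>V. \<Sum>e\<in>EF. expectation (\<lambda>w. \<bar>r w e - rhoK K (\<tau> e)\<bar>))"
    by linarith
  then show ?thesis by (simp only: A_def r_def \<beta>_def)
qed

lemma weight_below_prob:
  assumes "f \<in> cedges n" "0 \<le> s" "s \<le> 1"
  shows "measure (weight_law n) {w \<in> space (weight_law n). w f < s} = s"
  using weight_box_threshold[of "{f}" n "{}" "{}" s s] assms by simp

text \<open>Two kinds of exceptional events are removed: an original weight on the copy lies below
  one of the levels (\<open>D1\<close>), or two labelled vertices form a bad pair at some level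
  (\<open>D2\<close>). Elsewhere \<open>cutev_overlay_iff_sep\<close> identifies the two
  events.\<close>

lemma conditional_cut_approx:
  fixes V :: "'a set"
  assumes F: "finite_simple_graph (V, EF)" "inj_on \<phi> V" "\<phi> ` V \<subseteq> {1..n}" and n: "n \<ge> 2"
    and \<tau>: "\<And>e. e \<in> EF \<Longrightarrow> 0 < \<tau> e \<and> \<tau> e \<le> real n"
  shows "\<bar>measure (weight_law n) {w \<in> space (weight_law n). cutev n EF \<phi> (overlay n EF \<phi> \<tau> w)} -
      measure (weight_law n) {w \<in> space (weight_law n). sep EF \<tau> (\<lambda>e. {x \<in> V. \<phi> x \<in> bigset n (lower n w (\<tau> e / real n)) K})}\<bar>
    \<le> (\<Sum>e\<in>EF. \<Sum>f\<in>EF. \<tau> e / real n) +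
      (\<Sum>e\<in>EF. \<Sum>x\<in>V. \<Sum>y\<in>V. 2 * (\<integral>w. real (badpairs n (lower n w (\<tau> e / real n)) K) \<partial>weight_law n) / (real n)\<^sup>2)"
proof -
  interpret prob_space "weight_law n" by simp
  have n0: "n > 0" using n by simp
  have fV: "finite V" and fE: "finite EF" using finite_simple_graphD(1,2)[OF F(1)] by auto
  define T where "T = (\<lambda>e f. {w \<in> space (weight_law n). w (\<phi> ` f) < \<tau> e / real n})"
  define Bd where "Bd = (\<lambda>e x y. {w \<in> space (weight_law n). x \<noteq> y \<and>
     ((\<phi> x, \<phi> y) \<in> (adj (lower n w (\<tau> e / real n)))\<^sup>*) \<noteq>
     (\<phi> x \<in> bigset n (lower n w (\<tau> e / real n)) K \<and> \<phi> y \<in> bigset n (lower n w (\<tau> e / real n)) K)})"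
  define D1 where "D1 = (\<Union>e\<in>EF. \<Union>f\<in>EF. T e f)"
  define D2 where "D2 = (\<Union>e\<in>EF. \<Union>x\<in>V. \<Union>y\<in>V. Bd e x y)"
  have Tm: "T e f \<in> events" if "f \<in> EF" for e f
  proof -
    have "\<phi> ` f \<in> cedges n" using image_edges_cedges[OF F] that by auto
    then show ?thesis unfolding T_def by measurable
  qed
  have Bm: "Bd e x y \<in> events" for e x y
    unfolding Bd_def by (rule lower_sets[where \<Phi> = "\<lambda>H. x \<noteq> y \<and> ((\<phi> x, \<phi> y) \<in> (adj H)\<^sup>*) \<noteq> (\<phi> x \<in> bigset n H K \<and> \<phi> y \<in> bigset n H K)"])
  have D1m: "D1 \<in> events" unfolding D1_def using Tm fE by (intro sets.finite_UN) auto
  have D2m: "D2 \<in> events" unfolding D2_def using Bm fE fV by (intro sets.finite_UN) auto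
  have pT: "prob (T e f) = \<tau> e / real n" if "e \<in> EF" "f \<in> EF" for e f
  proof -
    have "\<phi> ` f \<in> cedges n" using image_edges_cedges[OF F] that by auto
    then show ?thesis unfolding T_def using \<tau>[OF that(1)] n0 by (intro weight_below_prob) auto
  qed
  have pB: "prob (Bd e x y) \<le> 2 * (\<integral>w. real (badpairs n (lower n w (\<tau> e / real n)) K) \<partial>weight_law n) / (real n)\<^sup>2"
    if xy: "x \<in> V" "y \<in> V" for e x y
  proof (cases "x = y")
    case True
    then have "prob (Bd e x y) = 0" by (simp add: Bd_def)
    then show ?thesis by (simp add: Bochner_Integration.integral_nonneg)
  next
    case False
    let ?E = "\<integral>w. real (badpairs n (lower n w (\<tau> e / real n)) K) \<partial>weight_law n"
    have "\<phi> x \<in> {1..n}" "\<phi> y \<in> {1..n}" "\<phi> x \<noteq> \<phi> y" using xy False F(2,3) by (auto simp: inj_on_def)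
    from badpair_prob[OF this, of "\<tau> e / real n" K]
    have eq: "real n * (real n - 1) * prob (Bd e x y) = ?E" using False by (simp add: Bd_def)
    \<comment> \<open>For n \<ge> 2 one has n^2 \<le> 2 n (n - 1), the source of the factor
      2.\<close>
    have "(real n)\<^sup>2 * prob (Bd e x y) \<le> (2 * (real n * (real n - 1))) * prob (Bd e x y)"
      using n by (intro mult_right_mono) (auto simp: power2_eq_square algebra_simps)
    then have "(real n)\<^sup>2 * prob (Bd e x y) \<le> 2 * ?E" using eq by (simp add: mult.assoc)
    then show ?thesis using n0 by (simp add: field_simps)
  qed
  let ?A = "{w \<in> space (weight_law n). cutev n EF \<phi> (overlay n EF \<phi> \<tau> w)}"
  let ?B = "{w \<in> space (weight_law n). sep EF \<tau> (\<lambda>e. {x \<in> V. \<phi> x \<in> bigset n (lower n w (\<tau> e / real n)) K})}"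
  have "\<bar>prob ?A - prob ?B\<bar> \<le> prob (D1 \<union> D2)"
  proof (rule abs_prob_diff_le)
    show "?A \<in> events" by (rule cutev_event_sets[OF F n0])
    show "?B \<in> events" by (rule sep_event_sets[OF fE])
    show "D1 \<union> D2 \<in> events" using D1m D2m by blast
    fix w assume w: "w \<in> space (weight_law n)" "w \<notin> D1 \<union> D2"
    have "cutev n EF \<phi> (overlay n EF \<phi> \<tau> w) \<longleftrightarrow> sep EF \<tau> (\<lambda>e. {x \<in> V. \<phi> x \<in> bigset n (lower n w (\<tau> e / real n)) K})"
    proof (rule cutev_overlay_iff_sep[OF F n0])
      fix e f assume "e \<in> EF" "f \<in> (`) \<phi> ` EF"
      then show "\<tau> e / real n \<le> w f" using w by (auto simp: D1_def T_def not_less)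
    next
      fix e x y assume exy: "e \<in> EF" "x \<in> V" "y \<in> V" "x \<noteq> y"
      have "w \<notin> Bd e x y" using w(2) exy unfolding D2_def by blast
      then show "((\<phi> x, \<phi> y) \<in> (adj (lower n w (\<tau> e / real n)))\<^sup>*) =
        (x \<in> {x \<in> V. \<phi> x \<in> bigset n (lower n w (\<tau> e / real n)) K} \<and> y \<in> {x \<in> V. \<phi> x \<in> bigset n (lower n w (\<tau> e / real n)) K})"
        using w(1) exy by (simp add: Bd_def)
    qed auto
    then show "w \<in> ?A \<longleftrightarrow> w \<in> ?B" using w(1) by simp
  qed
  also have "\<dots> \<le> prob D1 + prob D2" using D1m D2m by (rule measure_Un_le)
  also have "prob D1 \<le> (\<Sum>e\<in>EF. \<Sum>f\<in>EF. \<tau> e / real n)"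
  proof -
    have "prob D1 \<le> (\<Sum>e\<in>EF. prob (\<Union>f\<in>EF. T e f))"
      unfolding D1_def using Tm fE by (intro finite_measure_subadditive_finite) (auto intro!: sets.finite_UN)
    also have "\<dots> \<le> (\<Sum>e\<in>EF. \<Sum>f\<in>EF. prob (T e f))"
      using Tm fE by (intro sum_mono finite_measure_subadditive_finite) auto
    also have "\<dots> = (\<Sum>e\<in>EF. \<Sum>f\<in>EF. \<tau> e / real n)" using pT by (intro sum.cong refl) auto
    finally show ?thesis .
  qed
  also have "prob D2 \<le> (\<Sum>e\<in>EF. \<Sum>x\<in>V. \<Sum>y\<in>V. 2 * (\<integral>w. real (badpairs n (lower n w (\<tau> e / real n)) K) \<partial>weight_law n) / (real n)\<^sup>2)"
  proof -
    have "prob D2 \<le> (\<Sum>e\<in>EF. prob (\<Union>x\<in>V. \<Union>y\<in>V. Bd e x y))"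
      unfolding D2_def using Bm fE fV by (intro finite_measure_subadditive_finite) (auto intro!: sets.finite_UN)
    also have "\<dots> \<le> (\<Sum>e\<in>EF. \<Sum>x\<in>V. prob (\<Union>y\<in>V. Bd e x y))"
      using Bm fV by (intro sum_mono finite_measure_subadditive_finite) (auto intro!: sets.finite_UN)
    also have "\<dots> \<le> (\<Sum>e\<in>EF. \<Sum>x\<in>V. \<Sum>y\<in>V. prob (Bd e x y))"
      using Bm fV by (intro sum_mono finite_measure_subadditive_finite) auto
    also have "\<dots> \<le> (\<Sum>e\<in>EF. \<Sum>x\<in>V. \<Sum>y\<in>V. 2 * (\<integral>w. real (badpairs n (lower n w (\<tau> e / real n)) K) \<partial>weight_law n) / (real n)\<^sup>2)"
      using pB by (intro sum_mono) auto
    finally show ?thesis .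
  qed
  finally show ?thesis by simp
qed

lemma rho_le_1: "rho \<theta> \<le> 1"
proof (cases "\<theta> \<le> 0")
  case False
  then show ?thesis using rho_le_rhoK[of \<theta> 0] rhoK_le_1[of \<theta> 0] by simp
qed (simp add: rho_def)

text \<open>The cutoff \<open>K\<close> is fixed first, large enough for every edge of the pattern,
  and only then n grows. Continuity of \<open>rho\<close> at each level enters through the bad
  pairs.\<close>

lemma conditional_cut_limit:
  fixes V :: "'a set" and \<phi> :: "nat \<Rightarrow> 'a \<Rightarrow> nat"
  assumes F: "finite_simple_graph (V, EF)"
    and \<phi>: "\<And>n. n \<ge> N0 \<Longrightarrow> inj_on (\<phi> n) V \<and> \<phi> n ` V \<subseteq> {1..n}"
    and \<tau>: "\<And>e. e \<in> EF \<Longrightarrow> 0 < \<tau> e \<and> isCont rho (\<tau> e)"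
  shows "(\<lambda>n. measure (weight_law n) {w \<in> space (weight_law n). cutev n EF (\<phi> n) (overlay n EF (\<phi> n) \<tau> w)})
    \<longlonglongrightarrow> hsep V EF \<tau> (\<lambda>e. rho (\<tau> e))"
proof -
  have fV: "finite V" and fE: "finite EF" using finite_simple_graphD(1,2)[OF F] by auto
  define m where "m = real (card EF)"
  define v where "v = real (card V)"
  \<comment> \<open>Three error terms that vanish with n, 20 \<epsilon> for each edge and ordered
    pair of vertices from the bad pairs, and \<epsilon> for each vertex and edge from replacing
    \<open>rhoK\<close> by \<open>rho\<close>.\<close>
  define C where "C = 3 + 20 * (m * (v * v)) + v * m"
  have mv: "0 \<le> m" "0 \<le> v" by (auto simp: m_def v_def)
  have C: "C > 0" using mv by (simp add: C_def add_pos_nonneg)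
  let ?Q = "\<lambda>n. measure (weight_law n) {w \<in> space (weight_law n). cutev n EF (\<phi> n) (overlay n EF (\<phi> n) \<tau> w)}"
  let ?g = "hsep V EF \<tau> (\<lambda>e. rho (\<tau> e))"
  have key: "\<forall>\<^sub>F n in sequentially. \<bar>?Q n - ?g\<bar> \<le> C * \<epsilon>" if \<epsilon>: "\<epsilon> > 0" for \<epsilon>
  proof -
    have "\<forall>\<^sub>F K in sequentially. \<forall>e\<in>EF. rhoK K (\<tau> e) < rho (\<tau> e) + \<epsilon>"
      using \<epsilon> \<tau> by (intro eventually_ball_finite[OF fE] ballI order_tendstoD(2)[OF rhoK_lim]) auto
    moreover have "\<forall>\<^sub>F K in sequentially. \<forall>e\<in>EF. \<forall>\<^sub>F n in sequentially.
      (\<integral>w. real (badpairs n (lower n w (\<tau> e / real n)) K) \<partial>weight_law n) \<le> 10 * \<epsilon> * (real n)\<^sup>2"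
    proof (intro eventually_ball_finite[OF fE] ballI)
      fix e assume "e \<in> EF"
      then have e: "0 < \<tau> e" "isCont rho (\<tau> e)" using \<tau> by auto
      obtain K0 where K0: "\<And>K. K0 \<le> K \<Longrightarrow> \<forall>\<^sub>F n in sequentially.
        (\<integral>w. real (badpairs n (lower n w (\<tau> e / real n)) K) \<partial>weight_law n) \<le> 10 * \<epsilon> * (real n)\<^sup>2"
        using badpairs_limit[OF e \<epsilon>] by auto
      show "\<forall>\<^sub>F K in sequentially. \<forall>\<^sub>F n in sequentially.
        (\<integral>w. real (badpairs n (lower n w (\<tau> e / real n)) K) \<partial>weight_law n) \<le> 10 * \<epsilon> * (real n)\<^sup>2"
        by (rule eventually_sequentiallyI[OF K0])
    qed
    ultimately have "\<forall>\<^sub>F K in sequentially. (\<forall>e\<in>EF. rhoK K (\<tau> e) < rho (\<tau> e) + \<epsilon>) \<and> (\<forall>e\<in>EF. \<forall>\<^sub>F n in sequentially.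
      (\<integral>w. real (badpairs n (lower n w (\<tau> e / real n)) K) \<partial>weight_law n) \<le> 10 * \<epsilon> * (real n)\<^sup>2)"
      by (rule eventually_conj)
    from eventually_happens'[OF sequentially_bot this] obtain K where K1: "\<And>e. e \<in> EF \<Longrightarrow> rhoK K (\<tau> e) < rho (\<tau> e) + \<epsilon>"
      and K2: "\<And>e. e \<in> EF \<Longrightarrow> \<forall>\<^sub>F n in sequentially.
        (\<integral>w. real (badpairs n (lower n w (\<tau> e / real n)) K) \<partial>weight_law n) \<le> 10 * \<epsilon> * (real n)\<^sup>2"
      by (elim exE conjE) (rule that, (erule (1) bspec)+)
    have e1: "\<forall>\<^sub>F n in sequentially. \<forall>e\<in>EF. (\<integral>w. real (badpairs n (lower n w (\<tau> e / real n)) K) \<partial>weight_law n) \<le> 10 * \<epsilon> * (real n)\<^sup>2"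
      using K2 by (intro eventually_ball_finite[OF fE] ballI)
    have e2: "\<forall>\<^sub>F n in sequentially. \<forall>e\<in>EF. \<tau> e \<le> real n"
    proof (intro eventually_ball_finite[OF fE] ballI)
      fix e
      show "\<forall>\<^sub>F n in sequentially. \<tau> e \<le> real n"
        using filterlim_real_sequentially by (simp add: filterlim_at_top)
    qed
    have "(\<lambda>n. \<Sum>e\<in>EF. \<Sum>f\<in>EF. \<tau> e / real n) \<longlonglongrightarrow> (\<Sum>e\<in>EF. \<Sum>f\<in>EF. 0)"
      by (intro tendsto_sum lim_const_over_n)
    then have e3: "\<forall>\<^sub>F n in sequentially. (\<Sum>e\<in>EF. \<Sum>f\<in>EF. \<tau> e / real n) < \<epsilon>"
      using \<epsilon> by (intro order_tendstoD(2)) auto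
    have e4: "\<forall>\<^sub>F n in sequentially. v\<^sup>2 / real n < \<epsilon>"
      using \<epsilon> lim_const_over_n[of "v\<^sup>2"] by (intro order_tendstoD(2)) auto
    have "(\<lambda>n. \<Sum>x\<in>V. \<Sum>e\<in>EF. \<integral>w. \<bar>real (card (bigset n (lower n w (\<tau> e / real n)) K)) / real n - rhoK K (\<tau> e)\<bar> \<partial>weight_law n)
      \<longlonglongrightarrow> (\<Sum>x\<in>V. \<Sum>e\<in>EF. 0)"
      using \<tau> by (intro tendsto_sum bigset_L1) auto
    then have e5: "\<forall>\<^sub>F n in sequentially. (\<Sum>x\<in>V. \<Sum>e\<in>EF. \<integral>w. \<bar>real (card (bigset n (lower n w (\<tau> e / real n)) K)) / real n - rhoK K (\<tau> e)\<bar> \<partial>weight_law n) < \<epsilon>"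
      using \<epsilon> by (intro order_tendstoD(2)) auto
    have rr: "\<bar>hsep V EF \<tau> (\<lambda>e. rhoK K (\<tau> e)) - ?g\<bar> \<le> v * m * \<epsilon>"
    proof -
      have "\<bar>hsep V EF \<tau> (\<lambda>e. rhoK K (\<tau> e)) - ?g\<bar> \<le> (\<Sum>x\<in>V. \<Sum>e\<in>EF. \<bar>rhoK K (\<tau> e) - rho (\<tau> e)\<bar>)"
        by (rule hsep_lipschitz[OF fV fE]) (use \<tau> rhoK_nonneg rhoK_le_1 rho_nonneg rho_le_1 in \<open>auto simp: less_imp_le\<close>)
      also have "\<dots> \<le> (\<Sum>x\<in>V. \<Sum>e\<in>EF. \<epsilon>)"
      proof (intro sum_mono)
        fix e assume e: "e \<in> EF"
        show "\<bar>rhoK K (\<tau> e) - rho (\<tau> e)\<bar> \<le> \<epsilon>" using K1[OF e] rho_le_rhoK[of "\<tau> e" K] \<tau>[OF e] by simp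
      qed
      also have "\<dots> = v * m * \<epsilon>" by (simp add: v_def m_def)
      finally show ?thesis .
    qed
    show ?thesis
      using e1 e2 e3 e4 e5 eventually_ge_at_top[of 2] eventually_ge_at_top[of N0]
    proof eventually_elim
      case (elim n)
      have lab: "inj_on (\<phi> n) V" "\<phi> n ` V \<subseteq> {1..n}" using \<phi>[of n] elim by auto
      have n0: "n > 0" using elim by simp
      have \<tau>n: "0 < \<tau> e \<and> \<tau> e \<le> real n" if "e \<in> EF" for e using \<tau>[OF that] elim(2) that by auto
      have \<tau>0: "0 < \<tau> e" if "e \<in> EF" for e using \<tau>[OF that] by auto
      let ?S = "measure (weight_law n) {w \<in> space (weight_law n). sep EF \<tau> (\<lambda>e. {x \<in> V. \<phi> n x \<in> bigset n (lower n w (\<tau> e / real n)) K})}"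
      have a1: "\<bar>?Q n - ?S\<bar> \<le> (\<Sum>e\<in>EF. \<Sum>f\<in>EF. \<tau> e / real n) +
        (\<Sum>e\<in>EF. \<Sum>x\<in>V. \<Sum>y\<in>V. 2 * (\<integral>w. real (badpairs n (lower n w (\<tau> e / real n)) K) \<partial>weight_law n) / (real n)\<^sup>2)"
        by (rule conditional_cut_approx[OF F lab elim(6) \<tau>n])
      have a2: "(\<Sum>e\<in>EF. \<Sum>x\<in>V. \<Sum>y\<in>V. 2 * (\<integral>w. real (badpairs n (lower n w (\<tau> e / real n)) K) \<partial>weight_law n) / (real n)\<^sup>2) \<le>
        (\<Sum>e\<in>EF. \<Sum>x\<in>V. \<Sum>y\<in>V. 20 * \<epsilon>)"
      proof (intro sum_mono)
        fix e assume "e \<in> EF"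
        then have "2 * (\<integral>w. real (badpairs n (lower n w (\<tau> e / real n)) K) \<partial>weight_law n) \<le> 2 * (10 * \<epsilon> * (real n)\<^sup>2)"
          using elim(1) by (intro mult_left_mono) auto
        then show "2 * (\<integral>w. real (badpairs n (lower n w (\<tau> e / real n)) K) \<partial>weight_law n) / (real n)\<^sup>2 \<le> 20 * \<epsilon>"
          using n0 by (simp add: divide_le_eq)
      qed
      have a3: "(\<Sum>e\<in>EF. \<Sum>x\<in>V. \<Sum>y\<in>V. 20 * \<epsilon>) = 20 * (m * (v * v)) * \<epsilon>" by (simp add: m_def v_def)
      have a4: "\<bar>?S - hsep V EF \<tau> (\<lambda>e. rhoK K (\<tau> e))\<bar> \<le> v\<^sup>2 / real n +
        (\<Sum>x\<in>V. \<Sum>e\<in>EF. \<integral>w. \<bar>real (card (bigset n (lower n w (\<tau> e / real n)) K)) / real n - rhoK K (\<tau> e)\<bar> \<partial>weight_law n)"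
        unfolding v_def by (rule sep_prob_approx[OF F lab n0 \<tau>0])
      have "C * \<epsilon> = 3 * \<epsilon> + 20 * (m * (v * v)) * \<epsilon> + v * m * \<epsilon>" by (simp add: C_def algebra_simps)
      then show ?case using a1 a2 a3 a4 rr elim(3,4,5) by linarith
    qed
  qed
  show ?thesis
  proof (rule LIMSEQ_I)
    fix r :: real assume r: "r > 0"
    have "\<forall>\<^sub>F n in sequentially. \<bar>?Q n - ?g\<bar> \<le> C * (r / (2 * C))"
      using r C by (intro key) simp
    moreover have "C * (r / (2 * C)) < r" using r C by simp
    ultimately have "\<forall>\<^sub>F n in sequentially. norm (?Q n - ?g) < r" by (auto elim: eventually_mono)
    then show "\<exists>no. \<forall>n\<ge>no. norm (?Q n - ?g) < r" by (simp add: eventually_sequentially)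
  qed
qed

section \<open>Integration over rescaled weights\<close>

text \<open>For n > 0 the law of n times a uniform weight, written as a density so that its products
  become densities against a Lebesgue product measure common to all n.\<close>

definition scaled_unif :: "nat \<Rightarrow> real measure" where
  "scaled_unif n = density lborel (\<lambda>x. ennreal (indicator {0..real n} x / real n))"

lemma sets_scaled_unif [measurable_cong, simp]: "sets (scaled_unif n) = sets borel"
  by (simp add: scaled_unif_def)

lemma space_scaled_unif [simp]: "space (scaled_unif n) = UNIV"
  by (simp add: scaled_unif_def)

lemma emeasure_scaled_unif:
  assumes n: "n > 0" and A: "A \<in> sets borel"
  shows "emeasure (scaled_unif n) {t. t / real n \<in> A} = emeasure unif A"
proof -
  have m: "{t. t / real n \<in> A} \<in> sets borel"
  proof -
    have "(\<lambda>t. t / real n) \<in> borel_measurable borel" by measurable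
    from measurable_sets[OF this A] show ?thesis by (simp add: vimage_def)
  qed
  have "emeasure (scaled_unif n) {t. t / real n \<in> A} =
    (\<integral>\<^sup>+t. ennreal (indicator {0..real n} t / real n) * indicator {t. t / real n \<in> A} t \<partial>lborel)"
    unfolding scaled_unif_def using m by (subst emeasure_density) auto
  also have "\<dots> = ennreal \<bar>real n\<bar> * (\<integral>\<^sup>+x. ennreal (indicator {0..real n} (0 + real n * x) / real n) * indicator {t. t / real n \<in> A} (0 + real n * x) \<partial>lborel)"
    using n m by (intro nn_integral_real_affine) auto
  also have "(\<integral>\<^sup>+x. ennreal (indicator {0..real n} (0 + real n * x) / real n) * indicator {t. t / real n \<in> A} (0 + real n * x) \<partial>lborel)
    = (\<integral>\<^sup>+x. ennreal (1 / real n) * indicator ({0..1} \<inter> A) x \<partial>lborel)"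
    using n by (intro nn_integral_cong) (auto simp: indicator_def field_simps mult_le_cancel_left_pos zero_le_mult_iff)
  also have "\<dots> = ennreal (1 / real n) * emeasure lborel ({0..1} \<inter> A)"
    using A by (subst nn_integral_cmult_indicator) auto
  also have "ennreal \<bar>real n\<bar> * (ennreal (1 / real n) * emeasure lborel ({0..1} \<inter> A)) = emeasure lborel ({0..1} \<inter> A)"
    using n by (simp add: mult.assoc[symmetric] ennreal_mult[symmetric])
  also have "\<dots> = emeasure unif A" using A by (simp add: divide_ennreal_def)
  finally show ?thesis .
qed

lemma prob_space_scaled_unif: "n > 0 \<Longrightarrow> prob_space (scaled_unif n)"
  using emeasure_scaled_unif[of n UNIV] prob_space.emeasure_space_1[OF prob_space_unif]
  by (intro prob_spaceI) simp

text \<open>The constants 1 / n multiply to n to the power minus the number of edges, which is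
  exactly what the normalization in the theorem cancels.\<close>

lemma PiM_scaled_unif:
  assumes n: "n > 0" and fin: "finite I"
  shows "PiM I (\<lambda>_. scaled_unif n) = density (PiM I (\<lambda>_. lborel)) (\<lambda>\<tau>. \<Prod>e\<in>I. ennreal (indicator {0..real n} (\<tau> e) / real n))"
proof -
  interpret L: product_sigma_finite "\<lambda>_. lborel :: real measure" by unfold_locales
  interpret S: product_sigma_finite "\<lambda>_. scaled_unif n"
    by (intro product_sigma_finite.intro prob_space_imp_sigma_finite prob_space_scaled_unif n)
  show ?thesis
  proof (rule S.PiM_eqI[OF fin, symmetric])
    show "sets (density (PiM I (\<lambda>_. lborel)) (\<lambda>\<tau>. \<Prod>e\<in>I. ennreal (indicator {0..real n} (\<tau> e) / real n))) = sets (PiM I (\<lambda>_. scaled_unif n))"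
      by (simp cong: sets_PiM_cong)
    fix A assume "\<And>i. i \<in> I \<Longrightarrow> A i \<in> sets (scaled_unif n)"
    then have A: "\<And>i. i \<in> I \<Longrightarrow> A i \<in> sets borel" by simp
    have box: "Pi\<^sub>E I A \<in> sets (PiM I (\<lambda>_. lborel))" using A fin by (intro sets_PiM_I_finite) auto
    have "emeasure (density (PiM I (\<lambda>_. lborel)) (\<lambda>\<tau>. \<Prod>e\<in>I. ennreal (indicator {0..real n} (\<tau> e) / real n))) (Pi\<^sub>E I A) =
      (\<integral>\<^sup>+\<tau>. (\<Prod>e\<in>I. ennreal (indicator {0..real n} (\<tau> e) / real n)) * indicator (Pi\<^sub>E I A) \<tau> \<partial>PiM I (\<lambda>_. lborel))"
      using box by (intro emeasure_density) auto
    also have "\<dots> = (\<integral>\<^sup>+\<tau>. (\<Prod>e\<in>I. ennreal (indicator {0..real n} (\<tau> e) / real n) * indicator (A e) (\<tau> e)) \<partial>PiM I (\<lambda>_. lborel))"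
    proof (rule nn_integral_cong)
      fix \<tau> :: "'a \<Rightarrow> real" assume "\<tau> \<in> space (PiM I (\<lambda>_. lborel))"
      then have "indicator (Pi\<^sub>E I A) \<tau> = (\<Prod>e\<in>I. indicator (A e) (\<tau> e) :: ennreal)"
        using fin by (auto simp: indicator_def space_PiM PiE_iff prod_zero_iff)
      then show "(\<Prod>e\<in>I. ennreal (indicator {0..real n} (\<tau> e) / real n)) * indicator (Pi\<^sub>E I A) \<tau> =
        (\<Prod>e\<in>I. ennreal (indicator {0..real n} (\<tau> e) / real n) * indicator (A e) (\<tau> e))"
        by (simp add: prod.distrib)
    qed
    also have "\<dots> = (\<Prod>e\<in>I. \<integral>\<^sup>+t. ennreal (indicator {0..real n} t / real n) * indicator (A e) t \<partial>lborel)"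
      using A by (intro L.product_nn_integral_prod fin) auto
    also have "\<dots> = (\<Prod>e\<in>I. emeasure (scaled_unif n) (A e))"
      unfolding scaled_unif_def using A by (intro prod.cong refl) (subst emeasure_density, auto)
    finally show "emeasure (density (PiM I (\<lambda>_. lborel)) (\<lambda>\<tau>. \<Prod>e\<in>I. ennreal (indicator {0..real n} (\<tau> e) / real n))) (Pi\<^sub>E I A) =
      (\<Prod>e\<in>I. emeasure (scaled_unif n) (A e))" .
  qed
qed

lemma overlay_measurable:
  assumes F: "finite_simple_graph (V, EF)" "inj_on \<phi> V" and S: "\<And>e. sets (S e) = sets borel"
  shows "(\<lambda>(\<tau>, w). overlay n EF \<phi> \<tau> w) \<in> (PiM EF S \<Otimes>\<^sub>M weight_law n) \<rightarrow>\<^sub>M weight_law n"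
proof -
  have "(\<lambda>p. overlay n EF \<phi> (fst p) (snd p)) \<in> (PiM EF S \<Otimes>\<^sub>M weight_law n) \<rightarrow>\<^sub>M (\<Pi>\<^sub>M e\<in>cedges n. borel)"
    unfolding overlay_def
  proof (rule measurable_restrict)
    fix f assume f: "f \<in> cedges n"
    show "(\<lambda>p. if f \<in> (`) \<phi> ` EF then fst p (the_inv_into EF ((`) \<phi>) f) / real n else snd p f) \<in> borel_measurable (PiM EF S \<Otimes>\<^sub>M weight_law n)"
    proof (cases "f \<in> (`) \<phi> ` EF")
      case True
      then have "the_inv_into EF ((`) \<phi>) f \<in> EF"
        using the_inv_into_into[OF image_inj_on_edges[OF F] True order_refl] by simp
      then have "(\<lambda>\<tau>. \<tau> (the_inv_into EF ((`) \<phi>) f)) \<in> PiM EF S \<rightarrow>\<^sub>M S (the_inv_into EF ((`) \<phi>) f)"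
        by (rule measurable_component_singleton)
      moreover have "PiM EF S \<rightarrow>\<^sub>M S (the_inv_into EF ((`) \<phi>) f) = borel_measurable (PiM EF S)"
        by (rule measurable_cong_sets[OF refl S])
      ultimately have "(\<lambda>\<tau>. \<tau> (the_inv_into EF ((`) \<phi>) f)) \<in> borel_measurable (PiM EF S)"
        by (simp only:)
      then have "(\<lambda>p. fst p (the_inv_into EF ((`) \<phi>) f)) \<in> borel_measurable (PiM EF S \<Otimes>\<^sub>M weight_law n)"
        by (rule measurable_compose[OF measurable_fst])
      then have "(\<lambda>p. fst p (the_inv_into EF ((`) \<phi>) f) / real n) \<in> borel_measurable (PiM EF S \<Otimes>\<^sub>M weight_law n)"
        by (rule borel_measurable_divide[OF _ borel_measurable_const])
      then show ?thesis by (simp only: True if_True)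
    next
      case False
      from measurable_compose[OF measurable_snd weight_component_measurable[OF f], of "PiM EF S"]
      show ?thesis by (simp only: False if_False)
    qed
  qed
  moreover have "(PiM EF S \<Otimes>\<^sub>M weight_law n) \<rightarrow>\<^sub>M (\<Pi>\<^sub>M e\<in>cedges n. borel) = (PiM EF S \<Otimes>\<^sub>M weight_law n) \<rightarrow>\<^sub>M weight_law n"
    by (rule measurable_cong_sets[OF refl sets_weight[symmetric]])
  ultimately show ?thesis by (simp only: case_prod_unfold)
qed

text \<open>Resampling some coordinates of a product measure by independent copies with the same law
  leaves the law unchanged. It suffices to compare boxes, since the preimage of a box is a product
  of two boxes.\<close>

lemma distr_overlay:
  assumes F: "finite_simple_graph (V, EF)" "inj_on \<phi> V" "\<phi> ` V \<subseteq> {1..n}" and n: "n > 0"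
  shows "distr (PiM EF (\<lambda>_. scaled_unif n) \<Otimes>\<^sub>M weight_law n) (weight_law n) (\<lambda>(\<tau>, w). overlay n EF \<phi> \<tau> w) = weight_law n"
proof -
  let ?J = "(`) \<phi> ` EF"
  have fE: "finite EF" using finite_simple_graphD(2)[OF F(1)] by simp
  have inj: "inj_on ((`) \<phi>) EF" by (rule image_inj_on_edges[OF F(1,2)])
  have J: "?J \<subseteq> cedges n" by (rule image_edges_cedges[OF F])
  interpret U: product_prob_space "\<lambda>_::nat set. unif" "cedges n" by (rule product_prob_space_unif)
  interpret S: product_prob_space "\<lambda>_::'a set. scaled_unif n" EF
    by (intro product_prob_spaceI prob_space_scaled_unif n)
  interpret W: prob_space "weight_law n" by simp
  let ?M = "PiM EF (\<lambda>_. scaled_unif n) \<Otimes>\<^sub>M weight_law n"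
  have om: "(\<lambda>(\<tau>, w). overlay n EF \<phi> \<tau> w) \<in> ?M \<rightarrow>\<^sub>M weight_law n"
    by (rule overlay_measurable[OF F(1,2)]) simp
  have "distr ?M (weight_law n) (\<lambda>(\<tau>, w). overlay n EF \<phi> \<tau> w) = PiM (cedges n) (\<lambda>_. unif)"
  proof (rule U.PiM_eqI)
    show "finite (cedges n)" by simp
    show "sets (distr ?M (weight_law n) (\<lambda>(\<tau>, w). overlay n EF \<phi> \<tau> w)) = sets (PiM (cedges n) (\<lambda>_. unif))"
      by (simp add: weight_law_def)
    fix A assume A: "\<And>i. i \<in> cedges n \<Longrightarrow> A i \<in> sets unif"
    then have Ab: "\<And>i. i \<in> cedges n \<Longrightarrow> A i \<in> sets borel" by simp
    define A1 where "A1 = (\<lambda>e. {t. t / real n \<in> A (\<phi> ` e)})"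
    \<comment> \<open>On the copy of the pattern the value of \<open>w\<close> is overwritten and
      hence unconstrained.\<close>
    define A2 where "A2 = (\<lambda>f. if f \<in> ?J then UNIV else A f)"
    have A1: "A1 e \<in> sets borel" if "e \<in> EF" for e
    proof -
      have "(\<lambda>t. t / real n) \<in> borel_measurable borel" by measurable
      moreover have "A (\<phi> ` e) \<in> sets borel" using Ab J that by auto
      ultimately have "(\<lambda>t. t / real n) -` A (\<phi> ` e) \<inter> space borel \<in> sets borel" by (rule measurable_sets)
      then show ?thesis by (simp add: A1_def vimage_def)
    qed
    have A2: "A2 f \<in> sets borel" if "f \<in> cedges n" for f using Ab that by (simp add: A2_def)
    have boxW: "Pi\<^sub>E (cedges n) A \<in> sets (weight_law n)"
      unfolding weight_law_def using A by (intro sets_PiM_I_finite) auto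
    have pre: "(\<lambda>(\<tau>, w). overlay n EF \<phi> \<tau> w) -` Pi\<^sub>E (cedges n) A \<inter> space ?M = Pi\<^sub>E EF A1 \<times> Pi\<^sub>E (cedges n) A2"
    proof (intro equalityI subsetI)
      fix p assume p: "p \<in> (\<lambda>(\<tau>, w). overlay n EF \<phi> \<tau> w) -` Pi\<^sub>E (cedges n) A \<inter> space ?M"
      obtain \<tau> w where tw: "p = (\<tau>, w)" by fastforce
      have sp: "\<tau> \<in> extensional EF" "w \<in> extensional (cedges n)"
        using p by (auto simp: tw space_pair_measure space_PiM space_weight PiE_iff)
      have o: "overlay n EF \<phi> \<tau> w f \<in> A f" if "f \<in> cedges n" for f using p that by (auto simp: tw PiE_iff)
      have "\<tau> e \<in> A1 e" if "e \<in> EF" for e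
        using o[of "\<phi> ` e"] overlay_image[OF F that, of \<tau> w] J that by (auto simp: A1_def)
      moreover have "w f \<in> A2 f" if "f \<in> cedges n" for f
        using o[OF that] overlay_other[OF that, of \<phi> EF \<tau> w] by (auto simp: A2_def)
      ultimately show "p \<in> Pi\<^sub>E EF A1 \<times> Pi\<^sub>E (cedges n) A2" using sp by (auto simp: tw PiE_iff)
    next
      fix p assume p: "p \<in> Pi\<^sub>E EF A1 \<times> Pi\<^sub>E (cedges n) A2"
      obtain \<tau> w where tw: "p = (\<tau>, w)" by fastforce
      have t: "\<tau> e \<in> A1 e" if "e \<in> EF" for e using p that by (auto simp: tw PiE_iff)
      have w: "w f \<in> A2 f" if "f \<in> cedges n" for f using p that by (auto simp: tw PiE_iff)
      have "overlay n EF \<phi> \<tau> w f \<in> A f" if f: "f \<in> cedges n" for f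
      proof (cases "f \<in> ?J")
        case True
        then obtain e where e: "e \<in> EF" "f = \<phi> ` e" by auto
        then show ?thesis using t[OF e(1)] overlay_image[OF F e(1), of \<tau> w] by (simp add: A1_def)
      next
        case False
        then show ?thesis using w[OF f] overlay_other[OF f False, of \<tau> w] by (simp add: A2_def)
      qed
      moreover have "overlay n EF \<phi> \<tau> w \<in> extensional (cedges n)" by (simp add: overlay_def)
      moreover have "p \<in> space ?M" using p by (auto simp: tw space_pair_measure space_PiM space_weight PiE_iff)
      ultimately show "p \<in> (\<lambda>(\<tau>, w). overlay n EF \<phi> \<tau> w) -` Pi\<^sub>E (cedges n) A \<inter> space ?M"
        by (simp add: tw PiE_iff)
    qed
    have "emeasure (distr ?M (weight_law n) (\<lambda>(\<tau>, w). overlay n EF \<phi> \<tau> w)) (Pi\<^sub>E (cedges n) A) =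
      emeasure ?M (Pi\<^sub>E EF A1 \<times> Pi\<^sub>E (cedges n) A2)"
      unfolding pre[symmetric] by (rule emeasure_distr[OF om boxW])
    also have "\<dots> = emeasure (PiM EF (\<lambda>_. scaled_unif n)) (Pi\<^sub>E EF A1) * emeasure (weight_law n) (Pi\<^sub>E (cedges n) A2)"
    proof (rule W.emeasure_pair_measure_Times)
      show "Pi\<^sub>E EF A1 \<in> sets (PiM EF (\<lambda>_. scaled_unif n))" using A1 fE by (intro sets_PiM_I_finite) auto
      show "Pi\<^sub>E (cedges n) A2 \<in> sets (weight_law n)" unfolding weight_law_def using A2 by (intro sets_PiM_I_finite) auto
    qed
    also have "emeasure (PiM EF (\<lambda>_. scaled_unif n)) (Pi\<^sub>E EF A1) = (\<Prod>e\<in>EF. emeasure (scaled_unif n) (A1 e))"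
      using A1 by (intro S.emeasure_PiM fE) auto
    also have "\<dots> = (\<Prod>e\<in>EF. emeasure unif (A (\<phi> ` e)))"
      unfolding A1_def by (rule prod.cong[OF refl], rule emeasure_scaled_unif[OF n Ab]) (use J in blast)
    also have "\<dots> = (\<Prod>f\<in>?J. emeasure unif (A f))"
      by (subst prod.reindex[OF inj]) simp
    also have "emeasure (weight_law n) (Pi\<^sub>E (cedges n) A2) = (\<Prod>f\<in>cedges n. emeasure unif (A2 f))"
      unfolding weight_law_def using A2 by (intro U.emeasure_PiM) auto
    also have "\<dots> = (\<Prod>f\<in>cedges n - ?J. emeasure unif (A f))"
    proof -
      have "(\<Prod>f\<in>cedges n. emeasure unif (A2 f)) = (\<Prod>f\<in>cedges n - ?J. emeasure unif (A2 f))"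
        using prob_space.emeasure_space_1[OF prob_space_unif]
        by (intro prod.mono_neutral_right) (auto simp: A2_def simp del: emeasure_uniform_measure)
      also have "\<dots> = (\<Prod>f\<in>cedges n - ?J. emeasure unif (A f))"
        by (intro prod.cong refl) (simp add: A2_def del: emeasure_uniform_measure)
      finally show ?thesis .
    qed
    also have "(\<Prod>f\<in>?J. emeasure unif (A f)) * (\<Prod>f\<in>cedges n - ?J. emeasure unif (A f)) = (\<Prod>f\<in>cedges n. emeasure unif (A f))"
      using prod.subset_diff[OF J finite_cedges, of "\<lambda>f. emeasure unif (A f)"] by (simp add: mult.commute)
    finally have fin_eq: "emeasure (distr ?M (weight_law n) (\<lambda>(\<tau>, w). overlay n EF \<phi> \<tau> w)) (Pi\<^sub>E (cedges n) A) =
      (\<Prod>f\<in>cedges n. emeasure unif (A f))" .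
    show "emeasure (distr ?M (weight_law n) (\<lambda>(\<tau>, w). overlay n EF \<phi> \<tau> w)) (Pi\<^sub>E (cedges n) A) =
      (\<Prod>f\<in>cedges n. emeasure unif (A f))" by (rule fin_eq)
  qed
  then show ?thesis by (simp add: weight_law_def)
qed

text \<open>Here the level is itself the weight of an edge, so the finite pattern consists of
  comparisons between pairs of edges.\<close>

lemma cutev_sets:
  assumes F: "finite_simple_graph (V, EF)" "inj_on \<phi> V" "\<phi> ` V \<subseteq> {1..n}"
  shows "{w \<in> space (weight_law n). cutev n EF \<phi> w} \<in> sets (weight_law n)"
proof -
  let ?I = "cedges n \<times> cedges n"
  have "cutev n EF \<phi> w \<longleftrightarrow> (\<forall>u v. {u, v} \<in> EF \<longrightarrow>
    (\<phi> u, \<phi> v) \<notin> (adj {f. (f, \<phi> ` {u, v}) \<in> {i \<in> ?I. w (fst i) < w (snd i)}})\<^sup>*)" for w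
    unfolding cutev_def
  proof (intro all_cong1 imp_cong refl)
    fix u v assume "{u, v} \<in> EF"
    then have "\<phi> ` {u, v} \<in> cedges n" using image_edges_cedges[OF F] by blast
    then have "lower n w (w (\<phi> ` {u, v})) = {f. (f, \<phi> ` {u, v}) \<in> {i \<in> ?I. w (fst i) < w (snd i)}}"
      by (auto simp: lower_def)
    then show "((\<phi> u, \<phi> v) \<notin> (adj (lower n w (w (\<phi> ` {u, v}))))\<^sup>*) =
      ((\<phi> u, \<phi> v) \<notin> (adj {f. (f, \<phi> ` {u, v}) \<in> {i \<in> ?I. w (fst i) < w (snd i)}})\<^sup>*)" by simp
  qed
  moreover have "{w \<in> space (weight_law n). \<forall>u v. {u, v} \<in> EF \<longrightarrow>
    (\<phi> u, \<phi> v) \<notin> (adj {f. (f, \<phi> ` {u, v}) \<in> {i \<in> ?I. w (fst i) < w (snd i)}})\<^sup>*} \<in> sets (weight_law n)"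
  proof (rule finite_pattern_sets[where \<Phi> = "\<lambda>X. \<forall>u v. {u, v} \<in> EF \<longrightarrow> (\<phi> u, \<phi> v) \<notin> (adj {f. (f, \<phi> ` {u, v}) \<in> X})\<^sup>*"])
    fix i assume "i \<in> ?I"
    then have "fst i \<in> cedges n" "snd i \<in> cedges n" by auto
    then show "{w \<in> space (weight_law n). w (fst i) < w (snd i)} \<in> sets (weight_law n)"
      by (intro borel_measurable_less weight_component_measurable)
  qed simp
  ultimately show ?thesis by simp
qed

text \<open>The conditional probability of the cut event, given that the edges of the copy carry the
  weights \<tau> / n.\<close>

definition cutprob :: "nat \<Rightarrow> 'a set set \<Rightarrow> ('a \<Rightarrow> nat) \<Rightarrow> ('a set \<Rightarrow> real) \<Rightarrow> real" where
  "cutprob n EF \<phi> \<tau> = measure (weight_law n) {w \<in> space (weight_law n). cutev n EF \<phi> (overlay n EF \<phi> \<tau> w)}"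

text \<open>Fubini for the resampled weights: the section at \<tau> of the cut event has probability
  \<open>cutprob\<close>. The integral is then taken against a fixed measure, with n left only in
  the integrand, as dominated convergence requires.\<close>

lemma cut_event_integral:
  assumes F: "finite_simple_graph (V, EF)" "inj_on \<phi> V" "\<phi> ` V \<subseteq> {1..n}" and n: "n > 0"
  shows "(\<lambda>\<tau>. cutprob n EF \<phi> \<tau>) \<in> borel_measurable (PiM EF (\<lambda>_. lborel))"
    "real n ^ card EF * measure (weight_law n) {w \<in> space (weight_law n). cutev n EF \<phi> w} =
      (\<integral>\<tau>. (\<Prod>e\<in>EF. indicator {0..real n} (\<tau> e)) * cutprob n EF \<phi> \<tau> \<partial>PiM EF (\<lambda>_. lborel))"
proof -
  interpret W: prob_space "weight_law n" by simp
  let ?S = "PiM EF (\<lambda>_. scaled_unif n)" and ?L = "PiM EF (\<lambda>_. lborel :: real measure)"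
  have fE: "finite EF" using finite_simple_graphD(2)[OF F(1)] by simp
  define C where "C = {w \<in> space (weight_law n). cutev n EF \<phi> w}"
  have C: "C \<in> sets (weight_law n)" unfolding C_def by (rule cutev_sets[OF F])
  define Q where "Q = (\<lambda>(\<tau>, w). overlay n EF \<phi> \<tau> w) -` C \<inter> space (?S \<Otimes>\<^sub>M weight_law n)"
  have sets_eq: "sets ?S = sets ?L" by (intro sets_PiM_cong) auto
  have omS: "(\<lambda>(\<tau>, w). overlay n EF \<phi> \<tau> w) \<in> (?S \<Otimes>\<^sub>M weight_law n) \<rightarrow>\<^sub>M weight_law n"
    by (rule overlay_measurable[OF F(1,2)]) simp
  have QS: "Q \<in> sets (?S \<Otimes>\<^sub>M weight_law n)" unfolding Q_def using omS C by (rule measurable_sets)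
  have QL: "Q \<in> sets (?L \<Otimes>\<^sub>M weight_law n)" using QS sets_pair_measure_cong[OF sets_eq refl, of "weight_law n"] by simp
  have spS: "space ?S = space ?L" by (rule sets_eq_imp_space_eq[OF sets_eq])
  have sec: "emeasure (weight_law n) (Pair \<tau> -` Q) = ennreal (cutprob n EF \<phi> \<tau>)" if "\<tau> \<in> space ?L" for \<tau>
  proof -
    have "overlay n EF \<phi> \<tau> w \<in> space (weight_law n)" for w
      by (simp add: overlay_def space_weight)
    then have "Pair \<tau> -` Q = {w \<in> space (weight_law n). cutev n EF \<phi> (overlay n EF \<phi> \<tau> w)}"
      using that spS by (auto simp: Q_def C_def space_pair_measure)
    then show ?thesis by (simp add: cutprob_def W.emeasure_eq_measure)
  qed
  have "(\<lambda>\<tau>. emeasure (weight_law n) (Pair \<tau> -` Q)) \<in> borel_measurable ?L"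
    by (rule W.measurable_emeasure_Pair[OF QL])
  then have m1: "(\<lambda>\<tau>. enn2real (emeasure (weight_law n) (Pair \<tau> -` Q))) \<in> borel_measurable ?L"
    by (rule borel_measurable_enn2real)
  have m2: "enn2real (emeasure (weight_law n) (Pair \<tau> -` Q)) = cutprob n EF \<phi> \<tau>" if "\<tau> \<in> space ?L" for \<tau>
    unfolding sec[OF that] by (simp add: cutprob_def)
  show meas: "(\<lambda>\<tau>. cutprob n EF \<phi> \<tau>) \<in> borel_measurable ?L"
    using iffD1[OF measurable_cong[OF m2] m1] .
  let ?G = "\<lambda>\<tau>. (\<Prod>e\<in>EF. indicator {0..real n} (\<tau> e) / real n) * cutprob n EF \<phi> \<tau>"
  have Gm: "?G \<in> borel_measurable ?L" using meas by measurable
  have cp0: "0 \<le> cutprob n EF \<phi> \<tau>" for \<tau> by (simp add: cutprob_def)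
  have G0: "0 \<le> ?G \<tau>" for \<tau> using cp0 by (intro mult_nonneg_nonneg prod_nonneg) auto
  have "emeasure (weight_law n) C = emeasure (distr (?S \<Otimes>\<^sub>M weight_law n) (weight_law n) (\<lambda>(\<tau>, w). overlay n EF \<phi> \<tau> w)) C"
    by (simp only: distr_overlay[OF F n])
  also have "\<dots> = emeasure (?S \<Otimes>\<^sub>M weight_law n) Q" unfolding Q_def by (rule emeasure_distr[OF omS C])
  also have "\<dots> = (\<integral>\<^sup>+\<tau>. emeasure (weight_law n) (Pair \<tau> -` Q) \<partial>?S)" by (rule W.emeasure_pair_measure_alt[OF QS])
  also have "\<dots> = (\<integral>\<^sup>+\<tau>. (\<Prod>e\<in>EF. ennreal (indicator {0..real n} (\<tau> e) / real n)) * emeasure (weight_law n) (Pair \<tau> -` Q) \<partial>?L)"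
    unfolding PiM_scaled_unif[OF n fE]
  proof (rule nn_integral_density)
    show "(\<lambda>\<tau>. \<Prod>e\<in>EF. ennreal (indicator {0..real n} (\<tau> e) / real n)) \<in> borel_measurable ?L" by measurable
    show "(\<lambda>\<tau>. emeasure (weight_law n) (Pair \<tau> -` Q)) \<in> borel_measurable ?L" by (rule W.measurable_emeasure_Pair[OF QL])
  qed
  also have "\<dots> = (\<integral>\<^sup>+\<tau>. ennreal (?G \<tau>) \<partial>?L)"
    by (intro nn_integral_cong) (simp add: sec ennreal_mult'' cp0 prod_ennreal)
  finally have "W.prob C = enn2real (\<integral>\<^sup>+\<tau>. ennreal (?G \<tau>) \<partial>?L)" by (simp add: measure_def)
  also have "\<dots> = (\<integral>\<tau>. ?G \<tau> \<partial>?L)"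
    by (rule integral_eq_nn_integral[OF Gm, symmetric]) (rule AE_I2, rule G0)
  finally have "real n ^ card EF * W.prob C = real n ^ card EF * (\<integral>\<tau>. ?G \<tau> \<partial>?L)" by simp
  also have "\<dots> = (\<integral>\<tau>. real n ^ card EF * ?G \<tau> \<partial>?L)" by (rule integral_mult_right_zero[symmetric])
  also have "\<dots> = (\<integral>\<tau>. (\<Prod>e\<in>EF. indicator {0..real n} (\<tau> e)) * cutprob n EF \<phi> \<tau> \<partial>?L)"
    using n by (intro Bochner_Integration.integral_cong refl) (simp add: prod_dividef)
  finally show "real n ^ card EF * W.prob {w \<in> space (weight_law n). cutev n EF \<phi> w} =
      (\<integral>\<tau>. (\<Prod>e\<in>EF. indicator {0..real n} (\<tau> e)) * cutprob n EF \<phi> \<tau> \<partial>?L)" by (simp add: C_def)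
qed

text \<open>The limit functional, defined for arbitrary graphs: forests enter through
  multiplicativity, and quotients of several tree copies, possibly with cycles, enter through the
  moments.\<close>

definition psiF :: "'a sgraph \<Rightarrow> real" where
  "psiF G = (\<integral>\<tau>. (\<Prod>e\<in>gedges G. indicator {0..} (\<tau> e)) * hsep (gverts G) (gedges G) \<tau> (\<lambda>e. rho (\<tau> e))
     \<partial>PiM (gedges G) (\<lambda>_. lborel))"

lemma sep_cong_both:
  assumes "\<And>e. e \<in> EF \<Longrightarrow> \<tau> e = \<tau>' e" "\<And>e. e \<in> EF \<Longrightarrow> B e = B' e"
  shows "sep EF \<tau> B = sep EF \<tau>' B'"
proof -
  have "{(x, y). {x, y} \<in> EF \<and> \<tau> {x, y} < \<tau> {u, v}} = {(x, y). {x, y} \<in> EF \<and> \<tau>' {x, y} < \<tau>' {u, v}}"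
    if "{u, v} \<in> EF" for u v
    using assms(1)[OF that] assms(1) by auto
  then show ?thesis unfolding sep_def by (intro all_cong1 imp_cong refl) (simp add: assms(2))
qed

text \<open>Jointly in weights and labels the event is a finite pattern: \<open>Inl\<close> records
  comparisons of two rescaled weights, \<open>Inr\<close> those of a label with a giant fraction.
  The measure of its sections is then measurable in \<tau>.\<close>

lemma hsep_measurable:
  assumes fin: "finite V" "finite EF"
  shows "(\<lambda>\<tau>. hsep V EF \<tau> (\<lambda>e. rho (\<tau> e))) \<in> borel_measurable (PiM EF (\<lambda>_. lborel))"
proof -
  let ?L = "PiM EF (\<lambda>_. lborel :: real measure)" and ?U = "PiM V (\<lambda>_. unif)"
  interpret U: prob_space ?U by simp
  have rm: "rho \<in> borel_measurable borel" by (rule borel_measurable_mono[OF mono_rho])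
  define Q where "Q = {p \<in> space (?L \<Otimes>\<^sub>M ?U). sep EF (fst p) (\<lambda>e. {x \<in> V. snd p x < rho (fst p e)})}"
  define I where "I = (EF \<times> EF) <+> (V \<times> EF)"
  define P where "P = (\<lambda>i (p :: ('a set \<Rightarrow> real) \<times> ('a \<Rightarrow> real)). case i of Inl (e, e') \<Rightarrow> fst p e < fst p e' | Inr (x, e) \<Rightarrow> snd p x < rho (fst p e))"
  define \<Phi> where "\<Phi> = (\<lambda>X :: (('a set \<times> 'a set) + ('a \<times> 'a set)) set. \<forall>u v. {u, v} \<in> EF \<longrightarrow>
     (u, v) \<notin> ({(x, y). {x, y} \<in> EF \<and> Inl ({x, y}, {u, v}) \<in> X} \<union> {x \<in> V. Inr (x, {u, v}) \<in> X} \<times> {x \<in> V. Inr (x, {u, v}) \<in> X})\<^sup>*)"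
  have L: "(\<lambda>p. fst p e) \<in> borel_measurable (?L \<Otimes>\<^sub>M ?U)" if "e \<in> EF" for e
  proof -
    have "(\<lambda>\<tau>. \<tau> e) \<in> ?L \<rightarrow>\<^sub>M lborel" by (rule measurable_component_singleton[OF that])
    then have "(\<lambda>\<tau>. \<tau> e) \<in> borel_measurable ?L" by (simp only: measurable_lborel1)
    then show ?thesis by (rule measurable_compose[OF measurable_fst])
  qed
  have R: "(\<lambda>p. snd p x) \<in> borel_measurable (?L \<Otimes>\<^sub>M ?U)" if "x \<in> V" for x
    by (rule measurable_compose[OF measurable_snd PiM_unif_component[OF that]])
  have "{p \<in> space (?L \<Otimes>\<^sub>M ?U). \<Phi> {i \<in> I. P i p}} \<in> sets (?L \<Otimes>\<^sub>M ?U)"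
  proof (rule finite_pattern_sets[where \<Phi> = \<Phi>])
    show "finite I" unfolding I_def using fin by auto
    fix i assume "i \<in> I"
    then consider e e' where "i = Inl (e, e')" "e \<in> EF" "e' \<in> EF" | x e where "i = Inr (x, e)" "x \<in> V" "e \<in> EF"
      unfolding I_def by blast
    then show "{p \<in> space (?L \<Otimes>\<^sub>M ?U). P i p} \<in> sets (?L \<Otimes>\<^sub>M ?U)"
    proof cases
      case 1
      have "{p \<in> space (?L \<Otimes>\<^sub>M ?U). fst p e < fst p e'} \<in> sets (?L \<Otimes>\<^sub>M ?U)"
        by (rule borel_measurable_less[OF L[OF 1(2)] L[OF 1(3)]])
      moreover have "P i p \<longleftrightarrow> fst p e < fst p e'" for p by (simp add: P_def 1(1))
      ultimately show ?thesis by (simp only:)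
    next
      case 2
      have "{p \<in> space (?L \<Otimes>\<^sub>M ?U). snd p x < rho (fst p e)} \<in> sets (?L \<Otimes>\<^sub>M ?U)"
        by (rule borel_measurable_less[OF R[OF 2(2)] measurable_compose[OF L[OF 2(3)] rm]])
      moreover have "P i p \<longleftrightarrow> snd p x < rho (fst p e)" for p by (simp add: P_def 2(1))
      ultimately show ?thesis by (simp only:)
    qed
  qed
  moreover have "\<Phi> {i \<in> I. P i p} \<longleftrightarrow> sep EF (fst p) (\<lambda>e. {x \<in> V. snd p x < rho (fst p e)})" for p
    unfolding \<Phi>_def sep_def
  proof (intro all_cong1 imp_cong refl)
    fix u v assume uv: "{u, v} \<in> EF"
    have "{(x, y). {x, y} \<in> EF \<and> Inl ({x, y}, {u, v}) \<in> {i \<in> I. P i p}} = {(x, y). {x, y} \<in> EF \<and> fst p {x, y} < fst p {u, v}}"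
      using uv by (auto simp: I_def P_def)
    moreover have "{x \<in> V. Inr (x, {u, v}) \<in> {i \<in> I. P i p}} = {x \<in> V. snd p x < rho (fst p {u, v})}"
      using uv by (auto simp: I_def P_def)
    ultimately show "((u, v) \<notin> ({(x, y). {x, y} \<in> EF \<and> Inl ({x, y}, {u, v}) \<in> {i \<in> I. P i p}} \<union>
        {x \<in> V. Inr (x, {u, v}) \<in> {i \<in> I. P i p}} \<times> {x \<in> V. Inr (x, {u, v}) \<in> {i \<in> I. P i p}})\<^sup>*) =
      ((u, v) \<notin> ({(x, y). {x, y} \<in> EF \<and> fst p {x, y} < fst p {u, v}} \<union>
        {x \<in> V. snd p x < rho (fst p {u, v})} \<times> {x \<in> V. snd p x < rho (fst p {u, v})})\<^sup>*)"
      by (simp only:)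
  qed
  ultimately have Q: "Q \<in> sets (?L \<Otimes>\<^sub>M ?U)" by (simp add: Q_def)
  have m1: "(\<lambda>\<tau>. enn2real (emeasure ?U (Pair \<tau> -` Q))) \<in> borel_measurable ?L"
    by (rule borel_measurable_enn2real) (rule U.measurable_emeasure_Pair[OF Q])
  have m2: "enn2real (emeasure ?U (Pair \<tau> -` Q)) = hsep V EF \<tau> (\<lambda>e. rho (\<tau> e))" if "\<tau> \<in> space ?L" for \<tau>
  proof -
    have "Pair \<tau> -` Q = {U \<in> space ?U. sep EF \<tau> (\<lambda>e. {x \<in> V. U x < rho (\<tau> e)})}"
      using that by (auto simp: Q_def space_pair_measure)
    then show ?thesis by (simp add: hsep_def measure_def)
  qed
  show ?thesis using iffD1[OF measurable_cong[OF m2] m1] .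
qed

section \<open>Domination and passage to the limit under the integral\<close>

lemma AE_PiM_lborel_notin:
  assumes "N \<in> null_sets lborel" "finite I"
  shows "AE \<tau> in PiM I (\<lambda>_. lborel :: real measure). \<forall>e\<in>I. \<tau> e \<notin> N"
proof (rule AE_finite_allI[OF assms(2)])
  fix e assume e: "e \<in> I"
  interpret L: product_sigma_finite "\<lambda>_. lborel :: real measure" by unfold_locales
  let ?B = "Pi\<^sub>E I (\<lambda>i. if i = e then N else UNIV)"
  have N: "N \<in> sets borel" "emeasure lborel N = 0" using assms(1) by auto
  have "emeasure (PiM I (\<lambda>_. lborel)) ?B = (\<Prod>i\<in>I. emeasure lborel (if i = e then N else UNIV))"
    using N by (intro L.emeasure_PiM assms(2)) auto
  also have "\<dots> = 0" using e N assms(2) by (intro prod_zero) auto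
  finally have "emeasure (PiM I (\<lambda>_. lborel)) ?B = 0" .
  moreover have "?B \<in> sets (PiM I (\<lambda>_. lborel))" using N assms(2) by (intro sets_PiM_I_finite) auto
  ultimately have B: "?B \<in> null_sets (PiM I (\<lambda>_. lborel))" by (rule null_setsI)
  show "AE \<tau> in PiM I (\<lambda>_. lborel). \<tau> e \<notin> N"
  proof (rule AE_I'[OF B], rule subsetI)
    fix \<tau> assume "\<tau> \<in> {x \<in> space (PiM I (\<lambda>_. lborel)). \<not> x e \<notin> N}"
    then show "\<tau> \<in> ?B" by (simp add: space_PiM PiE_iff)
  qed
qed

lemma integrable_exp_tail:
  assumes a: "(a :: real) > 0"
  shows "integrable lborel (\<lambda>x. indicator {0..} x * exp (- a * x))"
proof -
  have m: "exponential_density a \<in> borel_measurable lborel" by simp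
  have nn: "0 \<le> exponential_density a x" for x using a by (simp add: exponential_density_def)
  have "emeasure (density lborel (\<lambda>x. ennreal (exponential_density a x))) UNIV = 1"
    using prob_space.emeasure_space_1[OF prob_space_exponential_density[OF a]] by simp
  moreover have "emeasure (density lborel (\<lambda>x. ennreal (exponential_density a x))) UNIV = (\<integral>\<^sup>+x. ennreal (exponential_density a x) \<partial>lborel)"
    using m by (subst emeasure_density) auto
  ultimately have "(\<integral>\<^sup>+x. ennreal (exponential_density a x) \<partial>lborel) = 1" by simp
  then have "integrable lborel (exponential_density a)"
    by (intro integrableI_nonneg m AE_I2 nn) simp
  then have "integrable lborel (\<lambda>x. exponential_density a x / a)" by (rule integrable_divide)
  moreover have "(\<lambda>x. exponential_density a x / a) = (\<lambda>x. indicator {0..} x * exp (- a * x))"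
    using a by (auto simp: exponential_density_def fun_eq_iff indicator_def mult.commute)
  ultimately show ?thesis by (simp only:)
qed

text \<open>The cut event forces the ends of each single edge to be separated, already in the lower
  graph without the copy. Deleting the copy leaves a graph that does not depend on the prescribed
  weights, so \<open>tail_bound\<close> applies.\<close>

lemma cutprob_tail:
  assumes F: "finite_simple_graph (V, EF)"
  shows "\<exists>C>0. \<exists>c>0. \<forall>n\<ge>max 1 (4 * card EF). \<forall>\<phi> \<tau> e. inj_on \<phi> V \<longrightarrow> \<phi> ` V \<subseteq> {1..n} \<longrightarrow> e \<in> EF \<longrightarrow>
    0 \<le> \<tau> e \<and> \<tau> e \<le> real n \<longrightarrow> cutprob n EF \<phi> \<tau> \<le> C * exp (- c * \<tau> e)"
proof -
  obtain C c where Cc: "C > 0" "c > 0" and tb: "\<forall>n\<ge>max 1 (4 * card EF). \<forall>J\<subseteq>cedges n. card J \<le> card EF \<longrightarrow>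
    (\<forall>u\<in>{1..n}. \<forall>v\<in>{1..n}. \<forall>t. 0 \<le> t \<and> t \<le> real n \<longrightarrow>
    measure (weight_law n) {w \<in> space (weight_law n). (u, v) \<notin> (adj (lower n w (t / real n) - J))\<^sup>*} \<le> C * exp (- c * t))"
    using tail_bound[of "card EF"] by auto
  have "cutprob n EF \<phi> \<tau> \<le> C * exp (- c * \<tau> e)"
    if n: "n \<ge> max 1 (4 * card EF)" and lab: "inj_on \<phi> V" "\<phi> ` V \<subseteq> {1..n}" and e: "e \<in> EF" and t: "0 \<le> \<tau> e \<and> \<tau> e \<le> real n"
    for n \<phi> \<tau> e
  proof -
    interpret prob_space "weight_law n" by simp
    have n0: "n > 0" using n by simp
    have "card e = 2" using finite_simple_graphD(4)[OF F] e by simp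
    then obtain u v where uv: "e = {u, v}" by (auto simp: card_2_iff)
    have uvV: "u \<in> V" "v \<in> V" using finite_simple_graphD(3)[OF F] e uv by auto
    let ?J = "(`) \<phi> ` EF"
    have J: "?J \<subseteq> cedges n" by (rule image_edges_cedges[OF F lab])
    have cJ: "card ?J \<le> card EF" using finite_simple_graphD(2)[OF F] by (intro card_image_le) simp
    let ?T = "{w \<in> space (weight_law n). (\<phi> u, \<phi> v) \<notin> (adj (lower n w (\<tau> e / real n) - ?J))\<^sup>*}"
    have "cutprob n EF \<phi> \<tau> \<le> prob ?T"
      unfolding cutprob_def
    proof (rule finite_measure_mono)
      show "?T \<in> events" by (rule lower_sets[where \<Phi> = "\<lambda>H. (\<phi> u, \<phi> v) \<notin> (adj (H - ?J))\<^sup>*"])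
      show "{w \<in> space (weight_law n). cutev n EF \<phi> (overlay n EF \<phi> \<tau> w)} \<subseteq> ?T"
      proof
        fix w assume w: "w \<in> {w \<in> space (weight_law n). cutev n EF \<phi> (overlay n EF \<phi> \<tau> w)}"
        then have "(\<phi> u, \<phi> v) \<notin> (adj ((lower n w (\<tau> {u, v} / real n) - ?J) \<union> (`) \<phi> ` {e \<in> EF. \<tau> e < \<tau> {u, v}}))\<^sup>*"
        proof -
          have "cutev n EF \<phi> (overlay n EF \<phi> \<tau> w)" using w by simp
          then show ?thesis using e unfolding uv cutev_overlay[OF F lab n0] by (elim allE impE)
        qed
        then show "w \<in> ?T" using w conn_mono[of "lower n w (\<tau> e / real n) - ?J"
            "(lower n w (\<tau> {u, v} / real n) - ?J) \<union> (`) \<phi> ` {e \<in> EF. \<tau> e < \<tau> {u, v}}"] by (auto simp: uv)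
      qed
    qed
    also have "\<dots> \<le> C * exp (- c * \<tau> e)"
    proof -
      have "\<phi> u \<in> {1..n}" "\<phi> v \<in> {1..n}" using lab(2) uvV by blast+
      from tb[rule_format, OF n J cJ this t] show ?thesis .
    qed
    finally show ?thesis .
  qed
  then show ?thesis using Cc by blast
qed

text \<open>The decay is available for one edge at a time. Taking the edge of largest rescaled
  weight, which is at least the average, spreads the decay over all coordinates and yields an
  integrable product.\<close>

lemma exp_max_le_prod:
  assumes "finite EF" "EF \<noteq> {}" "(c :: real) > 0" "\<And>e. e \<in> EF \<Longrightarrow> 0 \<le> \<tau> e"
  shows "\<exists>e\<in>EF. exp (- c * \<tau> e) \<le> (\<Prod>e\<in>EF. exp (- (c / real (card EF)) * \<tau> e))"
proof -
  obtain e0 where e0: "e0 \<in> EF" "\<And>e. e \<in> EF \<Longrightarrow> \<tau> e \<le> \<tau> e0"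
    using obtains_MAX[OF assms(1,2), of \<tau>] assms(1) by (metis Max_ge finite_imageI imageI)
  have m: "real (card EF) > 0" using assms by (simp add: card_gt_0_iff)
  have "(\<Sum>e\<in>EF. \<tau> e) \<le> real (card EF) * \<tau> e0" using e0(2) by (rule sum_bounded_above)
  then have "(c / real (card EF)) * (\<Sum>e\<in>EF. \<tau> e) \<le> (c / real (card EF)) * (real (card EF) * \<tau> e0)"
    using assms(3) m by (intro mult_left_mono) auto
  also have "\<dots> = c * \<tau> e0" using m by simp
  finally have "exp (- (c * \<tau> e0)) \<le> exp (- ((c / real (card EF)) * (\<Sum>e\<in>EF. \<tau> e)))" by simp
  also have "- ((c / real (card EF)) * (\<Sum>e\<in>EF. \<tau> e)) = (\<Sum>e\<in>EF. - (c / real (card EF)) * \<tau> e)"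
    by (simp add: sum_distrib_left sum_negf)
  also have "exp \<dots> = (\<Prod>e\<in>EF. exp (- (c / real (card EF)) * \<tau> e))" by (rule exp_sum[OF assms(1)])
  finally show ?thesis using e0(1) by (intro bexI[of _ e0]) simp_all
qed

lemma cut_limit_aux:
  fixes V :: "'a set" and \<phi> :: "nat \<Rightarrow> 'a \<Rightarrow> nat"
  assumes F: "finite_simple_graph (V, EF)"
    and \<phi>: "\<And>n. n \<ge> N0 \<Longrightarrow> inj_on (\<phi> n) V \<and> \<phi> n ` V \<subseteq> {1..n}"
  shows "integrable (PiM EF (\<lambda>_. lborel)) (\<lambda>\<tau>. (\<Prod>e\<in>EF. indicator {0..} (\<tau> e)) * hsep V EF \<tau> (\<lambda>e. rho (\<tau> e)))"
    "(\<lambda>n. real n ^ card EF * measure (weight_law n) {w \<in> space (weight_law n). cutev n EF (\<phi> n) w}) \<longlonglongrightarrow> psiF (V, EF)"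
proof -
  have fV: "finite V" and fE: "finite EF" using finite_simple_graphD(1,2)[OF F] by auto
  let ?L = "PiM EF (\<lambda>_. lborel :: real measure)"
  interpret L: product_sigma_finite "\<lambda>_. lborel :: real measure" by unfold_locales
  obtain C c where Cc: "C > 0" "c > 0" and tail: "\<forall>n\<ge>max 1 (4 * card EF). \<forall>\<phi> \<tau> e. inj_on \<phi> V \<longrightarrow> \<phi> ` V \<subseteq> {1..n} \<longrightarrow> e \<in> EF \<longrightarrow>
    0 \<le> \<tau> e \<and> \<tau> e \<le> real n \<longrightarrow> cutprob n EF \<phi> \<tau> \<le> C * exp (- c * \<tau> e)"
    using cutprob_tail[OF F] by auto
  \<comment> \<open>Shifting the index by \<open>N1\<close> makes the labelings and the tail bound
    available for every term of the sequence.\<close>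
  define N1 where "N1 = max N0 (max 1 (4 * card EF))"
  define f where "f = (\<lambda>\<tau>. (\<Prod>e\<in>EF. indicator {0..} (\<tau> e)) * hsep V EF \<tau> (\<lambda>e. rho (\<tau> e)))"
  define s where "s = (\<lambda>n \<tau>. (\<Prod>e\<in>EF. indicator {0..real (n + N1)} (\<tau> e)) * cutprob (n + N1) EF (\<phi> (n + N1)) \<tau>)"
  \<comment> \<open>The maximum with 1 covers the pattern without edges, where the tail bound has no
    edge to act on and the trivial bound 1 is used.\<close>
  define w where "w = (\<lambda>\<tau>. max 1 C * (\<Prod>e\<in>EF. indicator {0..} (\<tau> e) * exp (- (c / real (card EF)) * \<tau> e)))"
  have lab: "inj_on (\<phi> (n + N1)) V" "\<phi> (n + N1) ` V \<subseteq> {1..n + N1}" for n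
  proof -
    have "n + N1 \<ge> N0" by (simp add: N1_def)
    from \<phi>[OF this] show "inj_on (\<phi> (n + N1)) V" "\<phi> (n + N1) ` V \<subseteq> {1..n + N1}" by blast+
  qed
  have "N1 \<ge> 1" by (simp add: N1_def le_max_iff_disj)
  then have pos: "n + N1 > 0" for n by linarith
  have ind: "(\<lambda>\<tau>. indicator A (\<tau> e) :: real) \<in> borel_measurable ?L" if "e \<in> EF" "A \<in> sets borel" for A e
  proof -
    have "(\<lambda>\<tau>. \<tau> e) \<in> ?L \<rightarrow>\<^sub>M lborel" by (rule measurable_component_singleton[OF that(1)])
    moreover have "indicator A \<in> borel_measurable lborel" using that(2) by simp
    ultimately show ?thesis by (rule measurable_compose)
  qed
  have fm: "f \<in> borel_measurable ?L" unfolding f_def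
    by (intro borel_measurable_times borel_measurable_prod ind hsep_measurable[OF fV fE]) auto
  have sm: "s n \<in> borel_measurable ?L" for n unfolding s_def
    by (intro borel_measurable_times borel_measurable_prod ind cut_event_integral(1)[OF F lab pos]) auto
  have wi: "integrable ?L w" unfolding w_def
  proof (cases "EF = {}")
    case True
    show "integrable ?L (\<lambda>\<tau>. max 1 C * (\<Prod>e\<in>EF. indicator {0..} (\<tau> e) * exp (- (c / real (card EF)) * \<tau> e)))"
      unfolding True by (rule integrable_mult_right) (rule L.product_integrable_prod, auto)
  next
    case False
    then have "c / real (card EF) > 0" using Cc fE by (simp add: card_gt_0_iff)
    then have "integrable ?L (\<lambda>\<tau>. \<Prod>e\<in>EF. indicator {0..} (\<tau> e) * exp (- (c / real (card EF)) * \<tau> e))"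
      by (intro L.product_integrable_prod[OF fE] integrable_exp_tail)
    then show "integrable ?L (\<lambda>\<tau>. max 1 C * (\<Prod>e\<in>EF. indicator {0..} (\<tau> e) * exp (- (c / real (card EF)) * \<tau> e)))"
      by (rule integrable_mult_right)
  qed
  have dom: "norm (s n \<tau>) \<le> w \<tau>" for n \<tau>
  proof -
    have w0: "0 \<le> w \<tau>" unfolding w_def by (intro mult_nonneg_nonneg prod_nonneg) auto
    have cp: "0 \<le> cutprob (n + N1) EF (\<phi> (n + N1)) \<tau>" "cutprob (n + N1) EF (\<phi> (n + N1)) \<tau> \<le> 1"
      using prob_space.prob_le_1[OF prob_space_weight] by (auto simp: cutprob_def)
    show ?thesis
    proof (cases "\<forall>e\<in>EF. \<tau> e \<in> {0..real (n + N1)}")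
      case False
      then have "(\<Prod>e\<in>EF. indicator {0..real (n + N1)} (\<tau> e) :: real) = 0" using fE by (auto simp: prod_zero_iff indicator_def)
      then show ?thesis using w0 by (simp add: s_def)
    next
      case True
      then have s: "s n \<tau> = cutprob (n + N1) EF (\<phi> (n + N1)) \<tau>" by (simp add: s_def)
      have t0: "\<And>e. e \<in> EF \<Longrightarrow> 0 \<le> \<tau> e" using True by auto
      have w: "w \<tau> = max 1 C * (\<Prod>e\<in>EF. exp (- (c / real (card EF)) * \<tau> e))"
        unfolding w_def using t0 by (auto intro!: prod.cong simp: indicator_def)
      show ?thesis
      proof (cases "EF = {}")
        case True
        then show ?thesis using cp s w by simp
      next
        case False
        obtain e where e: "e \<in> EF" "exp (- c * \<tau> e) \<le> (\<Prod>e\<in>EF. exp (- (c / real (card EF)) * \<tau> e))"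
          using exp_max_le_prod[where \<tau> = \<tau>, OF fE False Cc(2) t0] by blast
        have "max 1 (4 * card EF) \<le> N1" unfolding N1_def by (rule max.cobounded2)
        then have n1: "n + N1 \<ge> max 1 (4 * card EF)" by (rule trans_le_add2)
        have te: "0 \<le> \<tau> e \<and> \<tau> e \<le> real (n + N1)" using True e(1) by auto
        have "cutprob (n + N1) EF (\<phi> (n + N1)) \<tau> \<le> C * exp (- c * \<tau> e)"
          using tail[rule_format, of "n + N1" "\<phi> (n + N1)" e \<tau>, OF n1 lab e(1) te] .
        also have "\<dots> \<le> max 1 C * (\<Prod>e\<in>EF. exp (- (c / real (card EF)) * \<tau> e))"
          using e(2) by (intro mult_mono) auto
        finally show ?thesis using cp s w by simp
      qed
    qed
  qed
  \<comment> \<open>Only continuity points of \<open>rho\<close> are covered by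
    \<open>conditional_cut_limit\<close>. A monotone function has countably many others, and 0 is
    added because that lemma asks for positive rescaled weights.\<close>
  define Nul where "Nul = insert 0 {a. \<not> isCont rho a}"
  have "countable Nul" unfolding Nul_def using mono_ctble_discont[OF mono_rho] by simp
  then have Nul: "Nul \<in> null_sets lborel" by (rule countable_imp_null_set_lborel)
  have lim: "AE \<tau> in ?L. (\<lambda>n. s n \<tau>) \<longlonglongrightarrow> f \<tau>"
    using AE_PiM_lborel_notin[OF Nul fE]
  proof eventually_elim
    case (elim \<tau>)
    show ?case
    proof (cases "\<forall>e\<in>EF. 0 < \<tau> e")
      case True
      then have \<tau>: "\<And>e. e \<in> EF \<Longrightarrow> 0 < \<tau> e \<and> isCont rho (\<tau> e)" using elim by (auto simp: Nul_def)
      have "(\<lambda>n. cutprob n EF (\<phi> n) \<tau>) \<longlonglongrightarrow> hsep V EF \<tau> (\<lambda>e. rho (\<tau> e))"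
        unfolding cutprob_def by (rule conditional_cut_limit[OF F \<phi> \<tau>])
      then have "(\<lambda>n. cutprob (n + N1) EF (\<phi> (n + N1)) \<tau>) \<longlonglongrightarrow> hsep V EF \<tau> (\<lambda>e. rho (\<tau> e))"
        by (rule LIMSEQ_ignore_initial_segment)
      moreover have "hsep V EF \<tau> (\<lambda>e. rho (\<tau> e)) = f \<tau>" using True by (simp add: f_def less_imp_le)
      moreover have "\<forall>\<^sub>F n in sequentially. cutprob (n + N1) EF (\<phi> (n + N1)) \<tau> = s n \<tau>"
      proof -
        have "\<forall>\<^sub>F n in sequentially. \<forall>e\<in>EF. \<tau> e \<le> real n"
        proof (intro eventually_ball_finite[OF fE] ballI)
          fix e
          show "\<forall>\<^sub>F n in sequentially. \<tau> e \<le> real n"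
            using filterlim_real_sequentially by (simp add: filterlim_at_top)
        qed
        then show ?thesis
        proof eventually_elim
          case (elim n)
          have "(\<Prod>e\<in>EF. indicator {0..real (n + N1)} (\<tau> e) :: real) = 1"
          proof (rule prod.neutral, rule ballI)
            fix e assume e: "e \<in> EF"
            then have "0 \<le> \<tau> e" "\<tau> e \<le> real n" using True elim by (auto simp: less_imp_le)
            then show "(indicator {0..real (n + N1)} (\<tau> e) :: real) = 1" by (simp add: indicator_def)
          qed
          then show ?case by (simp add: s_def)
        qed
      qed
      ultimately show ?thesis by (rule tendsto_eqI)
    next
      case False
      then obtain e where e: "e \<in> EF" "\<tau> e < 0" using elim by (auto simp: Nul_def not_less order_le_less)
      have z: "(\<Prod>e\<in>EF. indicator A (\<tau> e) :: real) = 0" if "A \<subseteq> {0..}" for A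
      proof (rule prod_zero[OF fE], rule bexI[OF _ e(1)])
        show "(indicator A (\<tau> e) :: real) = 0" using that e(2) by (auto simp: indicator_def)
      qed
      have "s n \<tau> = 0" for n using z[of "{0..real (n + N1)}"] by (simp add: s_def)
      moreover have "f \<tau> = 0" using z[of "{0..}"] by (simp add: f_def)
      ultimately show ?thesis by simp
    qed
  qed
  have if': "integrable ?L f"
    by (rule integrable_dominated_convergence[OF fm sm wi lim]) (rule AE_I2, rule dom)
  then show "integrable ?L (\<lambda>\<tau>. (\<Prod>e\<in>EF. indicator {0..} (\<tau> e)) * hsep V EF \<tau> (\<lambda>e. rho (\<tau> e)))" by (simp only: f_def)
  have "(\<lambda>n. integral\<^sup>L ?L (s n)) \<longlonglongrightarrow> integral\<^sup>L ?L f"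
    by (rule integral_dominated_convergence[OF fm sm wi lim]) (rule AE_I2, rule dom)
  moreover have "integral\<^sup>L ?L f = psiF (V, EF)" by (simp add: psiF_def f_def)
  moreover have "integral\<^sup>L ?L (s n) = real (n + N1) ^ card EF * measure (weight_law (n + N1)) {w \<in> space (weight_law (n + N1)). cutev (n + N1) EF (\<phi> (n + N1)) w}" for n
    unfolding s_def by (rule cut_event_integral(2)[OF F lab pos, symmetric])
  ultimately have "(\<lambda>n. real (n + N1) ^ card EF * measure (weight_law (n + N1)) {w \<in> space (weight_law (n + N1)). cutev (n + N1) EF (\<phi> (n + N1)) w}) \<longlonglongrightarrow> psiF (V, EF)"
    by (simp only:)
  then show "(\<lambda>n. real n ^ card EF * measure (weight_law n) {w \<in> space (weight_law n). cutev n EF (\<phi> n) w}) \<longlonglongrightarrow> psiF (V, EF)"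
    by (rule LIMSEQ_offset)
qed

section \<open>From cut events to the minimum spanning tree\<close>

text \<open>
  The tree depends on the weights only through finitely many comparisons of total weights, and so
  every function of it is measurable, whatever minimizer the choice operator selects.
\<close>

definition mst_pattern :: "nat \<Rightarrow> (nat sgraph \<times> nat sgraph) set \<Rightarrow> nat sgraph" where
  "mst_pattern n X = (SOME T. spanning_tree (complete_graph n) T \<and> \<not> (\<exists>T'. spanning_tree (complete_graph n) T' \<and> (T', T) \<in> X))"

lemma mst_eq_pattern:
  "mst n w = mst_pattern n {p \<in> {T. spanning_tree (complete_graph n) T} \<times> {T. spanning_tree (complete_graph n) T}.
     (\<Sum>e\<in>gedges (fst p). w e) < (\<Sum>e\<in>gedges (snd p). w e)}"
  unfolding mst_def mst_pattern_def arg_min_def is_arg_min_def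
  by (rule arg_cong[where f = Eps]) auto

lemma mst_event_sets: "{w \<in> space (weight_law n). \<Phi> (mst n w)} \<in> sets (weight_law n)"
  unfolding mst_eq_pattern
proof (rule finite_pattern_sets[where \<Phi> = "\<lambda>X. \<Phi> (mst_pattern n X)"])
  let ?ST = "{T. spanning_tree (complete_graph n) T}"
  show "finite (?ST \<times> ?ST)" using finite_spanning_trees by (intro finite_cartesian_product)
  have m: "(\<lambda>w. \<Sum>e\<in>gedges T. w e) \<in> borel_measurable (weight_law n)" if "T \<in> ?ST" for T
    using that by (intro borel_measurable_sum weight_component_measurable) (auto simp: spanning_tree_def)
  fix p assume "p \<in> ?ST \<times> ?ST"
  then show "{w \<in> space (weight_law n). (\<Sum>e\<in>gedges (fst p). w e) < (\<Sum>e\<in>gedges (snd p). w e)} \<in> sets (weight_law n)"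
    by (intro borel_measurable_less m) auto
qed

lemma prob_contained_eq_cut:
  assumes F: "finite_simple_graph (V, EF)" "inj_on \<phi> V" "\<phi> ` V \<subseteq> {1..n}"
  shows "prob_contained n (V, EF) \<phi> = measure (weight_law n) {w \<in> space (weight_law n). cutev n EF \<phi> w}"
proof -
  have "prob_contained n (V, EF) \<phi> = measure (weight_law n) {w \<in> space (weight_law n). \<forall>e\<in>EF. \<phi> ` e \<in> gedges (mst n w)}"
    by (simp add: prob_contained_def)
  also have "\<dots> = measure (weight_law n) {w \<in> space (weight_law n). cutev n EF \<phi> w}"
  proof (rule measure_eq_AE)
    show "{w \<in> space (weight_law n). \<forall>e\<in>EF. \<phi> ` e \<in> gedges (mst n w)} \<in> sets (weight_law n)"
      by (rule mst_event_sets[where \<Phi> = "\<lambda>T. \<forall>e\<in>EF. \<phi> ` e \<in> gedges T"])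
    show "{w \<in> space (weight_law n). cutev n EF \<phi> w} \<in> sets (weight_law n)" by (rule cutev_sets[OF F])
    show "AE w in weight_law n. (w \<in> {w \<in> space (weight_law n). \<forall>e\<in>EF. \<phi> ` e \<in> gedges (mst n w)}) =
      (w \<in> {w \<in> space (weight_law n). cutev n EF \<phi> w})"
      using AE_weight_pos[of n] AE_weight_inj[of n]
    proof eventually_elim
      case (elim w)
      have pos: "\<And>f. f \<in> cedges n \<Longrightarrow> 0 < w f" using elim(1) by blast
      have edge: "\<phi> ` {u, v} \<in> gedges (mst n w) \<longleftrightarrow> (\<phi> u, \<phi> v) \<notin> (adj (lower n w (w (\<phi> ` {u, v}))))\<^sup>*" if uv: "{u, v} \<in> EF" for u v
      proof -
        have c: "{\<phi> u, \<phi> v} \<in> cedges n" using image_edges_cedges[OF F] uv by fastforce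
        then have n: "n \<ge> 1" using pair_in_cedges by auto
        show ?thesis
        proof
          assume "\<phi> ` {u, v} \<in> gedges (mst n w)"
          then have "{\<phi> u, \<phi> v} \<in> gedges (mst n w)" by simp
          from mst_no_lighter_path[OF pos this n] show "(\<phi> u, \<phi> v) \<notin> (adj (lower n w (w (\<phi> ` {u, v}))))\<^sup>*" by simp
        next
          assume "(\<phi> u, \<phi> v) \<notin> (adj (lower n w (w (\<phi> ` {u, v}))))\<^sup>*"
          then have "(\<phi> u, \<phi> v) \<notin> (adj (lower n w (w {\<phi> u, \<phi> v})))\<^sup>*" by simp
          from mst_edge_if_cut[OF pos elim(2) c this] show "\<phi> ` {u, v} \<in> gedges (mst n w)" by simp
        qed
      qed
      have "(\<forall>e\<in>EF. \<phi> ` e \<in> gedges (mst n w)) \<longleftrightarrow> (\<forall>u v. {u, v} \<in> EF \<longrightarrow> \<phi> ` {u, v} \<in> gedges (mst n w))"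
      proof (intro iffI ballI)
        fix e assume a: "\<forall>u v. {u, v} \<in> EF \<longrightarrow> \<phi> ` {u, v} \<in> gedges (mst n w)" and e: "e \<in> EF"
        have "card e = 2" using finite_simple_graphD(4)[OF F(1)] e by simp
        then obtain u v where "e = {u, v}" by (auto simp: card_2_iff)
        then show "\<phi> ` e \<in> gedges (mst n w)" using a e by blast
      qed blast
      also have "\<dots> \<longleftrightarrow> cutev n EF \<phi> w" unfolding cutev_def by (intro all_cong1 imp_cong refl edge)
      finally show ?case by simp
    qed
  qed
  finally show ?thesis .
qed

lemma prob_contained_limit:
  fixes F :: "'a sgraph"
  assumes "finite_simple_graph F" "\<And>n. n \<ge> N0 \<Longrightarrow> labeling n F (\<phi> n)"
  shows "(\<lambda>n. real n ^ card (gedges F) * prob_contained n F (\<phi> n)) \<longlonglongrightarrow> psiF F"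
proof -
  obtain V EF where F: "F = (V, EF)" by fastforce
  have fsg: "finite_simple_graph (V, EF)" using assms(1) F by simp
  have lab: "inj_on (\<phi> n) V \<and> \<phi> n ` V \<subseteq> {1..n}" if "n \<ge> N0" for n
    using assms(2)[OF that] by (simp add: F labeling_def)
  have ev: "\<forall>\<^sub>F n in sequentially. real n ^ card EF * measure (weight_law n) {w \<in> space (weight_law n). cutev n EF (\<phi> n) w} =
    real n ^ card EF * prob_contained n F (\<phi> n)"
    using eventually_ge_at_top[of N0]
  proof eventually_elim
    case (elim n)
    then show ?case using prob_contained_eq_cut[OF fsg, of "\<phi> n" n] lab[OF elim] by (simp add: F)
  qed
  show ?thesis
    using Lim_transform_eventually[OF cut_limit_aux(2)[OF fsg lab] ev] by (simp add: F)
qed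

section \<open>Multiplicativity of the limit\<close>

text \<open>A path can pass between \<open>V1\<close> and \<open>V2\<close> only by a step inside
  \<open>B\<close>. A detour through \<open>V2\<close> therefore leaves from and returns to points
  of \<open>B \<inter> V1\<close>, which are adjacent in the restricted relation, so it can be cut
  short.\<close>

lemma merge_conn_restrict:
  assumes V: "V1 \<inter> V2 = {}" and E1: "\<And>e. e \<in> E1 \<Longrightarrow> e \<subseteq> V1" and E2: "\<And>e. e \<in> E2 \<Longrightarrow> e \<subseteq> V2"
    and B: "B \<subseteq> V1 \<union> V2" and u: "u \<in> V1" and v: "v \<in> V1"
  shows "(u, v) \<in> ({(x, y). {x, y} \<in> E1 \<union> E2 \<and> \<tau> {x, y} < t} \<union> B \<times> B)\<^sup>* \<longleftrightarrow>
    (u, v) \<in> ({(x, y). {x, y} \<in> E1 \<and> \<tau> {x, y} < t} \<union> (B \<inter> V1) \<times> (B \<inter> V1))\<^sup>*"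
    (is "_ \<in> ?R\<^sup>* \<longleftrightarrow> _ \<in> ?R1\<^sup>*")
proof
  assume "(u, v) \<in> ?R1\<^sup>*"
  moreover have "?R1\<^sup>* \<subseteq> ?R\<^sup>*" by (rule rtrancl_mono) auto
  ultimately show "(u, v) \<in> ?R\<^sup>*" by blast
next
  assume uv: "(u, v) \<in> ?R\<^sup>*"
  \<comment> \<open>While the path is in \<open>V2\<close> it is enough to remember that some point
    of \<open>B \<inter> V1\<close> has been reached.\<close>
  have "(z \<in> V1 \<and> (u, z) \<in> ?R1\<^sup>*) \<or> (z \<in> V2 \<and> (\<exists>b\<in>B \<inter> V1. (u, b) \<in> ?R1\<^sup>*))" if "(u, z) \<in> ?R\<^sup>*" for z
    using that
  proof (induction rule: rtrancl_induct)
    case base then show ?case using u by simp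
  next
    case (step y z)
    have yz: "({y, z} \<in> E1 \<and> \<tau> {y, z} < t) \<or> {y, z} \<in> E2 \<or> (y \<in> B \<and> z \<in> B)" using step(2) by auto
    from step(3) show ?case
    proof
      assume y: "y \<in> V1 \<and> (u, y) \<in> ?R1\<^sup>*"
      from yz show ?thesis
      proof (elim disjE)
        assume e: "{y, z} \<in> E1 \<and> \<tau> {y, z} < t"
        then have "z \<in> V1" "(y, z) \<in> ?R1" using E1[of "{y, z}"] by auto
        then show ?thesis using y rtrancl_into_rtrancl[of u y ?R1 z] by blast
      next
        assume "{y, z} \<in> E2"
        then have "y \<in> V2" using E2[of "{y, z}"] by auto
        then show ?thesis using y V by blast
      next
        assume b: "y \<in> B \<and> z \<in> B"
        show ?thesis
        proof (cases "z \<in> V1")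
          case True
          then have "(y, z) \<in> ?R1" using b y by auto
          then show ?thesis using y True rtrancl_into_rtrancl[of u y ?R1 z] by blast
        next
          case False
          then have "z \<in> V2" using B b by auto
          then show ?thesis using y b by blast
        qed
      qed
    next
      assume y: "y \<in> V2 \<and> (\<exists>b\<in>B \<inter> V1. (u, b) \<in> ?R1\<^sup>*)"
      then obtain b where b: "b \<in> B \<inter> V1" "(u, b) \<in> ?R1\<^sup>*" by auto
      show ?thesis
      proof (cases "z \<in> V1")
        case True
        have "{y, z} \<notin> E1" using E1[of "{y, z}"] y V by auto
        moreover have "{y, z} \<notin> E2" using E2[of "{y, z}"] True V by auto
        ultimately have "z \<in> B" using yz by auto
        then have "(b, z) \<in> ?R1" using b True by auto
        then show ?thesis using b(2) True rtrancl_into_rtrancl[of u b ?R1 z] by blast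
      next
        case False
        have "z \<in> V2"
          using yz
        proof (elim disjE)
          assume "{y, z} \<in> E1 \<and> \<tau> {y, z} < t"
          then show ?thesis using E1[of "{y, z}"] False by auto
        next
          assume "{y, z} \<in> E2" then show ?thesis using E2[of "{y, z}"] by auto
        next
          assume "y \<in> B \<and> z \<in> B" then show ?thesis using B False by auto
        qed
        then show ?thesis using b by blast
      qed
    qed
  qed
  from this[OF uv] show "(u, v) \<in> ?R1\<^sup>*" using v V by blast
qed

lemma sep_union:
  assumes V: "V1 \<inter> V2 = {}" and E1: "\<And>e. e \<in> E1 \<Longrightarrow> e \<subseteq> V1" and E2: "\<And>e. e \<in> E2 \<Longrightarrow> e \<subseteq> V2"
    and B: "\<And>e. B e \<subseteq> V1 \<union> V2"
  shows "sep (E1 \<union> E2) \<tau> B \<longleftrightarrow> sep E1 \<tau> (\<lambda>e. B e \<inter> V1) \<and> sep E2 \<tau> (\<lambda>e. B e \<inter> V2)"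
proof -
  have 1: "(u, v) \<in> ({(x, y). {x, y} \<in> E1 \<union> E2 \<and> \<tau> {x, y} < \<tau> {u, v}} \<union> B {u, v} \<times> B {u, v})\<^sup>* \<longleftrightarrow>
    (u, v) \<in> ({(x, y). {x, y} \<in> E1 \<and> \<tau> {x, y} < \<tau> {u, v}} \<union> (B {u, v} \<inter> V1) \<times> (B {u, v} \<inter> V1))\<^sup>*" if "{u, v} \<in> E1" for u v
    using E1[OF that] by (intro merge_conn_restrict[OF V E1 E2 B]) auto
  have V': "V2 \<inter> V1 = {}" and B': "B e \<subseteq> V2 \<union> V1" for e using V B[of e] by auto
  have 2: "(u, v) \<in> ({(x, y). {x, y} \<in> E1 \<union> E2 \<and> \<tau> {x, y} < \<tau> {u, v}} \<union> B {u, v} \<times> B {u, v})\<^sup>* \<longleftrightarrow>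
    (u, v) \<in> ({(x, y). {x, y} \<in> E2 \<and> \<tau> {x, y} < \<tau> {u, v}} \<union> (B {u, v} \<inter> V2) \<times> (B {u, v} \<inter> V2))\<^sup>*" if "{u, v} \<in> E2" for u v
    unfolding Un_commute[of E1 E2] using E2[OF that] by (intro merge_conn_restrict[OF V' E2 E1 B']) auto
  show ?thesis
  proof
    assume s: "sep (E1 \<union> E2) \<tau> B"
    show "sep E1 \<tau> (\<lambda>e. B e \<inter> V1) \<and> sep E2 \<tau> (\<lambda>e. B e \<inter> V2)"
    proof (intro conjI; unfold sep_def; intro allI impI)
      fix u v assume "{u, v} \<in> E1"
      then show "(u, v) \<notin> ({(x, y). {x, y} \<in> E1 \<and> \<tau> {x, y} < \<tau> {u, v}} \<union> (B {u, v} \<inter> V1) \<times> (B {u, v} \<inter> V1))\<^sup>*"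
        using s[unfolded sep_def, rule_format, of u v] 1 by simp
    next
      fix u v assume "{u, v} \<in> E2"
      then show "(u, v) \<notin> ({(x, y). {x, y} \<in> E2 \<and> \<tau> {x, y} < \<tau> {u, v}} \<union> (B {u, v} \<inter> V2) \<times> (B {u, v} \<inter> V2))\<^sup>*"
        using s[unfolded sep_def, rule_format, of u v] 2 by simp
    qed
  next
    assume s: "sep E1 \<tau> (\<lambda>e. B e \<inter> V1) \<and> sep E2 \<tau> (\<lambda>e. B e \<inter> V2)"
    show "sep (E1 \<union> E2) \<tau> B"
    proof (unfold sep_def, intro allI impI)
      fix u v assume "{u, v} \<in> E1 \<union> E2"
      then show "(u, v) \<notin> ({(x, y). {x, y} \<in> E1 \<union> E2 \<and> \<tau> {x, y} < \<tau> {u, v}} \<union> B {u, v} \<times> B {u, v})\<^sup>*"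
      proof
        assume e: "{u, v} \<in> E1"
        show ?thesis using s[THEN conjunct1, unfolded sep_def, rule_format, OF e] 1[OF e] by simp
      next
        assume e: "{u, v} \<in> E2"
        show ?thesis using s[THEN conjunct2, unfolded sep_def, rule_format, OF e] 2[OF e] by simp
      qed
    qed
  qed
qed

text \<open>Labels on disjoint vertex sets are independent, and by \<open>sep_union\<close> each
  part of the condition looks only at the labels of its own side.\<close>

lemma hsep_union:
  assumes V: "V1 \<inter> V2 = {}" and F1: "finite_simple_graph (V1, E1)" and F2: "finite_simple_graph (V2, E2)"
  shows "hsep (V1 \<union> V2) (E1 \<union> E2) \<tau> r = hsep V1 E1 \<tau> r * hsep V2 E2 \<tau> r"
proof -
  have fin: "finite V1" "finite V2" "finite E1" "finite E2" using finite_simple_graphD(1,2)[OF F1] finite_simple_graphD(1,2)[OF F2] by auto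
  have E1: "\<And>e. e \<in> E1 \<Longrightarrow> e \<subseteq> V1" using finite_simple_graphD(3)[OF F1] by simp
  have E2: "\<And>e. e \<in> E2 \<Longrightarrow> e \<subseteq> V2" using finite_simple_graphD(3)[OF F2] by simp
  interpret U: product_sigma_finite "\<lambda>_::'a. unif"
    by (intro product_sigma_finite.intro prob_space_imp_sigma_finite prob_space_unif)
  let ?M = "\<lambda>V. PiM V (\<lambda>_::'a. unif)"
  interpret P2: prob_space "?M V2" by simp
  define S where "S = (\<lambda>V E. {U \<in> space (?M V). sep E \<tau> (\<lambda>e. {x \<in> V. U x < r e})})"
  have Ss: "S V E \<in> sets (?M V)" if "finite V" "finite E" for V E unfolding S_def by (rule hsep_sets[OF that])
  have pre: "merge V1 V2 -` S (V1 \<union> V2) (E1 \<union> E2) \<inter> space (?M V1 \<Otimes>\<^sub>M ?M V2) = S V1 E1 \<times> S V2 E2"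
  proof (rule set_eqI)
    fix p
    obtain U1 U2 :: "'a \<Rightarrow> real" where p: "p = (U1, U2)" by fastforce
    have eq: "sep (E1 \<union> E2) \<tau> (\<lambda>e. {x \<in> V1 \<union> V2. merge V1 V2 (U1, U2) x < r e}) \<longleftrightarrow>
      sep E1 \<tau> (\<lambda>e. {x \<in> V1. U1 x < r e}) \<and> sep E2 \<tau> (\<lambda>e. {x \<in> V2. U2 x < r e})"
    proof -
      have "{x \<in> V1 \<union> V2. merge V1 V2 (U1, U2) x < r e} \<inter> V1 = {x \<in> V1. U1 x < r e}" for e
        by (auto simp: merge_def)
      moreover have "{x \<in> V1 \<union> V2. merge V1 V2 (U1, U2) x < r e} \<inter> V2 = {x \<in> V2. U2 x < r e}" for e
        using V by (auto simp: merge_def)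
      ultimately show ?thesis by (subst sep_union[OF V E1 E2]) auto
    qed
    have sp: "merge V1 V2 (U1, U2) \<in> space (?M (V1 \<union> V2))" if "U1 \<in> space (?M V1)" "U2 \<in> space (?M V2)"
      using measurable_space[OF measurable_merge, of "(U1, U2)" V1 "\<lambda>_. unif" V2] that by (simp add: space_pair_measure)
    show "p \<in> merge V1 V2 -` S (V1 \<union> V2) (E1 \<union> E2) \<inter> space (?M V1 \<Otimes>\<^sub>M ?M V2) \<longleftrightarrow> p \<in> S V1 E1 \<times> S V2 E2"
      using sp eq by (auto simp: p S_def space_pair_measure)
  qed
  have "emeasure (?M (V1 \<union> V2)) (S (V1 \<union> V2) (E1 \<union> E2)) =
    emeasure (distr (?M V1 \<Otimes>\<^sub>M ?M V2) (?M (V1 \<union> V2)) (merge V1 V2)) (S (V1 \<union> V2) (E1 \<union> E2))"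
    by (simp only: U.distr_merge[OF V fin(1,2)])
  also have "\<dots> = emeasure (?M V1 \<Otimes>\<^sub>M ?M V2) (S V1 E1 \<times> S V2 E2)"
    unfolding pre[symmetric] by (rule emeasure_distr[OF measurable_merge Ss]) (use fin in auto)
  also have "\<dots> = emeasure (?M V1) (S V1 E1) * emeasure (?M V2) (S V2 E2)"
    by (rule P2.emeasure_pair_measure_Times[OF Ss Ss]) (use fin in auto)
  finally have "emeasure (?M (V1 \<union> V2)) (S (V1 \<union> V2) (E1 \<union> E2)) = emeasure (?M V1) (S V1 E1) * emeasure (?M V2) (S V2 E2)" .
  then show ?thesis unfolding hsep_def measure_def S_def by (simp add: enn2real_mult)
qed

lemma exists_labeling:
  assumes "finite V" "card V \<le> n"
  shows "\<exists>\<phi>. inj_on \<phi> V \<and> \<phi> ` V \<subseteq> {1..n}"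
  using inj_on_iff_card_le[of V "{1..n}"] assms by auto

text \<open>A by-product of dominated convergence: the limiting integrand inherits the dominating
  function.\<close>

lemma integrable_psi:
  fixes V :: "'a set"
  assumes F: "finite_simple_graph (V, EF)"
  shows "integrable (PiM EF (\<lambda>_. lborel)) (\<lambda>\<tau>. (\<Prod>e\<in>EF. indicator {0..} (\<tau> e)) * hsep V EF \<tau> (\<lambda>e. rho (\<tau> e)))"
proof -
  have fV: "finite V" using finite_simple_graphD(1)[OF F] by simp
  have "\<forall>n. \<exists>\<phi>. card V \<le> n \<longrightarrow> inj_on \<phi> V \<and> \<phi> ` V \<subseteq> {1..n}" using exists_labeling[OF fV] by blast
  then obtain \<phi> where "\<And>n. card V \<le> n \<Longrightarrow> inj_on (\<phi> n) V \<and> \<phi> n ` V \<subseteq> {1..n}" by metis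
  from cut_limit_aux(1)[OF F this] show ?thesis .
qed

text \<open>For each \<tau> the integrand factorizes, each factor depends only on the coordinates of
  its own edge set, and these edge sets are disjoint. Fubini then separates the integral.\<close>

lemma psiF_union:
  fixes V1 V2 :: "'a set"
  assumes V: "V1 \<inter> V2 = {}" and F1: "finite_simple_graph (V1, E1)" and F2: "finite_simple_graph (V2, E2)"
  shows "psiF (V1 \<union> V2, E1 \<union> E2) = psiF (V1, E1) * psiF (V2, E2)"
proof -
  have fin: "finite V1" "finite V2" "finite E1" "finite E2" using finite_simple_graphD(1,2)[OF F1] finite_simple_graphD(1,2)[OF F2] by auto
  have E: "E1 \<inter> E2 = {}"
  proof (rule ccontr)
    assume "E1 \<inter> E2 \<noteq> {}"
    then obtain e where e: "e \<in> E1" "e \<in> E2" by auto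
    then have "e \<subseteq> V1" "e \<subseteq> V2" "card e = 2" using finite_simple_graphD(3,4)[OF F1] finite_simple_graphD(3)[OF F2] by auto
    then have "e = {}" "card e = 2" using V by auto
    then show False by simp
  qed
  have F: "finite_simple_graph (V1 \<union> V2, E1 \<union> E2)" using F1 F2 by (auto simp: finite_simple_graph_def)
  interpret L: product_sigma_finite "\<lambda>_::'a set. lborel :: real measure" by unfold_locales
  let ?L = "\<lambda>E. PiM E (\<lambda>_::'a set. lborel :: real measure)"
  define G where "G = (\<lambda>V E \<tau>. (\<Prod>e\<in>E. indicator {0..} (\<tau> e :: real) :: real) * hsep (V :: 'a set) E \<tau> (\<lambda>e. rho (\<tau> e)))"
  have Gcong: "G V E \<tau> = G V E \<tau>'" if "\<And>e. e \<in> E \<Longrightarrow> \<tau> e = \<tau>' e" for V E \<tau> \<tau>'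
  proof -
    have "sep E \<tau> (\<lambda>e. {x \<in> V. U x < rho (\<tau> e)}) = sep E \<tau>' (\<lambda>e. {x \<in> V. U x < rho (\<tau>' e)})" for U :: "'a \<Rightarrow> real"
      using that by (intro sep_cong_both) auto
    moreover have "(\<Prod>e\<in>E. indicator {0..} (\<tau> e) :: real) = (\<Prod>e\<in>E. indicator {0..} (\<tau>' e))"
      using that by (intro prod.cong) auto
    ultimately show ?thesis by (simp add: G_def hsep_def)
  qed
  have Gmul: "G (V1 \<union> V2) (E1 \<union> E2) \<tau> = G V1 E1 \<tau> * G V2 E2 \<tau>" for \<tau>
    using E fin by (simp add: G_def hsep_union[OF V F1 F2] prod.union_disjoint)
  have "psiF (V1 \<union> V2, E1 \<union> E2) = (\<integral>\<tau>. G (V1 \<union> V2) (E1 \<union> E2) \<tau> \<partial>?L (E1 \<union> E2))"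
    by (simp add: psiF_def G_def)
  also have "\<dots> = (\<integral>x. (\<integral>y. G (V1 \<union> V2) (E1 \<union> E2) (merge E1 E2 (x, y)) \<partial>?L E2) \<partial>?L E1)"
    using integrable_psi[OF F] unfolding G_def by (intro L.product_integral_fold E fin)
  also have "\<dots> = (\<integral>x. (\<integral>y. G V1 E1 x * G V2 E2 y \<partial>?L E2) \<partial>?L E1)"
  proof -
    have "G V1 E1 (merge E1 E2 (x, y)) = G V1 E1 x" for x y by (rule Gcong) (simp add: merge_def)
    moreover have "G V2 E2 (merge E1 E2 (x, y)) = G V2 E2 y" for x y
      by (rule Gcong) (use E in \<open>auto simp: merge_def\<close>)
    ultimately show ?thesis by (simp add: Gmul)
  qed
  also have "\<dots> = (\<integral>x. G V1 E1 x \<partial>?L E1) * (\<integral>y. G V2 E2 y \<partial>?L E2)" by simp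
  finally show ?thesis by (simp add: psiF_def G_def)
qed

lemma psiF_empty: "psiF ({}, {}) = 1"
proof -
  have F: "finite_simple_graph ({} :: 'a set, {})" by (simp add: finite_simple_graph_def)
  have "(\<lambda>n. real n ^ card (gedges ({} :: 'a set, {})) * prob_contained n ({} :: 'a set, {}) (\<lambda>_. 0)) \<longlonglongrightarrow> psiF ({} :: 'a set, {})"
    by (rule prob_contained_limit[OF F, of 0]) (simp add: labeling_def)
  moreover have "prob_contained n ({} :: 'a set, {}) (\<lambda>_. 0) = 1" for n
    using prob_space.prob_space[OF prob_space_weight[of n]] by (simp add: prob_contained_def)
  ultimately have "(\<lambda>n :: nat. 1 :: real) \<longlonglongrightarrow> psiF ({} :: 'a set, {})" by simp
  then show ?thesis using LIMSEQ_unique tendsto_const by blast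
qed

lemma psiF_Union:
  assumes "finite I" "\<And>i. i \<in> I \<Longrightarrow> finite_simple_graph (Vf i, Ef i)"
    and "\<And>i j. i \<in> I \<Longrightarrow> j \<in> I \<Longrightarrow> i \<noteq> j \<Longrightarrow> Vf i \<inter> Vf j = {}"
  shows "psiF (\<Union>i\<in>I. Vf i, \<Union>i\<in>I. Ef i) = (\<Prod>i\<in>I. psiF (Vf i, Ef i))"
  using assms
proof (induction I rule: finite_induct)
  case (insert i I)
  have d: "Vf i \<inter> (\<Union>j\<in>I. Vf j) = {}"
  proof -
    have "Vf i \<inter> Vf j = {}" if "j \<in> I" for j using insert.prems(2)[of i j] insert.hyps that by auto
    then show ?thesis by blast
  qed
  have F: "finite_simple_graph (\<Union>i\<in>I. Vf i, \<Union>i\<in>I. Ef i)"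
    using insert.prems(1) insert.hyps(1) unfolding finite_simple_graph_def by fastforce
  have "psiF (Vf i \<union> (\<Union>i\<in>I. Vf i), Ef i \<union> (\<Union>i\<in>I. Ef i)) = psiF (Vf i, Ef i) * psiF (\<Union>i\<in>I. Vf i, \<Union>i\<in>I. Ef i)"
    by (rule psiF_union[OF d insert.prems(1)[OF insertI1] F])
  moreover have "psiF (\<Union>i\<in>I. Vf i, \<Union>i\<in>I. Ef i) = (\<Prod>i\<in>I. psiF (Vf i, Ef i))"
    using insert.prems by (intro insert.IH) auto
  ultimately show ?case using insert.hyps by simp
qed (simp add: psiF_empty)

text \<open>A change of variables in the integral is avoided: a labeling \<phi> of the image and the
  labeling \<phi> \<circ> \<iota> of the original describe the same event, so both functionals are
  limits of the same sequence.\<close>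

lemma psiF_image:
  fixes \<iota> :: "'a \<Rightarrow> 'b"
  assumes F: "finite_simple_graph (V, EF)" and \<iota>: "inj_on \<iota> V"
  shows "psiF (\<iota> ` V, (`) \<iota> ` EF) = psiF (V, EF)"
proof -
  have fV: "finite V" using finite_simple_graphD(1)[OF F] by simp
  have sub: "\<And>e. e \<in> EF \<Longrightarrow> e \<subseteq> V \<and> card e = 2" using finite_simple_graphD(3,4)[OF F] by auto
  have F': "finite_simple_graph (\<iota> ` V, (`) \<iota> ` EF)"
    unfolding finite_simple_graph_def using fV sub inj_on_subset[OF \<iota>] by (auto simp: card_image)
  have cV: "card (\<iota> ` V) = card V" using \<iota> by (rule card_image)
  have cE: "card ((`) \<iota> ` EF) = card EF" by (rule card_image[OF image_inj_on_edges[OF F \<iota>]])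
  have "\<forall>n. \<exists>\<phi>. card (\<iota> ` V) \<le> n \<longrightarrow> inj_on \<phi> (\<iota> ` V) \<and> \<phi> ` (\<iota> ` V) \<subseteq> {1..n}"
    using exists_labeling[of "\<iota> ` V"] fV by blast
  then obtain \<phi> where \<phi>: "\<And>n. card (\<iota> ` V) \<le> n \<Longrightarrow> inj_on (\<phi> n) (\<iota> ` V) \<and> \<phi> n ` (\<iota> ` V) \<subseteq> {1..n}" by metis
  have l1: "(\<lambda>n. real n ^ card (gedges (\<iota> ` V, (`) \<iota> ` EF)) * prob_contained n (\<iota> ` V, (`) \<iota> ` EF) (\<phi> n)) \<longlonglongrightarrow> psiF (\<iota> ` V, (`) \<iota> ` EF)"
    by (rule prob_contained_limit[OF F', of "card V"]) (use \<phi> cV in \<open>auto simp: labeling_def\<close>)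
  have l2: "(\<lambda>n. real n ^ card (gedges (V, EF)) * prob_contained n (V, EF) (\<phi> n \<circ> \<iota>)) \<longlonglongrightarrow> psiF (V, EF)"
    by (rule prob_contained_limit[OF F, of "card V"])
       (use \<phi> cV \<iota> in \<open>auto simp: labeling_def comp_inj_on image_comp[symmetric]\<close>)
  have "prob_contained n (\<iota> ` V, (`) \<iota> ` EF) (\<phi> n) = prob_contained n (V, EF) (\<phi> n \<circ> \<iota>)" for n
    by (simp add: prob_contained_def image_comp)
  then show ?thesis using LIMSEQ_unique[OF l1] l2 cE by simp
qed

lemma psiF_components:
  fixes F :: "'a sgraph"
  assumes F: "finite_simple_graph F"
  shows "psiF F = (\<Prod>T\<in>gcomponents F. psiF T)"
proof -
  define V where "V = gverts F"
  define E where "E = gedges F"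
  have FV: "F = (V, E)" by (simp add: V_def E_def)
  define comp_of where "comp_of = (\<lambda>u. (cluster E u, {e \<in> E. e \<subseteq> cluster E u}))"
  have gc: "gcomponents F = comp_of ` V"
    by (simp add: gcomponents_def comp_of_def Let_def gadj_eq cluster_def V_def E_def)
  have fV: "finite V" and sub: "\<And>e. e \<in> E \<Longrightarrow> e \<subseteq> V \<and> card e = 2" using finite_simple_graphD[OF F] by (auto simp: V_def E_def)
  have cl: "cluster E u \<subseteq> V" if "u \<in> V" for u by (rule cluster_subset) (use sub that in auto)
  have fsg: "finite_simple_graph (gverts T, gedges T)" if "T \<in> gcomponents F" for T
    using that sub cl finite_subset[OF cl fV] unfolding gc by (auto simp: comp_of_def finite_simple_graph_def)
  have disj: "gverts T \<inter> gverts T' = {}" if T: "T \<in> gcomponents F" "T' \<in> gcomponents F" "T \<noteq> T'" for T T'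
  proof (rule ccontr)
    assume ne: "gverts T \<inter> gverts T' \<noteq> {}"
    obtain u u' where u: "T = comp_of u" "T' = comp_of u'" using T unfolding gc by auto
    then obtain z where "z \<in> cluster E u" "z \<in> cluster E u'" using ne by (auto simp: comp_of_def)
    then have "cluster E u = cluster E z" "cluster E u' = cluster E z" by (auto simp: mem_cluster cluster_eq_iff)
    then have "cluster E u = cluster E u'" by simp
    then show False using u T(3) by (simp add: comp_of_def)
  qed
  have UV: "(\<Union>T\<in>gcomponents F. gverts T) = V"
    unfolding gc using cl self_in_cluster by (auto simp: comp_of_def)
  have UE: "(\<Union>T\<in>gcomponents F. gedges T) = E"
  proof (intro equalityI subsetI)
    fix e assume e: "e \<in> E"
    then have "card e = 2" "e \<subseteq> V" using sub by auto
    then obtain a b where ab: "e = {a, b}" "a \<in> V" by (auto simp: card_2_iff)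
    have "(a, b) \<in> adj E" using e ab by (simp add: adj_def)
    then have "e \<subseteq> cluster E a" using ab by (auto simp: mem_cluster)
    then show "e \<in> (\<Union>T\<in>gcomponents F. gedges T)" unfolding gc using e ab(2) by (auto simp: comp_of_def)
  qed (auto simp: gc comp_of_def)
  have "psiF (\<Union>T\<in>gcomponents F. gverts T, \<Union>T\<in>gcomponents F. gedges T) = (\<Prod>T\<in>gcomponents F. psiF (gverts T, gedges T))"
    by (rule psiF_Union) (use fV fsg disj in \<open>auto simp: gc\<close>)
  then have "psiF (V, E) = (\<Prod>T\<in>gcomponents F. psiF (gverts T, gedges T))" by (simp only: UV UE)
  then show ?thesis by (simp only: FV[symmetric] prod.collapse)
qed

lemma psiF_isomorphic:
  fixes T :: "'a sgraph" and T' :: "'b sgraph"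
  assumes T: "finite_simple_graph T" and T': "finite_simple_graph T'" and iso: "gisomorphic T T'"
  shows "psiF T = psiF T'"
proof -
  obtain \<iota> where \<iota>: "bij_betw \<iota> (gverts T) (gverts T')"
    "\<And>u v. u \<in> gverts T \<Longrightarrow> v \<in> gverts T \<Longrightarrow> {u, v} \<in> gedges T \<longleftrightarrow> {\<iota> u, \<iota> v} \<in> gedges T'"
    using iso unfolding gisomorphic_def by blast
  have im: "gverts T' = \<iota> ` gverts T" and inj: "inj_on \<iota> (gverts T)" using \<iota>(1) by (auto simp: bij_betw_def)
  have "gedges T' = (`) \<iota> ` gedges T"
  proof (intro equalityI subsetI)
    fix e' assume e': "e' \<in> gedges T'"
    then have "card e' = 2" "e' \<subseteq> gverts T'" using finite_simple_graphD(3,4)[OF T'] by auto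
    then obtain a' b' where ab': "e' = {a', b'}" "a' \<in> \<iota> ` gverts T" "b' \<in> \<iota> ` gverts T" by (auto simp: card_2_iff im)
    then obtain a b where ab: "a \<in> gverts T" "b \<in> gverts T" "a' = \<iota> a" "b' = \<iota> b" by auto
    then have "{a, b} \<in> gedges T" using \<iota>(2)[OF ab(1,2)] e' ab' by simp
    moreover have "e' = \<iota> ` {a, b}" using ab' ab by simp
    ultimately show "e' \<in> (`) \<iota> ` gedges T" by blast
  next
    fix e' assume "e' \<in> (`) \<iota> ` gedges T"
    then obtain e where e: "e \<in> gedges T" "e' = \<iota> ` e" by auto
    then have "card e = 2" "e \<subseteq> gverts T" using finite_simple_graphD(3,4)[OF T] by auto
    then obtain a b where ab: "e = {a, b}" "a \<in> gverts T" "b \<in> gverts T" by (auto simp: card_2_iff)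
    then show "e' \<in> gedges T'" using \<iota>(2)[OF ab(2,3)] e by simp
  qed
  moreover have "psiF (\<iota> ` gverts T, (`) \<iota> ` gedges T) = psiF (gverts T, gedges T)"
    by (rule psiF_image) (use T inj in auto)
  ultimately show ?thesis using im by (metis prod.collapse)
qed

section \<open>Moments of the number of copies\<close>

definition emb :: "nat \<Rightarrow> 'a sgraph \<Rightarrow> (nat set \<Rightarrow> real) \<Rightarrow> ('a \<Rightarrow> nat) set" where
  "emb n Q w = {h \<in> gverts Q \<rightarrow>\<^sub>E {1..n}. inj_on h (gverts Q) \<and> (\<forall>e\<in>gedges Q. h ` e \<in> gedges (mst n w))}"

lemma mst_integrable:
  fixes h :: "nat sgraph \<Rightarrow> real"
  shows "integrable (weight_law n) (\<lambda>w. h (mst n w))"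
  unfolding mst_eq_pattern
proof (rule finite_pattern_integrable[where h = "\<lambda>X. h (mst_pattern n X)"])
  let ?ST = "{T. spanning_tree (complete_graph n) T}"
  show "finite_measure (weight_law n)" by (intro prob_space.finite_measure) simp
  show "finite (?ST \<times> ?ST)" using finite_spanning_trees by (intro finite_cartesian_product)
  have m: "(\<lambda>w. \<Sum>e\<in>gedges T. w e) \<in> borel_measurable (weight_law n)" if "T \<in> ?ST" for T
    using that by (intro borel_measurable_sum weight_component_measurable) (auto simp: spanning_tree_def)
  fix p assume "p \<in> ?ST \<times> ?ST"
  then show "{w \<in> space (weight_law n). (\<Sum>e\<in>gedges (fst p). w e) < (\<Sum>e\<in>gedges (snd p). w e)} \<in> sets (weight_law n)"
    by (intro borel_measurable_less m) auto
qed

lemma num_copies_eq_emb: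
  assumes "finite_simple_graph T"
  shows "num_copies n T w = card (emb n T w)"
proof -
  have "(\<forall>u v. {u, v} \<in> gedges T \<longrightarrow> {f u, f v} \<in> gedges (mst n w)) \<longleftrightarrow> (\<forall>e\<in>gedges T. f ` e \<in> gedges (mst n w))" for f
  proof (intro iffI ballI allI impI)
    fix e assume a: "\<forall>u v. {u, v} \<in> gedges T \<longrightarrow> {f u, f v} \<in> gedges (mst n w)" and e: "e \<in> gedges T"
    have "card e = 2" using finite_simple_graphD(4)[OF assms e] .
    then obtain u v where "e = {u, v}" by (auto simp: card_2_iff)
    then show "f ` e \<in> gedges (mst n w)" using a e by simp
  next
    fix u v assume a: "\<forall>e\<in>gedges T. f ` e \<in> gedges (mst n w)" and e: "{u, v} \<in> gedges T"
    from bspec[OF a e] show "{f u, f v} \<in> gedges (mst n w)" by simp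
  qed
  then show ?thesis by (simp add: num_copies_def emb_def)
qed

text \<open>The limit theorem lets the labeling vary with n. Choosing for each n a labeling that
  violates the bound, if there is one, turns pointwise convergence into convergence uniform over
  labelings.\<close>

lemma prob_contained_uniform:
  fixes Q :: "'a sgraph"
  assumes Q: "finite_simple_graph Q" and \<epsilon>: "\<epsilon> > 0"
  shows "\<forall>\<^sub>F n in sequentially. \<forall>h. labeling n Q h \<longrightarrow> \<bar>real n ^ card (gedges Q) * prob_contained n Q h - psiF Q\<bar> < \<epsilon>"
proof -
  let ?a = "\<lambda>n h. real n ^ card (gedges Q) * prob_contained n Q h"
  define P where "P = (\<lambda>n h. labeling n Q h \<and> ((\<exists>h'. labeling n Q h' \<and> \<not> \<bar>?a n h' - psiF Q\<bar> < \<epsilon>) \<longrightarrow> \<not> \<bar>?a n h - psiF Q\<bar> < \<epsilon>))"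
  have "\<exists>h. P n h" if cn: "card (gverts Q) \<le> n" for n
  proof (cases "\<exists>h'. labeling n Q h' \<and> \<not> \<bar>?a n h' - psiF Q\<bar> < \<epsilon>")
    case True
    then show ?thesis unfolding P_def by blast
  next
    case False
    obtain h where "inj_on h (gverts Q) \<and> h ` gverts Q \<subseteq> {1..n}"
      using exists_labeling[OF finite_simple_graphD(1)[OF Q] cn] by blast
    then have "P n h" using False by (simp add: P_def labeling_def)
    then show ?thesis by blast
  qed
  then have "\<forall>n. \<exists>h. card (gverts Q) \<le> n \<longrightarrow> P n h" by blast
  then obtain \<phi> where \<phi>: "\<And>n. card (gverts Q) \<le> n \<Longrightarrow> P n (\<phi> n)" by metis
  have "(\<lambda>n. ?a n (\<phi> n)) \<longlonglongrightarrow> psiF Q"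
    by (rule prob_contained_limit[OF Q, of "card (gverts Q)"]) (use \<phi> in \<open>simp add: P_def\<close>)
  then have "\<forall>\<^sub>F n in sequentially. dist (?a n (\<phi> n)) (psiF Q) < \<epsilon>" using \<epsilon> by (rule tendstoD)
  then show ?thesis
    using eventually_ge_at_top[of "card (gverts Q)"]
  proof eventually_elim
    case (elim n)
    have "\<bar>?a n (\<phi> n) - psiF Q\<bar> < \<epsilon>" using elim(1) by (simp add: dist_real_def)
    then show ?case using \<phi>[OF elim(2)] by (auto simp: P_def)
  qed
qed

lemma injections_fraction:
  assumes "finite V"
  shows "(\<lambda>n. real (card {h \<in> V \<rightarrow>\<^sub>E {1..n}. inj_on h V}) / real n ^ card V) \<longlonglongrightarrow> 1"
proof -
  have b: "1 - (real (card V))\<^sup>2 / real n \<le> real (card {h \<in> V \<rightarrow>\<^sub>E {1..n}. inj_on h V}) / real n ^ card V \<and>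
    real (card {h \<in> V \<rightarrow>\<^sub>E {1..n}. inj_on h V}) / real n ^ card V \<le> 1" if n: "n > 0" for n
  proof -
    let ?I = "{h \<in> V \<rightarrow>\<^sub>E {1..n}. inj_on h V}" and ?N = "{h \<in> V \<rightarrow>\<^sub>E {1..n}. \<not> inj_on h V}"
    have fin: "finite (V \<rightarrow>\<^sub>E {1..n})" using assms by (intro finite_PiE) auto
    have "card (V \<rightarrow>\<^sub>E {1..n}) = card (?I \<union> ?N)" by (rule arg_cong[where f = card]) auto
    also have "\<dots> = card ?I + card ?N" by (rule card_Un_disjoint) (use fin in auto)
    finally have "n ^ card V = card ?I + card ?N" using assms by (simp add: card_funcsetE)
    then have "real (n ^ card V) = real (card ?I + card ?N)" by (rule arg_cong)
    then have c: "real n ^ card V = real (card ?I) + real (card ?N)" by simp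
    have nv: "real n ^ card V > 0" using n by simp
    have "real (card ?N) / real n ^ card V \<le> (real (card V))\<^sup>2 * real n ^ (card V - 1) / real n ^ card V"
      using card_noninjective[OF assms, of n] nv by (intro divide_right_mono) auto
    also have "\<dots> \<le> (real (card V))\<^sup>2 / real n"
    proof (cases "card V")
      case (Suc j)
      then show ?thesis using n by simp
    qed simp
    finally have N: "real (card ?N) / real n ^ card V \<le> (real (card V))\<^sup>2 / real n" .
    have "real (card ?I) / real n ^ card V = 1 - real (card ?N) / real n ^ card V"
    proof -
      have "real (card ?I) = real n ^ card V - real (card ?N)" using c by simp
      then show ?thesis using nv by (simp only: diff_divide_distrib) simp
    qed
    moreover have "0 \<le> real (card ?N) / real n ^ card V" by simp
    ultimately show ?thesis using N by linarith
  qed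
  have lo: "(\<lambda>n. 1 - (real (card V))\<^sup>2 / real n) \<longlonglongrightarrow> 1"
    using tendsto_diff[OF tendsto_const lim_const_over_n[of "(real (card V))\<^sup>2"], of 1] by simp
  show ?thesis
    by (rule tendsto_sandwich[OF _ _ lo tendsto_const]) (use b in \<open>auto intro!: eventually_sequentiallyI[of 1]\<close>)
qed

lemma mean_emb_sum:
  assumes Q: "finite_simple_graph Q"
  shows "(\<integral>w. real (card (emb n Q w)) \<partial>weight_law n) = (\<Sum>h\<in>{h \<in> gverts Q \<rightarrow>\<^sub>E {1..n}. inj_on h (gverts Q)}. prob_contained n Q h)"
proof -
  interpret prob_space "weight_law n" by simp
  let ?I = "{h \<in> gverts Q \<rightarrow>\<^sub>E {1..n}. inj_on h (gverts Q)}"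
  have fin: "finite ?I"
    by (rule finite_subset[of _ "gverts Q \<rightarrow>\<^sub>E {1..n}"], force) (use finite_simple_graphD(1)[OF Q] in \<open>auto intro: finite_PiE\<close>)
  have ms: "{w \<in> space (weight_law n). \<forall>e\<in>gedges Q. h ` e \<in> gedges (mst n w)} \<in> events" for h
    by (rule mst_event_sets[where \<Phi> = "\<lambda>T. \<forall>e\<in>gedges Q. h ` e \<in> gedges T"])
  have "real (card (emb n Q w)) = (\<Sum>h\<in>?I. of_bool (\<forall>e\<in>gedges Q. h ` e \<in> gedges (mst n w)))" for w
  proof -
    have "emb n Q w = ?I \<inter> {h. \<forall>e\<in>gedges Q. h ` e \<in> gedges (mst n w)}" by (auto simp: emb_def)
    then show ?thesis using fin by (simp add: sum.If_cases of_bool_def)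
  qed
  then have "(\<integral>w. real (card (emb n Q w)) \<partial>weight_law n) =
    (\<integral>w. (\<Sum>h\<in>?I. of_bool (\<forall>e\<in>gedges Q. h ` e \<in> gedges (mst n w))) \<partial>weight_law n)" by simp
  also have "\<dots> = (\<Sum>h\<in>?I. \<integral>w. of_bool (\<forall>e\<in>gedges Q. h ` e \<in> gedges (mst n w)) \<partial>weight_law n)"
    by (rule Bochner_Integration.integral_sum) (rule mst_integrable[where h = "\<lambda>T. of_bool (\<forall>e\<in>gedges Q. _ ` e \<in> gedges T)"])
  also have "\<dots> = (\<Sum>h\<in>?I. prob_contained n Q h)"
    by (simp only: integral_of_bool[OF ms] prob_contained_def)
  finally show ?thesis .
qed

text \<open>There are about n^v injections for v vertices, each contributing about
  \<open>psiF Q\<close> divided by n^m for m edges. The normalization is kept as a quotient of two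
  powers since a quotient graph may have more edges than vertices.\<close>

lemma mean_emb_limit:
  fixes Q :: "'a sgraph"
  assumes Q: "finite_simple_graph Q"
  shows "(\<lambda>n. (\<integral>w. real (card (emb n Q w)) \<partial>weight_law n) * real n ^ card (gedges Q) / real n ^ card (gverts Q)) \<longlonglongrightarrow> psiF Q"
proof -
  let ?I = "\<lambda>n. {h \<in> gverts Q \<rightarrow>\<^sub>E {1..n}. inj_on h (gverts Q)}"
  let ?v = "card (gverts Q)" and ?m = "card (gedges Q)"
  define f where "f = (\<lambda>n. real (card (?I n)) / real n ^ ?v)"
  define g where "g = (\<lambda>n. (\<integral>w. real (card (emb n Q w)) \<partial>weight_law n) * real n ^ ?m / real n ^ ?v)"
  have f: "f \<longlonglongrightarrow> 1" unfolding f_def by (rule injections_fraction[OF finite_simple_graphD(1)[OF Q]])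
  have "(\<lambda>n. g n - f n * psiF Q) \<longlonglongrightarrow> 0"
  proof (rule LIMSEQ_I)
    fix r :: real assume r: "r > 0"
    have ev: "\<forall>\<^sub>F n in sequentially. f n < 2" using f by (rule order_tendstoD(2)) simp
    have half: "r / 2 > 0" using r by simp
    have "\<forall>\<^sub>F n in sequentially. norm (g n - f n * psiF Q - 0) < r"
      using prob_contained_uniform[OF Q half] ev
    proof eventually_elim
      case (elim n)
      have lab: "labeling n Q h" if "h \<in> ?I n" for h using that by (auto simp: labeling_def)
      have f0: "0 \<le> f n" by (simp add: f_def)
      have "g n - f n * psiF Q = (\<Sum>h\<in>?I n. real n ^ ?m * prob_contained n Q h - psiF Q) / real n ^ ?v"
        unfolding g_def f_def mean_emb_sum[OF Q] by (simp only: sum_subtractf sum_distrib_left[symmetric] sum_constant diff_divide_distrib) (simp only: mult.commute[of "real n ^ ?m"] times_divide_eq_left)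
      then have "\<bar>g n - f n * psiF Q\<bar> = \<bar>\<Sum>h\<in>?I n. real n ^ ?m * prob_contained n Q h - psiF Q\<bar> / real n ^ ?v"
        by simp
      also have "\<dots> \<le> (\<Sum>h\<in>?I n. r / 2) / real n ^ ?v"
      proof (intro divide_right_mono order_trans[OF sum_abs] sum_mono)
        fix h assume "h \<in> ?I n"
        then show "\<bar>real n ^ ?m * prob_contained n Q h - psiF Q\<bar> \<le> r / 2" using elim(1) lab by (simp add: less_imp_le)
      qed simp
      also have "\<dots> = f n * (r / 2)" by (simp add: f_def)
      also have "\<dots> < 2 * (r / 2)" using elim(2) r by (intro mult_strict_right_mono) auto
      finally show ?case by simp
    qed
    then show "\<exists>no. \<forall>n\<ge>no. norm (g n - f n * psiF Q - 0) < r" by (simp add: eventually_sequentially)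
  qed
  from tendsto_add[OF this tendsto_mult[OF f tendsto_const[of "psiF Q"]]] have "g \<longlonglongrightarrow> psiF Q" by simp
  then show ?thesis by (simp only: g_def)
qed

section \<open>Kernels and quotients of disjoint copies of a tree\<close>

definition ker_rep :: "('b \<times> 'b) set \<Rightarrow> 'b \<Rightarrow> 'b" where
  "ker_rep \<kappa> d = (SOME d'. d' \<in> \<kappa> `` {d})"

lemma ker_rep:
  assumes "equiv D \<kappa>" "d \<in> D"
  shows "(d, ker_rep \<kappa> d) \<in> \<kappa>" "ker_rep \<kappa> d \<in> D"
    "d' \<in> D \<Longrightarrow> ker_rep \<kappa> d = ker_rep \<kappa> d' \<longleftrightarrow> (d, d') \<in> \<kappa>"
proof -
  have r: "(x, ker_rep \<kappa> x) \<in> \<kappa>" if "x \<in> D" for x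
  proof -
    have "x \<in> \<kappa> `` {x}" using equiv_class_self[OF assms(1) that] .
    then have "ker_rep \<kappa> x \<in> \<kappa> `` {x}" unfolding ker_rep_def by (rule someI)
    then show ?thesis by simp
  qed
  show 1: "(d, ker_rep \<kappa> d) \<in> \<kappa>" by (rule r[OF assms(2)])
  show "ker_rep \<kappa> d \<in> D" using 1 equiv_type[OF assms(1)] by auto
  show "ker_rep \<kappa> d = ker_rep \<kappa> d' \<longleftrightarrow> (d, d') \<in> \<kappa>" if d': "d' \<in> D"
  proof
    assume "ker_rep \<kappa> d = ker_rep \<kappa> d'"
    then have "(d, ker_rep \<kappa> d) \<in> \<kappa>" "(d', ker_rep \<kappa> d) \<in> \<kappa>" using 1 r[OF d'] by auto
    then show "(d, d') \<in> \<kappa>" using assms(1) unfolding equiv_def sym_def trans_def by blast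
  next
    assume "(d, d') \<in> \<kappa>"
    then have "\<kappa> `` {d} = \<kappa> `` {d'}" by (rule equiv_class_eq[OF assms(1)])
    then show "ker_rep \<kappa> d = ker_rep \<kappa> d'" by (simp add: ker_rep_def)
  qed
qed

definition copies_verts :: "nat \<Rightarrow> 'a set \<Rightarrow> (nat \<times> 'a) set" where
  "copies_verts k V = {..<k} \<times> V"

definition copies_edges :: "nat \<Rightarrow> 'a set set \<Rightarrow> (nat \<times> 'a) set set" where
  "copies_edges k E = (\<Union>i\<in>{..<k}. (`) (Pair i) ` E)"

text \<open>
  A \<open>k\<close>-tuple of embeddings is a map on \<open>k\<close> disjoint copies of the tree that is injective on each
  copy; its kernel records the coincidences between different copies.
\<close>

definition good_kernels :: "nat \<Rightarrow> 'a set \<Rightarrow> ((nat \<times> 'a) \<times> (nat \<times> 'a)) set set" where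
  "good_kernels k V = {\<kappa>. equiv (copies_verts k V) \<kappa> \<and> (\<forall>i x y. ((i, x), (i, y)) \<in> \<kappa> \<longrightarrow> x = y)}"

text \<open>Classes are replaced by chosen representatives, so the quotient is again a graph on
  pairs of a copy index and a vertex. Edges of different copies with the same image are
  merged.\<close>

definition quotient_graph :: "nat \<Rightarrow> 'a sgraph \<Rightarrow> ((nat \<times> 'a) \<times> (nat \<times> 'a)) set \<Rightarrow> (nat \<times> 'a) sgraph" where
  "quotient_graph k T \<kappa> = (ker_rep \<kappa> ` copies_verts k (gverts T), (`) (ker_rep \<kappa>) ` copies_edges k (gedges T))"

lemma finite_good_kernels: "finite V \<Longrightarrow> finite (good_kernels k V)"
  by (rule finite_subset[of _ "Pow (copies_verts k V \<times> copies_verts k V)"])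
     (auto simp: good_kernels_def copies_verts_def dest!: equiv_type)

text \<open>Edges keep two ends because a good kernel never identifies two vertices of the same
  copy.\<close>

lemma quotient_fsg:
  assumes T: "finite_simple_graph T" and \<kappa>: "\<kappa> \<in> good_kernels k (gverts T)"
  shows "finite_simple_graph (quotient_graph k T \<kappa>)"
proof -
  let ?D = "copies_verts k (gverts T)"
  have eq: "equiv ?D \<kappa>" and inj: "\<And>i x y. ((i, x), (i, y)) \<in> \<kappa> \<Longrightarrow> x = y" using \<kappa> by (auto simp: good_kernels_def)
  have fin: "finite ?D" using finite_simple_graphD(1)[OF T] by (simp add: copies_verts_def)
  have "e \<subseteq> ker_rep \<kappa> ` ?D \<and> card e = 2" if e: "e \<in> (`) (ker_rep \<kappa>) ` copies_edges k (gedges T)" for e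
  proof -
    obtain i e0 where e0: "i < k" "e0 \<in> gedges T" "e = ker_rep \<kappa> ` (Pair i ` e0)"
      using e unfolding copies_edges_def by blast
    have sub: "e0 \<subseteq> gverts T" "card e0 = 2" using finite_simple_graphD(3,4)[OF T e0(2)] by auto
    have subD: "Pair i ` e0 \<subseteq> ?D" using sub(1) e0(1) by (auto simp: copies_verts_def)
    have "inj_on (\<lambda>x. ker_rep \<kappa> (i, x)) e0"
    proof (rule inj_onI)
      fix x y assume xy: "x \<in> e0" "y \<in> e0" "ker_rep \<kappa> (i, x) = ker_rep \<kappa> (i, y)"
      have "(i, x) \<in> ?D" "(i, y) \<in> ?D" using subD xy by auto
      then have "((i, x), (i, y)) \<in> \<kappa>" using ker_rep(3)[OF eq] xy(3) by blast
      then show "x = y" by (rule inj)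
    qed
    moreover have "e = (\<lambda>x. ker_rep \<kappa> (i, x)) ` e0" unfolding e0(3) by (simp add: image_image)
    ultimately have "card e = 2" using sub(2) by (simp add: card_image)
    then show ?thesis using subD e0(3) by auto
  qed
  then show ?thesis using fin by (simp add: finite_simple_graph_def quotient_graph_def)
qed

text \<open>A k-tuple of embeddings is one map on k disjoint copies. Sorting these maps by their
  kernel leaves, for each kernel, exactly the injective embeddings of the corresponding
  quotient.\<close>

lemma num_copies_power:
  fixes T :: "'a sgraph"
  assumes T: "finite_simple_graph T"
  shows "card (emb n T w) ^ k = (\<Sum>\<kappa>\<in>good_kernels k (gverts T). card (emb n (quotient_graph k T \<kappa>) w))"
proof -
  let ?V = "gverts T" and ?E = "gedges T"
  let ?D = "copies_verts k ?V"
  have fV: "finite ?V" using finite_simple_graphD(1)[OF T] .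
  have fD: "finite ?D" using fV by (simp add: copies_verts_def)
  define M where "M = gedges (mst n w)"
  define GM where "GM = {g \<in> ?D \<rightarrow>\<^sub>E {1..n}. (\<forall>i<k. inj_on (\<lambda>x. g (i, x)) ?V) \<and> (\<forall>e\<in>copies_edges k ?E. g ` e \<in> M)}"
  have fGM: "finite GM"
    by (rule finite_subset[of _ "?D \<rightarrow>\<^sub>E {1..n}"], force simp: GM_def) (use fD in \<open>auto intro: finite_PiE\<close>)
  define cur where "cur = (\<lambda>(g :: nat \<times> 'a \<Rightarrow> nat). \<lambda>i\<in>{..<k}. \<lambda>x\<in>?V. g (i, x))"
  \<comment> \<open>Currying between maps on the disjoint copies and k-tuples of embeddings.\<close>
  have "bij_betw cur GM ({..<k} \<rightarrow>\<^sub>E emb n T w)"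
  proof (rule bij_betwI[where g = "\<lambda>G. \<lambda>d\<in>?D. G (fst d) (snd d)"])
    show "cur \<in> GM \<rightarrow> {..<k} \<rightarrow>\<^sub>E emb n T w"
    proof
      fix g assume g: "g \<in> GM"
      have "(\<lambda>x\<in>?V. g (i, x)) \<in> emb n T w" if i: "i < k" for i
      proof -
        have "inj_on (\<lambda>x. g (i, x)) ?V" using g i by (simp add: GM_def)
        then have 1: "inj_on (\<lambda>x\<in>?V. g (i, x)) ?V" by (simp add: inj_on_def)
        have 2: "(\<lambda>x\<in>?V. g (i, x)) \<in> ?V \<rightarrow>\<^sub>E {1..n}" using g i by (auto simp: GM_def copies_verts_def PiE_iff)
        have 3: "(\<lambda>x\<in>?V. g (i, x)) ` e \<in> M" if e: "e \<in> ?E" for e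
        proof -
          have "(\<lambda>x\<in>?V. g (i, x)) ` e = g ` (Pair i ` e)"
            using finite_simple_graphD(3)[OF T e] by (auto simp: image_image intro!: image_cong)
          moreover have "Pair i ` e \<in> copies_edges k ?E" using e i by (auto simp: copies_edges_def)
          ultimately show ?thesis using g by (simp add: GM_def)
        qed
        show ?thesis using 1 2 3 by (simp add: emb_def M_def)
      qed
      then show "cur g \<in> {..<k} \<rightarrow>\<^sub>E emb n T w" by (auto simp: cur_def)
    qed
    show "(\<lambda>G. \<lambda>d\<in>?D. G (fst d) (snd d)) \<in> ({..<k} \<rightarrow>\<^sub>E emb n T w) \<rightarrow> GM"
    proof
      fix G assume G: "G \<in> {..<k} \<rightarrow>\<^sub>E emb n T w"
      let ?g = "\<lambda>d\<in>?D. G (fst d) (snd d)"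
      have Gi: "G i \<in> emb n T w" if "i < k" for i using G that by (auto simp: PiE_iff)
      have "?g \<in> ?D \<rightarrow>\<^sub>E {1..n}"
      proof (rule PiE_I)
        fix d assume d: "d \<in> ?D"
        then have "fst d < k" "snd d \<in> ?V" by (auto simp: copies_verts_def)
        then show "?g d \<in> {1..n}" using Gi[of "fst d"] d by (simp add: emb_def PiE_iff)
      qed simp
      moreover have "inj_on (\<lambda>x. ?g (i, x)) ?V" if "i < k" for i
        using Gi[OF that] that by (simp add: emb_def inj_on_def copies_verts_def)
      moreover have "?g ` e \<in> M" if e: "e \<in> copies_edges k ?E" for e
      proof -
        obtain i e0 where e0: "i < k" "e0 \<in> ?E" "e = Pair i ` e0" using e by (auto simp: copies_edges_def)
        have "?g ` e = G i ` e0" unfolding e0(3) image_image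
          using finite_simple_graphD(3)[OF T e0(2)] e0(1) by (intro image_cong) (auto simp: copies_verts_def)
        then show ?thesis using Gi[OF e0(1)] e0(2) by (simp add: emb_def M_def)
      qed
      ultimately show "?g \<in> GM" by (simp add: GM_def)
    qed
    show "(\<lambda>d\<in>?D. cur g (fst d) (snd d)) = g" if g: "g \<in> GM" for g
    proof
      fix d
      show "(\<lambda>d\<in>?D. cur g (fst d) (snd d)) d = g d"
      proof (cases "d \<in> ?D")
        case True
        then show ?thesis by (cases d) (auto simp: cur_def copies_verts_def)
      next
        case False
        moreover have "g d = undefined" using g False by (cases d) (simp add: GM_def PiE_iff extensional_def)
        ultimately show ?thesis by simp
      qed
    qed
    show "cur (\<lambda>d\<in>?D. G (fst d) (snd d)) = G" if G: "G \<in> {..<k} \<rightarrow>\<^sub>E emb n T w" for G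
    proof
      fix i
      show "cur (\<lambda>d\<in>?D. G (fst d) (snd d)) i = G i"
      proof (cases "i < k")
        case True
        then have "G i \<in> ?V \<rightarrow>\<^sub>E {1..n}" using G by (auto simp: PiE_iff emb_def)
        then show ?thesis using True by (auto simp: cur_def copies_verts_def fun_eq_iff PiE_iff extensional_def)
      next
        case False
        then show ?thesis using G by (simp add: cur_def PiE_iff extensional_def)
      qed
    qed
  qed
  then have c1: "card GM = card (emb n T w) ^ k" by (simp add: bij_betw_same_card card_funcsetE)
  define ker where "ker = (\<lambda>g :: nat \<times> 'a \<Rightarrow> nat. {(d, d') \<in> ?D \<times> ?D. g d = g d'})"
  have ker_good: "ker g \<in> good_kernels k ?V" if g: "g \<in> GM" for g
  proof -
    have "equiv ?D (ker g)"
      by (rule equivI) (auto simp: ker_def refl_on_def sym_def trans_def)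
    moreover have "x = y" if "((i, x), (i, y)) \<in> ker g" for i x y
    proof -
      have "i < k" "x \<in> ?V" "y \<in> ?V" "g (i, x) = g (i, y)" using that by (auto simp: ker_def copies_verts_def)
      moreover have "inj_on (\<lambda>x. g (i, x)) ?V" using g \<open>i < k\<close> by (simp add: GM_def)
      ultimately show ?thesis by (auto dest: inj_onD)
    qed
    ultimately show ?thesis by (simp add: good_kernels_def)
  qed
  have "GM = (\<Union>\<kappa>\<in>good_kernels k ?V. {g \<in> GM. ker g = \<kappa>})" using ker_good by auto
  then have "card GM = card (\<Union>\<kappa>\<in>good_kernels k ?V. {g \<in> GM. ker g = \<kappa>})" by (rule arg_cong)
  also have "\<dots> = (\<Sum>\<kappa>\<in>good_kernels k ?V. card {g \<in> GM. ker g = \<kappa>})"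
    by (rule card_UN_disjoint[OF finite_good_kernels[OF fV]]) (use fGM in auto)
  also have "\<dots> = (\<Sum>\<kappa>\<in>good_kernels k ?V. card (emb n (quotient_graph k T \<kappa>) w))"
  proof (rule sum.cong[OF refl])
    fix \<kappa> assume \<kappa>: "\<kappa> \<in> good_kernels k ?V"
    have eq: "equiv ?D \<kappa>" and inj: "\<And>i x y. ((i, x), (i, y)) \<in> \<kappa> \<Longrightarrow> x = y" using \<kappa> by (auto simp: good_kernels_def)
    let ?r = "ker_rep \<kappa>"
    let ?W = "?r ` ?D"
    have rD: "?r d \<in> ?D" if "d \<in> ?D" for d using ker_rep(2)[OF eq that] .
    have rr: "?r (?r d) = ?r d" if "d \<in> ?D" for d
      using ker_rep(3)[OF eq that rD[OF that]] ker_rep(1)[OF eq that] by simp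
    have Esub: "e \<subseteq> ?D" if "e \<in> copies_edges k ?E" for e
      using that finite_simple_graphD(3)[OF T] by (auto simp: copies_edges_def copies_verts_def)
    \<comment> \<open>A map with kernel \<kappa> is constant on classes and separates them, so its
      restriction to representatives loses nothing and is injective.\<close>
    have "bij_betw (\<lambda>g. restrict g ?W) {g \<in> GM. ker g = \<kappa>} (emb n (quotient_graph k T \<kappa>) w)"
    proof (rule bij_betwI[where g = "\<lambda>h. \<lambda>d\<in>?D. h (?r d)"])
      have gr: "g (?r d) = g d" if "g \<in> GM" "ker g = \<kappa>" "d \<in> ?D" for g d
        using ker_rep(1)[OF eq that(3)] that(2) by (auto simp: ker_def)
      show "(\<lambda>g. restrict g ?W) \<in> {g \<in> GM. ker g = \<kappa>} \<rightarrow> emb n (quotient_graph k T \<kappa>) w"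
      proof
        fix g assume "g \<in> {g \<in> GM. ker g = \<kappa>}"
        then have g: "g \<in> GM" "ker g = \<kappa>" by auto
        have 1: "restrict g ?W \<in> ?W \<rightarrow>\<^sub>E {1..n}" using g(1) rD by (auto simp: GM_def PiE_iff)
        have 2: "inj_on (restrict g ?W) ?W"
        proof (rule inj_onI)
          fix a b assume ab: "a \<in> ?W" "b \<in> ?W" "restrict g ?W a = restrict g ?W b"
          then obtain d d' where d: "a = ?r d" "b = ?r d'" "d \<in> ?D" "d' \<in> ?D" by auto
          have "g d = g d'" using ab gr[OF g d(3)] gr[OF g d(4)] d by simp
          then have "(d, d') \<in> \<kappa>" using d g(2) by (auto simp: ker_def)
          then show "a = b" using ker_rep(3)[OF eq d(3,4)] d by simp
        qed
        have 3: "restrict g ?W ` (?r ` e) \<in> M" if e: "e \<in> copies_edges k ?E" for e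
        proof -
          have "restrict g ?W ` (?r ` e) = g ` e"
            unfolding image_image using Esub[OF e] gr[OF g] by (intro image_cong) auto
          then show ?thesis using g(1) e by (simp add: GM_def)
        qed
        show "restrict g ?W \<in> emb n (quotient_graph k T \<kappa>) w"
          using 1 2 3 by (simp add: emb_def quotient_graph_def M_def)
      qed
      show "(\<lambda>h. \<lambda>d\<in>?D. h (?r d)) \<in> emb n (quotient_graph k T \<kappa>) w \<rightarrow> {g \<in> GM. ker g = \<kappa>}"
      proof
        fix h assume "h \<in> emb n (quotient_graph k T \<kappa>) w"
        then have h: "h \<in> ?W \<rightarrow>\<^sub>E {1..n}" "inj_on h ?W" "\<And>e. e \<in> copies_edges k ?E \<Longrightarrow> h ` (?r ` e) \<in> M"
          by (auto simp: emb_def quotient_graph_def M_def)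
        let ?g = "\<lambda>d\<in>?D. h (?r d)"
        have gk: "?g d = ?g d' \<longleftrightarrow> (d, d') \<in> \<kappa>" if "d \<in> ?D" "d' \<in> ?D" for d d'
        proof -
          have "?g d = ?g d' \<longleftrightarrow> ?r d = ?r d'" using that inj_on_eq_iff[OF h(2)] by simp
          then show ?thesis using ker_rep(3)[OF eq that] by simp
        qed
        have "?g \<in> ?D \<rightarrow>\<^sub>E {1..n}" using h(1) by (auto simp: PiE_iff)
        moreover have "inj_on (\<lambda>x. ?g (i, x)) ?V" if "i < k" for i
        proof (rule inj_onI)
          fix x y assume xy: "x \<in> ?V" "y \<in> ?V" "?g (i, x) = ?g (i, y)"
          then have "(i, x) \<in> ?D" "(i, y) \<in> ?D" using that by (auto simp: copies_verts_def)
          from gk[OF this] xy(3) have "((i, x), (i, y)) \<in> \<kappa>" by blast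
          then show "x = y" by (rule inj)
        qed
        moreover have "?g ` e \<in> M" if e: "e \<in> copies_edges k ?E" for e
        proof -
          have "?g ` e = h ` (?r ` e)" unfolding image_image using Esub[OF e] by (intro image_cong) auto
          then show ?thesis using h(3)[OF e] by simp
        qed
        moreover have "ker ?g = \<kappa>"
        proof (intro equalityI subsetI)
          fix p assume "p \<in> ker ?g"
          then obtain d d' where "p = (d, d')" "d \<in> ?D" "d' \<in> ?D" "?g d = ?g d'" by (auto simp: ker_def)
          then show "p \<in> \<kappa>" using gk by blast
        next
          fix p assume p: "p \<in> \<kappa>"
          obtain d d' where dd: "p = (d, d')" by (rule prod.exhaust)
          have "d \<in> ?D" "d' \<in> ?D" using p dd equiv_type[OF eq] by auto
          then show "p \<in> ker ?g" using gk[of d d'] p dd unfolding ker_def by blast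
        qed
        ultimately show "?g \<in> {g \<in> GM. ker g = \<kappa>}" by (simp add: GM_def)
      qed
      show "(\<lambda>d\<in>?D. restrict g ?W (?r d)) = g" if "g \<in> {g \<in> GM. ker g = \<kappa>}" for g
      proof
        fix d
        have g: "g \<in> GM" "ker g = \<kappa>" using that by auto
        show "(\<lambda>d\<in>?D. restrict g ?W (?r d)) d = g d"
        proof (cases "d \<in> ?D")
          case True then show ?thesis using gr[OF g True] by simp
        next
          case False then show ?thesis using g(1) by (cases d) (simp add: GM_def PiE_iff extensional_def)
        qed
      qed
      show "restrict (\<lambda>d\<in>?D. h (?r d)) ?W = h" if "h \<in> emb n (quotient_graph k T \<kappa>) w" for h
      proof
        fix a
        have h: "h \<in> ?W \<rightarrow>\<^sub>E {1..n}" using that by (simp add: emb_def quotient_graph_def)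
        show "restrict (\<lambda>d\<in>?D. h (?r d)) ?W a = h a"
        proof (cases "a \<in> ?W")
          case True
          then obtain d where "a = ?r d" "d \<in> ?D" by auto
          then show ?thesis using rD rr by simp
        next
          case False then show ?thesis using h by (cases a) (simp add: PiE_iff extensional_def)
        qed
      qed
    qed
    then show "card {g \<in> GM. ker g = \<kappa>} = card (emb n (quotient_graph k T \<kappa>) w)" by (rule bij_betw_same_card)
  qed
  finally show ?thesis using c1 by simp
qed

lemma gtreeD: "gtree T \<Longrightarrow> finite_simple_graph T"
  by (simp add: gtree_def gforest_def)

text \<open>Each copy is connected, so the quotient is reached from k roots, one in each copy, and
  \<open>card_roots_edges\<close> applies. A nontrivial kernel glues two different copies together,
  which saves a root.\<close>

lemma quotient_counts:
  fixes T :: "'a sgraph"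
  assumes T: "gtree T" and \<kappa>: "\<kappa> \<in> good_kernels k (gverts T)"
  shows "card (gverts (quotient_graph k T \<kappa>)) \<le> card (gedges (quotient_graph k T \<kappa>)) + k"
    and "\<kappa> \<noteq> Id_on (copies_verts k (gverts T)) \<Longrightarrow>
      card (gverts (quotient_graph k T \<kappa>)) < card (gedges (quotient_graph k T \<kappa>)) + k"
proof -
  let ?V = "gverts T"
  let ?D = "copies_verts k ?V"
  define VQ where "VQ = gverts (quotient_graph k T \<kappa>)"
  define EQ where "EQ = gedges (quotient_graph k T \<kappa>)"
  define r where "r = ker_rep \<kappa>"
  have fsg: "finite_simple_graph T" by (rule gtreeD[OF T])
  have eq: "equiv ?D \<kappa>" and inj: "\<And>i x y. ((i, x), (i, y)) \<in> \<kappa> \<Longrightarrow> x = y" using \<kappa> by (auto simp: good_kernels_def)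
  have fE: "finite EQ" unfolding EQ_def by (rule finite_simple_graphD(2)[OF quotient_fsg[OF fsg \<kappa>]])
  have con: "?V \<noteq> {}" "\<And>u v. u \<in> ?V \<Longrightarrow> v \<in> ?V \<Longrightarrow> (u, v) \<in> (gadj T)\<^sup>*"
    using T by (auto simp: gtree_def gconnected_def)
  obtain r0 where r0: "r0 \<in> ?V" using con(1) by blast
  have path: "(r (i, x), r (i, y)) \<in> (adj EQ)\<^sup>*" if i: "i < k" and xy: "x \<in> ?V" "y \<in> ?V" for i x y
  proof -
    have "(r (i, x), r (i, y)) \<in> (adj EQ)\<^sup>*" if "(x, y) \<in> (gadj T)\<^sup>*" for x y
      using that
    proof induction
      case (step y z)
      have "{y, z} \<in> gedges T" using step(2) by (simp add: gadj_def)
      then have "Pair i ` {y, z} \<in> copies_edges k (gedges T)" unfolding copies_edges_def using i by blast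
      then have "r ` (Pair i ` {y, z}) \<in> EQ" unfolding EQ_def quotient_graph_def r_def snd_conv by (rule imageI)
      then have "(r (i, y), r (i, z)) \<in> adj EQ" by (simp add: adj_def)
      with step(3) show ?case by (rule rtrancl_into_rtrancl)
    qed simp
    then show ?thesis using con(2)[OF xy] by blast
  qed
  have VQ: "\<exists>i x. a = r (i, x) \<and> i < k \<and> x \<in> ?V" if "a \<in> VQ" for a
    using that by (auto simp: VQ_def quotient_graph_def r_def copies_verts_def)
  have "VQ \<subseteq> (adj EQ)\<^sup>* `` ((\<lambda>i. r (i, r0)) ` {..<k})"
  proof
    fix a assume "a \<in> VQ"
    then obtain i x where a: "a = r (i, x)" "i < k" "x \<in> ?V" using VQ by blast
    then show "a \<in> (adj EQ)\<^sup>* `` ((\<lambda>i. r (i, r0)) ` {..<k})" using path[OF a(2) r0 a(3)] by blast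
  qed
  from card_roots_edges[OF fE this] have "card VQ \<le> card EQ + card ((\<lambda>i. r (i, r0)) ` {..<k})" by simp
  also have "\<dots> \<le> card EQ + k" using card_image_le[of "{..<k}" "\<lambda>i. r (i, r0)"] by simp
  finally show "card (gverts (quotient_graph k T \<kappa>)) \<le> card (gedges (quotient_graph k T \<kappa>)) + k"
    by (simp only: VQ_def EQ_def)
  show "card (gverts (quotient_graph k T \<kappa>)) < card (gedges (quotient_graph k T \<kappa>)) + k" if ne: "\<kappa> \<noteq> Id_on ?D"
  proof -
    have "Id_on ?D \<subseteq> \<kappa>" using equiv_class_self[OF eq] by (auto simp: Id_on_def)
    then obtain d d' where dd: "(d, d') \<in> \<kappa>" "(d, d') \<notin> Id_on ?D" using ne by auto
    have D: "d \<in> ?D" "d' \<in> ?D" using dd(1) equiv_type[OF eq] by auto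
    obtain i x where d: "d = (i, x)" by (rule prod.exhaust)
    obtain j y where d': "d' = (j, y)" by (rule prod.exhaust)
    have ix: "i < k" "x \<in> ?V" "j < k" "y \<in> ?V" using D d d' by (auto simp: copies_verts_def)
    have ij: "i \<noteq> j"
    proof
      assume ij: "i = j"
      then have "x = y" using inj dd(1) d d' by blast
      then have "d = d'" using d d' ij by simp
      then show False using dd(2) D by auto
    qed
    have rr: "r (i, x) = r (j, y)" using ker_rep(3)[OF eq D] dd(1) d d' by (simp add: r_def)
    \<comment> \<open>Copy \<open>j\<close> shares a vertex with copy \<open>i\<close>, so it is
      reached from the root of copy \<open>i\<close> and its own root is dropped.\<close>
    define R where "R = (\<lambda>i. r (i, r0)) ` ({..<k} - {j})"
    have "VQ \<subseteq> (adj EQ)\<^sup>* `` R"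
    proof
      fix a assume "a \<in> VQ"
      then obtain l z where a: "a = r (l, z)" "l < k" "z \<in> ?V" using VQ by blast
      show "a \<in> (adj EQ)\<^sup>* `` R"
      proof (cases "l = j")
        case True
        have "(r (i, r0), r (j, y)) \<in> (adj EQ)\<^sup>*" using path[OF ix(1) r0 ix(2)] rr by simp
        then have "(r (i, r0), a) \<in> (adj EQ)\<^sup>*"
          using path[OF ix(3,4) a(3)] unfolding a(1) True by (rule rtrancl_trans)
        moreover have "r (i, r0) \<in> R" using ix(1) ij by (auto simp: R_def)
        ultimately show ?thesis by blast
      next
        case False
        have "r (l, r0) \<in> R" using a(2) False by (auto simp: R_def)
        then show ?thesis using path[OF a(2) r0 a(3)] a(1) by blast
      qed
    qed
    from card_roots_edges[OF fE this] have "card VQ \<le> card EQ + card R" by (simp add: R_def)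
    moreover have "card R \<le> card ({..<k} - {j})" unfolding R_def by (rule card_image_le) simp
    moreover have "card ({..<k} - {j}) < k" using ix(3) by (simp add: card_Diff_singleton)
    ultimately show ?thesis unfolding VQ_def[symmetric] EQ_def[symmetric] by linarith
  qed
qed

lemma quotient_Id_on:
  assumes T: "finite_simple_graph T"
  shows "quotient_graph k T (Id_on (copies_verts k (gverts T))) = (copies_verts k (gverts T), copies_edges k (gedges T))"
    and "Id_on (copies_verts k (gverts T)) \<in> good_kernels k (gverts T)"
proof -
  let ?D = "copies_verts k (gverts T)"
  have eq: "equiv ?D (Id_on ?D)" by (auto intro!: equivI simp: refl_on_def sym_def trans_def)
  have r: "ker_rep (Id_on ?D) d = d" if "d \<in> ?D" for d
    using ker_rep(1)[OF eq that] by auto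
  have "ker_rep (Id_on ?D) ` ?D = ?D" using r by auto
  moreover have "(`) (ker_rep (Id_on ?D)) ` copies_edges k (gedges T) = copies_edges k (gedges T)"
  proof -
    have "ker_rep (Id_on ?D) ` e = e" if "e \<in> copies_edges k (gedges T)" for e
    proof -
      have "e \<subseteq> ?D" using that finite_simple_graphD(3)[OF T] by (fastforce simp: copies_edges_def copies_verts_def)
      then have "ker_rep (Id_on ?D) ` e = (\<lambda>d. d) ` e" using r by (intro image_cong) auto
      then show ?thesis by simp
    qed
    then show ?thesis by (simp cong: image_cong)
  qed
  ultimately show "quotient_graph k T (Id_on ?D) = (?D, copies_edges k (gedges T))" by (simp add: quotient_graph_def)
  show "Id_on ?D \<in> good_kernels k (gverts T)" using eq by (auto simp: good_kernels_def)
qed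

lemma psiF_copies:
  fixes T :: "'a sgraph"
  assumes T: "finite_simple_graph T"
  shows "psiF (copies_verts k (gverts T), copies_edges k (gedges T)) = psiF T ^ k"
proof -
  let ?V = "gverts T" and ?E = "gedges T"
  have TE: "finite_simple_graph (?V, ?E)" using T by simp
  have i: "inj_on (Pair i) A" for i :: nat and A :: "'a set" by (simp add: inj_on_def)
  have "copies_verts k ?V = (\<Union>i\<in>{..<k}. Pair i ` ?V)" by (auto simp: copies_verts_def)
  then have "psiF (copies_verts k ?V, copies_edges k ?E) = psiF (\<Union>i\<in>{..<k}. Pair i ` ?V, \<Union>i\<in>{..<k}. (`) (Pair i) ` ?E)"
    by (simp only: copies_edges_def)
  also have "\<dots> = (\<Prod>i<k. psiF (Pair i ` ?V, (`) (Pair i) ` ?E))"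
  proof (rule psiF_Union)
    fix l :: nat
    have "finite (Pair l ` ?V)" using finite_simple_graphD(1)[OF T] by simp
    moreover have "e \<subseteq> Pair l ` ?V \<and> card e = 2" if e: "e \<in> (`) (Pair l) ` ?E" for e
    proof -
      obtain e0 where e0: "e0 \<in> ?E" "e = Pair l ` e0" using e by auto
      then show ?thesis using finite_simple_graphD(3,4)[OF T e0(1)] i by (auto simp: card_image)
    qed
    ultimately show "finite_simple_graph (Pair l ` ?V, (`) (Pair l) ` ?E)" by (simp add: finite_simple_graph_def)
  qed auto
  also have "\<dots> = (\<Prod>i<k. psiF T)"
    using psiF_image[OF TE i] by (intro prod.cong) auto
  finally show ?thesis by simp
qed

text \<open>After division by n^k the term of a kernel has order n^(v - m - k). By
  \<open>quotient_counts\<close> this vanishes unless the copies remain disjoint, and k disjoint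
  copies contribute the k-th power.\<close>

lemma moment_limit:
  fixes T :: "'a sgraph"
  assumes T: "gtree T"
  shows "(\<lambda>n. \<integral>w. (real (num_copies n T w) / real n) ^ k \<partial>weight_law n) \<longlonglongrightarrow> psiF T ^ k"
proof -
  have fsg: "finite_simple_graph T" by (rule gtreeD[OF T])
  define G where "G = good_kernels k (gverts T)"
  define Q where "Q = quotient_graph k T"
  define I where "I = Id_on (copies_verts k (gverts T))"
  define v where "v = (\<lambda>\<kappa>. card (gverts (Q \<kappa>)))"
  define m where "m = (\<lambda>\<kappa>. card (gedges (Q \<kappa>)))"
  define X where "X = (\<lambda>n \<kappa>. \<integral>w. real (card (emb n (Q \<kappa>) w)) \<partial>weight_law n)"
  have fG: "finite G" unfolding G_def by (rule finite_good_kernels[OF finite_simple_graphD(1)[OF fsg]])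
  have IG: "I \<in> G" unfolding I_def G_def by (rule quotient_Id_on(2)[OF fsg])
  have vm: "v \<kappa> \<le> m \<kappa> + k" if "\<kappa> \<in> G" for \<kappa>
    using quotient_counts(1)[OF T] that by (simp add: v_def m_def Q_def G_def)
  have vm': "v \<kappa> < m \<kappa> + k" if "\<kappa> \<in> G" "\<kappa> \<noteq> I" for \<kappa>
    using quotient_counts(2)[OF T] that by (simp add: v_def m_def Q_def G_def I_def)
  \<comment> \<open>For the trivial kernel the exponent \<open>m I + k - v I\<close> is therefore 0,
    and \<open>0 ^ 0 = 1\<close> keeps the term in the limit below.\<close>
  have vI: "m I + k \<le> v I"
  proof -
    have "card (copies_edges k (gedges T)) \<le> (\<Sum>i<k. card ((`) (Pair i) ` gedges T))"
      unfolding copies_edges_def by (rule card_UN_le) simp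
    also have "\<dots> \<le> (\<Sum>i<k. card (gedges T))"
      by (intro sum_mono card_image_le finite_simple_graphD(2)[OF fsg])
    finally have "m I \<le> k * card (gedges T)" by (simp add: m_def Q_def I_def quotient_Id_on(1)[OF fsg])
    moreover have "v I = card (copies_verts k (gverts T))" by (simp add: v_def Q_def I_def quotient_Id_on(1)[OF fsg])
    then have "v I = k * Suc (card (gedges T))" by (simp add: copies_verts_def card_cartesian_product tree_card[OF T])
    ultimately show ?thesis by simp
  qed
  have qI: "psiF (Q I) = psiF T ^ k"
    by (simp add: Q_def I_def quotient_Id_on(1)[OF fsg] psiF_copies[OF fsg])
  have X: "(\<lambda>n. X n \<kappa> * real n ^ m \<kappa> / real n ^ v \<kappa>) \<longlonglongrightarrow> psiF (Q \<kappa>)" if "\<kappa> \<in> G" for \<kappa>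
    unfolding X_def m_def v_def using that
    by (intro mean_emb_limit) (auto simp: Q_def G_def intro: quotient_fsg[OF fsg])
  \<comment> \<open>The factor n^(-k) is split into the normalization n^(m - v) of
    \<open>mean_emb_limit\<close> and a remaining power of 1 / n, whose natural-number exponent
    involves no truncation by \<open>vm\<close>.\<close>
  have eq: "(\<integral>w. (real (num_copies n T w) / real n) ^ k \<partial>weight_law n) =
      (\<Sum>\<kappa>\<in>G. X n \<kappa> * real n ^ m \<kappa> / real n ^ v \<kappa> * (1 / real n) ^ (m \<kappa> + k - v \<kappa>))" if n: "n > 0" for n
  proof -
    have "(real (num_copies n T w) / real n) ^ k = (\<Sum>\<kappa>\<in>G. real (card (emb n (Q \<kappa>) w)) / real n ^ k)" for w
    proof -
      have "real (num_copies n T w) ^ k = real (card (emb n T w) ^ k)" by (simp add: num_copies_eq_emb[OF fsg])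
      also have "\<dots> = (\<Sum>\<kappa>\<in>G. real (card (emb n (Q \<kappa>) w)))"
        by (simp only: num_copies_power[OF fsg] G_def Q_def of_nat_sum)
      finally show ?thesis by (simp add: power_divide sum_divide_distrib)
    qed
    then have "(\<integral>w. (real (num_copies n T w) / real n) ^ k \<partial>weight_law n) =
      (\<integral>w. (\<Sum>\<kappa>\<in>G. real (card (emb n (Q \<kappa>) w)) / real n ^ k) \<partial>weight_law n)" by simp
    also have "\<dots> = (\<Sum>\<kappa>\<in>G. \<integral>w. real (card (emb n (Q \<kappa>) w)) / real n ^ k \<partial>weight_law n)"
    proof (rule Bochner_Integration.integral_sum)
      fix \<kappa>
      show "integrable (weight_law n) (\<lambda>w. real (card (emb n (Q \<kappa>) w)) / real n ^ k)"
        unfolding emb_def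
        by (rule mst_integrable[where h = "\<lambda>M. real (card {h \<in> gverts (Q \<kappa>) \<rightarrow>\<^sub>E {1..n}. inj_on h (gverts (Q \<kappa>)) \<and>
          (\<forall>e\<in>gedges (Q \<kappa>). h ` e \<in> gedges M)}) / real n ^ k"])
    qed
    also have "\<dots> = (\<Sum>\<kappa>\<in>G. X n \<kappa> * real n ^ m \<kappa> / real n ^ v \<kappa> * (1 / real n) ^ (m \<kappa> + k - v \<kappa>))"
    proof (rule sum.cong[OF refl])
      fix \<kappa> assume "\<kappa> \<in> G"
      then have "v \<kappa> + (m \<kappa> + k - v \<kappa>) = m \<kappa> + k" using vm by simp
      then have "real n ^ v \<kappa> * real n ^ (m \<kappa> + k - v \<kappa>) = real n ^ m \<kappa> * real n ^ k" by (simp only: power_add[symmetric])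
      then have "X n \<kappa> * real n ^ m \<kappa> / (real n ^ v \<kappa> * real n ^ (m \<kappa> + k - v \<kappa>)) = X n \<kappa> / real n ^ k" using n by simp
      then show "(\<integral>w. real (card (emb n (Q \<kappa>) w)) / real n ^ k \<partial>weight_law n) =
          X n \<kappa> * real n ^ m \<kappa> / real n ^ v \<kappa> * (1 / real n) ^ (m \<kappa> + k - v \<kappa>)"
        by (simp add: X_def power_one_over)
    qed
    finally show ?thesis .
  qed
  have lim: "(\<lambda>n. \<Sum>\<kappa>\<in>G. X n \<kappa> * real n ^ m \<kappa> / real n ^ v \<kappa> * (1 / real n) ^ (m \<kappa> + k - v \<kappa>))
      \<longlonglongrightarrow> (\<Sum>\<kappa>\<in>G. psiF (Q \<kappa>) * 0 ^ (m \<kappa> + k - v \<kappa>))"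
    by (intro tendsto_sum tendsto_mult tendsto_power X lim_const_over_n)
  have "(\<Sum>\<kappa>\<in>G. psiF (Q \<kappa>) * 0 ^ (m \<kappa> + k - v \<kappa>)) = (\<Sum>\<kappa>\<in>G. if \<kappa> = I then psiF T ^ k else 0)"
  proof (rule sum.cong[OF refl])
    fix \<kappa> assume \<kappa>: "\<kappa> \<in> G"
    show "psiF (Q \<kappa>) * 0 ^ (m \<kappa> + k - v \<kappa>) = (if \<kappa> = I then psiF T ^ k else 0)"
    proof (cases "\<kappa> = I")
      case True
      then show ?thesis using vI qI by simp
    next
      case False
      then show ?thesis using vm'[OF \<kappa>] by (simp add: zero_power)
    qed
  qed
  also have "\<dots> = psiF T ^ k" using fG IG by simp
  finally have s: "(\<Sum>\<kappa>\<in>G. psiF (Q \<kappa>) * 0 ^ (m \<kappa> + k - v \<kappa>)) = psiF T ^ k" .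
  have "\<forall>\<^sub>F n in sequentially. (\<Sum>\<kappa>\<in>G. X n \<kappa> * real n ^ m \<kappa> / real n ^ v \<kappa> * (1 / real n) ^ (m \<kappa> + k - v \<kappa>)) =
      (\<integral>w. (real (num_copies n T w) / real n) ^ k \<partial>weight_law n)"
    using eventually_gt_at_top[of 0]
  proof eventually_elim
    case (elim n)
    from eq[OF elim] show ?case by (rule sym)
  qed
  from tendsto_eqI[OF lim s this] show ?thesis .
qed

section \<open>From moments to convergence in L^p\<close>

lemma central_moment_limit:
  fixes T :: "'a sgraph"
  assumes T: "gtree T" and q: "q > 0"
  shows "(\<lambda>n. \<integral>w. (real (num_copies n T w) / real n - psiF T) ^ q \<partial>weight_law n) \<longlonglongrightarrow> 0"
proof -
  let ?Y = "\<lambda>n w. real (num_copies n T w) / real n"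
  have "(\<integral>w. (?Y n w - psiF T) ^ q \<partial>weight_law n) =
    (\<Sum>i\<le>q. real (q choose i) * (\<integral>w. ?Y n w ^ i \<partial>weight_law n) * (- psiF T) ^ (q - i))" for n
  proof -
    have "(?Y n w - psiF T) ^ q = (\<Sum>i\<le>q. real (q choose i) * ?Y n w ^ i * (- psiF T) ^ (q - i))" for w
      using binomial_ring[of "?Y n w" "- psiF T" q] by simp
    then have "(\<integral>w. (?Y n w - psiF T) ^ q \<partial>weight_law n) =
      (\<integral>w. (\<Sum>i\<le>q. real (q choose i) * ?Y n w ^ i * (- psiF T) ^ (q - i)) \<partial>weight_law n)" by simp
    also have "\<dots> = (\<Sum>i\<le>q. \<integral>w. real (q choose i) * ?Y n w ^ i * (- psiF T) ^ (q - i) \<partial>weight_law n)"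
      unfolding num_copies_def
      by (intro Bochner_Integration.integral_sum mst_integrable[where h = "\<lambda>M. real (q choose _) *
          (real (card {f \<in> gverts T \<rightarrow>\<^sub>E {1..n}. inj_on f (gverts T) \<and>
             (\<forall>u v. {u, v} \<in> gedges T \<longrightarrow> {f u, f v} \<in> gedges M)}) / real n) ^ _ * (- psiF T) ^ (q - _)"])
    finally show ?thesis by simp
  qed
  moreover have "(\<lambda>n. \<Sum>i\<le>q. real (q choose i) * (\<integral>w. ?Y n w ^ i \<partial>weight_law n) * (- psiF T) ^ (q - i))
      \<longlonglongrightarrow> (\<Sum>i\<le>q. real (q choose i) * psiF T ^ i * (- psiF T) ^ (q - i))"
    by (intro tendsto_intros moment_limit[OF T])
  \<comment> \<open>The limit is the binomial expansion of (x - x)^q at x = \<open>psiF T\<close>,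
    which is 0 as q is positive.\<close>
  moreover have "(\<Sum>i\<le>q. real (q choose i) * psiF T ^ i * (- psiF T) ^ (q - i)) = 0"
    using binomial_ring[of "psiF T" "- psiF T" q] q by (simp add: zero_power)
  ultimately show ?thesis by simp
qed

text \<open>The p-th power of the deviation is at most \<epsilon> / 2 plus a constant multiple of an
  even power of it, so a vanishing even central moment suffices. This covers small and non-integer p
  alike.\<close>

lemma Lp_limit:
  fixes T :: "'a sgraph"
  assumes T: "gtree T" and p: "p > (0::real)"
  shows "(\<lambda>n. \<integral>w. \<bar>real (num_copies n T w) / real n - psiF T\<bar> powr p \<partial>weight_law n) \<longlonglongrightarrow> 0"
proof -
  let ?Y = "\<lambda>n w. real (num_copies n T w) / real n - psiF T"
  have int: "integrable (weight_law n) (\<lambda>w. h (?Y n w))" for h :: "real \<Rightarrow> real" and n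
    unfolding num_copies_def
    by (rule mst_integrable[where h = "\<lambda>M. h (real (card {f \<in> gverts T \<rightarrow>\<^sub>E {1..n}. inj_on f (gverts T) \<and>
             (\<forall>u v. {u, v} \<in> gedges T \<longrightarrow> {f u, f v} \<in> gedges M)}) / real n - psiF T)"])
  obtain j :: nat where j: "p \<le> real j" using real_arch_simple by blast
  \<comment> \<open>Evenness makes y^q nonnegative without absolute values, and doubling keeps q
    \<ge> p.\<close>
  define q where "q = 2 * j"
  have q: "q > 0" "even q" "p \<le> real q" using j p by (auto simp: q_def intro: Nat.gr0I)
  show ?thesis
  proof (rule LIMSEQ_I)
    fix \<epsilon> :: real assume \<epsilon>: "\<epsilon> > 0"
    \<comment> \<open>Chosen so that \<delta> to the power p is \<epsilon> / 2, which bounds small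
      deviations. For larger ones the nonpositive exponent p - q makes |y|^(p - q) at most
      \<open>C\<close>.\<close>
    define \<delta> where "\<delta> = (\<epsilon> / 2) powr (1 / p)"
    define C where "C = \<delta> powr (p - real q)"
    have \<delta>: "\<delta> > 0" "\<delta> powr p = \<epsilon> / 2" using \<epsilon> p by (auto simp: \<delta>_def powr_powr)
    have C: "C \<ge> 0" by (simp add: C_def)
    have pw: "\<bar>y\<bar> powr p \<le> \<epsilon> / 2 + C * y ^ q" for y :: real
    proof (cases "\<bar>y\<bar> \<le> \<delta>")
      case True
      then have "\<bar>y\<bar> powr p \<le> \<delta> powr p" using p by (intro powr_mono2) auto
      moreover have "0 \<le> C * y ^ q" using C q(2) by (simp add: zero_le_even_power)
      ultimately show ?thesis using \<delta>(2) by linarith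
    next
      case False
      then have y: "\<delta> \<le> \<bar>y\<bar>" "\<bar>y\<bar> > 0" using \<delta>(1) by auto
      have "\<bar>y\<bar> powr p = \<bar>y\<bar> powr (p - real q) * \<bar>y\<bar> powr real q" by (simp add: powr_add[symmetric])
      also have "\<bar>y\<bar> powr real q = y ^ q" using y(2) q(2) by (simp add: powr_realpow power_even_abs)
      also have "\<bar>y\<bar> powr (p - real q) * y ^ q \<le> C * y ^ q"
        unfolding C_def using y \<delta>(1) q(2,3) by (intro mult_right_mono powr_mono2') (auto simp: zero_le_even_power)
      finally show ?thesis using \<epsilon> by linarith
    qed
    have up: "(\<integral>w. \<bar>?Y n w\<bar> powr p \<partial>weight_law n) \<le> \<epsilon> / 2 + C * (\<integral>w. ?Y n w ^ q \<partial>weight_law n)" for n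
    proof -
      interpret prob_space "weight_law n" by simp
      have i1: "integrable (weight_law n) (\<lambda>w. C * ?Y n w ^ q)" by (rule int[where h = "\<lambda>y. C * y ^ q"])
      have "(\<integral>w. \<bar>?Y n w\<bar> powr p \<partial>weight_law n) \<le> (\<integral>w. \<epsilon> / 2 + C * ?Y n w ^ q \<partial>weight_law n)"
        by (rule integral_mono[OF int[where h = "\<lambda>y. \<bar>y\<bar> powr p"] int[where h = "\<lambda>y. \<epsilon> / 2 + C * y ^ q"]]) (rule pw)
      also have "\<dots> = \<epsilon> / 2 + C * (\<integral>w. ?Y n w ^ q \<partial>weight_law n)"
        using i1 by (simp add: prob_space)
      finally show ?thesis .
    qed
    have "(\<lambda>n. \<epsilon> / 2 + C * (\<integral>w. ?Y n w ^ q \<partial>weight_law n)) \<longlonglongrightarrow> \<epsilon> / 2 + C * 0"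
      by (intro tendsto_add tendsto_mult tendsto_const central_moment_limit[OF T q(1)])
    then have "\<forall>\<^sub>F n in sequentially. \<epsilon> / 2 + C * (\<integral>w. ?Y n w ^ q \<partial>weight_law n) < \<epsilon>"
      by (rule order_tendstoD(2)) (use \<epsilon> in simp)
    then have "\<forall>\<^sub>F n in sequentially. norm ((\<integral>w. \<bar>?Y n w\<bar> powr p \<partial>weight_law n) - 0) < \<epsilon>"
    proof eventually_elim
      case (elim n)
      have "0 \<le> (\<integral>w. \<bar>?Y n w\<bar> powr p \<partial>weight_law n)" by (rule Bochner_Integration.integral_nonneg) simp
      then show ?case using up[of n] elim by simp
    qed
    then show "\<exists>no. \<forall>n\<ge>no. norm ((\<integral>w. \<bar>?Y n w\<bar> powr p \<partial>weight_law n) - 0) < \<epsilon>"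
      by (simp add: eventually_sequentially)
  qed
qed

theorem theorem1p1:
  "\<exists>\<Psi> :: nat sgraph \<Rightarrow> real.
     (\<forall>T T'. gtree T \<longrightarrow> gtree T' \<longrightarrow> gisomorphic T T' \<longrightarrow> \<Psi> T = \<Psi> T') \<and>
     (\<forall>F :: nat sgraph. gforest F \<longrightarrow>
        (\<forall>\<phi> :: nat \<Rightarrow> nat \<Rightarrow> nat. (\<forall>n \<ge> card (gverts F). labeling n F (\<phi> n)) \<longrightarrow>
           (\<lambda>n. real n ^ card (gedges F) * prob_contained n F (\<phi> n))
             \<longlonglongrightarrow> (\<Prod>T\<in>gcomponents F. \<Psi> T))) \<and>
     (\<forall>T :: nat sgraph. gtree T \<longrightarrow>
        (\<forall>p :: real. 0 < p \<longrightarrow>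
           (\<lambda>n. integral\<^sup>L (weight_law n)
                  (\<lambda>w. \<bar>real (num_copies n T w) / real n - \<Psi> T\<bar> powr p)) \<longlonglongrightarrow> 0))"
proof (intro exI[of _ psiF] conjI allI impI)
  fix T T' :: "nat sgraph"
  assume "gtree T" "gtree T'" "gisomorphic T T'"
  then show "psiF T = psiF T'" using psiF_isomorphic gtreeD by blast
next
  fix F :: "nat sgraph" and \<phi> :: "nat \<Rightarrow> nat \<Rightarrow> nat"
  assume F: "gforest F" and \<phi>: "\<forall>n\<ge>card (gverts F). labeling n F (\<phi> n)"
  have fsg: "finite_simple_graph F" using F by (simp add: gforest_def)
  have "(\<lambda>n. real n ^ card (gedges F) * prob_contained n F (\<phi> n)) \<longlonglongrightarrow> psiF F"
    by (rule prob_contained_limit[OF fsg, of "card (gverts F)"]) (use \<phi> in blast)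
  then show "(\<lambda>n. real n ^ card (gedges F) * prob_contained n F (\<phi> n)) \<longlonglongrightarrow> (\<Prod>T\<in>gcomponents F. psiF T)"
    by (simp only: psiF_components[OF fsg])
next
  fix T :: "nat sgraph" and p :: real
  assume "gtree T" "0 < p"
  then show "(\<lambda>n. integral\<^sup>L (weight_law n) (\<lambda>w. \<bar>real (num_copies n T w) / real n - psiF T\<bar> powr p)) \<longlonglongrightarrow> 0"
    by (rule Lp_limit)
qed

end
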